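(* Let $\beta\in Br_n^+$ be a positive braid on $n$ strands, of length $\ell(\beta)$. Then for all integers $t$ the (reduced) triply-graded Khovanov–Rozansky homology of $\beta$ in degree $(a,t,q)=(0,t,-t)$ satisfies $$HHH^{0,t,-t}(\beta)=\begin{cases}0 & t\neq \ell(\beta)\\ \mathbb{Q} & t=\ell(\beta).\end{cases}$$
   Context: $Br_n^+$ is the monoid of positive braids on $n$ strands with generators $\sigma_1,\dots,\sigma_{n-1}$; $\ell(\beta)$ is the number of letters of $\beta$. Reduced Khovanov–Rozansky homology. Let $R=\mathbb{Q}[\alpha_1,\dots,\alpha_{n-1}]$ be the polynomial ring on the $(n-1)$-dimensional reflection representation of $S_n$, with each simple root $\alpha_i$ in degree $2$ (quantum degree). Write $M(1)$ for the grading shift with $M(1)^j=M^{j+1}$. For a simple reflection $s$ let $B_s=R\otimes_{R^s}R(1)$, a graded $R$-bimodule. The Rouquier complex of $\sigma_s$ is $F_{\sigma_s}^\bullet=(B_s\to R(1))$, with $B_s$ in cohomological degree $0$, $R(1)$ in cohomological degree $1$, and differential the multiplication map. For $\beta=\sigma_{i_1}\cdots\sigma_{i_r}$ put $F_\beta^\bullet=F_{\sigma_{i_1}}^\bullet\otimes_R\cdots\otimes_RF_{\sigma_{i_r}}^\bullet$. Applying the Hochschild cohomology functor $HH^a(-)=\mathrm{Ext}^a_{R\otimes R}(R,-)$ termwise gives a complex of graded $R$-modules; $HHH^{a,t,q}(\beta)$ is the quantum degree $q$ part of its $t$-th cohomology. In particular, for $a=0$, $HH^0(M)=\mathrm{Hom}_{R\otimes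 R}(R,M)$ (bimodule homomorphisms of all degrees). *)

theory Defs
  imports
    "HOL-Algebra.Free_Abelian_Groups"
    "HOL-Algebra.Product_Groups"
    "HOL-Library.Poly_Mapping"
    "HOL-Library.Countable_Set"
begin

section \<open>Positive braids\<close>

text \<open>A word is a list of generator indices; the letter \<open>i\<close> stands for the generator
  \<open>\<sigma>\<^sub>i\<close>.\<close>

definition braid_words :: "nat \<Rightarrow> nat list set" where
  "braid_words n = lists {1..<n}"

inductive braid_move :: "nat list \<Rightarrow> nat list \<Rightarrow> bool" where
  far: "i + 2 \<le> j \<Longrightarrow> braid_move (u @ [i, j] @ v) (u @ [j, i] @ v)"
| braid: "braid_move (u @ [i, Suc i, i] @ v) (u @ [Suc i, i, Suc i] @ v)"

definition braid_rel :: "nat \<Rightarrow> (nat list \<times> nat list) set" where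
  "braid_rel n = {(u, v) \<in> braid_words n \<times> braid_words n. equivclp braid_move u v}"

definition pos_braids :: "nat \<Rightarrow> nat list set set" where
  "pos_braids n = braid_words n // braid_rel n"

text \<open>The braid relations preserve the number of letters, so the image below is a singleton.\<close>

definition braid_length :: "nat list set \<Rightarrow> nat" where
  "braid_length \<beta> = the_elem (length ` \<beta>)"


section \<open>The polynomial ring on the reflection representation\<close>

text \<open>Polynomials over the rationals in variables indexed by \<open>nat\<close>: a finitely supported map
  from exponent vectors to coefficients.\<close>

type_synonym mpoly = "(nat \<Rightarrow>\<^sub>0 nat) \<Rightarrow>\<^sub>0 rat"

definition const_poly :: "rat \<Rightarrow> mpoly" where
  "const_poly c = Poly_Mapping.single 0 c"

definition alpha :: "nat \<Rightarrow> mpoly" where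
  "alpha i = Poly_Mapping.single (Poly_Mapping.single i 1) 1"

definition polyR :: "nat \<Rightarrow> mpoly set" where
  "polyR n = {p. \<forall>m \<in> Poly_Mapping.keys p. Poly_Mapping.keys m \<subseteq> {1..<n}}"

text \<open>Each \<open>\<alpha>\<^sub>i\<close> has quantum degree 2.\<close>

definition polyR_grade :: "nat \<Rightarrow> int \<Rightarrow> mpoly set" where
  "polyR_grade n q = {p \<in> polyR n. \<forall>m \<in> Poly_Mapping.keys p.
     2 * int (\<Sum>i \<in> Poly_Mapping.keys m. Poly_Mapping.lookup m i) = q}"

definition poly_subst :: "(nat \<Rightarrow> mpoly) \<Rightarrow> mpoly \<Rightarrow> mpoly" where
  "poly_subst f p = (\<Sum>m \<in> Poly_Mapping.keys p.
     const_poly (Poly_Mapping.lookup p m) *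
     (\<Prod>j \<in> Poly_Mapping.keys m. f j ^ Poly_Mapping.lookup m j))"

text \<open>The simple reflection \<open>s\<^sub>i\<close> of type \<open>A\<close> sends a simple root \<open>\<alpha>\<^sub>j\<close> to
  \<open>\<alpha>\<^sub>j - a\<^sub>i\<^sub>j \<alpha>\<^sub>i\<close>, where \<open>a\<^sub>i\<^sub>j\<close> is the Cartan integer
  (2 if \<open>i = j\<close>, -1 if \<open>i\<close> and \<open>j\<close> are adjacent, 0 otherwise).\<close>

definition simple_refl :: "nat \<Rightarrow> nat \<Rightarrow> mpoly" where
  "simple_refl i j =
     (if j = i then - alpha i
      else if j = Suc i \<or> i = Suc j then alpha j + alpha i
      else alpha j)"

definition invariants :: "nat \<Rightarrow> nat \<Rightarrow> mpoly set" where
  "invariants n i = {p \<in> polyR n. poly_subst (simple_refl i) p = p}"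


section \<open>Graded bimodules\<close>

text \<open>The underlying additive group of a bimodule is stored in the fields of \<open>monoid\<close>, as in
  \<open>free_Abelian_group\<close> and \<open>sum_group\<close>: thus \<open>\<otimes>\<^bsub>M\<^esub>\<close> is the
  addition of \<open>M\<close> and \<open>\<one>\<^bsub>M\<^esub>\<close> its zero element. \<open>grade M q\<close> is the
  homogeneous component of quantum degree \<open>q\<close>.\<close>

record 'a gbim = "'a monoid" +
  lact :: "mpoly \<Rightarrow> 'a \<Rightarrow> 'a"
  ract :: "'a \<Rightarrow> mpoly \<Rightarrow> 'a"
  grade :: "int \<Rightarrow> 'a set"

definition regular_bim :: "nat \<Rightarrow> mpoly gbim" where
  "regular_bim n = \<lparr>carrier = polyR n, monoid.mult = (+), one = 0,
     lact = (*), ract = (*), grade = polyR_grade n\<rparr>"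

definition zero_bim :: "nat gbim" where
  "zero_bim = \<lparr>carrier = {0}, monoid.mult = (\<lambda>_ _. 0), one = 0,
     lact = (\<lambda>_ _. 0), ract = (\<lambda>_ _. 0), grade = (\<lambda>_. {0})\<rparr>"

definition shift :: "int \<Rightarrow> 'a gbim \<Rightarrow> 'a gbim" where
  "shift k M = M\<lparr>grade := (\<lambda>j. grade M (j + k))\<rparr>"

definition bimod_hom :: "nat \<Rightarrow> 'a gbim \<Rightarrow> 'b gbim \<Rightarrow> ('a \<Rightarrow> 'b) set" where
  "bimod_hom n M N = {f \<in> hom M N \<inter> extensional (carrier M).
     \<forall>r \<in> polyR n. \<forall>x \<in> carrier M.
       f (lact M r x) = lact N r (f x) \<and> f (ract M x r) = ract N (f x) r}"


subsection \<open>Tensor products\<close>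

text \<open>\<open>tensor S M N\<close> is \<open>M \<otimes>\<^sub>S N\<close> for a subring \<open>S\<close> of
  the polynomial ring: the free abelian group on pairs modulo biadditivity and
  \<open>(x r, y) = (x, r y)\<close> for \<open>r \<in> S\<close>. Its elements are cosets.\<close>

definition tensor_free :: "'a gbim \<Rightarrow> 'b gbim \<Rightarrow> (('a \<times> 'b) \<Rightarrow>\<^sub>0 int) monoid" where
  "tensor_free M N = free_Abelian_group (carrier M \<times> carrier N)"

definition tensor_rels :: "mpoly set \<Rightarrow> 'a gbim \<Rightarrow> 'b gbim \<Rightarrow> (('a \<times> 'b) \<Rightarrow>\<^sub>0 int) set" where
  "tensor_rels S M N =
     {frag_of (x \<otimes>\<^bsub>M\<^esub> x', y) - frag_of (x, y) - frag_of (x', y) | x x' y.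
        x \<in> carrier M \<and> x' \<in> carrier M \<and> y \<in> carrier N} \<union>
     {frag_of (x, y \<otimes>\<^bsub>N\<^esub> y') - frag_of (x, y) - frag_of (x, y') | x y y'.
        x \<in> carrier M \<and> y \<in> carrier N \<and> y' \<in> carrier N} \<union>
     {frag_of (ract M x r, y) - frag_of (x, lact N r y) | x r y.
        x \<in> carrier M \<and> r \<in> S \<and> y \<in> carrier N}"

definition tensor_ker :: "mpoly set \<Rightarrow> 'a gbim \<Rightarrow> 'b gbim \<Rightarrow> (('a \<times> 'b) \<Rightarrow>\<^sub>0 int) set" where
  "tensor_ker S M N = generate (tensor_free M N) (tensor_rels S M N)"

definition pure_tensor ::
    "mpoly set \<Rightarrow> 'a gbim \<Rightarrow> 'b gbim \<Rightarrow> 'a \<Rightarrow> 'b \<Rightarrow> (('a \<times> 'b) \<Rightarrow>\<^sub>0 int) set" where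
  "pure_tensor S M N x y = tensor_ker S M N #>\<^bsub>tensor_free M N\<^esub> frag_of (x, y)"

text \<open>The map \<open>f \<otimes> g\<close> into \<open>M \<otimes>\<^sub>S N\<close>. When \<open>f \<otimes> g\<close> is well
  defined, the union is one of identical cosets.\<close>

definition tensor_map ::
    "mpoly set \<Rightarrow> 'a gbim \<Rightarrow> 'b gbim \<Rightarrow> ('c \<Rightarrow> 'a) \<Rightarrow> ('d \<Rightarrow> 'b)
     \<Rightarrow> (('c \<times> 'd) \<Rightarrow>\<^sub>0 int) set \<Rightarrow> (('a \<times> 'b) \<Rightarrow>\<^sub>0 int) set" where
  "tensor_map S M N f g X =
     (\<Union>z \<in> X. tensor_ker S M N #>\<^bsub>tensor_free M N\<^esub>
        frag_extend (\<lambda>(x, y). frag_of (f x, g y)) z)"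

definition tensor :: "mpoly set \<Rightarrow> 'a gbim \<Rightarrow> 'b gbim \<Rightarrow> (('a \<times> 'b) \<Rightarrow>\<^sub>0 int) set gbim" where
  "tensor S M N =
     (let T = tensor_free M N Mod tensor_ker S M N in
      \<lparr>carrier = carrier T, monoid.mult = monoid.mult T, one = one T,
       lact = (\<lambda>r. tensor_map S M N (lact M r) id),
       ract = (\<lambda>X r. tensor_map S M N id (\<lambda>y. ract N y r) X),
       grade = (\<lambda>q. generate T
         {pure_tensor S M N x y | x y i. x \<in> grade M i \<and> y \<in> grade N (q - i)})\<rparr>)"


subsection \<open>Direct sums\<close>

definition bim_sum :: "(int \<Rightarrow> 'a gbim) \<Rightarrow> (int \<Rightarrow> 'a) gbim" where
  "bim_sum M =
     (let G = sum_group UNIV M in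
      \<lparr>carrier = carrier G, monoid.mult = monoid.mult G, one = one G,
       lact = (\<lambda>r x i. lact (M i) r (x i)),
       ract = (\<lambda>x r i. ract (M i) (x i) r),
       grade = (\<lambda>q. {x \<in> carrier G. \<forall>i. x i \<in> grade (M i) q})\<rparr>)"


section \<open>Complexes of graded bimodules\<close>

text \<open>Cochain complexes; \<open>diff C t\<close> maps \<open>obj C t\<close> to \<open>obj C (t + 1)\<close>.\<close>

record 'a cpx =
  obj :: "int \<Rightarrow> 'a gbim"
  diff :: "int \<Rightarrow> 'a \<Rightarrow> 'a"

text \<open>The degree \<open>k\<close> term is the sum over \<open>i\<close> of \<open>F\<^sup>i \<otimes> G\<^sup>k\<^sup>-\<^sup>i\<close>, and
  \<open>d (x \<otimes> y) = d x \<otimes> y + (-1)\<^sup>i x \<otimes> d y\<close> for \<open>x\<close> in \<open>F\<^sup>i\<close>; so the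
  component of \<open>d x\<close> at \<open>i\<close> collects contributions from \<open>x (i - 1)\<close> and \<open>x i\<close>.\<close>

definition cpx_tensor ::
    "mpoly set \<Rightarrow> 'a cpx \<Rightarrow> 'b cpx \<Rightarrow> (int \<Rightarrow> (('a \<times> 'b) \<Rightarrow>\<^sub>0 int) set) cpx" where
  "cpx_tensor S F G =
     \<lparr>obj = (\<lambda>k. bim_sum (\<lambda>i. tensor S (obj F i) (obj G (k - i)))),
      diff = (\<lambda>k x i.
        tensor_map S (obj F i) (obj G (k + 1 - i)) (diff F (i - 1)) id (x (i - 1))
        \<otimes>\<^bsub>tensor S (obj F i) (obj G (k + 1 - i))\<^esub>
        tensor_map S (obj F i) (obj G (k + 1 - i)) id
          (\<lambda>y. if even i then diff G (k - i) y
               else inv\<^bsub>obj G (k + 1 - i)\<^esub> (diff G (k - i) y)) (x i))\<rparr>"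

text \<open>Tensor products change the type of elements, which obstructs iterating them in a recursive
  definition. All bimodules occurring below are countable, so elements are renamed by natural
  numbers, along the bijection of \<open>carrier M\<close> with a set of natural numbers that is provided by
  \<open>to_nat_on\<close>. The result is isomorphic to the original bimodule or complex.\<close>

definition relabel :: "'a gbim \<Rightarrow> nat gbim" where
  "relabel M =
     (let f = to_nat_on (carrier M); g = from_nat_into (carrier M) in
      \<lparr>carrier = f ` carrier M,
       monoid.mult = (\<lambda>x y. f (g x \<otimes>\<^bsub>M\<^esub> g y)),
       one = f \<one>\<^bsub>M\<^esub>,
       lact = (\<lambda>r x. f (lact M r (g x))),
       ract = (\<lambda>x r. f (ract M (g x) r)),
       grade = (\<lambda>q. f ` grade M q)\<rparr>)"

definition relabel_map :: "'a gbim \<Rightarrow> 'b gbim \<Rightarrow> ('a \<Rightarrow> 'b) \<Rightarrow> nat \<Rightarrow> nat" where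
  "relabel_map M N h x = to_nat_on (carrier N) (h (from_nat_into (carrier M) x))"

definition relabel_cpx :: "'a cpx \<Rightarrow> nat cpx" where
  "relabel_cpx C =
     \<lparr>obj = (\<lambda>t. relabel (obj C t)),
      diff = (\<lambda>t. relabel_map (obj C t) (obj C (t + 1)) (diff C t))\<rparr>"


section \<open>Rouquier complexes\<close>

definition Bs :: "nat \<Rightarrow> nat \<Rightarrow> ((mpoly \<times> mpoly) \<Rightarrow>\<^sub>0 int) set gbim" where
  "Bs n i = shift 1 (tensor (invariants n i) (regular_bim n) (regular_bim n))"

text \<open>The multiplication map \<open>x \<otimes> y \<mapsto> x y\<close>; it is constant on cosets.\<close>

definition Bs_mult :: "((mpoly \<times> mpoly) \<Rightarrow>\<^sub>0 int) set \<Rightarrow> mpoly" where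
  "Bs_mult X = the_elem ((\<lambda>z. \<Sum>(x, y) \<in> Poly_Mapping.keys z.
     of_int (Poly_Mapping.lookup z (x, y)) * (x * y)) ` X)"

definition rouquier_gen :: "nat \<Rightarrow> nat \<Rightarrow> nat cpx" where
  "rouquier_gen n i =
     \<lparr>obj = (\<lambda>t. if t = 0 then relabel (Bs n i)
                 else if t = 1 then relabel (shift 1 (regular_bim n))
                 else zero_bim),
      diff = (\<lambda>t. if t = 0 then relabel_map (Bs n i) (shift 1 (regular_bim n)) Bs_mult
                 else if t = -1 then (\<lambda>_. \<one>\<^bsub>relabel (Bs n i)\<^esub>)
                 else (\<lambda>_. 0))\<rparr>"

definition unit_cpx :: "nat \<Rightarrow> nat cpx" where
  "unit_cpx n =
     \<lparr>obj = (\<lambda>t. if t = 0 then relabel (regular_bim n) else zero_bim),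
      diff = (\<lambda>t. if t = -1 then (\<lambda>_. \<one>\<^bsub>relabel (regular_bim n)\<^esub>) else (\<lambda>_. 0))\<rparr>"

text \<open>The empty tensor product is \<open>R\<close>; a nonempty word yields
  \<open>F\<^sub>1 \<otimes> (F\<^sub>2 \<otimes> (\<dots> \<otimes> (F\<^sub>r \<otimes> R)))\<close>, all tensor products
  being over \<open>R\<close>.\<close>

primrec rouquier :: "nat \<Rightarrow> nat list \<Rightarrow> nat cpx" where
  "rouquier n [] = unit_cpx n"
| "rouquier n (i # w) = relabel_cpx (cpx_tensor (polyR n) (rouquier_gen n i) (rouquier n w))"


section \<open>Hochschild cohomology in degree 0 and triply graded homology\<close>

text \<open>Bimodule homomorphisms of all degrees from \<open>R\<close>. The two actions on this
  bimodule agree, so it is a graded \<open>R\<close>-module.\<close>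

definition HH0 :: "nat \<Rightarrow> 'a gbim \<Rightarrow> (mpoly \<Rightarrow> 'a) gbim" where
  "HH0 n M =
     \<lparr>carrier = bimod_hom n (regular_bim n) M,
      monoid.mult = (\<lambda>f g. \<lambda>x\<in>polyR n. f x \<otimes>\<^bsub>M\<^esub> g x),
      one = (\<lambda>x\<in>polyR n. \<one>\<^bsub>M\<^esub>),
      lact = (\<lambda>r f. \<lambda>x\<in>polyR n. lact M r (f x)),
      ract = (\<lambda>f r. \<lambda>x\<in>polyR n. ract M (f x) r),
      grade = (\<lambda>q. {f \<in> bimod_hom n (regular_bim n) M.
                 \<forall>j. f ` polyR_grade n j \<subseteq> grade M (j + q)})\<rparr>"

definition HH0_cpx :: "nat \<Rightarrow> 'a cpx \<Rightarrow> (mpoly \<Rightarrow> 'a) cpx" where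
  "HH0_cpx n C =
     \<lparr>obj = (\<lambda>t. HH0 n (obj C t)),
      diff = (\<lambda>t f. \<lambda>x\<in>polyR n. diff C t (f x))\<rparr>"

definition cocycles :: "'a cpx \<Rightarrow> int \<Rightarrow> 'a set" where
  "cocycles C t = kernel (obj C t) (obj C (t + 1)) (diff C t)"

definition coboundaries :: "'a cpx \<Rightarrow> int \<Rightarrow> 'a set" where
  "coboundaries C t = diff C (t - 1) ` carrier (obj C (t - 1))"

definition cohomology :: "'a cpx \<Rightarrow> int \<Rightarrow> 'a set gbim" where
  "cohomology C t =
     (let H = (obj C t)\<lparr>carrier := cocycles C t\<rparr> Mod coboundaries C t in
      \<lparr>carrier = carrier H, monoid.mult = monoid.mult H, one = one H,
       lact = (\<lambda>r X. \<Union>x \<in> X. coboundaries C t #>\<^bsub>obj C t\<^esub> lact (obj C t) r x),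
       ract = (\<lambda>X r. \<Union>x \<in> X. coboundaries C t #>\<^bsub>obj C t\<^esub> ract (obj C t) x r),
       grade = (\<lambda>q. {coboundaries C t #>\<^bsub>obj C t\<^esub> x | x.
                  x \<in> cocycles C t \<inter> grade (obj C t) q})\<rparr>)"

text \<open>Rational vector spaces, again with the additive group stored in the fields of
  \<open>monoid\<close>.\<close>

record 'a qspace = "'a monoid" +
  qscale :: "rat \<Rightarrow> 'a \<Rightarrow> 'a"

definition Q_space :: "rat qspace" where
  "Q_space = \<lparr>carrier = UNIV, monoid.mult = (+), one = 0, qscale = (*)\<rparr>"

definition qspace_iso :: "'a qspace \<Rightarrow> 'b qspace \<Rightarrow> bool" where
  "qspace_iso V W \<longleftrightarrow> (\<exists>f \<in> iso V W. \<forall>c. \<forall>x \<in> carrier V. f (qscale V c x) = qscale W c (f x))"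

text \<open>\<open>HHH0 n w t q\<close> is the homology in degree \<open>(a, t, q) = (0, t, q)\<close> of the braid on
  \<open>n\<close> strands represented by the word \<open>w\<close>.\<close>

definition HHH0 :: "nat \<Rightarrow> nat list \<Rightarrow> int \<Rightarrow> int \<Rightarrow> (mpoly \<Rightarrow> nat) set qspace" where
  "HHH0 n w t q =
     (let H = cohomology (HH0_cpx n (rouquier n w)) t in
      \<lparr>carrier = grade H q, monoid.mult = monoid.mult H, one = one H,
       qscale = (\<lambda>c. lact H (const_poly c))\<rparr>)"

end

theory Submission
  imports Defs "HOL-Library.Function_Algebras" "HOL-Library.Product_Plus"
begin

text \<open>A bimodule map from \<open>R\<close> is determined by the image of \<open>1\<close>, a central element, that is, one on which
  the left and right actions of \<open>R\<close> agree. Thus the homology in question is that of the complex of central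
  elements of \<open>F\<^sub>w\<close>. The claim \<open>Q(w)\<close> is that this complex is exact in bidegree \<open>(t, q)\<close> if \<open>q < - t\<close>, and
  if \<open>q = - t\<close> and \<open>t < \<ell>(w)\<close>. There is nothing above \<open>t = \<ell>(w)\<close>; for \<open>t = \<ell>(w)\<close> and \<open>q = - t\<close> the cocycles
  form a copy of the rational numbers, which meets the coboundaries trivially, because those have zero constant
  term.

  A central element of \<open>F\<^sub>s \<otimes> C\<close> is given by a central element of \<open>C\<close> and an element of \<open>C\<close> that commutes with
  \<open>R\<^sup>s\<close> only. This yields \<open>Q(i i w)\<close> from \<open>Q(i w)\<close> and \<open>Q(w)\<close>; it yields \<open>Q(i w)\<close> from \<open>Q(w)\<close> if \<open>i\<close> does not
  occur in \<open>w\<close>, because then commuting with \<open>R\<^sup>s\<close> implies commuting with \<open>R\<close>. Moreover, \<open>Q\<close> is invariant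
  under rotation of the word, under exchanging distant letters, and under braid moves, as the central elements of
  \<open>F\<^sub>s \<otimes> F\<^sub>t \<otimes> F\<^sub>s \<otimes> C\<close> retract to a complex of six terms that is symmetric in \<open>s\<close> and \<open>t\<close>. By these moves every
  word is turned into one that contains a square \<open>i i\<close> or has distinct letters, and \<open>Q\<close> follows by induction on
  the length.\<close>

section \<open>Complexes with commuting left and right variables\<close>

text \<open>The complex of central elements of F_s \<otimes> C is the cone of a map from the
  s-central elements of C, in bidegree (t, q - 1), to the central elements of C, in bidegree (t - 1,
  q + 1). The second part keeps t + q and the first lowers it. This is why the claim includes all q
  < - t: the s-central part always falls strictly below the line q = - t. Exactness of two of the
  three complexes, in suitable degrees, gives exactness of the third, and this is what reduces F_s
  F_s to F_s and R.

  The obstacle is the braid relation. F_s F_t F_s and F_t F_s F_t are only homotopy equivalent, so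
  the relation is proved for the central elements of a word that begins with the three letters;
  rotation brings every position there. The common retract comes from the minimal complex B_sts ->
  B_s B_t + B_t B_s -> B_s + B_t -> R.

  Variables x_1, ..., x_n permuted by the reflections replace the simple roots, so that one formula
  serves every reflection. Computations take place in coordinates, and a separate comparison
  identifies this model with the cosets and relabelled complexes of the definitions.\<close>

text \<open>An iterated tensor product is encoded by functions on lists of digits, one digit for each factor, so that
  all words share one type of elements; \<open>trip\<close> prepends a factor with three components.\<close>

definition trip :: "(nat list \<Rightarrow> 'v::ab_group_add) \<Rightarrow> (nat list \<Rightarrow> 'v) \<Rightarrow> (nat list \<Rightarrow> 'v) \<Rightarrow> nat list \<Rightarrow> 'v" where
  "trip a b c l = (case l of [] \<Rightarrow> 0 | k # l' \<Rightarrow>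
     if k = 0 then a l' else if k = 1 then b l' else if k = 2 then c l' else 0)"

definition part :: "nat \<Rightarrow> (nat list \<Rightarrow> 'v) \<Rightarrow> nat list \<Rightarrow> 'v" where
  "part k v = (\<lambda>l. v (k # l))"

lemma part_trip [simp]:
  "part 0 (trip a b c) = a" "part (Suc 0) (trip a b c) = b" "part 2 (trip a b c) = c"
  by (auto simp: part_def trip_def)

lemma part_simps [simp]:
  fixes u v :: "nat list \<Rightarrow> 'v::ab_group_add"
  shows "part k (u + v) = part k u + part k v" "part k (- u) = - part k u" "part k 0 = (0 :: nat list \<Rightarrow> 'v)"
    "part k (u - v) = part k u - part k v"
  by (auto simp: part_def fun_eq_iff fun_diff_def)

lemma trip_eq_iff [simp]: "trip a b c = trip a' b' c' \<longleftrightarrow> a = a' \<and> b = b' \<and> c = c'"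
  by (metis part_trip)

lemma trip_zero [simp]: "trip 0 0 0 = 0"
  by (auto simp: trip_def fun_eq_iff split: list.splits)

lemma trip_eq_0_iff [simp]: "trip a b c = 0 \<longleftrightarrow> a = 0 \<and> b = 0 \<and> c = 0"
  by (metis trip_zero trip_eq_iff)

lemma trip_add [simp]: "trip a b c + trip a' b' c' = trip (a + a') (b + b') (c + c')"
  by (auto simp: trip_def fun_eq_iff split: list.splits)

lemma trip_minus [simp]: "- trip a b c = trip (- a) (- b) (- c)"
  by (auto simp: trip_def fun_eq_iff split: list.splits)

lemma trip_diff [simp]: "trip a b c - trip a' b' c' = trip (a - a') (b - b') (c - c')"
  by (auto simp: trip_def fun_eq_iff fun_diff_def split: list.splits)

text \<open>A bigraded complex of bimodules, all degrees sharing one function space.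
  \<open>lop j\<close> and \<open>rop j\<close> are left and right multiplication by x_j,
  \<open>del\<close> is the differential, \<open>eps\<close> the Koszul sign (-1)^t, and
  \<open>piece t q\<close> the part of cohomological degree t and quantum degree q. The operators
  are total, so most laws hold without membership assumptions.\<close>

record 'v bcx =
  lop :: "nat \<Rightarrow> (nat list \<Rightarrow> 'v) \<Rightarrow> nat list \<Rightarrow> 'v"
  rop :: "nat \<Rightarrow> (nat list \<Rightarrow> 'v) \<Rightarrow> nat list \<Rightarrow> 'v"
  del :: "(nat list \<Rightarrow> 'v) \<Rightarrow> nat list \<Rightarrow> 'v"
  eps :: "(nat list \<Rightarrow> 'v) \<Rightarrow> nat list \<Rightarrow> 'v"
  piece :: "int \<Rightarrow> int \<Rightarrow> (nat list \<Rightarrow> 'v) set"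

locale bcx =
  fixes C :: "'v::ab_group_add bcx"
  assumes lop_add: "lop C j (u + v) = lop C j u + lop C j v"
    and rop_add: "rop C j (u + v) = rop C j u + rop C j v"
    and del_add: "del C (u + v) = del C u + del C v"
    and eps_add: "eps C (u + v) = eps C u + eps C v"
    and lop_lop: "lop C i (lop C j u) = lop C j (lop C i u)"
    and rop_rop: "rop C i (rop C j u) = rop C j (rop C i u)"
    and rop_lop: "rop C i (lop C j u) = lop C j (rop C i u)"
    and del_lop: "del C (lop C j u) = lop C j (del C u)"
    and del_rop: "del C (rop C j u) = rop C j (del C u)"
    and del_del: "del C (del C u) = 0"
    and eps_lop: "eps C (lop C j u) = lop C j (eps C u)"
    and eps_rop: "eps C (rop C j u) = rop C j (eps C u)"
    and del_eps: "del C (eps C u) = - eps C (del C u)"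
    and eps_eps: "u \<in> piece C t q \<Longrightarrow> eps C (eps C u) = u"
    and piece_0: "0 \<in> piece C t q"
    and piece_add: "u \<in> piece C t q \<Longrightarrow> v \<in> piece C t q \<Longrightarrow> u + v \<in> piece C t q"
    and piece_minus: "u \<in> piece C t q \<Longrightarrow> - u \<in> piece C t q"
    and piece_lop': "u \<in> piece C t q \<Longrightarrow> lop C j u \<in> piece C t (q + 2)"
    and piece_rop': "u \<in> piece C t q \<Longrightarrow> rop C j u \<in> piece C t (q + 2)"
    and piece_del': "u \<in> piece C t q \<Longrightarrow> del C u \<in> piece C (t + 1) q"
    and piece_eps: "u \<in> piece C t q \<Longrightarrow> eps C u \<in> piece C t q"
begin

lemma op_0: "lop C j 0 = 0" "rop C j 0 = 0" "del C 0 = 0" "eps C 0 = 0"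
  using lop_add[of j 0 0] rop_add[of j 0 0] del_add[of 0 0] eps_add[of 0 0] by simp_all

lemma op_minus: "lop C j (- u) = - lop C j u" "rop C j (- u) = - rop C j u" "del C (- u) = - del C u"
    "eps C (- u) = - eps C u"
  using lop_add[of j u "- u"] rop_add[of j u "- u"] del_add[of u "- u"] eps_add[of u "- u"]
  by (simp_all add: op_0 eq_neg_iff_add_eq_0 add.commute)

lemma op_diff: "lop C j (u - v) = lop C j u - lop C j v" "rop C j (u - v) = rop C j u - rop C j v"
  "del C (u - v) = del C u - del C v" "eps C (u - v) = eps C u - eps C v"
  using lop_add[of j u "- v"] rop_add[of j u "- v"] del_add[of u "- v"] eps_add[of u "- v"]
  by (simp_all add: op_minus)

lemmas op_linear = lop_add rop_add del_add eps_add op_0 op_minus op_diff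
lemmas op_commute = lop_lop rop_rop rop_lop del_lop del_rop del_del eps_lop eps_rop del_eps

lemma piece_diff: "u \<in> piece C t q \<Longrightarrow> v \<in> piece C t q \<Longrightarrow> u - v \<in> piece C t q"
  using piece_add[of u t q "- v"] piece_minus by simp

text \<open>The degree of the result is an equation, so that these serve as introduction rules
  whatever arithmetic form the goal has.\<close>

lemma piece_lop: "u \<in> piece C t q \<Longrightarrow> q' = q + 2 \<Longrightarrow> lop C j u \<in> piece C t q'"
  and piece_rop: "u \<in> piece C t q \<Longrightarrow> q' = q + 2 \<Longrightarrow> rop C j u \<in> piece C t q'"
  and piece_del: "u \<in> piece C t q \<Longrightarrow> t' = t + 1 \<Longrightarrow> del C u \<in> piece C t' q"
  using piece_lop' piece_rop' piece_del' by auto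

lemmas piece_intros = piece_0 piece_add piece_minus piece_diff piece_lop piece_rop piece_del piece_eps

end

subsection \<open>Tensoring with the Rouquier complex of a transposition\<close>

text \<open>Let \<open>s\<close> exchange the variables \<open>x\<^sub>p\<close> and \<open>x\<^sub>q\<close>. As \<open>R\<close> is free over \<open>R\<^sup>s\<close> on
  \<open>1\<close> and \<open>x\<^sub>p\<close>, an element of \<open>F\<^sub>s \<otimes> C\<close> is a triple \<open>(a, b, c)\<close> standing for
  \<open>1 \<otimes> a + x\<^sub>p \<otimes> b\<close> in \<open>B\<^sub>s \<otimes> C\<close> and \<open>c\<close> in \<open>R(1) \<otimes> C\<close>. The left action follows from
  \<open>x\<^sub>p\<^sup>2 = (x\<^sub>p + x\<^sub>q) x\<^sub>p - x\<^sub>p x\<^sub>q\<close>.\<close>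

definition lten :: "nat \<Rightarrow> nat \<Rightarrow> 'v::ab_group_add bcx \<Rightarrow> 'v bcx" where
  "lten p q C = \<lparr>
     lop = (\<lambda>j v. let a = part 0 v; b = part (Suc 0) v; c = part 2 v in
        trip (if j = p then - lop C p (lop C q b)
              else if j = q then lop C p a + lop C q a + lop C p (lop C q b) else lop C j a)
             (if j = p then a + lop C p b + lop C q b else if j = q then - a else lop C j b)
             (lop C j c)),
     rop = (\<lambda>j v. trip (rop C j (part 0 v)) (rop C j (part (Suc 0) v)) (rop C j (part 2 v))),
     del = (\<lambda>v. let a = part 0 v; b = part (Suc 0) v; c = part 2 v in
        trip (del C a) (del C b) (a + lop C p b - del C c)),
     eps = (\<lambda>v. trip (eps C (part 0 v)) (eps C (part (Suc 0) v)) (- eps C (part 2 v))),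
     piece = (\<lambda>t d. {trip a b c | a b c.
        a \<in> piece C t (d + 1) \<and> b \<in> piece C t (d - 1) \<and> c \<in> piece C (t - 1) (d + 1)})\<rparr>"

text \<open>The right-handed version \<open>C \<otimes> F\<^sub>s\<close>; the sign operator \<open>eps\<close> supplies the Koszul sign.\<close>

definition rten :: "nat \<Rightarrow> nat \<Rightarrow> 'v::ab_group_add bcx \<Rightarrow> 'v bcx" where
  "rten p q C = \<lparr>
     lop = (\<lambda>j v. trip (lop C j (part 0 v)) (lop C j (part (Suc 0) v)) (lop C j (part 2 v))),
     rop = (\<lambda>j v. let a = part 0 v; b = part (Suc 0) v; c = part 2 v in
        trip (if j = p then - rop C p (rop C q b)
              else if j = q then rop C p a + rop C q a + rop C p (rop C q b) else rop C j a)
             (if j = p then a + rop C p b + rop C q b else if j = q then - a else rop C j b)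
             (rop C j c)),
     del = (\<lambda>v. let a = part 0 v; b = part (Suc 0) v; c = part 2 v in
        trip (del C a) (del C b) (eps C (a + rop C p b) + del C c)),
     eps = (\<lambda>v. trip (eps C (part 0 v)) (eps C (part (Suc 0) v)) (- eps C (part 2 v))),
     piece = (\<lambda>t d. {trip a b c | a b c.
        a \<in> piece C t (d + 1) \<and> b \<in> piece C t (d - 1) \<and> c \<in> piece C (t - 1) (d + 1)})\<rparr>"

lemma piece_ltenI:
  "a \<in> piece C t (d + 1) \<Longrightarrow> b \<in> piece C t (d - 1) \<Longrightarrow> c \<in> piece C (t - 1) (d + 1)
    \<Longrightarrow> trip a b c \<in> piece (lten p q C) t d"
  and piece_rtenI:
  "a \<in> piece C t (d + 1) \<Longrightarrow> b \<in> piece C t (d - 1) \<Longrightarrow> c \<in> piece C (t - 1) (d + 1)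
    \<Longrightarrow> trip a b c \<in> piece (rten p q C) t d"
  by (auto simp: lten_def rten_def)

lemma piece_ltenE:
  assumes "v \<in> piece (lten p q C) t d"
  obtains a b c where "v = trip a b c" "a \<in> piece C t (d + 1)" "b \<in> piece C t (d - 1)"
    "c \<in> piece C (t - 1) (d + 1)"
  using assms by (auto simp: lten_def)

lemma piece_rtenE:
  assumes "v \<in> piece (rten p q C) t d"
  obtains a b c where "v = trip a b c" "a \<in> piece C t (d + 1)" "b \<in> piece C t (d - 1)"
    "c \<in> piece C (t - 1) (d + 1)"
  using assms by (auto simp: rten_def)

lemma piece_lten_iff: "trip a b c \<in> piece (lten p q C) t d \<longleftrightarrow>
   a \<in> piece C t (d + 1) \<and> b \<in> piece C t (d - 1) \<and> c \<in> piece C (t - 1) (d + 1)"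
  by (auto simp: lten_def)

lemma piece_rten_iff: "trip a b c \<in> piece (rten p q C) t d \<longleftrightarrow>
   a \<in> piece C t (d + 1) \<and> b \<in> piece C t (d - 1) \<and> c \<in> piece C (t - 1) (d + 1)"
  by (auto simp: rten_def)

lemma lten_trip:
  "rop (lten p q C) j (trip a b c) = trip (rop C j a) (rop C j b) (rop C j c)"
  "del (lten p q C) (trip a b c) = trip (del C a) (del C b) (a + lop C p b - del C c)"
  "eps (lten p q C) (trip a b c) = trip (eps C a) (eps C b) (- eps C c)"
  "lop (lten p q C) j (trip a b c) =
    trip (if j = p then - lop C p (lop C q b)
              else if j = q then lop C p a + lop C q a + lop C p (lop C q b) else lop C j a)
             (if j = p then a + lop C p b + lop C q b else if j = q then - a else lop C j b)
             (lop C j c)"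
  by (simp_all add: lten_def Let_def)

lemma rten_trip:
  "lop (rten p q C) j (trip a b c) = trip (lop C j a) (lop C j b) (lop C j c)"
  "del (rten p q C) (trip a b c) = trip (del C a) (del C b) (eps C (a + rop C p b) + del C c)"
  "eps (rten p q C) (trip a b c) = trip (eps C a) (eps C b) (- eps C c)"
  "rop (rten p q C) j (trip a b c) =
    trip (if j = p then - rop C p (rop C q b)
              else if j = q then rop C p a + rop C q a + rop C p (rop C q b) else rop C j a)
             (if j = p then a + rop C p b + rop C q b else if j = q then - a else rop C j b)
             (rop C j c)"
  by (simp_all add: rten_def Let_def)

context bcx
begin

lemma bcx_lten:
  assumes "p \<noteq> q"
  shows "bcx (lten p q C)"
proof
  fix i j u v
  show "lop (lten p q C) j (u + v) = lop (lten p q C) j u + lop (lten p q C) j v"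
    "rop (lten p q C) j (u + v) = rop (lten p q C) j u + rop (lten p q C) j v"
    "del (lten p q C) (u + v) = del (lten p q C) u + del (lten p q C) v"
    "eps (lten p q C) (u + v) = eps (lten p q C) u + eps (lten p q C) v"
    by (simp_all add: lten_def Let_def op_linear algebra_simps)
  show "rop (lten p q C) i (rop (lten p q C) j u) = rop (lten p q C) j (rop (lten p q C) i u)"
    "rop (lten p q C) i (lop (lten p q C) j u) = lop (lten p q C) j (rop (lten p q C) i u)"
    "del (lten p q C) (rop (lten p q C) j u) = rop (lten p q C) j (del (lten p q C) u)"
    "eps (lten p q C) (rop (lten p q C) j u) = rop (lten p q C) j (eps (lten p q C) u)"
    "eps (lten p q C) (lop (lten p q C) j u) = lop (lten p q C) j (eps (lten p q C) u)"
    "del (lten p q C) (del (lten p q C) u) = 0"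
    "del (lten p q C) (eps (lten p q C) u) = - eps (lten p q C) (del (lten p q C) u)"
    by (simp_all add: lten_def Let_def op_linear op_commute algebra_simps)
  show "del (lten p q C) (lop (lten p q C) j u) = lop (lten p q C) j (del (lten p q C) u)"
    using assms
    by (auto simp add: lten_def Let_def op_linear op_commute algebra_simps)
  show "lop (lten p q C) i (lop (lten p q C) j u) = lop (lten p q C) j (lop (lten p q C) i u)"
    using assms by (auto simp add: lten_def Let_def op_linear op_commute algebra_simps)
next
  fix u v t d j
  show "0 \<in> piece (lten p q C) t d"
    using piece_ltenI[of 0 C t d 0 0] by (simp add: piece_0)
  assume u: "u \<in> piece (lten p q C) t d"
  then obtain a b c where [simp]: "u = trip a b c" and a: "a \<in> piece C t (d + 1)"
    and b: "b \<in> piece C t (d - 1)" and c: "c \<in> piece C (t - 1) (d + 1)"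
    by (rule piece_ltenE)
  show "eps (lten p q C) (eps (lten p q C) u) = u"
    using a b c by (simp add: lten_trip op_linear eps_eps)
  show "- u \<in> piece (lten p q C) t d" "eps (lten p q C) u \<in> piece (lten p q C) t d"
    using a b c by (auto simp: lten_trip piece_lten_iff intro!: piece_intros)
  show "rop (lten p q C) j u \<in> piece (lten p q C) t (d + 2)"
    using a b c by (auto simp: lten_trip piece_lten_iff intro!: piece_intros)
  have a': "a \<in> piece C t (1 + d)"
    using a by (simp add: add.commute)
  have b': "lop C p (lop C q b) \<in> piece C t (d + 3)" "lop C j b \<in> piece C t (d + 1)" for j
    using b by (auto intro!: piece_intros)
  show "lop (lten p q C) j u \<in> piece (lten p q C) t (d + 2)"
    using a a' b b' c by (auto simp: lten_trip piece_lten_iff intro!: piece_intros)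
  show "del (lten p q C) u \<in> piece (lten p q C) (t + 1) d"
    using a a' b b' c by (auto simp: lten_trip piece_lten_iff intro!: piece_intros)
  assume "v \<in> piece (lten p q C) t d"
  then show "u + v \<in> piece (lten p q C) t d"
    using a b c by (auto simp: piece_lten_iff elim!: piece_ltenE intro!: piece_intros)
qed

lemma bcx_rten:
  assumes "p \<noteq> q"
  shows "bcx (rten p q C)"
proof
  fix i j u v
  show "lop (rten p q C) j (u + v) = lop (rten p q C) j u + lop (rten p q C) j v"
    "rop (rten p q C) j (u + v) = rop (rten p q C) j u + rop (rten p q C) j v"
    "del (rten p q C) (u + v) = del (rten p q C) u + del (rten p q C) v"
    "eps (rten p q C) (u + v) = eps (rten p q C) u + eps (rten p q C) v"
    by (simp_all add: rten_def Let_def op_linear algebra_simps)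
  show "lop (rten p q C) i (lop (rten p q C) j u) = lop (rten p q C) j (lop (rten p q C) i u)"
    "rop (rten p q C) i (lop (rten p q C) j u) = lop (rten p q C) j (rop (rten p q C) i u)"
    "del (rten p q C) (lop (rten p q C) j u) = lop (rten p q C) j (del (rten p q C) u)"
    "eps (rten p q C) (rop (rten p q C) j u) = rop (rten p q C) j (eps (rten p q C) u)"
    "eps (rten p q C) (lop (rten p q C) j u) = lop (rten p q C) j (eps (rten p q C) u)"
    "del (rten p q C) (del (rten p q C) u) = 0"
    "del (rten p q C) (eps (rten p q C) u) = - eps (rten p q C) (del (rten p q C) u)"
    by (simp_all add: rten_def Let_def op_linear op_commute algebra_simps)
  show "del (rten p q C) (rop (rten p q C) j u) = rop (rten p q C) j (del (rten p q C) u)"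
    using assms
    by (auto simp add: rten_def Let_def op_linear op_commute algebra_simps)
  show "rop (rten p q C) i (rop (rten p q C) j u) = rop (rten p q C) j (rop (rten p q C) i u)"
    using assms by (auto simp add: rten_def Let_def op_linear op_commute algebra_simps)
next
  fix u v t d j
  show "0 \<in> piece (rten p q C) t d"
    using piece_rtenI[of 0 C t d 0 0] by (simp add: piece_0)
  assume u: "u \<in> piece (rten p q C) t d"
  then obtain a b c where [simp]: "u = trip a b c" and a: "a \<in> piece C t (d + 1)"
    and b: "b \<in> piece C t (d - 1)" and c: "c \<in> piece C (t - 1) (d + 1)"
    by (rule piece_rtenE)
  show "eps (rten p q C) (eps (rten p q C) u) = u"
    using a b c by (simp add: rten_trip op_linear eps_eps)
  show "- u \<in> piece (rten p q C) t d" "eps (rten p q C) u \<in> piece (rten p q C) t d"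
    using a b c by (auto simp: rten_trip piece_rten_iff intro!: piece_intros)
  show "lop (rten p q C) j u \<in> piece (rten p q C) t (d + 2)"
    using a b c by (auto simp: rten_trip piece_rten_iff intro!: piece_intros)
  have a': "a \<in> piece C t (1 + d)"
    using a by (simp add: add.commute)
  have b': "rop C p (rop C q b) \<in> piece C t (d + 3)" "rop C j b \<in> piece C t (d + 1)" for j
    using b by (auto intro!: piece_intros)
  show "rop (rten p q C) j u \<in> piece (rten p q C) t (d + 2)"
    using a a' b b' c by (auto simp: rten_trip piece_rten_iff intro!: piece_intros)
  show "del (rten p q C) u \<in> piece (rten p q C) (t + 1) d"
    using a a' b b' c by (auto simp: rten_trip piece_rten_iff intro!: piece_intros)
  assume "v \<in> piece (rten p q C) t d"
  then show "u + v \<in> piece (rten p q C) t d"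
    using a b c by (auto simp: piece_rten_iff elim!: piece_rtenE intro!: piece_intros)
qed

end

subsection \<open>Isomorphisms\<close>

text \<open>The conditions concern homogeneous elements only: the isomorphism used for rotation is
  built from invariant coefficients, which are meaningful only for polynomials in
  \<open>polyR\<close>.\<close>

definition bcx_hom :: "((nat list \<Rightarrow> 'v::ab_group_add) \<Rightarrow> nat list \<Rightarrow> 'v) \<Rightarrow> 'v bcx \<Rightarrow> 'v bcx \<Rightarrow> bool" where
  "bcx_hom f C C' \<longleftrightarrow> (\<forall>t d. \<forall>u \<in> piece C t d. f u \<in> piece C' t d \<and> del C' (f u) = f (del C u)
     \<and> eps C' (f u) = f (eps C u) \<and> (\<forall>j. lop C' j (f u) = f (lop C j u) \<and> rop C' j (f u) = f (rop C j u))
     \<and> (\<forall>v \<in> piece C t d. f (u + v) = f u + f v))"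

definition bcx_iso :: "'v::ab_group_add bcx \<Rightarrow> 'v bcx \<Rightarrow> bool" where
  "bcx_iso C C' \<longleftrightarrow> (\<exists>f g. bcx_hom f C C' \<and> bcx_hom g C' C
     \<and> (\<forall>t d. \<forall>u \<in> piece C t d. g (f u) = u) \<and> (\<forall>t d. \<forall>u \<in> piece C' t d. f (g u) = u))"

lemma bcx_homD:
  assumes "bcx_hom f C C'" "u \<in> piece C t d"
  shows "f u \<in> piece C' t d" "del C' (f u) = f (del C u)" "eps C' (f u) = f (eps C u)"
    "lop C' j (f u) = f (lop C j u)" "rop C' j (f u) = f (rop C j u)"
    "v \<in> piece C t d \<Longrightarrow> f (u + v) = f u + f v"
  using assms unfolding bcx_hom_def by blast+

lemma bcx_isoI:
  assumes "bcx_hom f C C'" "bcx_hom g C' C" "\<And>t d u. u \<in> piece C t d \<Longrightarrow> g (f u) = u"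
    "\<And>t d u. u \<in> piece C' t d \<Longrightarrow> f (g u) = u"
  shows "bcx_iso C C'"
  using assms unfolding bcx_iso_def by blast

lemma bcx_isoE:
  assumes "bcx_iso C C'"
  obtains f g where "bcx_hom f C C'" "bcx_hom g C' C" "\<And>t d u. u \<in> piece C t d \<Longrightarrow> g (f u) = u"
    "\<And>t d u. u \<in> piece C' t d \<Longrightarrow> f (g u) = u"
  using assms unfolding bcx_iso_def by blast

lemma bcx_iso_sym: "bcx_iso C C' \<Longrightarrow> bcx_iso C' C"
  unfolding bcx_iso_def by blast

lemma bcx_hom_comp: "bcx_hom f C C' \<Longrightarrow> bcx_hom g C' C'' \<Longrightarrow> bcx_hom (\<lambda>u. g (f u)) C C''"
  unfolding bcx_hom_def by metis

lemma bcx_iso_trans: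
  assumes "bcx_iso C C'" "bcx_iso C' C''"
  shows "bcx_iso C C''"
proof -
  from assms(1) obtain f g where 1: "bcx_hom f C C'" "bcx_hom g C' C"
    "\<And>t d u. u \<in> piece C t d \<Longrightarrow> g (f u) = u" "\<And>t d u. u \<in> piece C' t d \<Longrightarrow> f (g u) = u"
    by (rule bcx_isoE) (rule that)
  from assms(2) obtain f' g' where 2: "bcx_hom f' C' C''" "bcx_hom g' C'' C'"
    "\<And>t d u. u \<in> piece C' t d \<Longrightarrow> g' (f' u) = u" "\<And>t d u. u \<in> piece C'' t d \<Longrightarrow> f' (g' u) = u"
    by (rule bcx_isoE) (rule that)
  show ?thesis
    by (rule bcx_isoI[OF bcx_hom_comp[OF 1(1) 2(1)] bcx_hom_comp[OF 2(2) 1(2)]])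
      (metis 1 2 bcx_homD(1))+
qed

lemma (in bcx) bcx_hom_diff:
  assumes "bcx_hom f C C'" "u \<in> piece C t d" "v \<in> piece C t d"
  shows "f 0 = 0" "f (- u) = - f u" "f (u - v) = f u - f v"
proof -
  have z: "f 0 = 0"
    using bcx_homD(6)[OF assms(1) piece_0 piece_0] by simp
  have m: "f (- w) = - f w" if "w \<in> piece C t d" for w
    using bcx_homD(6)[OF assms(1) that piece_minus[OF that]] z
    by (simp add: eq_neg_iff_add_eq_0 add.commute)
  show "f 0 = 0" "f (- u) = - f u" "f (u - v) = f u - f v"
    using z m[OF assms(2)] bcx_homD(6)[OF assms(1,2) piece_minus[OF assms(3)]] m[OF assms(3)] by simp_all
qed

lemma lten_hom:
  assumes "bcx C" "bcx_hom f C C'"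
  shows "bcx_hom (\<lambda>u. trip (f (part 0 u)) (f (part (Suc 0) u)) (f (part 2 u))) (lten p q C) (lten p q C')"
proof -
  interpret bcx C by fact
  note h = bcx_homD[OF assms(2)]
  note hd = bcx_hom_diff[OF assms(2)]
  show ?thesis
    unfolding bcx_hom_def
  proof (intro allI ballI conjI)
    fix t d u j v
    assume "u \<in> piece (lten p q C) t d"
    then obtain a b c where [simp]: "u = trip a b c" and a: "a \<in> piece C t (d + 1)"
      and b: "b \<in> piece C t (d - 1)" and c: "c \<in> piece C (t - 1) (d + 1)"
      by (rule piece_ltenE)
    let ?f = "\<lambda>u. trip (f (part 0 u)) (f (part (Suc 0) u)) (f (part 2 u))"
    show "?f u \<in> piece (lten p q C') t d"
      using a b c by (auto simp: h intro!: piece_ltenI)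
    show "eps (lten p q C') (?f u) = ?f (eps (lten p q C) u)"
      using a b c by (auto simp: lten_trip h(3) hd(2)[OF piece_eps[OF c] piece_eps[OF c]])
    show "rop (lten p q C') j (?f u) = ?f (rop (lten p q C) j u)"
      using a b c by (auto simp: lten_trip h(5))
    have xb: "lop C p b \<in> piece C t (d + 1)" "lop C q b \<in> piece C t (d + 1)"
      "lop C p a \<in> piece C t (d + 3)" "lop C q a \<in> piece C t (d + 3)"
      "del C c \<in> piece C t (d + 1)" "a + lop C p b \<in> piece C t (d + 1)"
      using a b c by (auto intro!: piece_intros)
    have xxb: "lop C p (lop C q b) \<in> piece C t (d + 3)"
      using b by (auto intro!: piece_intros)
    show "del (lten p q C') (?f u) = ?f (del (lten p q C) u)"
      using a b c by (simp add: lten_trip h(2,4) hd(3)[OF xb(6,5)] h(6)[OF a xb(1)])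
    have 1: "f (lop C p a + lop C q a + lop C p (lop C q b)) = lop C' p (f a) + lop C' q (f a) + lop C' p (lop C' q (f b))"
      using h(6)[OF piece_add[OF xb(3,4)] xxb] h(6)[OF xb(3,4)] h(4)[OF a] h(4)[OF b] h(4)[OF xb(2)] by simp
    have 2: "f (a + lop C p b + lop C q b) = f a + lop C' p (f b) + lop C' q (f b)"
      using h(6)[OF xb(6,2)] h(6)[OF a xb(1)] h(4)[OF b] by simp
    have 3: "lop C' p (f (lop C j b)) = f (lop C p (lop C j b))" for j
      using h(4)[of "lop C j b" t "d + 1"] b by (simp add: piece_lop)
    show "lop (lten p q C') j (?f u) = ?f (lop (lten p q C) j u)"
      using h(4)[OF a] h(4)[OF b] h(4)[OF c] 1 2 hd(2)[OF xxb xxb] hd(2)[OF a a]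
      by (simp add: lten_trip 3)
    assume "v \<in> piece (lten p q C) t d"
    then show "?f (u + v) = ?f u + ?f v"
      using a b c by (auto elim!: piece_ltenE simp: h(6))
  qed
qed

lemma lten_cong:
  assumes "bcx C" "bcx C'" "bcx_iso C C'"
  shows "bcx_iso (lten p q C) (lten p q C')"
proof -
  from assms(3) obtain f g where 1: "bcx_hom f C C'" "bcx_hom g C' C"
    "\<And>t d u. u \<in> piece C t d \<Longrightarrow> g (f u) = u" "\<And>t d u. u \<in> piece C' t d \<Longrightarrow> f (g u) = u"
    by (rule bcx_isoE) (rule that)
  show ?thesis
    by (rule bcx_isoI[OF lten_hom[OF assms(1) 1(1)] lten_hom[OF assms(2) 1(2)]])
      (auto elim!: piece_ltenE simp: 1(3,4))
qed

text \<open>Both maps exchange the outer two digits. \<open>stransp\<close> carries the Koszul sign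
  on the summand R(1) \<otimes> R(1), where two factors of cohomological degree 1 pass each
  other.\<close>

definition transp :: "(nat list \<Rightarrow> 'v::ab_group_add) \<Rightarrow> nat list \<Rightarrow> 'v" where
  "transp u = trip (trip (part 0 (part 0 u)) (part 0 (part (Suc 0) u)) (part 0 (part 2 u)))
     (trip (part (Suc 0) (part 0 u)) (part (Suc 0) (part (Suc 0) u)) (part (Suc 0) (part 2 u)))
     (trip (part 2 (part 0 u)) (part 2 (part (Suc 0) u)) (part 2 (part 2 u)))"

definition stransp :: "(nat list \<Rightarrow> 'v::ab_group_add) \<Rightarrow> nat list \<Rightarrow> 'v" where
  "stransp u = trip (trip (part 0 (part 0 u)) (part 0 (part (Suc 0) u)) (part 0 (part 2 u)))
     (trip (part (Suc 0) (part 0 u)) (part (Suc 0) (part (Suc 0) u)) (part (Suc 0) (part 2 u)))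
     (trip (part 2 (part 0 u)) (part 2 (part (Suc 0) u)) (- part 2 (part 2 u)))"

lemma transp_add: "transp (u + v) = transp u + transp v" "stransp (u + v) = stransp u + stransp v"
  by (simp_all add: transp_def stransp_def)

lemma transp_trip:
  "transp (trip (trip a0 a1 a2) (trip b0 b1 b2) (trip c0 c1 c2))
    = trip (trip a0 b0 c0) (trip a1 b1 c1) (trip a2 b2 c2)"
  "stransp (trip (trip a0 a1 a2) (trip b0 b1 b2) (trip c0 c1 c2))
    = trip (trip a0 b0 c0) (trip a1 b1 c1) (trip a2 b2 (- c2))"
  by (simp_all add: transp_def stransp_def)

text \<open>This is associativity, F_s \<otimes> (C \<otimes> F_t) against (F_s \<otimes> C)
  \<otimes> F_t. Only the order in which the digits are recorded changes, and the factors keep their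
  places, whence no sign.\<close>

lemma lten_rten_iso:
  assumes "bcx C"
  shows "bcx_iso (lten p q (rten p' q' C)) (rten p' q' (lten p q C))"
proof -
  interpret bcx C by fact
  have 1: "bcx_hom transp (lten p q (rten p' q' C)) (rten p' q' (lten p q C))"
    unfolding bcx_hom_def
  proof (intro allI ballI conjI transp_add)
    fix t d u j
    assume "u \<in> piece (lten p q (rten p' q' C)) t d"
    then obtain a0 a1 a2 b0 b1 b2 c0 c1 c2 where
      u [simp]: "u = trip (trip a0 a1 a2) (trip b0 b1 b2) (trip c0 c1 c2)"
      and raw: "a0 \<in> piece C t (d + 1 + 1)" "a1 \<in> piece C t (d + 1 - 1)" "a2 \<in> piece C (t - 1) (d + 1 + 1)"
        "b0 \<in> piece C t (d - 1 + 1)" "b1 \<in> piece C t (d - 1 - 1)" "b2 \<in> piece C (t - 1) (d - 1 + 1)"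
        "c0 \<in> piece C (t - 1) (d + 1 + 1)" "c1 \<in> piece C (t - 1) (d + 1 - 1)" "c2 \<in> piece C (t - 1 - 1) (d + 1 + 1)"
      by (elim piece_ltenE piece_rtenE) blast
    from raw show "transp u \<in> piece (rten p' q' (lten p q C)) t d"
      by (simp add: transp_trip piece_lten_iff piece_rten_iff algebra_simps)
    show "del (rten p' q' (lten p q C)) (transp u) = transp (del (lten p q (rten p' q' C)) u)"
      "eps (rten p' q' (lten p q C)) (transp u) = transp (eps (lten p q (rten p' q' C)) u)"
      "lop (rten p' q' (lten p q C)) j (transp u) = transp (lop (lten p q (rten p' q' C)) j u)"
      "rop (rten p' q' (lten p q C)) j (transp u) = transp (rop (lten p q (rten p' q' C)) j u)"
      by (simp_all add: transp_trip lten_trip rten_trip op_linear op_commute)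
  qed
  have 2: "bcx_hom transp (rten p' q' (lten p q C)) (lten p q (rten p' q' C))"
    unfolding bcx_hom_def
  proof (intro allI ballI conjI transp_add)
    fix t d u j
    assume "u \<in> piece (rten p' q' (lten p q C)) t d"
    then obtain a0 a1 a2 b0 b1 b2 c0 c1 c2 where
      u [simp]: "u = trip (trip a0 a1 a2) (trip b0 b1 b2) (trip c0 c1 c2)"
      and raw: "a0 \<in> piece C t (d + 1 + 1)" "a1 \<in> piece C t (d + 1 - 1)" "a2 \<in> piece C (t - 1) (d + 1 + 1)"
        "b0 \<in> piece C t (d - 1 + 1)" "b1 \<in> piece C t (d - 1 - 1)" "b2 \<in> piece C (t - 1) (d - 1 + 1)"
        "c0 \<in> piece C (t - 1) (d + 1 + 1)" "c1 \<in> piece C (t - 1) (d + 1 - 1)" "c2 \<in> piece C (t - 1 - 1) (d + 1 + 1)"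
      by (elim piece_ltenE piece_rtenE) blast
    from raw show "transp u \<in> piece (lten p q (rten p' q' C)) t d"
      by (simp add: transp_trip piece_lten_iff piece_rten_iff algebra_simps)
    show "del (lten p q (rten p' q' C)) (transp u) = transp (del (rten p' q' (lten p q C)) u)"
      "eps (lten p q (rten p' q' C)) (transp u) = transp (eps (rten p' q' (lten p q C)) u)"
      "lop (lten p q (rten p' q' C)) j (transp u) = transp (lop (rten p' q' (lten p q C)) j u)"
      "rop (lten p q (rten p' q' C)) j (transp u) = transp (rop (rten p' q' (lten p q C)) j u)"
      by (simp_all add: transp_trip lten_trip rten_trip op_linear op_commute)
  qed
  show ?thesis
    by (rule bcx_isoI[OF 1 2]) (auto simp: transp_trip elim!: piece_ltenE piece_rtenE)
qed

text \<open>For disjoint transpositions B_s \<otimes> B_t has the basis 1, x_p, x_p', x_p x_p' in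
  either order of the factors; exchanging them costs the Koszul sign.\<close>

lemma lten_comm_iso:
  assumes "bcx C" "p \<noteq> p'" "p \<noteq> q'" "q \<noteq> p'" "q \<noteq> q'"
  shows "bcx_iso (lten p q (lten p' q' C)) (lten p' q' (lten p q C))"
proof -
  interpret bcx C by fact
  have hom: "bcx_hom stransp (lten p q (lten p' q' C)) (lten p' q' (lten p q C))"
    if "p \<noteq> p'" "p \<noteq> q'" "q \<noteq> p'" "q \<noteq> q'" for p q p' q'
    unfolding bcx_hom_def
  proof (intro allI ballI conjI transp_add)
    fix t d u j
    assume "u \<in> piece (lten p q (lten p' q' C)) t d"
    then obtain a0 a1 a2 b0 b1 b2 c0 c1 c2 where
      u [simp]: "u = trip (trip a0 a1 a2) (trip b0 b1 b2) (trip c0 c1 c2)"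
      and raw: "a0 \<in> piece C t (d + 1 + 1)" "a1 \<in> piece C t (d + 1 - 1)" "a2 \<in> piece C (t - 1) (d + 1 + 1)"
        "b0 \<in> piece C t (d - 1 + 1)" "b1 \<in> piece C t (d - 1 - 1)" "b2 \<in> piece C (t - 1) (d - 1 + 1)"
        "c0 \<in> piece C (t - 1) (d + 1 + 1)" "c1 \<in> piece C (t - 1) (d + 1 - 1)" "c2 \<in> piece C (t - 1 - 1) (d + 1 + 1)"
      by (elim piece_ltenE) blast
    from raw show "stransp u \<in> piece (lten p' q' (lten p q C)) t d"
      by (simp add: transp_trip piece_lten_iff piece_minus algebra_simps)
    show "del (lten p' q' (lten p q C)) (stransp u) = stransp (del (lten p q (lten p' q' C)) u)"
      "eps (lten p' q' (lten p q C)) (stransp u) = stransp (eps (lten p q (lten p' q' C)) u)"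
      "rop (lten p' q' (lten p q C)) j (stransp u) = stransp (rop (lten p q (lten p' q' C)) j u)"
      using that by (simp_all add: transp_trip lten_trip op_linear op_commute)
    consider "j = p" | "j = q" "j \<noteq> p" | "j = p'" | "j = q'" "j \<noteq> p'" | "j \<notin> {p, q, p', q'}"
      by auto
    then show "lop (lten p' q' (lten p q C)) j (stransp u) = stransp (lop (lten p q (lten p' q' C)) j u)"
      using that by cases (simp_all add: transp_trip lten_trip op_linear op_commute)
  qed
  show ?thesis
    by (rule bcx_isoI[of stransp _ _ stransp, OF hom hom])
      (use assms in \<open>auto simp: transp_trip elim!: piece_ltenE\<close>)
qed

text \<open>R is free over the s-invariants on 1, x_q as well as on 1, x_p. Since x_p = (x_p + x_q)
  - x_q, the change of basis sends (a, b) to (a + (x_p + x_q) b, - b). The symmetry of the braid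
  relation needs both bases.\<close>

lemma lten_swap_iso:
  assumes "bcx C" "p \<noteq> q"
  shows "bcx_iso (lten p q C) (lten q p C)"
proof -
  interpret bcx C by fact
  define f where "f p q u = trip (part 0 u + (lop C p (part (Suc 0) u) + lop C q (part (Suc 0) u)))
     (- part (Suc 0) u) (part 2 u)" for p q u
  have hom: "bcx_hom (f p q) (lten p q C) (lten q p C)" if "p \<noteq> q" for p q
    unfolding bcx_hom_def
  proof (intro allI ballI)
    fix t d u
    assume "u \<in> piece (lten p q C) t d"
    then obtain a b c where [simp]: "u = trip a b c" and a: "a \<in> piece C t (d + 1)"
      and b: "b \<in> piece C t (d - 1)" and c: "c \<in> piece C (t - 1) (d + 1)"
      by (rule piece_ltenE)
    have xb: "lop C p b + lop C q b \<in> piece C t (d + 1)"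
      using b by (auto intro!: piece_intros)
    show "f p q u \<in> piece (lten q p C) t d \<and> del (lten q p C) (f p q u) = f p q (del (lten p q C) u)
     \<and> eps (lten q p C) (f p q u) = f p q (eps (lten p q C) u)
     \<and> (\<forall>j. lop (lten q p C) j (f p q u) = f p q (lop (lten p q C) j u) \<and> rop (lten q p C) j (f p q u) = f p q (rop (lten p q C) j u))
     \<and> (\<forall>v \<in> piece (lten p q C) t d. f p q (u + v) = f p q u + f p q v)"
      using a b c xb that
      by (auto simp: f_def piece_lten_iff lten_trip op_linear op_commute algebra_simps
        elim!: piece_ltenE intro!: piece_intros)
  qed
  show ?thesis
    by (rule bcx_isoI[OF hom hom])
      (use assms in \<open>auto simp: f_def op_linear elim!: piece_ltenE\<close>)
qed

subsection \<open>Central elements\<close>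

text \<open>Bimodule maps from \<open>R\<close> are elements on which both actions agree; maps from \<open>B\<^sub>s\<close> are
  elements on which the actions of the \<open>s\<close>-invariants agree, where \<open>s\<close> exchanges \<open>x\<^sub>p\<close> and \<open>x\<^sub>q\<close>.\<close>

definition central :: "'v bcx \<Rightarrow> int \<Rightarrow> int \<Rightarrow> (nat list \<Rightarrow> 'v) set" where
  "central C t d = {u \<in> piece C t d. \<forall>j. lop C j u = rop C j u}"

definition scentral :: "nat \<Rightarrow> nat \<Rightarrow> 'v::ab_group_add bcx \<Rightarrow> int \<Rightarrow> int \<Rightarrow> (nat list \<Rightarrow> 'v) set" where
  "scentral p q C t d = {u \<in> piece C t d. (\<forall>j. j \<noteq> p \<longrightarrow> j \<noteq> q \<longrightarrow> lop C j u = rop C j u)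
     \<and> lop C p u + lop C q u = rop C p u + rop C q u
     \<and> lop C p (lop C q u) = rop C p (rop C q u)}"

text \<open>The family of elements is a parameter, because exactness is compared for central
  elements, for s-central elements and for the six-term complex of the braid relation.\<close>

definition exact_at :: "(int \<Rightarrow> int \<Rightarrow> 'u::zero set) \<Rightarrow> ('u \<Rightarrow> 'u) \<Rightarrow> int \<Rightarrow> int \<Rightarrow> bool" where
  "exact_at Z D t d \<longleftrightarrow> (\<forall>z \<in> Z t d. D z = 0 \<longrightarrow> (\<exists>u \<in> Z (t - 1) d. D u = z))"

definition acyc :: "'v::ab_group_add bcx \<Rightarrow> int \<Rightarrow> int \<Rightarrow> bool" where
  "acyc C = exact_at (central C) (del C)"

definition sacyc :: "nat \<Rightarrow> nat \<Rightarrow> 'v::ab_group_add bcx \<Rightarrow> int \<Rightarrow> int \<Rightarrow> bool" where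
  "sacyc p q C = exact_at (scentral p q C) (del C)"

lemma exact_atD:
  assumes "exact_at Z D t d" "z \<in> Z t d" "D z = 0"
  obtains u where "u \<in> Z (t - 1) d" "D u = z"
  using assms unfolding exact_at_def by blast

text \<open>If D' u = f z, then D (g u) = g (f z) = z: exactness passes to a retract. The maps f and
  g are used only in the degrees where they are known to respect the elements.\<close>

lemma exact_at_retract:
  assumes "exact_at Z' D' t d"
    and "\<And>z. z \<in> Z t d \<Longrightarrow> f z \<in> Z' t d" "\<And>z. z \<in> Z t d \<Longrightarrow> D' (f z) = f (D z)" "f 0 = 0"
    and "\<And>z. z \<in> Z' (t - 1) d \<Longrightarrow> g z \<in> Z (t - 1) d" "\<And>z. z \<in> Z' (t - 1) d \<Longrightarrow> D (g z) = g (D' z)"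
    and "\<And>z. z \<in> Z t d \<Longrightarrow> g (f z) = z"
  shows "exact_at Z D t d"
  unfolding exact_at_def
proof (intro ballI impI)
  fix z
  assume z: "z \<in> Z t d" "D z = 0"
  then have "f z \<in> Z' t d" "D' (f z) = 0"
    using assms(2-4) by simp_all
  with assms(1) obtain u where u: "u \<in> Z' (t - 1) d" "D' u = f z"
    by (rule exact_atD)
  with z assms(5-7) show "\<exists>u \<in> Z (t - 1) d. D u = z"
    by (intro bexI[of _ "g u"]) simp_all
qed

lemma acyc_iso:
  assumes "bcx C" "bcx_iso C C'" "acyc C' t d"
  shows "acyc C t d"
proof -
  interpret bcx C by fact
  from assms(2) obtain f g where 1: "bcx_hom f C C'" "bcx_hom g C' C"
    "\<And>t d u. u \<in> piece C t d \<Longrightarrow> g (f u) = u" "\<And>t d u. u \<in> piece C' t d \<Longrightarrow> f (g u) = u"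
    by (rule bcx_isoE) (rule that)
  show ?thesis
    unfolding acyc_def
    by (rule exact_at_retract[OF assms(3)[unfolded acyc_def], where f = f and g = g])
      (auto simp: central_def bcx_homD[OF 1(1)] bcx_homD[OF 1(2)] 1(3) bcx_hom_diff(1)[OF 1(1) piece_0 piece_0])
qed

context bcx
begin

lemma centralD: "u \<in> central C t d \<Longrightarrow> u \<in> piece C t d" "u \<in> central C t d \<Longrightarrow> lop C j u = rop C j u"
  by (auto simp: central_def)

lemma scentralD: "u \<in> scentral p q C t d \<Longrightarrow> u \<in> piece C t d"
  "u \<in> scentral p q C t d \<Longrightarrow> j \<noteq> p \<Longrightarrow> j \<noteq> q \<Longrightarrow> lop C j u = rop C j u"
  "u \<in> scentral p q C t d \<Longrightarrow> lop C q u = rop C p u + rop C q u - lop C p u"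
  "u \<in> scentral p q C t d \<Longrightarrow> lop C p (lop C q u) = rop C p (rop C q u)"
  by (auto simp: scentral_def algebra_simps)

lemma central_0: "0 \<in> central C t d"
  and central_add: "u \<in> central C t d \<Longrightarrow> v \<in> central C t d \<Longrightarrow> u + v \<in> central C t d"
  and central_minus: "u \<in> central C t d \<Longrightarrow> - u \<in> central C t d"
  and central_diff: "u \<in> central C t d \<Longrightarrow> v \<in> central C t d \<Longrightarrow> u - v \<in> central C t d"
  and central_eps: "u \<in> central C t d \<Longrightarrow> eps C u \<in> central C t d"
  and central_del: "u \<in> central C t d \<Longrightarrow> t' = t + 1 \<Longrightarrow> del C u \<in> central C t' d"
  by (auto simp: central_def op_linear intro!: piece_intros simp flip: eps_lop eps_rop del_lop del_rop)

lemma scentral_0: "0 \<in> scentral p q C t d"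
  and scentral_add: "u \<in> scentral p q C t d \<Longrightarrow> v \<in> scentral p q C t d \<Longrightarrow> u + v \<in> scentral p q C t d"
  and scentral_minus: "u \<in> scentral p q C t d \<Longrightarrow> - u \<in> scentral p q C t d"
  and scentral_diff: "u \<in> scentral p q C t d \<Longrightarrow> v \<in> scentral p q C t d \<Longrightarrow> u - v \<in> scentral p q C t d"
  and scentral_eps: "u \<in> scentral p q C t d \<Longrightarrow> eps C u \<in> scentral p q C t d"
  and scentral_del: "u \<in> scentral p q C t d \<Longrightarrow> t' = t + 1 \<Longrightarrow> del C u \<in> scentral p q C t' d"
  and scentral_lop: "u \<in> scentral p q C t d \<Longrightarrow> d' = d + 2 \<Longrightarrow> lop C j u \<in> scentral p q C t d'"
  and scentral_rop: "u \<in> scentral p q C t d \<Longrightarrow> d' = d + 2 \<Longrightarrow> rop C j u \<in> scentral p q C t d'"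
proof -
  \<comment> \<open>The two symmetric conditions say that u lies in the kernels of E and E2, and
    these commute with every structure map; all closure properties follow from that.\<close>
  define E where "E u = lop C p u + lop C q u - (rop C p u + rop C q u)" for u
  define E2 where "E2 u = lop C p (lop C q u) - rop C p (rop C q u)" for u
  have iff: "u \<in> scentral p q C t d \<longleftrightarrow> u \<in> piece C t d
      \<and> (\<forall>j. j \<noteq> p \<longrightarrow> j \<noteq> q \<longrightarrow> lop C j u = rop C j u) \<and> E u = 0 \<and> E2 u = 0" for u t d
    by (simp add: scentral_def E_def E2_def)
  have E: "E (u + v) = E u + E v" "E (- u) = - E u" "E (u - v) = E u - E v" "E 0 = 0" "E (eps C u) = eps C (E u)"
    "E (del C u) = del C (E u)" "E (lop C j u) = lop C j (E u)" "E (rop C j u) = rop C j (E u)" for u v j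
    by (simp_all add: E_def op_linear op_commute)
  have E2: "E2 (u + v) = E2 u + E2 v" "E2 (- u) = - E2 u" "E2 (u - v) = E2 u - E2 v" "E2 0 = 0" "E2 (eps C u) = eps C (E2 u)"
    "E2 (del C u) = del C (E2 u)" "E2 (lop C j u) = lop C j (E2 u)" "E2 (rop C j u) = rop C j (E2 u)" for u v j
    by (simp_all add: E2_def op_linear op_commute)
  show "0 \<in> scentral p q C t d"
    "u \<in> scentral p q C t d \<Longrightarrow> v \<in> scentral p q C t d \<Longrightarrow> u + v \<in> scentral p q C t d"
    "u \<in> scentral p q C t d \<Longrightarrow> - u \<in> scentral p q C t d"
    "u \<in> scentral p q C t d \<Longrightarrow> v \<in> scentral p q C t d \<Longrightarrow> u - v \<in> scentral p q C t d"
    unfolding iff by (simp_all add: E E2 op_linear piece_intros)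
  show "eps C u \<in> scentral p q C t d" if "u \<in> scentral p q C t d"
    using that unfolding iff by (simp add: E E2 op_linear piece_eps flip: eps_lop eps_rop)
  show "del C u \<in> scentral p q C t' d" if "u \<in> scentral p q C t d" "t' = t + 1"
    using that unfolding iff by (simp add: E E2 op_linear piece_del' flip: del_lop del_rop)
  show "lop C j u \<in> scentral p q C t d'" if "u \<in> scentral p q C t d" "d' = d + 2"
    using that unfolding iff by (simp add: E E2 op_linear piece_lop' rop_lop lop_lop[of _ j])
  show "rop C j u \<in> scentral p q C t d'" if "u \<in> scentral p q C t d" "d' = d + 2"
    using that unfolding iff by (simp add: E E2 op_linear piece_rop' rop_rop[of _ j] flip: rop_lop)
qed

text \<open>B_s \<otimes> _ is self-adjoint, so a map from R to B_s \<otimes> C is a map from B_s to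
  C, and b is that map. In coordinates, commuting with x_q forces a = - b x_q, and commuting with
  x_p then becomes the two conditions on x_p + x_q and x_p x_q.\<close>

lemma central_lten:
  assumes "p \<noteq> q"
  shows "trip a b c \<in> central (lten p q C) t d \<longleftrightarrow>
    b \<in> scentral p q C t (d - 1) \<and> c \<in> central C (t - 1) (d + 1) \<and> a = - rop C q b"
proof
  assume *: "trip a b c \<in> central (lten p q C) t d"
  then have mem: "a \<in> piece C t (d + 1)" "b \<in> piece C t (d - 1)" "c \<in> piece C (t - 1) (d + 1)"
    and eq: "\<And>j. lop (lten p q C) j (trip a b c) = rop (lten p q C) j (trip a b c)"
    by (auto simp: central_def piece_lten_iff)
  have c: "c \<in> central C (t - 1) (d + 1)"
    using mem(3) eq by (auto simp: central_def lten_trip)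
  have na: "- a = rop C q b"
    using eq[of q] assms by (simp add: lten_trip)
  have a: "a = - rop C q b" "- lop C p (lop C q b) = rop C p a" "a + lop C p b + lop C q b = rop C p b"
    using eq[of p] assms by (simp_all add: lten_trip flip: na)
  have "lop C p b + lop C q b = rop C p b + rop C q b"
    using a(1,3) by (simp add: algebra_simps)
  moreover have "lop C p (lop C q b) = rop C p (rop C q b)"
    using a(1,2) by (simp add: op_linear)
  moreover have "lop C j b = rop C j b" if "j \<noteq> p" "j \<noteq> q" for j
    using eq[of j] that by (simp add: lten_trip)
  ultimately show "b \<in> scentral p q C t (d - 1) \<and> c \<in> central C (t - 1) (d + 1) \<and> a = - rop C q b"
    using mem c a(1) by (simp add: scentral_def)
next
  assume "b \<in> scentral p q C t (d - 1) \<and> c \<in> central C (t - 1) (d + 1) \<and> a = - rop C q b"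
  then have b: "b \<in> scentral p q C t (d - 1)" and c: "c \<in> central C (t - 1) (d + 1)" and a: "a = - rop C q b"
    by auto
  have "lop C p a + lop C q a = - rop C q (lop C p b + lop C q b)"
    by (simp add: a op_linear rop_lop algebra_simps)
  also have "\<dots> = - rop C p (rop C q b) - rop C q (rop C q b)"
    using b by (simp add: scentral_def op_linear rop_rop[of q p])
  finally have 1: "lop C p a + lop C q a + lop C p (lop C q b) = rop C q a"
    by (simp add: scentralD(4)[OF b] a op_linear)
  have 2: "a + lop C p b + lop C q b = rop C p b"
    by (simp add: a scentralD(3)[OF b])
  have 3: "- lop C p (lop C q b) = rop C p a"
    by (simp add: scentralD(4)[OF b] a op_linear)
  have "lop (lten p q C) j (trip a b c) = rop (lten p q C) j (trip a b c)" for j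
    using 1 2 3 centralD(2)[OF c, of j] scentralD(2)[OF b, of j] assms
    by (simp add: lten_trip) (simp add: a op_linear rop_rop[of q j] flip: rop_lop)
  moreover have "trip a b c \<in> piece (lten p q C) t d"
    using scentralD(1)[OF b] centralD(1)[OF c] by (simp add: piece_lten_iff a piece_intros)
  ultimately show "trip a b c \<in> central (lten p q C) t d"
    by (simp add: central_def)
qed

text \<open>The mirror image of \<open>central_lten\<close>. The same pairs (b, c) parametrize the
  central elements on both sides, which makes the two complexes comparable.\<close>

lemma central_rten:
  assumes "p \<noteq> q"
  shows "trip a b c \<in> central (rten p q C) t d \<longleftrightarrow>
    b \<in> scentral p q C t (d - 1) \<and> c \<in> central C (t - 1) (d + 1) \<and> a = - lop C q b"
proof
  assume *: "trip a b c \<in> central (rten p q C) t d"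
  then have mem: "a \<in> piece C t (d + 1)" "b \<in> piece C t (d - 1)" "c \<in> piece C (t - 1) (d + 1)"
    and eq: "\<And>j. lop (rten p q C) j (trip a b c) = rop (rten p q C) j (trip a b c)"
    by (auto simp: central_def piece_rten_iff)
  have c: "c \<in> central C (t - 1) (d + 1)"
    using mem(3) eq by (auto simp: central_def rten_trip)
  have a: "a = - lop C q b" "- rop C p (rop C q b) = lop C p a" "a + rop C p b + rop C q b = lop C p b"
    using eq[of p] eq[of q] assms by (simp_all add: rten_trip)
  have "lop C p b + lop C q b = rop C p b + rop C q b"
    using a(1,3) by (simp add: algebra_simps)
  moreover have "lop C p (lop C q b) = rop C p (rop C q b)"
    using a(1,2) by (simp add: op_linear)
  moreover have "lop C j b = rop C j b" if "j \<noteq> p" "j \<noteq> q" for j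
    using eq[of j] that by (simp add: rten_trip)
  ultimately show "b \<in> scentral p q C t (d - 1) \<and> c \<in> central C (t - 1) (d + 1) \<and> a = - lop C q b"
    using mem c a(1) by (simp add: scentral_def)
next
  assume "b \<in> scentral p q C t (d - 1) \<and> c \<in> central C (t - 1) (d + 1) \<and> a = - lop C q b"
  then have b: "b \<in> scentral p q C t (d - 1)" and c: "c \<in> central C (t - 1) (d + 1)" and a: "a = - lop C q b"
    by auto
  have "rop C p a + rop C q a = - lop C q (rop C p b + rop C q b)"
    by (simp add: a op_linear rop_lop algebra_simps)
  also have "\<dots> = - lop C q (lop C p b + lop C q b)"
    using b by (simp add: scentral_def)
  also have "\<dots> = - lop C p (lop C q b) - lop C q (lop C q b)"
    by (simp add: op_linear lop_lop[of q p])
  finally have 1: "rop C p a + rop C q a + rop C p (rop C q b) = lop C q a"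
    by (simp add: a op_linear flip: scentralD(4)[OF b])
  have 2: "a + rop C p b + rop C q b = lop C p b"
    by (simp add: a scentralD(3)[OF b])
  have 3: "- rop C p (rop C q b) = lop C p a"
    by (simp add: a op_linear flip: scentralD(4)[OF b])
  have 4: "lop C j (lop C q b) = lop C q (rop C j b)" if "j \<noteq> p" "j \<noteq> q" for j
    using scentralD(2)[OF b that] lop_lop[of j q b] by simp
  have "lop (rten p q C) j (trip a b c) = rop (rten p q C) j (trip a b c)" for j
    using 4[of j] 1 2 3 centralD(2)[OF c, of j] scentralD(2)[OF b, of j] assms
    by (simp add: rten_trip) (simp add: a op_linear rop_lop)
  moreover have "trip a b c \<in> piece (rten p q C) t d"
    using scentralD(1)[OF b] centralD(1)[OF c] by (simp add: piece_rten_iff a piece_intros)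
  ultimately show "trip a b c \<in> central (rten p q C) t d"
    by (simp add: central_def)
qed

text \<open>Invariants of s pass through B_s = R \<otimes> R over the s-invariants, hence they act
  on each coordinate separately.\<close>

lemma scentral_lten_same:
  assumes "p \<noteq> q"
  shows "trip a b c \<in> scentral p q (lten p q C) t d \<longleftrightarrow> a \<in> scentral p q C t (d + 1)
    \<and> b \<in> scentral p q C t (d - 1) \<and> c \<in> scentral p q C (t - 1) (d + 1)"
  using assms by (auto simp: scentral_def lten_trip piece_lten_iff op_linear algebra_simps lop_lop[of q p])

text \<open>The map from s-central to central elements induced by R -> B_s, 1 to x_p \<otimes> 1 - 1
  \<otimes> x_q. It is also a + x_p b for a = - b x_q, that is, the multiplication B_s -> R applied
  to the element described by \<open>central_lten\<close>.\<close>

definition scross :: "nat \<Rightarrow> nat \<Rightarrow> (nat list \<Rightarrow> 'v) \<Rightarrow> nat list \<Rightarrow> 'v" where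
  "scross p q b = lop C p b - rop C q b"

lemma scross_linear: "scross p q (u + v) = scross p q u + scross p q v" "scross p q 0 = 0"
  "scross p q (- u) = - scross p q u" "scross p q (u - v) = scross p q u - scross p q v"
  "scross p q (del C u) = del C (scross p q u)" "scross p q (eps C u) = eps C (scross p q u)"
  by (simp_all add: scross_def op_linear op_commute)

text \<open>Multiplying x_p \<otimes> 1 - 1 \<otimes> x_q by x_p \<otimes> 1 - 1 \<otimes> x_p gives
  the polynomial (X - x_p)(X - x_q), with right coefficients, at X = x_p on the left. Its
  coefficients are s-invariant, so it annihilates s-central elements.\<close>

lemma scross_central:
  assumes "b \<in> scentral p q C t d" "d' = d + 2"
  shows "scross p q b \<in> central C t d'"
proof -
  note b = scentralD[OF assms(1)]
  have e: "lop C p (lop C q b) = rop C p (rop C q b)" "lop C q b = rop C p b + rop C q b - lop C p b"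
    using b by auto
  have "lop C j (scross p q b) = rop C j (scross p q b)" for j
  proof (cases "j = p \<or> j = q")
    case False
    then show ?thesis
      using b(2)[of j] by (simp add: scross_def op_linear lop_lop[of j p] flip: rop_lop) (simp add: rop_lop rop_rop)
  next
    case True
    have 1: "lop C p (lop C p b) = lop C p (rop C p b) + lop C p (rop C q b) - rop C p (rop C q b)"
    proof -
      have "lop C p (lop C p b) + lop C p (lop C q b) = lop C p (rop C p b) + lop C p (rop C q b)"
        unfolding e(2) by (simp add: op_linear)
      then show ?thesis
        by (simp add: e(1) algebra_simps)
    qed
    have 2: "lop C q (scross p q b) = rop C p (scross p q b) + rop C q (scross p q b) - lop C p (scross p q b)"
    proof -
      have "lop C p b + lop C q b = rop C p b + rop C q b"
        using e(2) by simp
      then have "scross p q (lop C p b + lop C q b) = scross p q (rop C p b + rop C q b)"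
        by simp
      then show ?thesis
        by (simp add: scross_def op_linear rop_lop rop_rop lop_lop algebra_simps)
    qed
    have 3: "lop C p (scross p q b) = rop C p (scross p q b)"
      by (simp add: scross_def op_linear rop_lop 1)
    show ?thesis
      using True 2 3 by auto
  qed
  moreover have "scross p q b \<in> piece C t d'"
    using b(1) assms(2) by (auto simp: scross_def intro!: piece_diff piece_lop piece_rop)
  ultimately show ?thesis
    by (simp add: central_def)
qed

section \<open>Cone sequences for one and two factors F_s\<close>

lemma del_lten_central: "del (lten p q C) (trip (- rop C q b) b c)
    = trip (- rop C q (del C b)) (del C b) (scross p q b - del C c)"
  by (simp add: lten_trip scross_def op_linear op_commute)

text \<open>On s-central elements the map (a, b) to a + x_p b onto the component c is split
  surjective, with kernel parametrized by b alone. So F_s \<otimes> C behaves like C in quantum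
  degree d - 1, as B_s \<otimes> F_s is B_s up to homotopy and shift.\<close>

lemma sacyc_lten_same:
  assumes "p \<noteq> q" "sacyc p q C t (d - 1)"
  shows "sacyc p q (lten p q C) t d"
  unfolding sacyc_def exact_at_def
proof (intro ballI impI)
  fix z
  assume z: "z \<in> scentral p q (lten p q C) t d" "del (lten p q C) z = 0"
  then obtain a b c where [simp]: "z = trip a b c"
    by (auto simp: scentral_def elim: piece_ltenE)
  from z have m: "a \<in> scentral p q C t (d + 1)" "b \<in> scentral p q C t (d - 1)" "c \<in> scentral p q C (t - 1) (d + 1)"
    and e: "del C a = 0" "del C b = 0" "a + lop C p b = del C c"
    by (simp_all add: scentral_lten_same assms(1) lten_trip)
  from assms(2) m(2) e(2) obtain y where y: "y \<in> scentral p q C (t - 1) (d - 1)" "del C y = b"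
    unfolding sacyc_def by (rule exact_atD)
  \<comment> \<open>The boundary of (c - x_p y, y, 0) is (del c - x_p b, b, c), and del c = a + x_p
    b because z is a cocycle.\<close>
  show "\<exists>u \<in> scentral p q (lten p q C) (t - 1) d. del (lten p q C) u = z"
    using m y e(3) assms(1)
    by (intro bexI[of _ "trip (c - lop C p y) y 0"])
      (auto simp: lten_trip scentral_lten_same op_linear op_commute scentral_0 algebra_simps
        intro!: scentral_diff scentral_lop)
qed

text \<open>One half of the cone argument: a cocycle (b, c) is corrected so that b disappears, and
  what is left of c bounds in C.\<close>

lemma acyc_lten:
  assumes "p \<noteq> q" "sacyc p q C t (d - 1)" "acyc C (t - 1) (d + 1)"
  shows "acyc (lten p q C) t d"
  unfolding acyc_def exact_at_def
proof (intro ballI impI)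
  fix z
  assume z: "z \<in> central (lten p q C) t d" "del (lten p q C) z = 0"
  then obtain a b c where z_eq: "z = trip a b c"
    by (auto simp: central_def elim: piece_ltenE)
  from z have m: "b \<in> scentral p q C t (d - 1)" "c \<in> central C (t - 1) (d + 1)" "a = - rop C q b"
    by (simp_all add: central_lten assms(1) z_eq)
  with z(2) have e: "del C b = 0" "scross p q b = del C c"
    by (simp_all add: z_eq del_lten_central)
  from assms(2) m(1) e(1) obtain y where y: "y \<in> scentral p q C (t - 1) (d - 1)" "del C y = b"
    unfolding sacyc_def by (rule exact_atD)
  \<comment> \<open>The part of z that y does not account for, up to sign: subtracting the boundary
    of (- y x_q, y, 0) from z leaves c - scross y.\<close>
  have "scross p q y - c \<in> central C (t - 1) (d + 1)"
    using y m by (auto intro!: central_diff scross_central)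
  moreover have "del C (scross p q y - c) = 0"
    using y e by (simp add: op_linear flip: scross_linear)
  ultimately obtain x where x: "x \<in> central C (t - 1 - 1) (d + 1)" "del C x = scross p q y - c"
    using assms(3) unfolding acyc_def by (metis exact_atD)
  show "\<exists>u \<in> central (lten p q C) (t - 1) d. del (lten p q C) u = z"
    using x y m by (intro bexI[of _ "trip (- rop C q y) y x"]) (simp_all add: del_lten_central z_eq central_lten assms(1))
qed

text \<open>The other half of the cone argument: exactness of C in degree d + 2 extends a cocycle b
  to a cocycle (b, c) of F_s \<otimes> C, and a bounding element there has a bounding element of b
  as its coordinate.\<close>

lemma sacyc_from_acyc:
  assumes "p \<noteq> q" "acyc (lten p q C) t (d + 1)" "acyc C t (d + 2)"
  shows "sacyc p q C t d"
  unfolding sacyc_def exact_at_def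
proof (intro ballI impI)
  fix b
  assume b: "b \<in> scentral p q C t d" "del C b = 0"
  have "scross p q b \<in> central C t (d + 2)" "del C (scross p q b) = 0"
    using b by (auto simp: scross_central scross_linear simp flip: scross_linear(5))
  with assms(3) obtain c where c: "c \<in> central C (t - 1) (d + 2)" "del C c = scross p q b"
    unfolding acyc_def by (metis exact_atD)
  have "trip (- rop C q b) b c \<in> central (lten p q C) t (d + 1)"
    using b c by (simp add: central_lten assms(1) add.commute)
  moreover have "del (lten p q C) (trip (- rop C q b) b c) = 0"
    using b c by (simp add: del_lten_central op_linear)
  ultimately obtain u where u: "u \<in> central (lten p q C) (t - 1) (d + 1)"
    "del (lten p q C) u = trip (- rop C q b) b c"
    using assms(2) unfolding acyc_def by (metis exact_atD)
  then obtain x y z where u_eq: "u = trip x y z"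
    by (auto simp: central_def elim: piece_ltenE)
  with u have "y \<in> scentral p q C (t - 1) d" "del C y = b"
    by (simp_all add: central_lten assms(1) lten_trip)
  then show "\<exists>u \<in> scentral p q C (t - 1) d. del C u = b"
    by blast
qed

text \<open>The outer factor contributes the s-central elements of F_s \<otimes> C in degree d - 1,
  and these reduce to the s-central elements of C in degree d - 2.\<close>

lemma acyc_lten_lten:
  assumes "p \<noteq> q" "acyc (lten p q C) (t - 1) (d + 1)" "sacyc p q C t (d - 2)"
  shows "acyc (lten p q (lten p q C)) t d"
proof -
  interpret F: bcx "lten p q C"
    using assms(1) by (rule bcx_lten)
  show ?thesis
    using assms by (intro F.acyc_lten sacyc_lten_same) simp_all
qed

text \<open>The trace property. Central elements of F_s \<otimes> C and of C \<otimes> F_s have the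
  same coordinates (b, c), and both cones use the map \<open>scross\<close>; the differentials
  differ by signs only, which \<open>eps\<close> on c repairs.\<close>

lemma acyc_rten_iff:
  assumes "p \<noteq> q"
  shows "acyc (rten p q C) t d \<longleftrightarrow> acyc (lten p q C) t d"
proof
  have e: "part (Suc 0) (0 :: nat list \<Rightarrow> 'v) = 0" "part 2 (0 :: nat list \<Rightarrow> 'v) = 0"
    by simp_all
  have l: "\<exists>b c. z = trip (- rop C q b) b c \<and> b \<in> scentral p q C t (d - 1) \<and> c \<in> central C (t - 1) (d + 1)"
    if "z \<in> central (lten p q C) t d" for z t d
    using that central_lten[OF assms] centralD by (metis (no_types, lifting) central_def mem_Collect_eq piece_ltenE)
  have r: "\<exists>b c. z = trip (- lop C q b) b c \<and> b \<in> scentral p q C t (d - 1) \<and> c \<in> central C (t - 1) (d + 1)"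
    if "z \<in> central (rten p q C) t d" for z t d
    using that central_rten[OF assms] centralD by (metis (no_types, lifting) central_def mem_Collect_eq piece_rtenE)
  define f where "f z = trip (- rop C q (part (Suc 0) z)) (part (Suc 0) z) (eps C (part 2 z))" for z
  define g where "g z = trip (- lop C q (part (Suc 0) z)) (part (Suc 0) z) (eps C (part 2 z))" for z
  \<comment> \<open>As x_p + x_q acts alike on both sides of b, the cone map computed from the right
    is \<open>scross\<close> again.\<close>
  have sm: "rop C p b - lop C q b = scross p q b" if "b \<in> scentral p q C t d" for b t d
    using scentralD(3)[OF that] by (simp add: scross_def)
  have fm: "f z \<in> central (lten p q C) t d" if "z \<in> central (rten p q C) t d" for z t d
    using r[OF that] by (auto simp: f_def central_lten assms central_eps)
  have gm: "g z \<in> central (rten p q C) t d" if "z \<in> central (lten p q C) t d" for z t d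
    using l[OF that] by (auto simp: g_def central_rten assms central_eps)
  have fd: "del (lten p q C) (f z) = f (del (rten p q C) z)" if z: "z \<in> central (rten p q C) t d" for z t d
  proof -
    from r[OF z] obtain b c where b: "z = trip (- lop C q b) b c" "b \<in> scentral p q C t (d - 1)" "c \<in> central C (t - 1) (d + 1)"
      by blast
    have "eps C (eps C (scross p q b)) = scross p q b"
      using scross_central[OF b(2) refl] by (auto dest: centralD(1) eps_eps)
    with sm[OF b(2)] show ?thesis
      by (simp add: b(1) f_def rten_trip del_lten_central op_linear del_eps)
  qed
  have gd: "del (rten p q C) (g z) = g (del (lten p q C) z)" if z: "z \<in> central (lten p q C) t d" for z t d
  proof -
    from l[OF z] obtain b c where b: "z = trip (- rop C q b) b c" "b \<in> scentral p q C t (d - 1)" "c \<in> central C (t - 1) (d + 1)"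
      by blast
    with sm[OF b(2)] show ?thesis
      by (simp add: b(1) g_def rten_trip del_lten_central op_linear op_commute)
  qed
  have fg: "f (g z) = z" if "z \<in> central (lten p q C) t d" for z t d
    using l[OF that] by (auto simp: f_def g_def eps_eps[OF centralD(1)])
  have gf: "g (f z) = z" if "z \<in> central (rten p q C) t d" for z t d
    using r[OF that] by (auto simp: f_def g_def eps_eps[OF centralD(1)])
  have f0: "f 0 = 0" "g 0 = 0"
    by (simp_all add: f_def g_def e op_linear)
  show "acyc (rten p q C) t d" if "acyc (lten p q C) t d"
    unfolding acyc_def by (rule exact_at_retract[OF that[unfolded acyc_def], of _ f _ g])
      (use fm gm fd gd gf f0 in auto)
  show "acyc (lten p q C) t d" if "acyc (rten p q C) t d"
    unfolding acyc_def by (rule exact_at_retract[OF that[unfolded acyc_def], of _ g _ f])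
      (use fm gm fd gd fg f0 in auto)
qed

end

subsection \<open>The braid relation\<close>

text \<open>Elements commuting with the invariants of the symmetric group on \<open>{p, q, r}\<close>, and elements
  supported on the graphs of the four permutations \<open>w\<close> with \<open>w p \<in> {p, q}\<close> or dually
  \<open>w\<^sup>-\<^sup>1 r \<in> {q, r}\<close>: these are the maps from \<open>B\<^sub>s\<^sub>t\<^sub>s\<close> and \<open>B\<^sub>s \<otimes> B\<^sub>t\<close>.\<close>

definition tcentral :: "nat \<Rightarrow> nat \<Rightarrow> nat \<Rightarrow> 'v::ab_group_add bcx \<Rightarrow> int \<Rightarrow> int \<Rightarrow> (nat list \<Rightarrow> 'v) set" where
  "tcentral p q r C t d = {u \<in> piece C t d. (\<forall>j. j \<noteq> p \<longrightarrow> j \<noteq> q \<longrightarrow> j \<noteq> r \<longrightarrow> lop C j u = rop C j u)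
     \<and> lop C p u + lop C q u + lop C r u = rop C p u + rop C q u + rop C r u
     \<and> lop C p (lop C q u) + lop C p (lop C r u) + lop C q (lop C r u)
       = rop C p (rop C q u) + rop C p (rop C r u) + rop C q (rop C r u)
     \<and> lop C p (lop C q (lop C r u)) = rop C p (rop C q (rop C r u))}"

definition mcentral :: "nat \<Rightarrow> nat \<Rightarrow> nat \<Rightarrow> 'v::ab_group_add bcx \<Rightarrow> int \<Rightarrow> int \<Rightarrow> (nat list \<Rightarrow> 'v) set" where
  "mcentral p q r C t d = {u \<in> piece C t d. (\<forall>j. j \<noteq> p \<longrightarrow> j \<noteq> q \<longrightarrow> j \<noteq> r \<longrightarrow> lop C j u = rop C j u)
     \<and> lop C p u + lop C q u + lop C r u = rop C p u + rop C q u + rop C r u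
     \<and> lop C p (lop C p u) + rop C p (rop C q u) = lop C p (rop C p u) + lop C p (rop C q u)
     \<and> lop C q (lop C r u) + rop C r (rop C r u) = lop C q (rop C r u) + lop C r (rop C r u)}"

lemma scentral_swap: "bcx C \<Longrightarrow> scentral q p C t d = scentral p q C t d"
  by (auto simp: scentral_def bcx.lop_lop[of C q p] bcx.rop_rop[of C q p] add.commute)

context bcx
begin

lemma tcentral_swap: "tcentral r q p C t d = tcentral p q r C t d"
  by (auto simp: tcentral_def lop_lop[of r q] rop_rop[of r q] lop_lop[of r p] rop_rop[of r p]
      lop_lop[of q p] rop_rop[of q p] add_ac)

text \<open>The relations as rewrite rules towards the left monomials x_p^i x_q^j with i <= 2 and j
  <= 1, six as the order of the symmetric group. The sum of the variables removes x_r, the second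
  elementary symmetric function x_q^2 and the third x_p^3. The last rule is the preceding one times
  x_q: products are sorted with x_p outermost, where that rule would not match.\<close>

lemma tcentralD:
  assumes "u \<in> tcentral p q r C t d"
  shows "u \<in> piece C t d" "j \<noteq> p \<Longrightarrow> j \<noteq> q \<Longrightarrow> j \<noteq> r \<Longrightarrow> lop C j u = rop C j u"
    "lop C r u = rop C p u + rop C q u + rop C r u - lop C p u - lop C q u"
    "lop C q (lop C q u) = rop C p (lop C p u + lop C q u) + rop C q (lop C p u + lop C q u)
      + rop C r (lop C p u + lop C q u) - lop C p (lop C p u) - lop C p (lop C q u)
      - rop C p (rop C q u) - rop C p (rop C r u) - rop C q (rop C r u)"
    "lop C p (lop C p (lop C p u)) = rop C p (lop C p (lop C p u)) + rop C q (lop C p (lop C p u))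
      + rop C r (lop C p (lop C p u)) - rop C p (rop C q (lop C p u)) - rop C p (rop C r (lop C p u))
      - rop C q (rop C r (lop C p u)) + rop C p (rop C q (rop C r u))"
    "lop C p (lop C p (lop C p (lop C q u))) = rop C p (lop C p (lop C p (lop C q u)))
      + rop C q (lop C p (lop C p (lop C q u))) + rop C r (lop C p (lop C p (lop C q u)))
      - rop C p (rop C q (lop C p (lop C q u))) - rop C p (rop C r (lop C p (lop C q u)))
      - rop C q (rop C r (lop C p (lop C q u))) + rop C p (rop C q (rop C r (lop C q u)))"
proof -
  have e: "lop C p u + lop C q u + lop C r u = rop C p u + rop C q u + rop C r u"
    "lop C p (lop C q u) + lop C p (lop C r u) + lop C q (lop C r u)
       = rop C p (rop C q u) + rop C p (rop C r u) + rop C q (rop C r u)"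
    "lop C p (lop C q (lop C r u)) = rop C p (rop C q (rop C r u))"
    using assms by (auto simp: tcentral_def)
  show "u \<in> piece C t d" "j \<noteq> p \<Longrightarrow> j \<noteq> q \<Longrightarrow> j \<noteq> r \<Longrightarrow> lop C j u = rop C j u"
    using assms by (auto simp: tcentral_def)
  show r: "lop C r u = rop C p u + rop C q u + rop C r u - lop C p u - lop C q u"
    using e(1) by (simp add: algebra_simps)
  show q: "lop C q (lop C q u) = rop C p (lop C p u + lop C q u) + rop C q (lop C p u + lop C q u)
      + rop C r (lop C p u + lop C q u) - lop C p (lop C p u) - lop C p (lop C q u)
      - rop C p (rop C q u) - rop C p (rop C r u) - rop C q (rop C r u)"
    using e(2) by (simp add: r op_linear lop_lop[of q p] algebra_simps flip: rop_lop)
  show ppp: "lop C p (lop C p (lop C p u)) = rop C p (lop C p (lop C p u)) + rop C q (lop C p (lop C p u))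
      + rop C r (lop C p (lop C p u)) - rop C p (rop C q (lop C p u)) - rop C p (rop C r (lop C p u))
      - rop C q (rop C r (lop C p u)) + rop C p (rop C q (rop C r u))"
    using e(3) by (simp add: r q op_linear lop_lop[of q p] algebra_simps flip: rop_lop)
  show "lop C p (lop C p (lop C p (lop C q u))) = rop C p (lop C p (lop C p (lop C q u)))
      + rop C q (lop C p (lop C p (lop C q u))) + rop C r (lop C p (lop C p (lop C q u)))
      - rop C p (rop C q (lop C p (lop C q u))) - rop C p (rop C r (lop C p (lop C q u)))
      - rop C q (rop C r (lop C p (lop C q u))) + rop C p (rop C q (rop C r (lop C q u)))"
    using arg_cong[OF ppp, of "lop C q"]
    by (simp add: op_linear lop_lop[of q p] flip: rop_lop)
qed

text \<open>With X for left and Y for right variables, the quadratic conditions are (X_p - Y_p)(X_p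
  - Y_q) = 0 and (X_q - Y_r)(X_r - Y_r) = 0. As rewrite rules they leave the left monomials 1, x_p,
  x_q, x_p x_q, one for each of the four permutations.\<close>

lemma mcentralD:
  assumes "u \<in> mcentral p q r C t d"
  shows "u \<in> piece C t d" "j \<noteq> p \<Longrightarrow> j \<noteq> q \<Longrightarrow> j \<noteq> r \<Longrightarrow> lop C j u = rop C j u"
    "lop C r u = rop C p u + rop C q u + rop C r u - lop C p u - lop C q u"
    "lop C p (lop C p u) = rop C p (lop C p u) + rop C q (lop C p u) - rop C p (rop C q u)"
    "lop C q (lop C q u) = rop C p (lop C q u) + rop C q (lop C q u) + rop C r (lop C q u) - lop C p (lop C q u)
      - rop C p (rop C r u) - rop C q (rop C r u) + rop C r (lop C p u)"
    "lop C p (lop C p (lop C q u)) = rop C p (lop C p (lop C q u)) + rop C q (lop C p (lop C q u))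
      - rop C p (rop C q (lop C q u))"
proof -
  have e: "lop C p u + lop C q u + lop C r u = rop C p u + rop C q u + rop C r u"
    "lop C p (lop C p u) + rop C p (rop C q u) = lop C p (rop C p u) + lop C p (rop C q u)"
    "lop C q (lop C r u) + rop C r (rop C r u) = lop C q (rop C r u) + lop C r (rop C r u)"
    using assms by (auto simp: mcentral_def)
  show "u \<in> piece C t d" "j \<noteq> p \<Longrightarrow> j \<noteq> q \<Longrightarrow> j \<noteq> r \<Longrightarrow> lop C j u = rop C j u"
    using assms by (auto simp: mcentral_def)
  show r: "lop C r u = rop C p u + rop C q u + rop C r u - lop C p u - lop C q u"
    using e(1) by (simp add: algebra_simps)
  show pp: "lop C p (lop C p u) = rop C p (lop C p u) + rop C q (lop C p u) - rop C p (rop C q u)"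
    using e(2) by (simp add: algebra_simps flip: rop_lop)
  show "lop C p (lop C p (lop C q u)) = rop C p (lop C p (lop C q u)) + rop C q (lop C p (lop C q u))
      - rop C p (rop C q (lop C q u))"
    using arg_cong[OF pp, of "lop C q"]
    by (simp add: op_linear lop_lop[of q p] flip: rop_lop)
  show "lop C q (lop C q u) = rop C p (lop C q u) + rop C q (lop C q u) + rop C r (lop C q u) - lop C p (lop C q u)
      - rop C p (rop C r u) - rop C q (rop C r u) + rop C r (lop C p u)"
    using e(3) by (simp add: r op_linear lop_lop[of q p] rop_rop algebra_simps flip: rop_lop)
qed

lemma mcentral_0: "0 \<in> mcentral p q r C t d" "0 \<in> tcentral p q r C t d"
  by (simp_all add: mcentral_def tcentral_def op_linear piece_0)

text \<open>An s-central element is supported on the graphs of 1 and (p q), and both permutations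
  belong to each of the two sets of four.\<close>

lemma scentral_mcentral:
  assumes "p \<noteq> r" "q \<noteq> r" "u \<in> scentral p q C t d"
  shows "u \<in> mcentral p q r C t d" "u \<in> mcentral r q p C t d"
proof -
  note u = scentralD(1,3)[OF assms(3)]
  have j: "j \<noteq> p \<Longrightarrow> j \<noteq> q \<Longrightarrow> lop C j u = rop C j u" for j
    using assms(3) by (rule scentralD(2))
  have r: "lop C r u = rop C r u"
    using j[of r] assms by auto
  have pp: "lop C p (lop C p u) = rop C p (lop C p u) + rop C q (lop C p u) - rop C p (rop C q u)"
    using scentralD(4)[OF assms(3)] by (simp add: u(2) op_linear algebra_simps flip: rop_lop)
  show "u \<in> mcentral p q r C t d"
    using u(1) j by (simp add: mcentral_def r u(2) pp rop_rop op_linear algebra_simps flip: rop_lop)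
  show "u \<in> mcentral r q p C t d"
    using u(1) j by (simp add: mcentral_def r u(2) pp rop_rop op_linear lop_lop[of q p] algebra_simps flip: rop_lop)
qed

text \<open>Let s = (p q) and t = (q r). By adjunction a map from B_s to B_t \<otimes> C is a map
  from B_t \<otimes> B_s to C, given by b. Here x_r commutes with the element, which forces a = - b
  x_r.\<close>

lemma scentral_lten_adj:
  assumes "p \<noteq> q" "p \<noteq> r" "q \<noteq> r"
  shows "trip a b c \<in> scentral p q (lten q r C) t d \<longleftrightarrow>
    b \<in> mcentral p q r C t (d - 1) \<and> c \<in> scentral p q C (t - 1) (d + 1) \<and> a = - rop C r b"
    (is "?L \<longleftrightarrow> ?R")
proof
  assume L: ?L
  then have mem: "a \<in> piece C t (d + 1)" "b \<in> piece C t (d - 1)" "c \<in> piece C (t - 1) (d + 1)"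
    by (auto simp: scentral_def piece_lten_iff)
  have c: "c \<in> scentral p q C (t - 1) (d + 1)"
    using L assms by (auto simp: scentral_def lten_trip piece_lten_iff)
  have na: "- a = rop C r b" and r1: "lop C q a + lop C r a + lop C q (lop C r b) = rop C r a"
    and e1: "lop C p b + (b' + lop C q b + lop C r b) = rop C p b + rop C q b" 
    and e2: "lop C p (b' + lop C q b + lop C r b) = rop C p (rop C q b)" if "b' = a" for b'
    using L assms that by (auto simp: scentral_def lten_trip)
  have a: "a = - rop C r b"
    by (simp flip: na)
  have j: "lop C j b = rop C j b" if "j \<noteq> p" "j \<noteq> q" "j \<noteq> r" for j
    using L that by (auto simp: scentral_def lten_trip)
  have E1: "lop C p b + lop C q b + lop C r b = rop C p b + rop C q b + rop C r b"
    using e1[OF refl] by (simp add: a algebra_simps)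
  then have r: "lop C r b = rop C p b + rop C q b + rop C r b - lop C p b - lop C q b"
    by (simp add: algebra_simps)
  have "b \<in> mcentral p q r C t (d - 1)"
    using mem(2) j E1 r1 e2[OF refl]
    by (simp add: mcentral_def r a op_linear lop_lop[of q p] algebra_simps rop_rop flip: rop_lop)
  with c a show ?R
    by blast
next
  assume R: ?R
  then have b: "b \<in> mcentral p q r C t (d - 1)" and c: "c \<in> scentral p q C (t - 1) (d + 1)" and a: "a = - rop C r b"
    by auto
  note bD = mcentralD[OF b]
  have "trip a b c \<in> piece (lten q r C) t d"
    using bD(1) scentralD(1)[OF c] by (simp add: piece_lten_iff a piece_intros)
  then show ?L
    using assms c
    by (simp add: scentral_def lten_trip a op_linear bD(2-) lop_lop[of q p] rop_rop algebra_simps flip: rop_lop)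
qed

text \<open>The previous adjunction with s and t exchanged. The basis 1, x_p of the factor now
  contains the variable fixed by (q r), so it is commuting with x_p that determines a.\<close>

lemma scentral_lten_adj':
  assumes "p \<noteq> q" "p \<noteq> r" "q \<noteq> r"
  shows "trip a b c \<in> scentral q r (lten p q C) t d \<longleftrightarrow>
    b \<in> mcentral r q p C t (d - 1) \<and> c \<in> scentral q r C (t - 1) (d + 1)
    \<and> a = rop C p b - lop C p b - lop C q b"
    (is "?L \<longleftrightarrow> ?R")
proof
  assume L: ?L
  then have mem: "a \<in> piece C t (d + 1)" "b \<in> piece C t (d - 1)" "c \<in> piece C (t - 1) (d + 1)"
    by (auto simp: scentral_def piece_lten_iff)
  have c: "c \<in> scentral q r C (t - 1) (d + 1)"
    using L assms by (auto simp: scentral_def lten_trip piece_lten_iff)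
  have na: "a + lop C p b + lop C q b = rop C p b"
    using L assms by (auto simp: scentral_def lten_trip)
  have a: "a = rop C p b - lop C p b - lop C q b"
    using na by (simp add: algebra_simps)
  have p1: "- lop C p (lop C q b) = rop C p a"
    using L assms by (auto simp: scentral_def lten_trip)
  have e1: "- a + lop C r b = rop C q b + rop C r b"
    using L assms by (auto simp: scentral_def lten_trip)
  have e2: "- lop C r a = rop C q (rop C r b)"
    using L assms by (auto simp: scentral_def lten_trip)
  have j: "lop C j b = rop C j b" if "j \<noteq> p" "j \<noteq> q" "j \<noteq> r" for j
    using L that by (auto simp: scentral_def lten_trip)
  have r: "lop C p b + lop C q b + lop C r b = rop C p b + rop C q b + rop C r b"
    using e1 by (simp add: a algebra_simps)
  have pq: "lop C q (lop C p b) + rop C p (rop C p b) = lop C q (rop C p b) + lop C p (rop C p b)"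
    using p1 by (simp add: a op_linear lop_lop[of q p] algebra_simps flip: rop_lop)
  have a2: "a = lop C r b - rop C q b - rop C r b"
    using e1 by (simp add: algebra_simps)
  have rr: "lop C r (lop C r b) + rop C r (rop C q b) = lop C r (rop C r b) + lop C r (rop C q b)"
    using e2 by (simp add: a2 op_linear rop_rop[of r q] algebra_simps)
  show ?R
    using mem(2) j c r pq rr by (simp add: mcentral_def a add_ac)
next
  assume R: ?R
  then have b: "b \<in> mcentral r q p C t (d - 1)" and c: "c \<in> scentral q r C (t - 1) (d + 1)"
    and a: "a = rop C p b - lop C p b - lop C q b"
    by auto
  note bD = mcentralD[OF b]
  \<comment> \<open>The linear relation for b rewrites a in terms of x_r; this form suits the
    conditions on x_r and on variables other than the three.\<close>
  have a2: "a = lop C r b - rop C q b - rop C r b"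
    by (simp add: a bD(3))
  have pq: "lop C p (lop C q b) = rop C p (lop C p b) + rop C p (lop C q b) - rop C p (rop C p b)"
    using b unfolding mcentral_def by (simp add: lop_lop[of q p] algebra_simps flip: rop_lop)
  have mem: "trip a b c \<in> piece (lten p q C) t d"
    using bD(1) scentralD(1)[OF c] by (simp add: piece_lten_iff a piece_intros)
  have p: "lop (lten p q C) p (trip a b c) = rop (lten p q C) p (trip a b c)"
    using assms scentralD(2)[OF c, of p] pq by (simp add: lten_trip a op_linear)
  have j: "lop (lten p q C) j (trip a b c) = rop (lten p q C) j (trip a b c)"
    if "j \<noteq> p" "j \<noteq> q" "j \<noteq> r" for j
  proof -
    have "lop C j b = rop C j b" "lop C j c = rop C j c"
      using that bD(2) scentralD(2)[OF c] by auto
    moreover from this have "lop C j a = rop C j a"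
      by (simp add: a2 op_linear lop_lop[of j r] rop_rop[of q j] rop_rop[of r j] flip: rop_lop)
    ultimately show ?thesis
      using that by (simp add: lten_trip)
  qed
  have ea: "lop C p a + lop C q a + lop C r a = rop C p a + rop C q a + rop C r a"
  proof -
    have "lop C p b + lop C q b + lop C r b = rop C p b + rop C q b + rop C r b"
      by (simp add: bD(3))
    \<comment> \<open>The operator that produces a from b, applied to the linear relation for
      b.\<close>
    then have "(\<lambda>x. rop C p x - lop C p x - lop C q x) (lop C p b + lop C q b + lop C r b)
      = (\<lambda>x. rop C p x - lop C p x - lop C q x) (rop C p b + rop C q b + rop C r b)"
      by simp
    then show ?thesis
      by (simp add: a op_linear lop_lop[of q p] lop_lop[of r p] lop_lop[of r q] rop_rop[of q p] rop_rop[of r p] algebra_simps flip: rop_lop)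
  qed
  have rr: "lop C r a = - rop C q (rop C r b)"
    by (simp add: a2 op_linear bD(4) rop_rop[of r q] algebra_simps flip: rop_lop)
  have h1: "lop C p a + lop C q a + lop C p (lop C q b) + lop C r a = rop C q a + rop C r a"
  proof -
    have "lop C p (lop C q b) = - rop C p a"
      using p assms by (simp add: lten_trip minus_equation_iff)
    with ea show ?thesis
      by (simp add: algebra_simps)
  qed
  have h2: "- a + lop C r b = rop C q b + rop C r b"
    by (simp add: a2)
  have h3: "lop C q c + lop C r c = rop C q c + rop C r c" "lop C q (lop C r c) = rop C q (rop C r c)"
    using c by (auto simp: scentral_def)
  have qr: "lop (lten p q C) q (trip a b c) + lop (lten p q C) r (trip a b c)
    = rop (lten p q C) q (trip a b c) + rop (lten p q C) r (trip a b c)"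
    using h1 h2 h3 assms by (simp add: lten_trip)
  have h4: "lop C p (lop C r a) + lop C q (lop C r a) + lop C p (lop C q (lop C r b)) = rop C q (rop C r a)"
  proof -
    have h1': "lop C p a + lop C q a + lop C p (lop C q b) = rop C q a + rop C r a - lop C r a"
      using h1 by (metis add_diff_cancel_right')
    have "lop C r (lop C p a + lop C q a + lop C p (lop C q b)) = lop C r (rop C q a + rop C r a - lop C r a)"
      by (simp only: h1')
    also have "\<dots> = rop C q (lop C r a) + rop C r (lop C r a) - lop C r (lop C r a)"
      by (simp add: op_linear rop_lop)
    also have "\<dots> = rop C q (rop C r (lop C r b - rop C q b - rop C r b))"
      by (simp add: rr op_linear rop_rop[of r q] algebra_simps flip: rop_lop)
    finally show ?thesis
      by (simp add: op_linear lop_lop[of r q] lop_lop[of r p] flip: a2)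
  qed
  have qr2: "lop (lten p q C) q (lop (lten p q C) r (trip a b c))
    = rop (lten p q C) q (rop (lten p q C) r (trip a b c))"
    using h3 h4 rr assms by (simp add: lten_trip)
  have "\<forall>i. i \<noteq> q \<longrightarrow> i \<noteq> r \<longrightarrow> lop (lten p q C) i (trip a b c) = rop (lten p q C) i (trip a b c)"
    using p j by metis
  with mem qr qr2 show ?L
    by (simp add: scentral_def)
qed

text \<open>The decomposition of B_s B_t B_s as the sum of B_sts and B_s, seen through maps to C: b
  is the map from B_sts, and a + b x_r the map from B_s, two quantum degrees higher.\<close>

lemma mcentral_lten:
  assumes "p \<noteq> q" "p \<noteq> r" "q \<noteq> r"
  shows "trip a b c \<in> mcentral p q r (lten p q C) t d \<longleftrightarrow>
    b \<in> tcentral p q r C t (d - 1) \<and> a + rop C r b \<in> scentral p q C t (d + 1)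
    \<and> c \<in> mcentral p q r C (t - 1) (d + 1)"
    (is "?L \<longleftrightarrow> ?R")
proof
  assume L: ?L
  then have mem: "a \<in> piece C t (d + 1)" "b \<in> piece C t (d - 1)" "c \<in> piece C (t - 1) (d + 1)"
    by (auto simp: mcentral_def piece_lten_iff)
  have c: "c \<in> mcentral p q r C (t - 1) (d + 1)"
    using L assms by (auto simp: mcentral_def lten_trip piece_lten_iff)
  define x where "x = a + rop C r b"
  have a: "a = x - rop C r b"
    by (simp add: x_def)
  have xm: "x \<in> piece C t (d + 1)"
    using mem by (auto simp: x_def intro!: piece_intros)
  have eq1: "lop (lten p q C) p (trip a b c) + lop (lten p q C) q (trip a b c) + lop (lten p q C) r (trip a b c)
    = rop (lten p q C) p (trip a b c) + rop (lten p q C) q (trip a b c) + rop (lten p q C) r (trip a b c)"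
    and eq2: "lop (lten p q C) p (lop (lten p q C) p (trip a b c)) + rop (lten p q C) p (rop (lten p q C) q (trip a b c))
      = lop (lten p q C) p (rop (lten p q C) p (trip a b c)) + lop (lten p q C) p (rop (lten p q C) q (trip a b c))"
    and eq3: "lop (lten p q C) q (lop (lten p q C) r (trip a b c)) + rop (lten p q C) r (rop (lten p q C) r (trip a b c))
      = lop (lten p q C) q (rop (lten p q C) r (trip a b c)) + lop (lten p q C) r (rop (lten p q C) r (trip a b c))"
    using L by (auto simp: mcentral_def)
  have j: "lop C j a = rop C j a" "lop C j b = rop C j b" if "j \<noteq> p" "j \<noteq> q" "j \<noteq> r" for j
    using L that by (auto simp: mcentral_def lten_trip)
  have e1b: "lop C r b = rop C p b + rop C q b + rop C r b - lop C p b - lop C q b"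
    using eq1 assms by (simp add: lten_trip algebra_simps)
  have e1a: "lop C p a + lop C q a + lop C r a = rop C p a + rop C q a + rop C r a"
    using eq1 assms by (simp add: lten_trip algebra_simps)
  have rx: "lop C r x = rop C r x"
    using eq3 assms by (simp add: lten_trip x_def op_linear algebra_simps flip: rop_lop)
  have "lop C p x + lop C q x + lop C r x = rop C p x + rop C q x + rop C r x"
    using e1a arg_cong[OF e1b, of "rop C r"] by (simp add: x_def op_linear rop_rop[of r p] rop_rop[of r q] algebra_simps flip: rop_lop)
  then have qx: "lop C q x = rop C p x + rop C q x - lop C p x"
    by (simp add: rx algebra_simps)
  \<comment> \<open>The linear relation for b came from \<open>eq1\<close>; now \<open>eq2\<close>
    yields the relation of the second elementary symmetric function, and \<open>eq3\<close> below
    that of the third.\<close>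
  have ii: "lop C q (lop C q b) = rop C p (lop C p b + lop C q b) + rop C q (lop C p b + lop C q b)
      + rop C r (lop C p b + lop C q b) - lop C p (lop C p b) - lop C p (lop C q b)
      - rop C p (rop C q b) - rop C p (rop C r b) - rop C q (rop C r b)"
    using eq2 assms by (simp add: lten_trip a op_linear qx lop_lop[of q p] rop_rop[of r p] rop_rop[of r q] rop_rop[of q p] algebra_simps flip: rop_lop)
  have iii: "lop C r (lop C p a + lop C q a + lop C p (lop C q b)) + rop C r (rop C r a)
     = rop C r (lop C p a + lop C q a + lop C p (lop C q b)) + rop C r (lop C r a)"
    using eq3 assms by (simp add: lten_trip op_linear lop_lop[of q p] lop_lop[of r p] lop_lop[of r q] algebra_simps flip: rop_lop)
  have ppp: "lop C p (lop C p (lop C p b)) +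
       (rop C p (rop C q (lop C p b)) +
        (rop C p (rop C r (lop C p b)) + rop C q (rop C r (lop C p b)))) =
       rop C p (lop C p (lop C p b)) +
       (rop C p (rop C q (rop C r b)) +
        (rop C q (lop C p (lop C p b)) + rop C r (lop C p (lop C p b))))"
    using iii by (simp add: a op_linear qx rx e1b ii lop_lop[of q p] lop_lop[of r p] lop_lop[of r q]
      rop_rop[of r p] rop_rop[of r q] rop_rop[of q p] algebra_simps flip: rop_lop)
  have b: "b \<in> tcentral p q r C t (d - 1)"
    using mem(2) j ppp
    by (simp add: tcentral_def e1b op_linear lop_lop[of q p] ii rop_rop[of r p] rop_rop[of r q] rop_rop[of q p] algebra_simps flip: rop_lop)
  note bD = tcentralD[OF b]
  have iv: "lop C p (lop C q x) = rop C p (rop C q x)"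
    using eq2 assms by (simp add: lten_trip a op_linear qx bD(3-) lop_lop[of q p] lop_lop[of r p] lop_lop[of r q]
      rop_rop[of r p] rop_rop[of r q] rop_rop[of q p] algebra_simps flip: rop_lop)
  have "lop C j x = rop C j x" if "j \<noteq> p" "j \<noteq> q" for j
  proof (cases "j = r")
    case False
    then show ?thesis
      using j[of j] that by (simp add: x_def op_linear rop_rop[of r j] flip: rop_lop)
  qed (simp add: rx)
  with xm iv have "x \<in> scentral p q C t (d + 1)"
    by (simp add: scentral_def) (simp add: qx)
  with b c show ?R
    by (simp add: a)
next
  assume R: ?R
  define x where "x = a + rop C r b"
  have a: "a = x - rop C r b"
    by (simp add: x_def)
  have b: "b \<in> tcentral p q r C t (d - 1)" and x: "x \<in> scentral p q C t (d + 1)" and c: "c \<in> mcentral p q r C (t - 1) (d + 1)"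
    using R by (auto simp: x_def)
  note bD = tcentralD[OF b]
  note xD = scentralD(1,3)[OF x]
  have xr: "lop C r x = rop C r x"
    using scentralD(2)[OF x] assms by auto
  have xpp: "lop C p (lop C p x) = rop C p (lop C p x) + rop C q (lop C p x) - rop C p (rop C q x)"
    using scentralD(4)[OF x] by (simp add: xD(2) op_linear algebra_simps flip: rop_lop)
  have mem: "trip a b c \<in> piece (lten p q C) t d"
    using bD(1) xD(1) mcentralD(1)[OF c] by (simp add: piece_lten_iff a piece_intros)
  have j: "lop (lten p q C) j (trip a b c) = rop (lten p q C) j (trip a b c)"
    if "j \<noteq> p" "j \<noteq> q" "j \<noteq> r" for j
    using that bD(2)[of j] scentralD(2)[OF x, of j] mcentralD(2)[OF c, of j]
    by (simp add: lten_trip a op_linear rop_rop[of r j] flip: rop_lop)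
  show ?L
    unfolding mcentral_def using mem j assms c
    apply (simp add: lten_trip)
    apply (intro conjI)
    apply (simp_all add: a mcentral_def op_linear xD(2) xr xpp bD(3-) lop_lop[of q p] lop_lop[of r p] lop_lop[of r q]
      rop_rop[of r p] rop_rop[of r q] rop_rop[of q p] algebra_simps flip: rop_lop)
    done
qed

text \<open>On the graph of a permutation w the left x_q acts as the right x_(w q). Hence x_q
  \<otimes> 1 - 1 \<otimes> x_r vanishes on the two graphs with w q = r, and only those of 1 and (p
  q) survive.\<close>

lemma mcentral_to_scentral:
  assumes "p \<noteq> q" "p \<noteq> r" "q \<noteq> r" "u \<in> mcentral p q r C t d" "d' = d + 2"
  shows "lop C q u - rop C r u \<in> scentral p q C t d'"
proof -
  note u = mcentralD[OF assms(4)]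
  have "lop C q u - rop C r u \<in> piece C t d'"
    using u(1) assms(5) by (auto intro!: piece_diff piece_lop piece_rop)
  moreover have "lop C j (lop C q u - rop C r u) = rop C j (lop C q u - rop C r u)" if "j \<noteq> p" "j \<noteq> q" for j
  proof (cases "j = r")
    case True
    then show ?thesis
      by (simp add: op_linear u(3-) lop_lop[of r q] lop_lop[of q p] rop_rop algebra_simps flip: rop_lop)
  next
    case False
    then show ?thesis
      using u(2)[of j] that by (simp add: op_linear lop_lop[of j q] rop_rop[of r j] flip: rop_lop)
  qed
  ultimately show ?thesis
    by (simp add: scentral_def op_linear u(3-) lop_lop[of q p] rop_rop algebra_simps flip: rop_lop)
qed


text \<open>The general central element of \<open>F\<^sub>s \<otimes> F\<^sub>t \<otimes> F\<^sub>s \<otimes> C\<close>, from the description of the central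
  elements of a single tensor product.\<close>

definition sts :: "nat \<Rightarrow> nat \<Rightarrow> nat \<Rightarrow> (nat list \<Rightarrow> 'v) \<Rightarrow> (nat list \<Rightarrow> 'v) \<Rightarrow> (nat list \<Rightarrow> 'v) \<Rightarrow> (nat list \<Rightarrow> 'v) \<Rightarrow> (nat list \<Rightarrow> 'v)
   \<Rightarrow> (nat list \<Rightarrow> 'v) \<Rightarrow> (nat list \<Rightarrow> 'v) \<Rightarrow> (nat list \<Rightarrow> 'v) \<Rightarrow> (nat list \<Rightarrow> 'v) \<Rightarrow> (nat list \<Rightarrow> 'v) \<Rightarrow> nat list \<Rightarrow> 'v" where
  "sts p q r m a n k0 k1 k2 c1 c2 z1 z2 =
    (let B = lten p q C; A = lten q r B;
       y = trip (a - rop C r m) m n;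
       b = trip (- rop B r y) y (trip k0 k1 k2);
       c = trip (rop C p c1 - lop C p c1 - lop C q c1) c1 c2
     in trip (- rop A q b) b (trip (- rop B r c) c (trip (- rop C q z1) z1 z2)))"

text \<open>The parameters follow the summands of the triple product. B_s B_t B_s gives m (for
  B_sts) and a (for B_s); the terms with one R(1) give n, the pair k0, k1 (B_s B_s is two copies of
  B_s) and c1; those with two give k2, c2 and z1; the last one gives z2.\<close>

lemma sts_central:
  assumes "p \<noteq> q" "p \<noteq> r" "q \<noteq> r"
  shows "sts p q r m a n k0 k1 k2 c1 c2 z1 z2 \<in> central (lten p q (lten q r (lten p q C))) t d \<longleftrightarrow>
    m \<in> tcentral p q r C t (d - 3) \<and> a \<in> scentral p q C t (d - 1) \<and> n \<in> mcentral p q r C (t - 1) (d - 1)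
    \<and> k0 \<in> scentral p q C (t - 1) (d + 1) \<and> k1 \<in> scentral p q C (t - 1) (d - 1)
    \<and> k2 \<in> scentral p q C (t - 2) (d + 1) \<and> c1 \<in> mcentral r q p C (t - 1) (d - 1)
    \<and> c2 \<in> scentral q r C (t - 2) (d + 1) \<and> z1 \<in> scentral p q C (t - 2) (d + 1)
    \<and> z2 \<in> central C (t - 3) (d + 3)"
proof -
  interpret B: bcx "lten p q C"
    using assms by (intro bcx_lten)
  interpret A: bcx "lten q r (lten p q C)"
    using assms by (intro B.bcx_lten)
  show ?thesis
    using assms
    by (simp add: sts_def Let_def A.central_lten B.scentral_lten_adj mcentral_lten scentral_lten_same
        B.central_lten scentral_lten_adj' central_lten add_ac conj_ac)
qed

lemma trip_parts:
  assumes "u \<in> piece (lten p q D) t d"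
  shows "u = trip (part 0 u) (part (Suc 0) u) (part 2 u)"
  using assms by (auto elim: piece_ltenE)

text \<open>Peeling off the three factors from the outside, one description of central or partially
  central elements per factor, recovers the coordinates that centrality leaves free.\<close>

lemma sts_exhaust:
  assumes "p \<noteq> q" "p \<noteq> r" "q \<noteq> r" "u \<in> central (lten p q (lten q r (lten p q C))) t d"
  defines "b \<equiv> part (Suc 0) u" and "v \<equiv> part 2 u"
  defines "y \<equiv> part (Suc 0) b" and "c \<equiv> part (Suc 0) v"
  shows "u = sts p q r (part (Suc 0) y) (part 0 y + rop C r (part (Suc 0) y)) (part 2 y)
    (part 0 (part 2 b)) (part (Suc 0) (part 2 b)) (part 2 (part 2 b))
    (part (Suc 0) c) (part 2 c) (part (Suc 0) (part 2 v)) (part 2 (part 2 v))"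
proof -
  interpret B: bcx "lten p q C"
    using assms by (intro bcx_lten)
  interpret A: bcx "lten q r (lten p q C)"
    using assms by (intro B.bcx_lten)
  have u: "u = trip (part 0 u) b v"
    using assms(4) unfolding b_def v_def central_def by (blast intro: trip_parts)
  with assms have b: "b \<in> scentral p q (lten q r (lten p q C)) t (d - 1)"
    and v: "v \<in> central (lten q r (lten p q C)) (t - 1) (d + 1)" and u0: "part 0 u = - rop (lten q r (lten p q C)) q b"
    by (metis A.central_lten)+
  have b': "b = trip (part 0 b) y (part 2 b)"
    using b unfolding scentral_def y_def by (blast intro: trip_parts)
  with b have y: "y \<in> mcentral p q r (lten p q C) t (d - 1 - 1)" and b2: "part 2 b \<in> scentral p q (lten p q C) (t - 1) (d - 1 + 1)"
    and b0: "part 0 b = - rop (lten p q C) r y"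
    using B.scentral_lten_adj[OF assms(1-3)] by metis+
  have y': "y = trip (part 0 y) (part (Suc 0) y) (part 2 y)"
    using y unfolding mcentral_def by (blast intro: trip_parts)
  have b2': "part 2 b = trip (part 0 (part 2 b)) (part (Suc 0) (part 2 b)) (part 2 (part 2 b))"
    using b2 unfolding scentral_def by (blast intro: trip_parts)
  have v': "v = trip (part 0 v) c (part 2 v)"
    using v unfolding central_def c_def by (blast intro: trip_parts)
  with v have c: "c \<in> scentral q r (lten p q C) (t - 1) (d + 1 - 1)" and v2: "part 2 v \<in> central (lten p q C) (t - 1 - 1) (d + 1 + 1)"
    and v0: "part 0 v = - rop (lten p q C) r c"
    using B.central_lten[OF assms(3)] by metis+
  have c': "c = trip (part 0 c) (part (Suc 0) c) (part 2 c)"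
    using c unfolding scentral_def by (blast intro: trip_parts)
  with c have c0: "part 0 c = rop C p (part (Suc 0) c) - lop C p (part (Suc 0) c) - lop C q (part (Suc 0) c)"
    using scentral_lten_adj'[OF assms(1-3)] by metis
  have v2': "part 2 v = trip (part 0 (part 2 v)) (part (Suc 0) (part 2 v)) (part 2 (part 2 v))"
    using v2 unfolding central_def by (blast intro: trip_parts)
  with v2 have v20: "part 0 (part 2 v) = - rop C q (part (Suc 0) (part 2 v))"
    using central_lten[OF assms(1)] by metis
  show ?thesis
    unfolding sts_def Let_def
    apply (subst u, subst u0)
    using b' b0 y' b2' v' v0 c' c0 v2' v20
    by simp
qed

lemma sts_del:
  assumes "p \<noteq> q" "p \<noteq> r" "q \<noteq> r"
    and "sts p q r m a n k0 k1 k2 c1 c2 z1 z2 \<in> central (lten p q (lten q r (lten p q C))) t d"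
  shows "del (lten p q (lten q r (lten p q C))) (sts p q r m a n k0 k1 k2 c1 c2 z1 z2)
    = sts p q r (del C m) (del C a) (a - rop C r m + lop C p m - del C n)
       (lop C p a + lop C q a - rop C r a + lop C p (lop C q m) - lop C p (rop C r m) - lop C q (rop C r m)
         + rop C r (rop C r m) - del C k0)
       (- a - del C k1) (lop C q n - rop C r n - k0 - lop C p k1 + del C k2)
       (a - rop C r m + lop C p m + lop C q m - rop C q m - del C c1)
       (lop C p n - rop C q n - (rop C p c1 - lop C q c1) + del C c2)
       (k0 + lop C p k1 + lop C q k1 - rop C q k1 + rop C r c1 + rop C p c1 - lop C p c1 - lop C q c1 + del C z1)
       (lop C p k2 - rop C q k2 - (lop C q c2 - rop C r c2) + (lop C p z1 - rop C q z1) - del C z2)"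
    (is "?D ?u = ?R")
proof -
  interpret B: bcx "lten p q C"
    using assms by (intro bcx_lten)
  interpret A: bcx "lten q r (lten p q C)"
    using assms by (intro B.bcx_lten)
  interpret F: bcx "lten p q (lten q r (lten p q C))"
    using assms by (intro A.bcx_lten)
  \<comment> \<open>The boundary is central again, so it is determined by its ten coordinates, and
    only these have to be read off.\<close>
  have "?D ?u \<in> central (lten p q (lten q r (lten p q C))) (t + 1) d"
    using assms(4) by (simp add: F.central_del)
  from sts_exhaust[OF assms(1-3) this] show ?thesis
    by (rule trans) (use assms(1-3) in \<open>simp add: sts_def Let_def lten_trip op_linear op_commute\<close>)
qed

text \<open>The complex of six terms to which the central elements retract. Exchanging \<open>p\<close> and \<open>r\<close> amounts to
  exchanging \<open>n\<close> with \<open>c\<close> and \<open>e\<close> with \<open>f\<close>, up to signs.\<close>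

definition stsE :: "(nat list \<Rightarrow> 'v) \<Rightarrow> (nat list \<Rightarrow> 'v) \<Rightarrow> (nat list \<Rightarrow> 'v)
   \<Rightarrow> (nat list \<Rightarrow> 'v) \<Rightarrow> (nat list \<Rightarrow> 'v) \<Rightarrow> (nat list \<Rightarrow> 'v) \<Rightarrow> nat list \<Rightarrow> 'v" where
  "stsE m n c e f g = trip (trip m n c) (trip e f g) 0"

text \<open>After adjunction these are the terms B_sts; B_s B_t and B_t B_s; B_s and B_t; R of the
  minimal complex of the half twist on three strands.\<close>

definition Epiece :: "nat \<Rightarrow> nat \<Rightarrow> nat \<Rightarrow> int \<Rightarrow> int \<Rightarrow> (nat list \<Rightarrow> 'v) set" where
  "Epiece p q r t d = {stsE m n c e f g | m n c e f g. m \<in> tcentral p q r C t (d - 3)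
     \<and> n \<in> mcentral p q r C (t - 1) (d - 1) \<and> c \<in> mcentral r q p C (t - 1) (d - 1)
     \<and> e \<in> scentral p q C (t - 2) (d + 1) \<and> f \<in> scentral q r C (t - 2) (d + 1) \<and> g \<in> central C (t - 3) (d + 3)}"

definition Edel :: "nat \<Rightarrow> nat \<Rightarrow> nat \<Rightarrow> (nat list \<Rightarrow> 'v) \<Rightarrow> nat list \<Rightarrow> 'v" where
  "Edel p q r u = (let m = part 0 (part 0 u); n = part (Suc 0) (part 0 u); c = part 2 (part 0 u);
      e = part 0 (part (Suc 0) u); f = part (Suc 0) (part (Suc 0) u); g = part 2 (part (Suc 0) u)
    in stsE (del C m) (lop C p m - rop C r m - del C n) (rop C p m - lop C r m - del C c)
      (lop C q n - rop C r n - (rop C q c - lop C r c) + del C e)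
      (lop C p n - rop C q n - (rop C p c - lop C q c) + del C f)
      (lop C p e - rop C q e - (lop C q f - rop C r f) - del C g))"

lemma mcentral_add: "u \<in> mcentral p q r C t d \<Longrightarrow> v \<in> mcentral p q r C t d \<Longrightarrow> u + v \<in> mcentral p q r C t d"
  and mcentral_minus: "u \<in> mcentral p q r C t d \<Longrightarrow> - u \<in> mcentral p q r C t d"
proof -
  define E1 where "E1 u = lop C p u + lop C q u + lop C r u - (rop C p u + rop C q u + rop C r u)" for u
  define E2 where "E2 u = lop C p (lop C p u) + rop C p (rop C q u) - (lop C p (rop C p u) + lop C p (rop C q u))" for u
  define E3 where "E3 u = lop C q (lop C r u) + rop C r (rop C r u) - (lop C q (rop C r u) + lop C r (rop C r u))" for u
  have iff: "u \<in> mcentral p q r C t d \<longleftrightarrow> u \<in> piece C t d \<and> (\<forall>j. j \<noteq> p \<longrightarrow> j \<noteq> q \<longrightarrow> j \<noteq> r \<longrightarrow> lop C j u = rop C j u)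
      \<and> E1 u = 0 \<and> E2 u = 0 \<and> E3 u = 0" for u
    by (simp add: mcentral_def E1_def E2_def E3_def)
  have "E1 (u + v) = E1 u + E1 v" "E2 (u + v) = E2 u + E2 v" "E3 (u + v) = E3 u + E3 v"
    "E1 (- u) = - E1 u" "E2 (- u) = - E2 u" "E3 (- u) = - E3 u"
    by (simp_all add: E1_def E2_def E3_def op_linear)
  then show "u \<in> mcentral p q r C t d \<Longrightarrow> v \<in> mcentral p q r C t d \<Longrightarrow> u + v \<in> mcentral p q r C t d"
    "u \<in> mcentral p q r C t d \<Longrightarrow> - u \<in> mcentral p q r C t d"
    unfolding iff by (simp_all add: op_linear piece_add piece_minus)
qed

lemma sts_cong:
  "m = m' \<Longrightarrow> a = a' \<Longrightarrow> n = n' \<Longrightarrow> k0 = k0' \<Longrightarrow> k1 = k1' \<Longrightarrow> k2 = k2' \<Longrightarrow> c1 = c1' \<Longrightarrow> c2 = c2'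
    \<Longrightarrow> z1 = z1' \<Longrightarrow> z2 = z2'
    \<Longrightarrow> sts p q r m a n k0 k1 k2 c1 c2 z1 z2 = sts p q r m' a' n' k0' k1' k2' c1' c2' z1' z2'"
  by simp

lemma stsE_cong:
  "m = m' \<Longrightarrow> n = n' \<Longrightarrow> c = c' \<Longrightarrow> e = e' \<Longrightarrow> f = f' \<Longrightarrow> g = g' \<Longrightarrow> stsE m n c e f g = stsE m' n' c' e' f' g'"
  by simp

lemma sts_0: "sts p q r 0 0 0 0 0 0 0 0 0 0 = 0"
  by (simp add: sts_def Let_def op_linear lten_def)

lemma sts_eqD:
  assumes "sts p q r m a n k0 k1 k2 c1 c2 z1 z2 = sts p q r m' a' n' k0' k1' k2' c1' c2' z1' z2'"
  shows "m = m'" "a = a'" "n = n'" "k0 = k0'" "k1 = k1'" "k2 = k2'" "c1 = c1'" "c2 = c2'" "z1 = z1'" "z2 = z2'"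
  using assms by (auto simp: sts_def Let_def)

lemma stsE_eq_0: "stsE m n c e f g = 0 \<longleftrightarrow> m = 0 \<and> n = 0 \<and> c = 0 \<and> e = 0 \<and> f = 0 \<and> g = 0"
  by (auto simp: stsE_def)

lemma Edel_stsE: "Edel p q r (stsE m n c e f g) = stsE (del C m) (lop C p m - rop C r m - del C n) (rop C p m - lop C r m - del C c)
      (lop C q n - rop C r n - (rop C q c - lop C r c) + del C e)
      (lop C p n - rop C q n - (rop C p c - lop C q c) + del C f)
      (lop C p e - rop C q e - (lop C q f - rop C r f) - del C g)"
  by (simp add: Edel_def stsE_def Let_def)

text \<open>Gaussian elimination. The differential has coefficient - 1 from a to k1 and from k0 to
  k2. Cancelling these two pairs adds k1 to n and to c1, and k2 to z1: in these sums a and k0 drop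
  out of the boundary.\<close>

definition Eretr :: "(nat list \<Rightarrow> 'v) \<Rightarrow> nat list \<Rightarrow> 'v" where
  "Eretr u = (let b = part (Suc 0) u; v = part 2 u; y = part (Suc 0) b; c = part (Suc 0) v; k1 = part (Suc 0) (part 2 b) in
     stsE (part (Suc 0) y) (part 2 y + k1) (part (Suc 0) c + k1) (part (Suc 0) (part 2 v) + part 2 (part 2 b))
       (part 2 c) (part 2 (part 2 v)))"

lemma Eretr_sts: "Eretr (sts p q r m a n k0 k1 k2 c1 c2 z1 z2) = stsE m (n + k1) (c1 + k1) (z1 + k2) c2 z2"
  by (simp add: Eretr_def sts_def Let_def)

lemma Eretr_diff: "Eretr (u - v) = Eretr u - Eretr v"
  by (simp add: Eretr_def stsE_def Let_def)

text \<open>The value x_q n - n x_r of k0 is the one for which the coordinate k2 of the boundary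
  vanishes, so that the image is stable under the differential.\<close>

definition Esect :: "nat \<Rightarrow> nat \<Rightarrow> nat \<Rightarrow> (nat list \<Rightarrow> 'v) \<Rightarrow> nat list \<Rightarrow> 'v" where
  "Esect p q r u = (let m = part 0 (part 0 u); n = part (Suc 0) (part 0 u); c = part 2 (part 0 u);
      e = part 0 (part (Suc 0) u); f = part (Suc 0) (part (Suc 0) u); g = part 2 (part (Suc 0) u)
    in sts p q r m 0 n (lop C q n - rop C r n) 0 0 c f e g)"

lemma Esect_stsE: "Esect p q r (stsE m n c e f g) = sts p q r m 0 n (lop C q n - rop C r n) 0 0 c f e g"
  by (simp add: Esect_def stsE_def Let_def)

section \<open>Exactness of the triple product and of the six-term complex\<close>

context
  fixes p q r :: nat
  assumes dist: "p \<noteq> q" "p \<noteq> r" "q \<noteq> r"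
begin

lemma stsE_mem:
  "stsE m n c e f g \<in> Epiece p q r t d \<longleftrightarrow> m \<in> tcentral p q r C t (d - 3)
     \<and> n \<in> mcentral p q r C (t - 1) (d - 1) \<and> c \<in> mcentral r q p C (t - 1) (d - 1)
     \<and> e \<in> scentral p q C (t - 2) (d + 1) \<and> f \<in> scentral q r C (t - 2) (d + 1) \<and> g \<in> central C (t - 3) (d + 3)"
  by (auto simp: Epiece_def stsE_def)

lemma Esect_mem:
  assumes "v \<in> Epiece p q r t d"
  shows "Esect p q r v \<in> central (lten p q (lten q r (lten p q C))) t d"
    and "del (lten p q (lten q r (lten p q C))) (Esect p q r v) = Esect p q r (Edel p q r v)"
    and "Eretr (Esect p q r v) = v"
proof -
  from assms obtain m n c e f g where v: "v = stsE m n c e f g"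
    by (auto simp: Epiece_def)
  with assms have mem: "m \<in> tcentral p q r C t (d - 3)" "n \<in> mcentral p q r C (t - 1) (d - 1)"
    "c \<in> mcentral r q p C (t - 1) (d - 1)" "e \<in> scentral p q C (t - 2) (d + 1)"
    "f \<in> scentral q r C (t - 2) (d + 1)" "g \<in> central C (t - 3) (d + 3)"
    by (simp_all add: stsE_mem)
  have "lop C q n - rop C r n \<in> scentral p q C (t - 1) (d + 1)"
    by (rule mcentral_to_scentral[OF dist mem(2)]) simp
  with mem show c: "Esect p q r v \<in> central (lten p q (lten q r (lten p q C))) t d"
    unfolding v Esect_stsE by (simp add: sts_central[OF dist] scentral_0)
  have m1: "lop C r m = rop C p m + rop C q m + rop C r m - lop C p m - lop C q m"
    using mem(1) by (rule tcentralD)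
  have c1: "lop C p c = rop C p c + rop C q c + rop C r c - lop C q c - lop C r c"
    using mcentralD(3)[OF mem(3)] by (simp add: algebra_simps)
  show "del (lten p q (lten q r (lten p q C))) (Esect p q r v) = Esect p q r (Edel p q r v)"
    unfolding v Edel_stsE Esect_stsE sts_del[OF dist c[unfolded v Esect_stsE]]
    by (rule sts_cong) (simp_all add: m1 c1 op_linear op_commute algebra_simps)
  show "Eretr (Esect p q r v) = v"
    by (simp add: v Esect_stsE Eretr_sts)
qed

lemma Eretr_mem:
  assumes "u \<in> central (lten p q (lten q r (lten p q C))) t d"
  shows "Eretr u \<in> Epiece p q r t d"
    and "Edel p q r (Eretr u) = Eretr (del (lten p q (lten q r (lten p q C))) u)"
proof -
  from sts_exhaust[OF dist assms] obtain m a n k0 k1 k2 c1 c2 z1 z2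
    where u: "u = sts p q r m a n k0 k1 k2 c1 c2 z1 z2"
    by blast
  note c = assms[unfolded u]
  from c have mem: "m \<in> tcentral p q r C t (d - 3)" "n \<in> mcentral p q r C (t - 1) (d - 1)"
    "k1 \<in> scentral p q C (t - 1) (d - 1)" "k2 \<in> scentral p q C (t - 2) (d + 1)" "c1 \<in> mcentral r q p C (t - 1) (d - 1)"
    "c2 \<in> scentral q r C (t - 2) (d + 1)" "z1 \<in> scentral p q C (t - 2) (d + 1)"
    "z2 \<in> central C (t - 3) (d + 3)"
    by (simp_all add: sts_central[OF dist])
  have "k1 \<in> mcentral p q r C (t - 1) (d - 1)" "k1 \<in> mcentral r q p C (t - 1) (d - 1)"
    using scentral_mcentral[OF dist(2,3) mem(3)] by auto
  with mem show "Eretr u \<in> Epiece p q r t d"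
    unfolding u Eretr_sts by (simp add: stsE_mem mcentral_add scentral_add)
  have m1: "lop C r m = rop C p m + rop C q m + rop C r m - lop C p m - lop C q m"
    using mem(1) by (rule tcentralD)
  have c1: "lop C p c1 = rop C p c1 + rop C q c1 + rop C r c1 - lop C q c1 - lop C r c1"
    using mcentralD(3)[OF mem(5)] by (simp add: algebra_simps)
  have k1: "lop C r k1 = rop C r k1" "lop C q k1 = rop C p k1 + rop C q k1 - lop C p k1"
    using scentralD(2)[OF mem(3), of r] scentralD(3)[OF mem(3)] dist by auto
  show "Edel p q r (Eretr u) = Eretr (del (lten p q (lten q r (lten p q C))) u)"
    unfolding u Eretr_sts sts_del[OF dist c] Edel_stsE
    by (rule stsE_cong) (simp_all add: m1 c1 k1 op_linear op_commute algebra_simps)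
qed

text \<open>From left to right the six-term complex is a retract. For the converse,
  \<open>Eretr\<close> has a kernel, made of the two cancelled pairs, and this kernel is shown to be
  exact by hand.\<close>

lemma acyc_sts:
  "acyc (lten p q (lten q r (lten p q C))) t d \<longleftrightarrow> exact_at (Epiece p q r) (Edel p q r) t d"
proof
  let ?F = "lten p q (lten q r (lten p q C))"
  interpret B: bcx "lten p q C"
    using dist by (intro bcx_lten)
  interpret A: bcx "lten q r (lten p q C)"
    using dist by (intro B.bcx_lten)
  interpret F: bcx ?F
    using dist by (intro A.bcx_lten)
  show "exact_at (Epiece p q r) (Edel p q r) t d" if "acyc ?F t d"
    by (rule exact_at_retract[OF that[unfolded acyc_def], of _ "Esect p q r" _ Eretr])
      (simp_all add: Esect_mem Eretr_mem, simp add: Esect_def op_linear sts_0)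
  assume E: "exact_at (Epiece p q r) (Edel p q r) t d"
  show "acyc ?F t d"
    unfolding acyc_def exact_at_def
  proof (intro ballI impI)
    fix v
    assume v: "v \<in> central ?F t d" "del ?F v = 0"
    have "Eretr v \<in> Epiece p q r t d" "Edel p q r (Eretr v) = 0"
      using Eretr_mem[OF v(1)] v(2) by (simp_all add: Eretr_def stsE_def Let_def)
    with E obtain w where w: "w \<in> Epiece p q r (t - 1) d" "Edel p q r w = Eretr v"
      by (rule exact_atD)
    \<comment> \<open>Subtracting the boundary of the lift of w leaves a cocycle in the kernel of
      \<open>Eretr\<close>.\<close>
    define x where "x = v - del ?F (Esect p q r w)"
    have wc: "Esect p q r w \<in> central ?F (t - 1) d"
      using Esect_mem[OF w(1)] by simp
    then have xc: "x \<in> central ?F t d"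
      unfolding x_def using F.central_del[OF wc, of t] v(1) by (intro F.central_diff) simp_all
    have x0: "del ?F x = 0"
      using v(2) by (simp add: x_def F.op_linear F.op_commute)
    have xr: "Eretr x = 0"
      using Eretr_mem(2)[OF wc] Esect_mem(3)[OF w(1)] w(2) by (simp add: x_def Eretr_diff)
    from sts_exhaust[OF dist xc] obtain m a n k0 k1 k2 c1 c2 z1 z2
      where xs: "x = sts p q r m a n k0 k1 k2 c1 c2 z1 z2"
      by blast
    note c = xc[unfolded xs]
    have e: "m = 0" "n = - k1" "c1 = - k1" "k2 = - z1" "c2 = 0" "z2 = 0"
      using xr unfolding xs Eretr_sts stsE_eq_0 by (simp_all add: eq_neg_iff_add_eq_0 add.commute)
    \<comment> \<open>All coordinates of the boundary of x vanish; those at k1 and k2 determine a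
      and k0.\<close>
    note ds = sts_eqD[OF trans[OF x0[unfolded xs sts_del[OF dist c]] sts_0[of p q r, symmetric]]]
    have a: "a = - del C k1"
      using ds(5) by (metis add.inverse_inverse eq_iff_diff_eq_0)
    have k0: "k0 = - (lop C p k1 + lop C q k1 - rop C r k1) - del C z1"
    proof -
      have "k0 = lop C q n - rop C r n - lop C p k1 + del C k2"
        using ds(6) by (simp add: algebra_simps)
      then show ?thesis
        by (simp add: e op_linear)
    qed
    have mem: "k1 \<in> scentral p q C (t - 1) (d - 1)" "z1 \<in> scentral p q C (t - 2) (d + 1)"
      using c by (simp_all add: sts_central[OF dist])
    \<comment> \<open>The inverse of the cancelled arrows: - k1 in the slot a maps to k1, and z1 in
      the slot k0 maps to z1 and to k2 = - z1. The slots n and c1 receive - k1, as required.\<close>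
    let ?u = "sts p q r 0 (- k1) 0 z1 0 0 0 0 0 0"
    have u: "?u \<in> central ?F (t - 1) d"
      using mem by (simp add: sts_central[OF dist] scentral_0 scentral_minus central_0 mcentral_0)
    have "del ?F ?u = x"
      unfolding sts_del[OF dist u] xs e a k0
      by (rule sts_cong) (simp_all add: op_linear)
    then have "del ?F (Esect p q r w + ?u) = v"
      by (simp add: F.op_linear x_def)
    with wc u show "\<exists>u \<in> central ?F (t - 1) d. del ?F u = v"
      by (blast intro: F.central_add)
  qed
qed

end

lemma Epiece_swap_exact:
  assumes dist: "p \<noteq> q" "p \<noteq> r" "q \<noteq> r" and ex: "exact_at (Epiece r q p) (Edel r q p) t d"
  shows "exact_at (Epiece p q r) (Edel p q r) t d"
proof -
  define f where "f u = (let m = part 0 (part 0 u); n = part (Suc 0) (part 0 u); c = part 2 (part 0 u);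
      e = part 0 (part (Suc 0) u); f = part (Suc 0) (part (Suc 0) u); g = part 2 (part (Suc 0) u)
    in stsE m (- c) (- n) (- f) (- e) (- g))" for u :: "nat list \<Rightarrow> 'v"
  have f: "f (stsE m n c e f' g) = stsE m (- c) (- n) (- f') (- e) (- g)" for m n c e f' g
    by (simp add: f_def stsE_def)
  have f0: "f 0 = 0"
    by (simp add: f_def stsE_def)
  have *: "f u \<in> Epiece r q p t d \<and> Edel r q p (f u) = f (Edel p q r u) \<and> f (f u) = u"
    if dist: "p \<noteq> q" "p \<noteq> r" "q \<noteq> r" and u: "u \<in> Epiece p q r t d" for u p q r t d
  proof -
    from u obtain m n c e f' g where v: "u = stsE m n c e f' g"
      by (auto simp: Epiece_def)
    with u have mem: "m \<in> tcentral p q r C t (d - 3)" "n \<in> mcentral p q r C (t - 1) (d - 1)"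
      "c \<in> mcentral r q p C (t - 1) (d - 1)" "e \<in> scentral p q C (t - 2) (d + 1)"
      "f' \<in> scentral q r C (t - 2) (d + 1)" "g \<in> central C (t - 3) (d + 3)"
      by (simp_all add: stsE_mem[OF dist])
    have sw: "scentral r q C t d = scentral q r C t d" "scentral q p C t d = scentral p q C t d" for t d
      by (rule scentral_swap[OF bcx_axioms])+
    have mem': "f u \<in> Epiece r q p t d"
      unfolding v f using mem dist
      by (subst stsE_mem) (auto simp: sw tcentral_swap mcentral_minus scentral_minus central_minus)
    \<comment> \<open>On s-central elements x_p e - e x_q = e x_p - x_q e, and likewise for f'; this
      matches the last components of the two differentials.\<close>
    have e: "lop C q e = rop C p e + rop C q e - lop C p e" and f': "lop C r f' = rop C q f' + rop C r f' - lop C q f'"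
      using scentralD(3)[OF mem(4)] scentralD(3)[OF mem(5)] by auto
    have "Edel r q p (f u) = f (Edel p q r u)"
      unfolding v f Edel_stsE
      by (rule stsE_cong) (simp_all add: op_linear e f' algebra_simps)
    with mem' show ?thesis
      by (simp add: v f)
  qed
  show ?thesis
    by (rule exact_at_retract[OF ex, of _ f _ f])
      (use *[OF dist] *[of r q p] dist f0 in auto)
qed

text \<open>The six-term complexes for (p, q, r) and (r, q, p) are isomorphic. The second one
  belongs to the transpositions written (r q), (q p), (r q), and \<open>lten_swap_iso\<close>
  changes the basis in each factor to reach t s t.\<close>

lemma acyc_braid:
  assumes dist: "p \<noteq> q" "p \<noteq> r" "q \<noteq> r"
  shows "acyc (lten p q (lten q r (lten p q C))) t d \<longleftrightarrow> acyc (lten q r (lten p q (lten q r C))) t d"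
proof -
  let ?S = "\<lambda>p q r. lten p q (lten q r (lten p q C))"
  have iso: "bcx_iso (?S r q p) (lten q r (lten p q (lten q r C)))"
  proof -
    have b: "bcx (lten r q C)" "bcx (lten q r C)" "bcx (lten q p (lten r q C))" "bcx (lten q p (lten q r C))" "bcx (lten p q (lten q r C))"
      using dist by (auto intro!: bcx_lten bcx.bcx_lten bcx_axioms)
    have "bcx_iso (lten r q C) (lten q r C)"
      using dist by (intro lten_swap_iso bcx_axioms) auto
    then have 1: "bcx_iso (lten q p (lten r q C)) (lten q p (lten q r C))"
      by (rule lten_cong[OF b(1,2)])
    have 2: "bcx_iso (lten q p (lten q r C)) (lten p q (lten q r C))"
      using dist b by (intro lten_swap_iso) auto
    have "bcx_iso (?S r q p) (lten r q (lten p q (lten q r C)))"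
      by (rule lten_cong[OF b(3,5) bcx_iso_trans[OF 1 2]])
    then show ?thesis
      by (rule bcx_iso_trans) (use dist b in \<open>auto intro: lten_swap_iso\<close>)
  qed
  have bb: "bcx (?S r q p)" "bcx (lten q r (lten p q (lten q r C)))"
    using dist by (auto intro!: bcx_lten bcx.bcx_lten bcx_axioms)
  have "acyc (?S r q p) t d \<longleftrightarrow> acyc (lten q r (lten p q (lten q r C))) t d"
    using acyc_iso[OF bb(1) iso] acyc_iso[OF bb(2) bcx_iso_sym[OF iso]] by blast
  moreover have "acyc (?S p q r) t d \<longleftrightarrow> acyc (?S r q p) t d"
    unfolding acyc_sts[OF dist] acyc_sts[OF dist(3,2,1)[symmetric]]
    using Epiece_swap_exact[OF dist, of t d] Epiece_swap_exact[OF dist(3,2,1)[symmetric], of t d] by (rule iffI[rotated])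
  ultimately show ?thesis
    by simp
qed

end

section \<open>The polynomial ring\<close>

definition mdeg :: "(nat \<Rightarrow>\<^sub>0 nat) \<Rightarrow> nat" where
  "mdeg m = (\<Sum>i \<in> Poly_Mapping.keys m. Poly_Mapping.lookup m i)"

lemma mdeg_superset: "finite A \<Longrightarrow> Poly_Mapping.keys m \<subseteq> A \<Longrightarrow> mdeg m = (\<Sum>i \<in> A. Poly_Mapping.lookup m i)"
  unfolding mdeg_def by (rule sum.mono_neutral_left) (auto simp: in_keys_iff)

lemma mdeg_add [simp]: "mdeg (m + m') = mdeg m + mdeg m'"
proof -
  let ?A = "Poly_Mapping.keys m \<union> Poly_Mapping.keys m'"
  have "mdeg (m + m') = (\<Sum>i \<in> ?A. Poly_Mapping.lookup (m + m') i)"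
    using Poly_Mapping.keys_add[of m m'] by (intro mdeg_superset) auto
  then show ?thesis
    by (simp add: lookup_add sum.distrib mdeg_superset[of ?A m] mdeg_superset[of ?A m'])
qed

lemma mdeg_single [simp]: "mdeg (Poly_Mapping.single i k) = k"
  by (simp add: mdeg_def)

lemma polyR_grade_def': "polyR_grade n q = {p \<in> polyR n. \<forall>m \<in> Poly_Mapping.keys p. 2 * int (mdeg m) = q}"
  by (simp add: polyR_grade_def mdeg_def)

lemma const_poly_simps: "const_poly 0 = 0" "const_poly 1 = 1" "const_poly (a + b) = const_poly a + const_poly b"
  "const_poly (a * b) = const_poly a * const_poly b" "const_poly (- a) = - const_poly a"
  by (simp_all add: const_poly_def single_add mult_single single_uminus)

lemma polyR_simps:
  "0 \<in> polyR n" "const_poly c \<in> polyR n" "1 \<in> polyR n"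
  "k \<in> {1..<n} \<Longrightarrow> alpha k \<in> polyR n"
  and polyR_add: "p \<in> polyR n \<Longrightarrow> p' \<in> polyR n \<Longrightarrow> p + p' \<in> polyR n"
  and polyR_uminus: "p \<in> polyR n \<Longrightarrow> - p \<in> polyR n"
  and polyR_diff: "p \<in> polyR n \<Longrightarrow> p' \<in> polyR n \<Longrightarrow> p - p' \<in> polyR n"
  and polyR_mult: "p \<in> polyR n \<Longrightarrow> p' \<in> polyR n \<Longrightarrow> p * p' \<in> polyR n"
proof -
  show "0 \<in> polyR n" "const_poly c \<in> polyR n" "1 \<in> polyR n" "k \<in> {1..<n} \<Longrightarrow> alpha k \<in> polyR n"
    by (auto simp: polyR_def const_poly_def alpha_def)
  show "p \<in> polyR n \<Longrightarrow> p' \<in> polyR n \<Longrightarrow> p + p' \<in> polyR n"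
    "p \<in> polyR n \<Longrightarrow> - p \<in> polyR n"
    "p \<in> polyR n \<Longrightarrow> p' \<in> polyR n \<Longrightarrow> p - p' \<in> polyR n"
    unfolding polyR_def using Poly_Mapping.keys_add[of p p'] keys_diff[of p p'] by auto
  show "p * p' \<in> polyR n" if "p \<in> polyR n" "p' \<in> polyR n"
    unfolding polyR_def
  proof (intro CollectI ballI)
    fix m
    assume "m \<in> Poly_Mapping.keys (p * p')"
    then obtain a b where "m = a + b" "a \<in> Poly_Mapping.keys p" "b \<in> Poly_Mapping.keys p'"
      using keys_mult[of p p'] by auto
    with that show "Poly_Mapping.keys m \<subseteq> {1..<n}"
      unfolding polyR_def using Poly_Mapping.keys_add[of a b] by blast
  qed
qed

lemma grade_simps:
  "0 \<in> polyR_grade n q" "const_poly c \<in> polyR_grade n 0" "1 \<in> polyR_grade n 0"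
  "k \<in> {1..<n} \<Longrightarrow> alpha k \<in> polyR_grade n 2"
  and grade_polyR: "p \<in> polyR_grade n q \<Longrightarrow> p \<in> polyR n"
  and grade_add: "p \<in> polyR_grade n q \<Longrightarrow> p' \<in> polyR_grade n q \<Longrightarrow> p + p' \<in> polyR_grade n q"
  and grade_uminus: "p \<in> polyR_grade n q \<Longrightarrow> - p \<in> polyR_grade n q"
  and grade_diff: "p \<in> polyR_grade n q \<Longrightarrow> p' \<in> polyR_grade n q \<Longrightarrow> p - p' \<in> polyR_grade n q"
  and grade_mult: "p \<in> polyR_grade n q \<Longrightarrow> p' \<in> polyR_grade n q' \<Longrightarrow> p * p' \<in> polyR_grade n (q + q')"
proof -
  show "0 \<in> polyR_grade n q" "const_poly c \<in> polyR_grade n 0" "1 \<in> polyR_grade n 0"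
    "k \<in> {1..<n} \<Longrightarrow> alpha k \<in> polyR_grade n 2"
    by (auto simp: polyR_grade_def' polyR_simps) (auto simp: const_poly_def alpha_def mdeg_def split: if_splits)
  show "p \<in> polyR_grade n q \<Longrightarrow> p \<in> polyR n"
    by (simp add: polyR_grade_def')
  show "p \<in> polyR_grade n q \<Longrightarrow> p' \<in> polyR_grade n q \<Longrightarrow> p + p' \<in> polyR_grade n q"
    "p \<in> polyR_grade n q \<Longrightarrow> - p \<in> polyR_grade n q"
    "p \<in> polyR_grade n q \<Longrightarrow> p' \<in> polyR_grade n q \<Longrightarrow> p - p' \<in> polyR_grade n q"
    unfolding polyR_grade_def' using Poly_Mapping.keys_add[of p p'] keys_diff[of p p']
    by (auto simp: polyR_add polyR_diff polyR_uminus)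
  show "p * p' \<in> polyR_grade n (q + q')" if "p \<in> polyR_grade n q" "p' \<in> polyR_grade n q'"
    unfolding polyR_grade_def'
  proof (intro CollectI conjI ballI)
    fix m
    assume "m \<in> Poly_Mapping.keys (p * p')"
    then obtain a b where "m = a + b" "a \<in> Poly_Mapping.keys p" "b \<in> Poly_Mapping.keys p'"
      using keys_mult[of p p'] by auto
    with that show "2 * int (mdeg m) = q + q'"
      by (auto simp: polyR_grade_def')
  qed (use that in \<open>auto simp: polyR_grade_def' polyR_mult\<close>)
qed

lemma grade_neg: "q < 0 \<Longrightarrow> polyR_grade n q = {0}"
  by (auto simp: polyR_grade_def' polyR_simps simp flip: keys_eq_empty)

lemma grade_0: "p \<in> polyR_grade n 0 \<longleftrightarrow> (\<exists>c. p = const_poly c)"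
proof
  assume "p \<in> polyR_grade n 0"
  then have "mdeg m = 0" if "m \<in> Poly_Mapping.keys p" for m
    using that by (auto simp: polyR_grade_def')
  then have k: "m = 0" if "m \<in> Poly_Mapping.keys p" for m
    using that by (auto simp: mdeg_def in_keys_iff intro!: poly_mapping_eqI)
  have "p = const_poly (Poly_Mapping.lookup p 0)"
    unfolding const_poly_def
  proof (rule poly_mapping_eqI)
    show "Poly_Mapping.lookup p m = Poly_Mapping.lookup (Poly_Mapping.single 0 (Poly_Mapping.lookup p 0)) m" for m
      using k[of m] by (cases "m = 0") (auto simp: lookup_single in_keys_iff)
  qed
  then show "\<exists>c. p = const_poly c" ..
qed (auto simp: grade_simps)

section \<open>Induction over polynomials\<close>

lemma poly_sum_monomials: "p = (\<Sum>m \<in> Poly_Mapping.keys p. Poly_Mapping.single m (Poly_Mapping.lookup p m))"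
proof (rule poly_mapping_eqI)
  fix k
  have "Poly_Mapping.lookup (\<Sum>m \<in> Poly_Mapping.keys p. Poly_Mapping.single m (Poly_Mapping.lookup p m)) k
    = (\<Sum>m \<in> Poly_Mapping.keys p. if m = k then Poly_Mapping.lookup p m else 0)"
    by (simp add: lookup_sum lookup_single when_def)
  then show "Poly_Mapping.lookup p k = Poly_Mapping.lookup (\<Sum>m \<in> Poly_Mapping.keys p. Poly_Mapping.single m (Poly_Mapping.lookup p m)) k"
    by (simp add: in_keys_iff)
qed

lemma monomial_induct [consumes 1, case_names const alpha]:
  assumes "Poly_Mapping.keys m \<subseteq> {1..<n}"
    and "\<And>c. P 0 (const_poly c)"
    and "\<And>k d p. k \<in> {1..<n} \<Longrightarrow> p \<in> polyR_grade n (2 * int d) \<Longrightarrow> P d p \<Longrightarrow> P (Suc d) (alpha k * p)"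
  shows "P (mdeg m) (Poly_Mapping.single m c)"
  using assms(1)
proof (induction "mdeg m" arbitrary: m)
  case 0
  then have "m = 0"
    by (auto simp: mdeg_def in_keys_iff intro!: poly_mapping_eqI)
  then show ?case
    using assms(2)[of c] 0 by (simp add: const_poly_def)
next
  case (Suc d)
  then obtain k where k: "k \<in> Poly_Mapping.keys m"
    by (metis Suc_neq_Zero finite_keys mdeg_def sum.neutral_const sum.empty ex_in_conv)
  define m' where "m' = m - Poly_Mapping.single k 1"
  have m: "m = Poly_Mapping.single k 1 + m'"
    using k by (intro poly_mapping_eqI) (auto simp: m'_def lookup_add lookup_minus lookup_single in_keys_iff when_def)
  then have d: "d = mdeg m'"
    using Suc(2) by simp
  have keys: "Poly_Mapping.keys m' \<subseteq> {1..<n}"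
    using Suc(3) by (auto simp: m'_def in_keys_iff lookup_minus lookup_single subset_iff)
  have "Poly_Mapping.single m c = alpha k * Poly_Mapping.single m' c"
    by (simp add: m alpha_def mult_single)
  moreover have "Poly_Mapping.single m' c \<in> polyR_grade n (2 * int d)"
    using keys d by (auto simp: polyR_grade_def' polyR_def)
  ultimately show ?case
    using assms(3)[of k "Poly_Mapping.single m' c" d] Suc(1)[OF d keys] k Suc(2,3) d by auto
qed

text \<open>Homogeneous polynomials are built within one degree at a time. The case of 0 is asked
  for in every degree, because the empty sum of monomials is homogeneous of any degree.\<close>

lemma grade_induct [consumes 1, case_names zero const add alpha]:
  assumes "p \<in> polyR_grade n q" "\<And>q. P q 0" "\<And>c. P 0 (const_poly c)"
    and add: "\<And>q p p'. p \<in> polyR_grade n q \<Longrightarrow> p' \<in> polyR_grade n q \<Longrightarrow> P q p \<Longrightarrow> P q p' \<Longrightarrow> P q (p + p')"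
    and al: "\<And>k q p. k \<in> {1..<n} \<Longrightarrow> p \<in> polyR_grade n q \<Longrightarrow> P q p \<Longrightarrow> P (q + 2) (alpha k * p)"
  shows "P q p"
proof -
  have mono: "P (2 * int (mdeg m)) (Poly_Mapping.single m c)" if "Poly_Mapping.keys m \<subseteq> {1..<n}" for m c
    using that
  proof (induction rule: monomial_induct)
    case (alpha k d p)
    then show ?case
      using al[of k p "2 * int d"] by (simp add: algebra_simps)
  qed (simp add: assms(3))
  have "P q (\<Sum>m \<in> A. Poly_Mapping.single m (Poly_Mapping.lookup p m)) \<and>
     (\<Sum>m \<in> A. Poly_Mapping.single m (Poly_Mapping.lookup p m)) \<in> polyR_grade n q"
    if "A \<subseteq> Poly_Mapping.keys p" for A
  proof -
    have "finite A"
      using that finite_keys finite_subset by blast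
    then show ?thesis
      using that
    proof (induction A)
      case (insert m A)
      have m: "Poly_Mapping.keys m \<subseteq> {1..<n}" "2 * int (mdeg m) = q"
        using insert(4) assms(1) by (auto simp: polyR_grade_def' polyR_def)
      have "Poly_Mapping.single m (Poly_Mapping.lookup p m) \<in> polyR_grade n q"
        using m by (auto simp: polyR_grade_def' polyR_def)
      then show ?case
        using insert mono[OF m(1)] m(2) by (auto intro!: add grade_add)
    qed (simp add: assms(2) grade_simps)
  qed
  from this[OF order_refl] show ?thesis
    using poly_sum_monomials[of p] by simp
qed

lemma polyR_induct [consumes 1, case_names const add alpha]:
  assumes "p \<in> polyR n" "\<And>c. P (const_poly c)"
    and add: "\<And>p p'. p \<in> polyR n \<Longrightarrow> p' \<in> polyR n \<Longrightarrow> P p \<Longrightarrow> P p' \<Longrightarrow> P (p + p')"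
    and al: "\<And>k p. k \<in> {1..<n} \<Longrightarrow> p \<in> polyR n \<Longrightarrow> P p \<Longrightarrow> P (alpha k * p)"
  shows "P p"
proof -
  have mono: "P (Poly_Mapping.single m c)" if "Poly_Mapping.keys m \<subseteq> {1..<n}" for m c
    using that by (induction rule: monomial_induct) (auto simp: assms(2) intro: al grade_polyR)
  have "P (\<Sum>m \<in> A. Poly_Mapping.single m (Poly_Mapping.lookup p m)) \<and>
     (\<Sum>m \<in> A. Poly_Mapping.single m (Poly_Mapping.lookup p m)) \<in> polyR n"
    if "A \<subseteq> Poly_Mapping.keys p" for A
  proof -
    have "finite A"
      using that finite_keys finite_subset by blast
    then show ?thesis
      using that
    proof (induction A)
      case (insert m A)
      have m: "Poly_Mapping.keys m \<subseteq> {1..<n}"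
        using insert(4) assms(1) by (auto simp: polyR_def)
      have "Poly_Mapping.single m (Poly_Mapping.lookup p m) \<in> polyR n"
        using m by (auto simp: polyR_def)
      then show ?case
        using insert mono[OF m(1)] by (auto intro!: add polyR_add)
    qed (use assms(2)[of 0] in \<open>simp add: const_poly_simps polyR_simps\<close>)
  qed
  from this[OF order_refl] show ?thesis
    using poly_sum_monomials[of p] by simp
qed

subsection \<open>Substitution and the simple reflections\<close>

definition msubst :: "(nat \<Rightarrow> mpoly) \<Rightarrow> (nat \<Rightarrow>\<^sub>0 nat) \<Rightarrow> mpoly" where
  "msubst f m = (\<Prod>j \<in> Poly_Mapping.keys m. f j ^ Poly_Mapping.lookup m j)"

lemma msubst_superset: "finite A \<Longrightarrow> Poly_Mapping.keys m \<subseteq> A \<Longrightarrow> msubst f m = (\<Prod>j \<in> A. f j ^ Poly_Mapping.lookup m j)"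
  unfolding msubst_def by (rule prod.mono_neutral_left) (auto simp: in_keys_iff)

lemma msubst_add: "msubst f (m + m') = msubst f m * msubst f m'"
proof -
  let ?A = "Poly_Mapping.keys m \<union> Poly_Mapping.keys m'"
  have "msubst f (m + m') = (\<Prod>j \<in> ?A. f j ^ Poly_Mapping.lookup (m + m') j)"
    using Poly_Mapping.keys_add[of m m'] by (intro msubst_superset) auto
  then show ?thesis
    by (simp add: lookup_add power_add prod.distrib msubst_superset[of ?A m] msubst_superset[of ?A m'])
qed

lemma poly_subst_superset:
  "finite A \<Longrightarrow> Poly_Mapping.keys p \<subseteq> A \<Longrightarrow> poly_subst f p = (\<Sum>m \<in> A. const_poly (Poly_Mapping.lookup p m) * msubst f m)"
  unfolding poly_subst_def msubst_def
  by (rule sum.mono_neutral_left) (auto simp: in_keys_iff const_poly_simps)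

lemma poly_subst_add: "poly_subst f (p + p') = poly_subst f p + poly_subst f p'"
proof -
  let ?A = "Poly_Mapping.keys p \<union> Poly_Mapping.keys p'"
  have "poly_subst f (p + p') = (\<Sum>m \<in> ?A. const_poly (Poly_Mapping.lookup (p + p') m) * msubst f m)"
    using Poly_Mapping.keys_add[of p p'] by (intro poly_subst_superset) auto
  then show ?thesis
    by (simp add: lookup_add const_poly_simps distrib_right sum.distrib
        poly_subst_superset[of ?A p] poly_subst_superset[of ?A p'])
qed

lemma poly_subst_single: "poly_subst f (Poly_Mapping.single m c) = const_poly c * msubst f m"
  by (simp add: poly_subst_def msubst_def const_poly_simps)

lemma poly_subst_0: "poly_subst f 0 = 0"
  by (simp add: poly_subst_def)

lemma poly_subst_sum: "poly_subst f (\<Sum>x \<in> A. g x) = (\<Sum>x \<in> A. poly_subst f (g x))"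
  by (induction A rule: infinite_finite_induct) (simp_all add: poly_subst_0 poly_subst_add)

lemma poly_subst_mult: "poly_subst f (p * p') = poly_subst f p * poly_subst f p'"
proof -
  have "poly_subst f (p * p') = poly_subst f
    ((\<Sum>m \<in> Poly_Mapping.keys p. Poly_Mapping.single m (Poly_Mapping.lookup p m))
      * (\<Sum>m \<in> Poly_Mapping.keys p'. Poly_Mapping.single m (Poly_Mapping.lookup p' m)))"
    using poly_sum_monomials[of p] poly_sum_monomials[of p'] by simp
  also have "\<dots> = (\<Sum>m \<in> Poly_Mapping.keys p. \<Sum>m' \<in> Poly_Mapping.keys p'.
      (const_poly (Poly_Mapping.lookup p m) * msubst f m) * (const_poly (Poly_Mapping.lookup p' m') * msubst f m'))"
    by (simp add: sum_product mult_single poly_subst_sum poly_subst_single const_poly_simps msubst_add mult_ac)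
  also have "\<dots> = poly_subst f p * poly_subst f p'"
    by (simp add: poly_subst_def msubst_def sum_product)
  finally show ?thesis .
qed

lemma poly_subst_const: "poly_subst f (const_poly c) = const_poly c"
  by (simp add: const_poly_def[of c] poly_subst_single msubst_def)

lemma poly_subst_alpha: "poly_subst f (alpha k) = f k"
  by (simp add: alpha_def poly_subst_single msubst_def const_poly_simps)

lemma poly_subst_uminus: "poly_subst f (- p) = - poly_subst f p"
  using poly_subst_add[of f p "- p"] by (simp add: poly_subst_0 eq_neg_iff_add_eq_0 add.commute)

lemma poly_subst_diff: "poly_subst f (p - p') = poly_subst f p - poly_subst f p'"
  using poly_subst_add[of f p "- p'"] by (simp add: poly_subst_uminus)

lemmas poly_subst_simps = poly_subst_add poly_subst_mult poly_subst_const poly_subst_alpha poly_subst_uminus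
  poly_subst_diff poly_subst_0 poly_subst_sum

subsection \<open>Coordinates permuted by the symmetric group\<close>

text \<open>The linear forms \<open>x\<^sub>1, \<dots>, x\<^sub>n\<close> with sum 0 and \<open>x\<^sub>i - x\<^sub>i\<^sub>+\<^sub>1 = \<alpha>\<^sub>i\<close>: the simple reflection
  \<open>s\<^sub>i\<close> exchanges \<open>x\<^sub>i\<close> and \<open>x\<^sub>i\<^sub>+\<^sub>1\<close>.\<close>

definition xvar :: "nat \<Rightarrow> nat \<Rightarrow> mpoly" where
  "xvar n j = (if 1 \<le> j \<and> j \<le> n then (\<Sum>k \<in> {1..<n}. const_poly (of_nat (n - k) / of_nat n) * alpha k)
     - (\<Sum>k \<in> {1..<j}. alpha k) else 0)"

abbreviation srefl :: "nat \<Rightarrow> mpoly \<Rightarrow> mpoly" where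
  "srefl i \<equiv> poly_subst (simple_refl i)"

lemma xvar_grade: "xvar n j \<in> polyR_grade n 2"
proof -
  have "(\<Sum>k \<in> A. const_poly (f k) * alpha k) \<in> polyR_grade n 2" if "A \<subseteq> {1..<n}" for A and f :: "nat \<Rightarrow> rat"
  proof -
    have "finite A"
      using that finite_subset by blast
    then show ?thesis
      using that
    proof (induction A)
      case (insert k A)
      then have "const_poly (f k) * alpha k \<in> polyR_grade n (0 + 2)"
        by (intro grade_mult grade_simps) auto
      with insert show ?case
        by (simp add: grade_add)
    qed (simp add: grade_simps)
  qed
  from this[of "{1..<n}"] this[of "{1..<j}" "\<lambda>_. 1"] show ?thesis
    by (auto simp: xvar_def const_poly_simps intro!: grade_diff grade_simps)
qed

lemma xvar_polyR: "xvar n j \<in> polyR n"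
  by (rule grade_polyR[OF xvar_grade])

lemma alpha_xvar: "i \<in> {1..<n} \<Longrightarrow> alpha i = xvar n i - xvar n (Suc i)"
  by (simp add: xvar_def)

text \<open>The coefficients (n - k) / n are those of the first fundamental weight. They are affine
  in k, so their second differences vanish, and s_i moves x_1 only at the left end i = 1.\<close>

lemma refl_xvar_1:
  assumes "i \<in> {1..<n}"
  shows "srefl i (xvar n 1) = xvar n 1 - (if i = 1 then alpha i else 0)"
proof -
  define c where "c k = const_poly (of_nat (n - k) / of_nat n :: rat)" for k
  have x1: "xvar n 1 = (\<Sum>k \<in> {1..<n}. c k * alpha k)"
    using assms by (simp add: xvar_def c_def)
  have sr: "simple_refl i k = alpha k + (if k = i then - 2 * alpha i else 0)
      + (if k = Suc i then alpha i else 0) + (if Suc k = i then alpha i else 0)" for k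
    by (auto simp: simple_refl_def)
  have c: "srefl i (c k) = c k" for k
    by (simp add: c_def poly_subst_const)
  have "srefl i (xvar n 1) = (\<Sum>k \<in> {1..<n}. c k * simple_refl i k)"
    unfolding x1 by (simp add: poly_subst_simps c)
  also have "\<dots> = xvar n 1 + (\<Sum>k \<in> {1..<n}. if k = i then c k * (- 2 * alpha i) else 0)
    + (\<Sum>k \<in> {1..<n}. if k = Suc i then c k * alpha i else 0)
    + (\<Sum>k \<in> {1..<n}. if Suc k = i then c k * alpha i else 0)"
    unfolding x1 sum.distrib[symmetric] by (rule sum.cong) (auto simp: sr distrib_left)
  also have "(\<Sum>k \<in> {1..<n}. if k = i then c k * (- 2 * alpha i) else 0) = - 2 * c i * alpha i"
    using assms by simp
  also have "(\<Sum>k \<in> {1..<n}. if k = Suc i then c k * alpha i else 0) = c (Suc i) * alpha i"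
  proof -
    \<comment> \<open>At the right end the neighbour i + 1 = n is not summed over; its coefficient
      is 0 anyway.\<close>
    have "c (Suc i) = 0" if "\<not> Suc i < n"
    proof -
      have "n - Suc i = 0"
        using that by simp
      then show ?thesis
        by (simp only: c_def of_nat_0 div_0 const_poly_simps)
    qed
    then show ?thesis
      by simp
  qed
  also have "(\<Sum>k \<in> {1..<n}. if Suc k = i then c k * alpha i else 0) = (if i = 1 then 0 else c (i - 1) * alpha i)"
  proof -
    have "(\<Sum>k \<in> {1..<n}. if Suc k = i then c k * alpha i else 0) = (\<Sum>k \<in> {1..<n}. if k = i - 1 then (if i = 1 then 0 else c k * alpha i) else 0)"
      using assms by (intro sum.cong) auto
    then show ?thesis
      using assms by auto
  qed
  finally have "srefl i (xvar n 1) = xvar n 1 + - 2 * c i * alpha i + c (Suc i) * alpha i + (if i = 1 then 0 else c (i - 1) * alpha i)" .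
  also have "\<dots> = xvar n 1 + (c (Suc i) + (if i = 1 then 0 else c (i - 1)) - c i - c i) * alpha i"
    by (simp add: algebra_simps)
  \<comment> \<open>A second difference of c. For i = 1 the left neighbour, whose value would be n /
    n = 1, is absent, and - 1 remains.\<close>
  also have "c (Suc i) + (if i = 1 then 0 else c (i - 1)) - c i - c i = (if i = 1 then - 1 else 0)"
  proof -
    have d: "const_poly a - const_poly b = const_poly (a - b)" for a b
      using const_poly_simps(3)[of a "- b"] by (simp add: const_poly_simps)
    show ?thesis
    proof (cases "i = 1")
      case True
      have "of_nat (n - Suc 1) / of_nat n - of_nat (n - 1) / of_nat n - of_nat (n - 1) / of_nat n = (- 1::rat)"
        using assms True by (simp add: field_simps of_nat_diff)
      then have "c (Suc 1) - c 1 - c 1 = const_poly (- 1)"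
        by (simp only: c_def d)
      also have "\<dots> = - 1"
        using const_poly_simps(5)[of 1] by (simp only: const_poly_simps)
      finally show ?thesis
        by (simp only: True if_True refl add_0_right)
    next
      case False
      have "(of_nat (n - Suc i) + of_nat (n - (i - 1)) :: rat) = of_nat (n - i) + of_nat (n - i)"
        using assms by (simp flip: of_nat_add)
      then have "of_nat (n - Suc i) / of_nat n + of_nat (n - (i - 1)) / of_nat n - of_nat (n - i) / of_nat n - of_nat (n - i) / of_nat n = (0::rat)"
        by (simp flip: add_divide_distrib diff_divide_distrib)
      then have "c (Suc i) + c (i - 1) - c i - c i = const_poly 0"
        by (simp only: c_def d const_poly_simps(3)[symmetric])
      then show ?thesis
        using False by (simp only: const_poly_simps if_False)
    qed
  qed
  finally show ?thesis
    by (auto simp: algebra_simps)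
qed

text \<open>The case of x_1 propagates along x_(j+1) = x_j - \<alpha>_j. The index j may be any
  number: outside 1, ..., n the variable is 0, hence fixed.\<close>

lemma refl_xvar:
  assumes "i \<in> {1..<n}"
  shows "srefl i (xvar n i) = xvar n (Suc i)" "srefl i (xvar n (Suc i)) = xvar n i"
    "j \<noteq> i \<Longrightarrow> j \<noteq> Suc i \<Longrightarrow> srefl i (xvar n j) = xvar n j"
proof -
  have *: "srefl i (xvar n j) = xvar n j - (if j = i then alpha i else if j = Suc i then - alpha i else 0)"
    if "1 \<le> j" "j \<le> n" for j
    using that
  proof (induction j rule: nat_induct_at_least)
    case base
    then show ?case
      using refl_xvar_1[OF assms] assms by simp
  next
    case (Suc j)
    have eq1: "xvar n (Suc j) = xvar n j - alpha j"
      using alpha_xvar[of j n] Suc by simp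
    have eq2: "srefl i (xvar n (Suc j)) = srefl i (xvar n j) - simple_refl i j"
      unfolding eq1 by (simp only: poly_subst_diff poly_subst_alpha)
    have sr: "simple_refl i j = (if j = i then - alpha i else if j = Suc i \<or> i = Suc j then alpha j + alpha i else alpha j)"
      by (simp add: simple_refl_def)
    have IH: "srefl i (xvar n j) = xvar n j - (if j = i then alpha i else if j = Suc i then - alpha i else 0)"
      using Suc by simp
    show ?case
      by (subst eq2, unfold IH eq1 sr) auto
  qed
  show "srefl i (xvar n i) = xvar n (Suc i)" "srefl i (xvar n (Suc i)) = xvar n i"
    using *[of i] *[of "Suc i"] assms alpha_xvar[OF assms] by auto
  show "srefl i (xvar n j) = xvar n j" if "j \<noteq> i" "j \<noteq> Suc i"
    using *[of j] that by (cases "1 \<le> j \<and> j \<le> n") (auto simp: xvar_def poly_subst_simps)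
qed

lemma invariants_simps:
  "const_poly c \<in> invariants n i" "0 \<in> invariants n i" "1 \<in> invariants n i"
  "p \<in> invariants n i \<Longrightarrow> p' \<in> invariants n i \<Longrightarrow> p + p' \<in> invariants n i"
  "p \<in> invariants n i \<Longrightarrow> p' \<in> invariants n i \<Longrightarrow> p - p' \<in> invariants n i"
  "p \<in> invariants n i \<Longrightarrow> p' \<in> invariants n i \<Longrightarrow> p * p' \<in> invariants n i"
  "p \<in> invariants n i \<Longrightarrow> - p \<in> invariants n i"
  using poly_subst_const[of "simple_refl i" 1]
  by (auto simp: invariants_def polyR_simps polyR_add polyR_diff polyR_mult polyR_uminus poly_subst_simps const_poly_simps)

lemma invariants_polyR: "p \<in> invariants n i \<Longrightarrow> p \<in> polyR n"
  by (simp add: invariants_def)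

section \<open>R as a free module over the invariants of s_i\<close>

context
  fixes n i :: nat
  assumes i: "i \<in> {1..<n}"
begin

abbreviation (input) "e1 \<equiv> xvar n i + xvar n (Suc i)"
abbreviation (input) "e2 \<equiv> xvar n i * xvar n (Suc i)"

lemma sym_invariants: "e1 \<in> invariants n i" "e2 \<in> invariants n i" "e1 \<in> polyR_grade n 2" "e2 \<in> polyR_grade n 4"
  "j \<noteq> i \<Longrightarrow> j \<noteq> Suc i \<Longrightarrow> xvar n j \<in> invariants n i"
  using grade_mult[OF xvar_grade xvar_grade, of n i "Suc i"]
  by (auto simp: invariants_def polyR_add polyR_mult xvar_polyR poly_subst_simps refl_xvar[OF i] algebra_simps intro: grade_add xvar_grade)

text \<open>Let c be the Cartan integer of i and k. Then s_i subtracts c \<alpha>_i from \<alpha>_k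
  and \<alpha>_i from x_i, so \<alpha>_k - c x_i is invariant.\<close>

lemma alpha_split:
  assumes "k \<in> {1..<n}"
  obtains e c where "e \<in> invariants n i" "e \<in> polyR_grade n 2" "alpha k = e + const_poly c * xvar n i"
proof -
  have m1: "const_poly (- 1) = - 1"
    using const_poly_simps(5)[of 1] by (simp add: const_poly_simps)
  consider "k = i" | "k = Suc i \<or> i = Suc k" | "k \<noteq> i" "k \<noteq> Suc i" "i \<noteq> Suc k"
    by blast
  then show ?thesis
  proof cases
    case 1
    have "const_poly 2 = 2"
      using const_poly_simps(3)[of 1 1] by (simp add: const_poly_simps)
    then show ?thesis
      using that[of "- e1" 2] sym_invariants(1,3) 1 alpha_xvar[OF i]
      by (simp add: invariants_simps(7) grade_uminus del: minus_add_distrib) 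
  next
    case 2
    have "alpha k + xvar n i \<in> invariants n i"
      using 2 assms alpha_xvar[OF i] polyR_simps(4)[OF assms]
      by (auto simp: invariants_def polyR_add xvar_polyR poly_subst_simps refl_xvar[OF i] simple_refl_def)
    then show ?thesis
      using that[of "alpha k + xvar n i" "- 1"] assms by (simp add: grade_add grade_simps xvar_grade m1)
  next
    case 3
    have "alpha k \<in> invariants n i"
      using 3 polyR_simps(4)[OF assms] by (auto simp: invariants_def poly_subst_simps simple_refl_def)
    then show ?thesis
      using that[of "alpha k" 0] assms by (simp add: grade_simps const_poly_simps)
  qed
qed

text \<open>Here x_i^2 has been replaced by e1 x_i - e2, as x_i is a root of X^2 - e1 X +
  e2.\<close>

lemma split_step:
  "(e + c * xvar n i) * (a + xvar n i * b) = (e * a - c * e2 * b) + xvar n i * (e * b + c * a + c * e1 * b)"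
  by (simp add: algebra_simps)

text \<open>The polynomials of the form a + x_i b contain the constants and are closed under sums;
  by \<open>alpha_split\<close> and \<open>split_step\<close> they are closed under multiplication
  by simple roots.\<close>

lemma split_exists_grade:
  assumes "p \<in> polyR_grade n d"
  shows "\<exists>a b. a \<in> invariants n i \<and> b \<in> invariants n i \<and> a \<in> polyR_grade n d \<and> b \<in> polyR_grade n (d - 2)
    \<and> p = a + xvar n i * b"
  using assms
proof (induction rule: grade_induct)
  case (zero q)
  then show ?case
    by (intro exI[of _ 0]) (simp add: invariants_simps grade_simps)
next
  case (const c)
  then show ?case
    by (intro exI[of _ "const_poly c"] exI[of _ 0]) (simp add: invariants_simps grade_simps)
next
  case (add q p p')
  then obtain a b a' b' where "a \<in> invariants n i" "b \<in> invariants n i" "a \<in> polyR_grade n q" "b \<in> polyR_grade n (q - 2)"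
    "p = a + xvar n i * b" "a' \<in> invariants n i" "b' \<in> invariants n i" "a' \<in> polyR_grade n q" "b' \<in> polyR_grade n (q - 2)"
    "p' = a' + xvar n i * b'"
    by blast
  then show ?case
    by (intro exI[of _ "a + a'"] exI[of _ "b + b'"]) (simp add: invariants_simps grade_add algebra_simps)
next
  case (alpha k q p)
  then obtain a b where ab: "a \<in> invariants n i" "b \<in> invariants n i" "a \<in> polyR_grade n q" "b \<in> polyR_grade n (q - 2)"
    "p = a + xvar n i * b"
    by blast
  from alpha(1) obtain e c where e: "e \<in> invariants n i" "e \<in> polyR_grade n 2" "alpha k = e + const_poly c * xvar n i"
    by (rule alpha_split)
  have g: "const_poly c * a \<in> polyR_grade n q" "const_poly c * e1 \<in> polyR_grade n 2" "const_poly c * e2 \<in> polyR_grade n 4"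
    using grade_mult[OF grade_simps(2) ab(3)] grade_mult[OF grade_simps(2) sym_invariants(3)] grade_mult[OF grade_simps(2) sym_invariants(4)]
    by simp_all
  have "e * a - const_poly c * e2 * b \<in> polyR_grade n (q + 2)"
    using grade_mult[OF e(2) ab(3)] grade_mult[OF g(3) ab(4)] by (simp add: grade_diff add.commute)
  moreover have "e * b + const_poly c * a + const_poly c * e1 * b \<in> polyR_grade n (q + 2 - 2)"
    using grade_mult[OF e(2) ab(4)] grade_mult[OF g(2) ab(4)] g(1) by (simp add: grade_add)
  ultimately show ?case
    using ab e sym_invariants
    by (intro exI[of _ "e * a - const_poly c * e2 * b"] exI[of _ "e * b + const_poly c * a + const_poly c * e1 * b"])
      (simp add: invariants_simps split_step)
qed

lemma split_exists:
  assumes "p \<in> polyR n"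
  shows "\<exists>a b. a \<in> invariants n i \<and> b \<in> invariants n i \<and> p = a + xvar n i * b"
  using assms
proof (induction rule: polyR_induct)
  case (const c)
  then show ?case
    by (intro exI[of _ "const_poly c"] exI[of _ 0]) (simp add: invariants_simps)
next
  case (add p p')
  then obtain a b a' b' where "a \<in> invariants n i" "b \<in> invariants n i"
    "p = a + xvar n i * b" "a' \<in> invariants n i" "b' \<in> invariants n i" "p' = a' + xvar n i * b'"
    by blast
  then show ?case
    by (intro exI[of _ "a + a'"] exI[of _ "b + b'"]) (simp add: invariants_simps algebra_simps)
next
  case (alpha k p)
  then obtain a b where ab: "a \<in> invariants n i" "b \<in> invariants n i" "p = a + xvar n i * b"
    by blast
  from alpha(1) obtain e c where e: "e \<in> invariants n i" "alpha k = e + const_poly c * xvar n i"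
    by (rule alpha_split)
  then show ?case
    using ab e sym_invariants
    by (intro exI[of _ "e * a - const_poly c * e2 * b"] exI[of _ "e * b + const_poly c * a + const_poly c * e1 * b"])
      (simp add: invariants_simps split_step)
qed

lemma split_unique:
  assumes "a \<in> invariants n i" "b \<in> invariants n i" "a' \<in> invariants n i" "b' \<in> invariants n i"
    and "a + xvar n i * b = a' + xvar n i * b'"
  shows "a = a'" "b = b'"
proof -
  \<comment> \<open>Applying s_i and subtracting leaves \<alpha>_i (b - b') = 0 in an integral
    domain.\<close>
  have "srefl i (a + xvar n i * b) = srefl i (a' + xvar n i * b')"
    using assms(5) by simp
  then have 2: "a + xvar n (Suc i) * b = a' + xvar n (Suc i) * b'"
    using assms(1-4) by (simp add: invariants_def poly_subst_simps refl_xvar[OF i])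
  have "alpha i * (b - b') = 0"
    using assms(5) 2 unfolding alpha_xvar[OF i] by algebra
  moreover have "alpha i \<noteq> 0"
  proof
    assume "alpha i = 0"
    then have "Poly_Mapping.keys (alpha i) = {}"
      by simp
    then show False
      by (simp add: alpha_def)
  qed
  ultimately show "b = b'"
    by simp
  with assms(5) show "a = a'"
    by simp
qed

text \<open>The coordinates in the basis 1, x_i. As p - s_i p = \<alpha>_i b, the coordinate
  \<open>icoeff1\<close> is the divided difference of p.\<close>

definition "isplit p = (THE ab. fst ab \<in> invariants n i \<and> snd ab \<in> invariants n i \<and> p = fst ab + xvar n i * snd ab)"

definition "icoeff0 p = fst (isplit p)"
definition "icoeff1 p = snd (isplit p)"

lemma icoeff_unique:
  assumes "a \<in> invariants n i" "b \<in> invariants n i" "p = a + xvar n i * b"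
  shows "icoeff0 p = a" "icoeff1 p = b"
proof -
  have "isplit p = (a, b)"
    unfolding isplit_def
  proof (rule the_equality)
    show "fst (a, b) \<in> invariants n i \<and> snd (a, b) \<in> invariants n i \<and> p = fst (a, b) + xvar n i * snd (a, b)"
      using assms by simp
    fix ab
    assume *: "fst ab \<in> invariants n i \<and> snd ab \<in> invariants n i \<and> p = fst ab + xvar n i * snd ab"
    then have "fst ab + xvar n i * snd ab = a + xvar n i * b"
      using assms(3) by metis
    with * assms(1,2) have "fst ab = a" "snd ab = b"
      using split_unique by metis+
    then show "ab = (a, b)"
      by (simp add: prod_eq_iff)
  qed
  then show "icoeff0 p = a" "icoeff1 p = b"
    by (simp_all add: icoeff0_def icoeff1_def)
qed

lemma icoeff:
  assumes "p \<in> polyR n"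
  shows "icoeff0 p \<in> invariants n i" "icoeff1 p \<in> invariants n i" "p = icoeff0 p + xvar n i * icoeff1 p"
    "icoeff0 p \<in> polyR n" "icoeff1 p \<in> polyR n"
proof -
  from split_exists[OF assms] obtain a b where ab: "a \<in> invariants n i" "b \<in> invariants n i" "p = a + xvar n i * b"
    by blast
  note u = icoeff_unique[OF ab]
  show "icoeff0 p \<in> invariants n i" "icoeff1 p \<in> invariants n i" "p = icoeff0 p + xvar n i * icoeff1 p"
    "icoeff0 p \<in> polyR n" "icoeff1 p \<in> polyR n"
    unfolding u by (fact ab | rule invariants_polyR)+
qed

lemma icoeff_grade:
  assumes "p \<in> polyR_grade n d"
  shows "icoeff0 p \<in> polyR_grade n d" "icoeff1 p \<in> polyR_grade n (d - 2)"
proof -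
  from split_exists_grade[OF assms] obtain a b where ab: "a \<in> invariants n i" "b \<in> invariants n i" "p = a + xvar n i * b"
    and g: "a \<in> polyR_grade n d" "b \<in> polyR_grade n (d - 2)"
    by blast
  show "icoeff0 p \<in> polyR_grade n d" "icoeff1 p \<in> polyR_grade n (d - 2)"
    unfolding icoeff_unique[OF ab] by (fact g)+
qed

lemma icoeff_add:
  assumes "p \<in> polyR n" "p' \<in> polyR n"
  shows "icoeff0 (p + p') = icoeff0 p + icoeff0 p'" "icoeff1 (p + p') = icoeff1 p + icoeff1 p'"
proof -
  note ic = icoeff[OF assms(1)] and ic' = icoeff[OF assms(2)]
  have eq: "p + p' = (icoeff0 p + icoeff0 p') + xvar n i * (icoeff1 p + icoeff1 p')"
    by (rule trans[OF arg_cong2[OF ic(3) ic'(3), of "(+)"]]) (simp add: algebra_simps)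
  have "icoeff0 p + icoeff0 p' \<in> invariants n i" "icoeff1 p + icoeff1 p' \<in> invariants n i"
    by (intro invariants_simps(4) ic ic')+
  then show "icoeff0 (p + p') = icoeff0 p + icoeff0 p'" "icoeff1 (p + p') = icoeff1 p + icoeff1 p'"
    using eq by (rule icoeff_unique)+
qed

lemma icoeff_mult_inv:
  assumes "g \<in> invariants n i" "p \<in> polyR n"
  shows "icoeff0 (g * p) = g * icoeff0 p" "icoeff1 (g * p) = g * icoeff1 p"
    "icoeff0 (p * g) = icoeff0 p * g" "icoeff1 (p * g) = icoeff1 p * g"
proof -
  note ic = icoeff[OF assms(2)]
  have eq: "g * p = (g * icoeff0 p) + xvar n i * (g * icoeff1 p)"
    by (rule trans[OF arg_cong[OF ic(3), of "(*) g"]]) (simp add: algebra_simps)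
  have "g * icoeff0 p \<in> invariants n i" "g * icoeff1 p \<in> invariants n i"
    by (intro invariants_simps(6) ic assms)+
  then show *: "icoeff0 (g * p) = g * icoeff0 p" "icoeff1 (g * p) = g * icoeff1 p"
    using eq by (rule icoeff_unique)+
  show "icoeff0 (p * g) = icoeff0 p * g" "icoeff1 (p * g) = icoeff1 p * g"
    using * by (simp_all only: mult.commute)
qed

lemma icoeff_mult_x:
  assumes "p \<in> polyR n"
  shows "icoeff0 (xvar n i * p) = - (xvar n i * xvar n (Suc i) * icoeff1 p)"
    "icoeff1 (xvar n i * p) = icoeff0 p + (xvar n i + xvar n (Suc i)) * icoeff1 p"
    "icoeff0 (xvar n (Suc i) * p) = (xvar n i + xvar n (Suc i)) * icoeff0 p + xvar n i * xvar n (Suc i) * icoeff1 p"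
    "icoeff1 (xvar n (Suc i) * p) = - icoeff0 p"
proof -
  note ic = icoeff[OF assms]
  have eq: "xvar n i * p = - (e2 * icoeff1 p) + xvar n i * (icoeff0 p + e1 * icoeff1 p)"
    by (rule trans[OF arg_cong[OF ic(3), of "(*) (xvar n i)"]]) (simp add: algebra_simps)
  have "- (e2 * icoeff1 p) \<in> invariants n i" "icoeff0 p + e1 * icoeff1 p \<in> invariants n i"
    by (intro invariants_simps(4,6,7) ic sym_invariants)+
  then show "icoeff0 (xvar n i * p) = - (e2 * icoeff1 p)" "icoeff1 (xvar n i * p) = icoeff0 p + e1 * icoeff1 p"
    using eq by (rule icoeff_unique)+
  have eq: "xvar n (Suc i) * p = (e1 * icoeff0 p + e2 * icoeff1 p) + xvar n i * (- icoeff0 p)"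
    by (rule trans[OF arg_cong[OF ic(3), of "(*) (xvar n (Suc i))"]]) (simp add: algebra_simps)
  have "e1 * icoeff0 p + e2 * icoeff1 p \<in> invariants n i" "- icoeff0 p \<in> invariants n i"
    by (intro invariants_simps(4,6,7) ic sym_invariants)+
  then show "icoeff0 (xvar n (Suc i) * p) = e1 * icoeff0 p + e2 * icoeff1 p" "icoeff1 (xvar n (Suc i) * p) = - icoeff0 p"
    using eq by (rule icoeff_unique)+
qed

lemma icoeff_inv:
  assumes "g \<in> invariants n i"
  shows "icoeff0 g = g" "icoeff1 g = 0" "icoeff0 (xvar n i * g) = 0" "icoeff1 (xvar n i * g) = g"
proof -
  show 1: "icoeff0 g = g" "icoeff1 g = 0"
    by (rule icoeff_unique[of g 0]; simp add: assms invariants_simps)+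
  show "icoeff0 (xvar n i * g) = 0" "icoeff1 (xvar n i * g) = g"
    by (rule icoeff_unique[of 0 g]; simp add: assms invariants_simps)+
qed

end

section \<open>Complexes of words\<close>

definition emb :: "mpoly \<Rightarrow> nat list \<Rightarrow> mpoly" where
  "emb r = (\<lambda>l. if l = [] then r else 0)"

lemma emb_simps [simp]: "emb r [] = r" "emb 0 = 0" "emb r + emb r' = emb (r + r')" "- emb r = emb (- r)"
  "emb r - emb r' = emb (r - r')" "emb r = emb r' \<longleftrightarrow> r = r'" "emb r = 0 \<longleftrightarrow> r = 0"
  by (auto simp: emb_def fun_eq_iff fun_diff_def split: if_splits)

definition base :: "nat \<Rightarrow> mpoly bcx" where
  "base n = \<lparr>lop = (\<lambda>j v l. xvar n j * v l), rop = (\<lambda>j v l. xvar n j * v l), del = (\<lambda>_. 0), eps = (\<lambda>v. v),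
     piece = (\<lambda>t d. if t = 0 then emb ` polyR_grade n d else {0})\<rparr>"

lemma base_emb: "lop (base n) j (emb r) = emb (xvar n j * r)" "rop (base n) j (emb r) = emb (xvar n j * r)"
  "del (base n) v = 0" "eps (base n) v = v"
  by (auto simp: base_def emb_def fun_eq_iff)

lemma piece_base: "v \<in> piece (base n) t d \<Longrightarrow> \<exists>r \<in> polyR_grade n d. v = emb r \<and> (t \<noteq> 0 \<longrightarrow> r = 0)"
  by (cases "t = 0") (auto simp: base_def grade_simps intro: bexI[of _ 0])

lemma emb_base: "emb r \<in> piece (base n) t d \<longleftrightarrow> r \<in> polyR_grade n d \<and> (t \<noteq> 0 \<longrightarrow> r = 0)"
  by (auto simp: base_def grade_simps)

lemma zero_base: "0 \<in> piece (base n) t d"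
  using emb_base[of 0 n t d] by (simp add: grade_simps)

lemma bcx_base: "bcx (base n)"
proof
  fix u v t d j
  assume u: "u \<in> piece (base n) t d"
  then obtain r where [simp]: "u = emb r" and r: "r \<in> polyR_grade n d" "t \<noteq> 0 \<longrightarrow> r = 0"
    using piece_base by blast
  show "- u \<in> piece (base n) t d" "del (base n) u \<in> piece (base n) (t + 1) d" "eps (base n) u \<in> piece (base n) t d"
    "eps (base n) (eps (base n) u) = u"
    using r by (auto simp: base_emb emb_base grade_uminus) (auto simp: base_def grade_simps image_def)
  show "lop (base n) j u \<in> piece (base n) t (d + 2)" "rop (base n) j u \<in> piece (base n) t (d + 2)"
    using r grade_mult[OF xvar_grade r(1), of j] by (auto simp: base_emb emb_base add.commute)
  assume "v \<in> piece (base n) t d"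
  then show "u + v \<in> piece (base n) t d"
    using r by (auto dest!: piece_base simp: emb_base grade_add zero_base)
next
  fix t d
  show "0 \<in> piece (base n) t d"
    by (rule zero_base)
qed (auto simp: base_def fun_eq_iff distrib_left mult_ac)

primrec wcx :: "nat \<Rightarrow> nat list \<Rightarrow> mpoly bcx" where
  "wcx n [] = base n"
| "wcx n (i # w) = lten i (Suc i) (wcx n w)"

lemma bcx_wcx: "bcx (wcx n w)"
  by (induction w) (auto simp: bcx_base intro: bcx.bcx_lten)

text \<open>Each factor raises the cohomological degree by at most 1. In degree t = length w only
  the product of the factors R(1) remains, and this starts in quantum degree - t.\<close>

lemma piece_wcx_top:
  assumes "t > int (length w) \<or> t = int (length w) \<and> d < - t" "v \<in> piece (wcx n w) t d"
  shows "v = 0"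
  using assms
proof (induction w arbitrary: t d v)
  case Nil
  then show ?case
    by (auto dest!: piece_base simp: grade_neg)
next
  case (Cons i w)
  from Cons.prems(2) obtain a b c where v: "v = trip a b c" and p: "a \<in> piece (wcx n w) t (d + 1)"
    "b \<in> piece (wcx n w) t (d - 1)" "c \<in> piece (wcx n w) (t - 1) (d + 1)"
    by (auto elim: piece_ltenE)
  have "a = 0" "b = 0" "c = 0"
    by (rule Cons.IH[OF _ p(1)] Cons.IH[OF _ p(2)] Cons.IH[OF _ p(3)], use Cons.prems(1) in force)+
  then show ?case
    by (simp add: v)
qed

subsection \<open>Rotation\<close>

lemma bcx_iso_inverse:
  assumes "bcx C" "bcx_hom f C C'"
    and "\<And>t d u. u \<in> piece C' t d \<Longrightarrow> g u \<in> piece C t d" "\<And>t d u. u \<in> piece C t d \<Longrightarrow> g (f u) = u"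
    "\<And>t d u. u \<in> piece C' t d \<Longrightarrow> f (g u) = u"
  shows "bcx_iso C C'"
proof -
  interpret bcx C by fact
  have "bcx_hom g C' C"
    unfolding bcx_hom_def
  proof (intro allI ballI conjI)
    fix t d u j
    assume "u \<in> piece C' t d"
    then have u: "g u \<in> piece C t d" "f (g u) = u"
      by (simp_all add: assms)
    note h = bcx_homD[OF assms(2) u(1), unfolded u(2)]
    show "g u \<in> piece C t d" "del C (g u) = g (del C' u)" "eps C (g u) = g (eps C' u)"
      "lop C j (g u) = g (lop C' j u)" "rop C j (g u) = g (rop C' j u)"
      using u(1) by (auto simp: h intro!: assms(4)[symmetric] piece_intros)
    fix v
    assume "v \<in> piece C' t d"
    then have v: "g v \<in> piece C t d" "f (g v) = v"
      by (simp_all add: assms)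
    have "f (g u + g v) = u + v"
      by (simp add: bcx_homD(6)[OF assms(2) u(1) v(1)] u v)
    then show "g (u + v) = g u + g v"
      using assms(4)[OF piece_add[OF u(1) v(1)]] by simp
  qed
  with assms show ?thesis
    by (blast intro: bcx_isoI)
qed

text \<open>Exchanging the two factors of \<open>R \<otimes> R\<close> over \<open>R\<^sup>s\<close>: an element with right coordinates
  \<open>r\<^sub>0, r\<^sub>1\<close> has left coordinates obtained by transposing the matrix of their invariant coefficients.\<close>

lemma base_rot:
  assumes i: "i \<in> {1..<n}"
  shows "bcx_iso (lten i (Suc i) (base n)) (rten i (Suc i) (base n))"
proof -
  define A where "A = icoeff0 n i"
  define B where "B = icoeff1 n i"
  define x where "x = xvar n i"
  define x' where "x' = xvar n (Suc i)"
  define f where "f v = trip (emb (A (part 0 v []) + x * A (part (Suc 0) v [])))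
    (emb (B (part 0 v []) + x * B (part (Suc 0) v []))) (part 2 v)" for v
  have f: "f (trip (emb a) (emb b) c) = trip (emb (A a + x * A b)) (emb (B a + x * B b)) c" for a b c
    by (simp add: f_def)
  have x: "x \<in> polyR n" "x' \<in> polyR n" "\<And>j. xvar n j \<in> polyR n"
    by (simp_all add: x_def x'_def xvar_polyR)
  have add: "A (p + p') = A p + A p'" "B (p + p') = B p + B p'" if "p \<in> polyR n" "p' \<in> polyR n" for p p'
    using icoeff_add[OF i that] by (simp_all add: A_def B_def)
  have inv: "A (g * p) = g * A p" "B (g * p) = g * B p" if "g \<in> invariants n i" "p \<in> polyR n" for g p
    using icoeff_mult_inv[OF i that] by (simp_all add: A_def B_def)
  have xm: "A (x * p) = - (x * x' * B p)" "B (x * p) = A p + (x + x') * B p"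
    "A (x' * p) = (x + x') * A p + x * x' * B p" "B (x' * p) = - A p" if "p \<in> polyR n" for p
    using icoeff_mult_x[OF i that] by (simp_all add: A_def B_def x_def x'_def)
  have spl: "p = A p + x * B p" if "p \<in> polyR n" for p
    using icoeff(3)[OF i that] by (simp add: A_def B_def x_def)
  have AB: "A p \<in> invariants n i" "B p \<in> invariants n i" "A p \<in> polyR n" "B p \<in> polyR n" if "p \<in> polyR n" for p
    using icoeff[OF i that] by (simp_all add: A_def B_def)
  have ff: "A (A p + x * A p') = A p" "B (A p + x * A p') = A p'"
     "A (B p + x * B p') = B p" "B (B p + x * B p') = B p'" if "p \<in> polyR n" "p' \<in> polyR n" for p p'
    using icoeff_unique[OF i _ _ refl, of "A p" "A p'"] icoeff_unique[OF i _ _ refl, of "B p" "B p'"] AB that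
    by (simp_all add: A_def B_def x_def)
  have gr: "A p \<in> polyR_grade n d" "B p \<in> polyR_grade n (d - 2)" if "p \<in> polyR_grade n d" for p d
    using icoeff_grade[OF i that] by (simp_all add: A_def B_def)
  have sym: "x + x' \<in> invariants n i" "x * x' \<in> invariants n i"
    "\<And>j. j \<noteq> i \<Longrightarrow> j \<noteq> Suc i \<Longrightarrow> xvar n j \<in> invariants n i"
    using sym_invariants[OF i] by (simp_all add: x_def x'_def)
  have elim: "\<exists>a b c. v = trip (emb a) (emb b) (emb c) \<and> a \<in> polyR_grade n (d + 1) \<and> b \<in> polyR_grade n (d - 1)
     \<and> c \<in> polyR_grade n (d + 1) \<and> (t \<noteq> 0 \<longrightarrow> a = 0 \<and> b = 0) \<and> (t \<noteq> 1 \<longrightarrow> c = 0)"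
    if "v \<in> piece (lten i (Suc i) (base n)) t d \<or> v \<in> piece (rten i (Suc i) (base n)) t d" for v t d
    using that by (auto elim!: piece_ltenE piece_rtenE dest!: piece_base)
  have zero: "A 0 = 0" "B 0 = 0"
    using icoeff_inv(1,2)[OF i invariants_simps(2)] by (simp_all add: A_def B_def)
  have mem: "A a + x * A b \<in> polyR_grade n (d + 1)" "B a + x * B b \<in> polyR_grade n (d - 1)"
    if "a \<in> polyR_grade n (d + 1)" "b \<in> polyR_grade n (d - 1)" for a b d
    using gr[OF that(1)] gr[OF that(2)] grade_mult[OF xvar_grade gr(1)[OF that(2)], of i]
      grade_mult[OF xvar_grade gr(2)[OF that(2)], of i]
    by (auto simp: x_def add.commute intro!: grade_add)
  have l: "bcx_hom f (lten i (Suc i) (base n)) (rten i (Suc i) (base n))"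
    unfolding bcx_hom_def
  proof (intro allI ballI conjI)
    fix t d u j
    assume "u \<in> piece (lten i (Suc i) (base n)) t d"
    then obtain a b c where u: "u = trip (emb a) (emb b) (emb c)" and g: "a \<in> polyR_grade n (d + 1)" "b \<in> polyR_grade n (d - 1)"
      "c \<in> polyR_grade n (d + 1)" and z: "t \<noteq> 0 \<longrightarrow> a = 0 \<and> b = 0" "t \<noteq> 1 \<longrightarrow> c = 0"
      using elim by blast
    note p = grade_polyR[OF g(1)] grade_polyR[OF g(2)]
    have xp: "xvar n j * a \<in> polyR n" "xvar n j * b \<in> polyR n" for j
      using p x by (auto intro: polyR_mult)
    have n12: "A (- (x * (x' * b))) = - (x * x' * A b)" "B (- (x * (x' * b))) = - (x * x' * B b)"
      "A (a + x * b + x' * b) = A a + (x + x') * A b" "B (a + x * b + x' * b) = B a + (x + x') * B b"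
    proof -
      have "- (x * x') \<in> invariants n i"
        by (rule invariants_simps sym)+
      from inv[OF this p(2)] show "A (- (x * (x' * b))) = - (x * x' * A b)" "B (- (x * (x' * b))) = - (x * x' * B b)"
        by (simp_all add: mult.assoc)
      have e: "a + x * b + x' * b = a + (x + x') * b"
        by (simp add: algebra_simps)
      show "A (a + x * b + x' * b) = A a + (x + x') * A b" "B (a + x * b + x' * b) = B a + (x + x') * B b"
        unfolding e using inv[OF sym(1) p(2)] add[OF p(1) polyR_mult[OF polyR_add[OF x(1,2)] p(2)]] by simp_all
    qed
    have n34: "A (- a) = - A a" "B (- a) = - B a"
      "A (x * a + x' * a + x * (x' * b)) = (x + x') * A a + x * x' * A b"
      "B (x * a + x' * a + x * (x' * b)) = (x + x') * B a + x * x' * B b"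
    proof -
      have "- 1 \<in> invariants n i"
        by (rule invariants_simps)+
      from inv[OF this p(1)] show "A (- a) = - A a" "B (- a) = - B a"
        by simp_all
      have e: "x * a + x' * a + x * (x' * b) = (x + x') * a + (x * x') * b"
        by (simp add: algebra_simps)
      have m: "(x + x') * a \<in> polyR n" "(x * x') * b \<in> polyR n"
        using x p by (auto intro!: polyR_mult polyR_add)
      show "A (x * a + x' * a + x * (x' * b)) = (x + x') * A a + x * x' * A b"
        "B (x * a + x' * a + x * (x' * b)) = (x + x') * B a + x * x' * B b"
        unfolding e using inv[OF sym(1) p(1)] inv[OF sym(2) p(2)] add[OF m] by simp_all
    qed
    show "f u \<in> piece (rten i (Suc i) (base n)) t d"
      using mem[OF g(1,2)] g(3) z by (auto simp: u f piece_rten_iff emb_base zero)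
    show "eps (rten i (Suc i) (base n)) (f u) = f (eps (lten i (Suc i) (base n)) u)"
      by (simp add: u f rten_trip lten_trip base_emb)
    \<comment> \<open>Multiplying out the tensor gives the same polynomial from either set of
      coordinates, so the map to R(1) is respected.\<close>
    have "A a + x * A b + x * (B a + x * B b) = (A a + x * B a) + x * (A b + x * B b)"
      by (simp add: algebra_simps)
    also have "\<dots> = a + x * b"
      using spl[OF p(1)] spl[OF p(2)] by simp
    finally show "del (rten i (Suc i) (base n)) (f u) = f (del (lten i (Suc i) (base n)) u)"
      using emb_simps(2) by (simp add: u f rten_trip lten_trip base_emb zero x_def f_def flip: x_def)
    show "rop (rten i (Suc i) (base n)) j (f u) = f (rop (lten i (Suc i) (base n)) j u)"
    proof -
      consider "j = i" | "j = Suc i" | "j \<noteq> i" "j \<noteq> Suc i"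
        by blast
      then show ?thesis
      proof cases
        case 1
        then show ?thesis
          using xm(1,2)[OF p(1)] xm(1,2)[OF p(2)]
          by (simp add: u f rten_trip lten_trip base_emb flip: x_def x'_def) (simp add: algebra_simps)
      next
        case 2
        then show ?thesis
          using xm(3,4)[OF p(1)] xm(3,4)[OF p(2)]
          by (simp add: u f rten_trip lten_trip base_emb flip: x_def x'_def) (simp add: algebra_simps)
      next
        case 3
        then show ?thesis
          using inv[OF sym(3) p(1)] inv[OF sym(3) p(2)]
          by (simp add: u f rten_trip lten_trip base_emb) (simp add: algebra_simps)
      qed
    qed
    show "lop (rten i (Suc i) (base n)) j (f u) = f (lop (lten i (Suc i) (base n)) j u)"
    proof -
      consider "j = i" | "j = Suc i" | "j \<noteq> i" "j \<noteq> Suc i"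
        by blast
      then show ?thesis
      proof cases
        case 1
        then show ?thesis
          by (simp add: u f rten_trip lten_trip base_emb n12 flip: x_def x'_def) (simp add: algebra_simps)
      next
        case 2
        then show ?thesis
          by (simp add: u f rten_trip lten_trip base_emb n34 flip: x_def x'_def) (simp add: algebra_simps)
      next
        case 3
        then show ?thesis
          using inv[OF sym(3) p(1)] inv[OF sym(3) p(2)]
          by (simp add: u f rten_trip lten_trip base_emb) (simp add: algebra_simps)
      qed
    qed
    fix v
    assume "v \<in> piece (lten i (Suc i) (base n)) t d"
    then obtain a' b' c' where v: "v = trip (emb a') (emb b') (emb c')" and g': "a' \<in> polyR_grade n (d + 1)" "b' \<in> polyR_grade n (d - 1)"
      using elim by blast
    show "f (u + v) = f u + f v"
      using add[OF p(1) grade_polyR[OF g'(1)]] add[OF p(2) grade_polyR[OF g'(2)]]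
      by (simp add: u v f algebra_simps)
  qed
  have bwd: "f u \<in> piece (lten i (Suc i) (base n)) t d" if "u \<in> piece (rten i (Suc i) (base n)) t d" for u t d
  proof -
    from that obtain a b c where u: "u = trip (emb a) (emb b) (emb c)" and g: "a \<in> polyR_grade n (d + 1)" "b \<in> polyR_grade n (d - 1)"
      "c \<in> polyR_grade n (d + 1)" and z: "t \<noteq> 0 \<longrightarrow> a = 0 \<and> b = 0" "t \<noteq> 1 \<longrightarrow> c = 0"
      using elim by blast
    show ?thesis
      using mem[OF g(1,2)] g(3) z by (auto simp: u f piece_lten_iff emb_base zero)
  qed
  \<comment> \<open>The map transposes a two by two matrix of invariants and is its own
    inverse.\<close>
  have inv: "f (f u) = u" if "u \<in> piece (lten i (Suc i) (base n)) t d \<or> u \<in> piece (rten i (Suc i) (base n)) t d" for u t d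
  proof -
    from elim[OF that] obtain a b c where u: "u = trip (emb a) (emb b) (emb c)" and g: "a \<in> polyR_grade n (d + 1)" "b \<in> polyR_grade n (d - 1)"
      by blast
    note p = grade_polyR[OF g(1)] grade_polyR[OF g(2)]
    show ?thesis
      using ff[OF p] spl[OF p(1)] spl[OF p(2)] by (simp add: u f)
  qed
  show ?thesis
    by (rule bcx_iso_inverse[OF bcx.bcx_lten[OF bcx_base] l bwd inv[OF disjI1] inv[OF disjI2]]) simp
qed

section \<open>Conjugation and braid relations\<close>

text \<open>The innermost factor F_i \<otimes> R is R \<otimes> F_i; associativity then carries it
  outwards to the right end.\<close>

lemma wcx_rot:
  assumes "i \<in> {1..<n}"
  shows "bcx_iso (wcx n (w @ [i])) (rten i (Suc i) (wcx n w))"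
proof (induction w)
  case Nil
  then show ?case
    using base_rot[OF assms] by simp
next
  case (Cons j w)
  have "bcx_iso (lten j (Suc j) (wcx n (w @ [i]))) (lten j (Suc j) (rten i (Suc i) (wcx n w)))"
    by (rule lten_cong[OF bcx_wcx bcx.bcx_rten[OF bcx_wcx] Cons]) simp
  from bcx_iso_trans[OF this lten_rten_iso[OF bcx_wcx]] show ?case
    by simp
qed

text \<open>Besides exactness in every bidegree, the length is kept because it bounds the range of
  vanishing, and the letters because all words must stay within the generators of n strands.\<close>

definition conj_eq :: "nat \<Rightarrow> nat list \<Rightarrow> nat list \<Rightarrow> bool" where
  "conj_eq n u v \<longleftrightarrow> length u = length v \<and> set u = set v \<and> (\<forall>t d. acyc (wcx n u) t d \<longleftrightarrow> acyc (wcx n v) t d)"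

lemma conj_eq_refl [simp]: "conj_eq n u u"
  and conj_eq_sym: "conj_eq n u v \<Longrightarrow> conj_eq n v u"
  and conj_eq_trans [trans]: "conj_eq n u v \<Longrightarrow> conj_eq n v w \<Longrightarrow> conj_eq n u w"
  by (auto simp: conj_eq_def)

lemma conj_eq_rotate1:
  assumes "i \<in> {1..<n}"
  shows "conj_eq n (i # w) (w @ [i])"
proof -
  interpret bcx "wcx n w"
    by (rule bcx_wcx)
  have "acyc (wcx n (w @ [i])) t d \<longleftrightarrow> acyc (rten i (Suc i) (wcx n w)) t d" for t d
    using acyc_iso[OF bcx_wcx wcx_rot[OF assms]]
      acyc_iso[OF bcx_rten bcx_iso_sym[OF wcx_rot[OF assms]]] by auto
  then show ?thesis
    by (auto simp: conj_eq_def acyc_rten_iff)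
qed

lemma conj_eq_rotate:
  assumes "u @ v \<in> lists {1..<n}"
  shows "conj_eq n (u @ v) (v @ u)"
  using assms
proof (induction u arbitrary: v)
  case (Cons i u)
  have "conj_eq n (i # u @ v) ((u @ v) @ [i])"
    using Cons.prems by (intro conj_eq_rotate1) auto
  also have "conj_eq n \<dots> (v @ i # u)"
    using Cons.IH[of "v @ [i]"] Cons.prems by simp
  finally show ?case
    by simp
qed simp

text \<open>The comparison for the braid relation concerns central elements of the whole product and
  is no isomorphism of complexes, so it does not pass through further factors on the left. Rotating
  the prefix to the end puts the move at the head of the word.\<close>

lemma conj_eq_move:
  assumes "braid_move u v" "u \<in> lists {1..<n}"
  shows "conj_eq n u v"
  using assms
proof (induction rule: braid_move.cases)
  case (far i j a b)
  have iso: "bcx_iso (wcx n ([i, j] @ b @ a)) (wcx n ([j, i] @ b @ a))"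
    using far(3) by (auto intro!: lten_comm_iso bcx_wcx)
  have "acyc (wcx n ([i, j] @ b @ a)) t d \<longleftrightarrow> acyc (wcx n ([j, i] @ b @ a)) t d" for t d
    using acyc_iso[OF bcx_wcx iso] acyc_iso[OF bcx_wcx bcx_iso_sym[OF iso]] by blast
  then have "conj_eq n ([i, j] @ b @ a) ([j, i] @ b @ a)"
    unfolding conj_eq_def by auto
  moreover have "conj_eq n (a @ [i, j] @ b) ([i, j] @ b @ a)" "conj_eq n (a @ [j, i] @ b) ([j, i] @ b @ a)"
    using conj_eq_rotate[of a "[i, j] @ b" n] conj_eq_rotate[of a "[j, i] @ b" n] far by auto
  ultimately show ?case
    unfolding far(1,2) by (blast intro: conj_eq_sym conj_eq_trans)
next
  case (braid a i b)
  let ?x = "[i, Suc i, i]" and ?y = "[Suc i, i, Suc i]"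
  have "conj_eq n (?x @ b @ a) (?y @ b @ a)"
    unfolding conj_eq_def by (auto simp: bcx.acyc_braid[OF bcx_wcx, of i "Suc i" "Suc (Suc i)"])
  moreover have "conj_eq n (a @ ?x @ b) (?x @ b @ a)" "conj_eq n (a @ ?y @ b) (?y @ b @ a)"
    using conj_eq_rotate[of a "?x @ b" n] conj_eq_rotate[of a "?y @ b" n] braid by auto
  ultimately show ?case
    unfolding braid(1,2) by (blast intro: conj_eq_sym conj_eq_trans)
qed

section \<open>Rewriting words by braid moves\<close>

lemma braid_move_invariants:
  assumes "braid_move u v"
  shows "length u = length v" "set u = set v"
  using assms by (auto elim: braid_move.cases)

lemma braid_equiv_invariants:
  assumes "equivclp braid_move u v"
  shows "length u = length v \<and> set u = set v"
  using assms by (induction rule: equivclp_induct) (auto dest: braid_move_invariants)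

lemma conj_eq_equiv:
  assumes "equivclp braid_move u v" "u \<in> lists {1..<n}"
  shows "conj_eq n u v"
  using assms
proof (induction rule: equivclp_induct)
  case (step y z)
  then have "y \<in> lists {1..<n}" "z \<in> lists {1..<n}"
    using braid_equiv_invariants[OF step.hyps(1)] braid_move_invariants[of y z] braid_move_invariants[of z y]
    by (auto simp: in_lists_conv_set)
  then have "conj_eq n y z"
    using step.hyps(2) conj_eq_move conj_eq_sym by blast
  with step show ?case
    by (blast intro: conj_eq_trans)
qed simp

lemma braid_equiv_cong:
  assumes "equivclp braid_move u v"
  shows "equivclp braid_move (a @ u @ b) (a @ v @ b)"
  using assms
proof (induction rule: equivclp_induct)
  case (step y z)
  have "braid_move (a @ y @ b) (a @ z @ b)" if "braid_move y z" for y z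
    using that
  proof cases
    case (far i j c d)
    then show ?thesis
      using braid_move.far[of i j "a @ c" "d @ b"] by simp
  next
    case (braid c i d)
    then show ?thesis
      using braid_move.braid[of "a @ c" i "d @ b"] by simp
  qed
  with step show ?case
    by (blast intro: equivclp_into_equivclp)
qed simp

lemma braid_equiv_commute:
  assumes "\<forall>x\<in>set u. x + 2 \<le> k"
  shows "equivclp braid_move (u @ [k]) (k # u)"
  using assms
proof (induction u)
  case (Cons x u)
  have "equivclp braid_move ([x] @ (u @ [k]) @ []) ([x] @ (k # u) @ [])"
    using Cons by (intro braid_equiv_cong) auto
  also have "[x] @ (k # u) @ [] = [] @ [x, k] @ u"
    by simp
  also have "equivclp braid_move \<dots> ([] @ [k, x] @ u)"
    using Cons.prems by (intro r_into_equivclp braid_move.far) auto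
  finally show ?case
    by simp
qed simp

lemma braid_equiv_commute_lists:
  assumes "\<forall>x\<in>set u. \<forall>y\<in>set v. x + 2 \<le> y"
  shows "equivclp braid_move (u @ v) (v @ u)"
  using assms
proof (induction v)
  case (Cons y v)
  have "equivclp braid_move ([] @ (u @ [y]) @ v) ([] @ (y # u) @ v)"
    using Cons.prems by (intro braid_equiv_cong braid_equiv_commute) auto
  also have "[] @ (y # u) @ v = [y] @ (u @ v) @ []"
    by simp
  also have "equivclp braid_move \<dots> ([y] @ (v @ u) @ [])"
    using Cons by (intro braid_equiv_cong) auto
  finally show ?case
    by simp
qed simp

text \<open>Between two consecutive occurrences of the top letter the next lower letter may be assumed to occur
  at most once, by induction. Hence the two occurrences can be made adjacent, or a braid move removes one of them.\<close>

lemma braid_reduce: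
  assumes "set w \<subseteq> {..<k}"
  shows "\<exists>w'. equivclp braid_move w w' \<and> ((\<exists>a i b. w' = a @ [i, i] @ b) \<or>
    (\<forall>j. k = Suc j \<longrightarrow> j \<notin> set w' \<or> (\<exists>a b. w' = a @ [j] @ b \<and> j \<notin> set a \<and> j \<notin> set b)))"
  using assms
proof (induction k arbitrary: w)
  case 0
  then show ?case
    by (auto intro: exI[of _ "[]"])
next
  case (Suc k)
  let ?P = "\<lambda>w w'. equivclp braid_move w w' \<and> ((\<exists>a i b. w' = a @ [i, i] @ b) \<or>
    k \<notin> set w' \<or> (\<exists>a b. w' = a @ [k] @ b \<and> k \<notin> set a \<and> k \<notin> set b))"
  have "\<exists>w'. ?P w w'"
    using Suc.prems
  \<comment> \<open>Here k is the largest letter that may occur. Each braid move made below removes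
    one of its occurrences.\<close>
  proof (induction "count_list w k" arbitrary: w rule: less_induct)
    case less
    consider "k \<notin> set w" | a b where "w = a @ [k] @ b" "k \<notin> set a" "k \<notin> set b"
      | a m b where "w = a @ [k] @ m @ [k] @ b" "k \<notin> set a" "k \<notin> set m"
    proof (cases "k \<in> set w")
      case True
      then obtain a c where w: "w = a @ k # c" "k \<notin> set a"
        by (meson split_list_first)
      show ?thesis
      proof (cases "k \<in> set c")
        case True
        then obtain m b where "c = m @ k # b" "k \<notin> set m"
          by (meson split_list_first)
        with w show ?thesis
          by (intro that(3)[of a m b]) auto
      next
        case False
        with w show ?thesis
          by (intro that(2)[of a c]) auto
      qed
    qed (use that(1) in blast)
    then show ?case
    proof cases
      case 1
      then have "?P w w"
        by simp
      then show ?thesis ..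
    next
      case 2
      then have "?P w w"
        by (intro conjI disjI2 exI[of _ a] exI[of _ b]) simp_all
      then show ?thesis ..
    next
      case (3 a m b)
      have "set m \<subseteq> {..<k}"
        using 3 less.prems by (auto simp: less_Suc_eq)
      from Suc.IH[OF this] obtain m' where m': "equivclp braid_move m m'"
        "(\<exists>a i b. m' = a @ [i, i] @ b) \<or>
          (\<forall>j. k = Suc j \<longrightarrow> j \<notin> set m' \<or> (\<exists>a b. m' = a @ [j] @ b \<and> j \<notin> set a \<and> j \<notin> set b))"
        by (elim exE conjE) (rule that)
      have w: "equivclp braid_move w (a @ [k] @ m' @ [k] @ b)"
        using braid_equiv_cong[OF m'(1), of "a @ [k]" "[k] @ b"] 3(1) by simp
      have sm': "set m' \<subseteq> {..<k}"
        using \<open>set m \<subseteq> {..<k}\<close> braid_equiv_invariants[OF m'(1)] by simp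
      consider c i d where "m' = c @ [i, i] @ d" | "\<forall>x\<in>set m'. x + 2 \<le> k"
        | j c d where "k = Suc j" "m' = c @ [j] @ d" "j \<notin> set c" "j \<notin> set d"
      proof (cases k)
        case 0
        then show ?thesis
          using sm' that(2) by auto
      next
        case (Suc j)
        have "\<forall>x\<in>set m'. x + 2 \<le> k" if "j \<notin> set m'"
        proof
          fix x
          assume "x \<in> set m'"
          then have "x < k" "x \<noteq> j"
            using sm' that by auto
          with Suc show "x + 2 \<le> k"
            by simp
        qed
        then show ?thesis
          using m'(2) that Suc by blast
      qed
      then show ?thesis
      proof cases
        case (1 c i d)
        then show ?thesis
          using w by (intro exI[of _ "a @ [k] @ m' @ [k] @ b"] conjI disjI1 exI[of _ "a @ [k] @ c"] exI[of _ i] exI[of _ "d @ [k] @ b"]) auto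
      next
        case 2
        have "equivclp braid_move ((a @ [k]) @ (m' @ [k]) @ b) ((a @ [k]) @ (k # m') @ b)"
          by (rule braid_equiv_cong[OF braid_equiv_commute[OF 2]])
        then have "equivclp braid_move w (a @ [k, k] @ m' @ b)"
          using equivclp_trans[OF w] by simp
        then show ?thesis
          by (intro exI[of _ "a @ [k, k] @ m' @ b"]) blast
      next
        case (3 j c d)
        have "x + 2 \<le> k" if "x \<in> set c \<union> set d" for x
        proof -
          have "x < k" "x \<noteq> j"
            using sm' 3 that by auto
          with 3(1) show ?thesis
            by simp
        qed
        then have cd: "\<forall>x\<in>set c. x + 2 \<le> k" "\<forall>x\<in>set d. x + 2 \<le> k"
          by auto
        \<comment> \<open>The letters of c and d commute with k, so k c j d k becomes c k j k d, and
          the braid move leaves a single k.\<close>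
        have "equivclp braid_move (a @ (k # c) @ ([j] @ d @ [k] @ b)) (a @ (c @ [k]) @ ([j] @ d @ [k] @ b))"
          by (rule braid_equiv_cong[OF equivclp_sym[OF braid_equiv_commute[OF cd(1)]]])
        also have "a @ (c @ [k]) @ ([j] @ d @ [k] @ b) = (a @ c @ [k, j]) @ (d @ [k]) @ b"
          by simp
        also have "equivclp braid_move \<dots> ((a @ c @ [k, j]) @ (k # d) @ b)"
          by (rule braid_equiv_cong[OF braid_equiv_commute[OF cd(2)]])
        also have "(a @ c @ [k, j]) @ (k # d) @ b = (a @ c) @ [k, j, k] @ (d @ b)"
          by simp
        also have "equivclp braid_move \<dots> ((a @ c) @ [j, k, j] @ (d @ b))"
          using braid_move.braid[of "a @ c" j "d @ b"] 3(1) by auto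
        finally have e: "equivclp braid_move w ((a @ c) @ [j, k, j] @ (d @ b))"
          using equivclp_trans[OF w] 3(2) by simp
        have "\<exists>w'. ?P ((a @ c) @ [j, k, j] @ (d @ b)) w'"
        proof (rule less.hyps)
          have "count_list c k = 0" "count_list d k = 0"
            using cd by (auto simp: count_list_0_iff)
          then show "count_list ((a @ c) @ [j, k, j] @ (d @ b)) k < count_list w k"
            using \<open>w = a @ [k] @ m @ [k] @ b\<close> 3(1) by simp
          show "set ((a @ c) @ [j, k, j] @ (d @ b)) \<subseteq> {..<Suc k}"
            using less.prems braid_equiv_invariants[OF e] by simp
        qed
        then show ?thesis
          using equivclp_trans[OF e] by blast
      qed
    qed
  qed
  then show ?case
    by simp
qed

section \<open>Vanishing\<close>

definition vanish :: "nat \<Rightarrow> nat list \<Rightarrow> bool" where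
  "vanish n w \<longleftrightarrow> (\<forall>t d. d < - t \<or> d = - t \<and> t < int (length w) \<longrightarrow> acyc (wcx n w) t d)"

lemma vanish_cong: "conj_eq n u v \<Longrightarrow> vanish n v \<Longrightarrow> vanish n u"
  by (simp add: vanish_def conj_eq_def)

lemma sacyc_wcx_top:
  assumes "t > int (length w) \<or> t = int (length w) \<and> d < - t"
  shows "acyc (wcx n w) t d" "sacyc p q (wcx n w) t d"
proof -
  interpret bcx "wcx n w"
    by (rule bcx_wcx)
  have z: "u = 0" if "u \<in> piece (wcx n w) t d" for u
    using piece_wcx_top[OF assms that] .
  show "acyc (wcx n w) t d"
    unfolding acyc_def exact_at_def using z central_0 op_0 by (blast dest: centralD(1))
  show "sacyc p q (wcx n w) t d"
    unfolding sacyc_def exact_at_def using z scentral_0 op_0 by (blast dest: scentralD(1))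
qed

lemma vanish_Nil: "vanish n []"
  unfolding vanish_def
proof (intro allI impI)
  fix t d :: int
  assume a: "d < - t \<or> d = - t \<and> t < int (length ([] :: nat list))"
  interpret bcx "wcx n []"
    by (rule bcx_wcx)
  have z: "u = 0" if "u \<in> piece (wcx n []) t d" for u
    using that a by (cases "t = 0") (auto dest!: piece_base simp: grade_neg)
  show "acyc (wcx n []) t d"
    unfolding acyc_def exact_at_def using z central_0 op_0 by (blast dest: centralD(1))
qed

text \<open>By the two-factor cone it suffices to control F_i \<otimes> C in (t - 1, d + 1) and the
  i-central elements of C in (t, d - 2). The latter come from F_i \<otimes> C in (t, d - 1) and C in
  (t, d).\<close>

lemma vanish_square:
  assumes "vanish n (i # w)" "vanish n w"
  shows "vanish n (i # i # w)"
  unfolding vanish_def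
proof (intro allI impI)
  fix t d
  assume td: "d < - t \<or> d = - t \<and> t < int (length (i # i # w))"
  interpret bcx "wcx n w"
    by (rule bcx_wcx)
  have 1: "acyc (lten i (Suc i) (wcx n w)) (t - 1) (d + 1)" "acyc (lten i (Suc i) (wcx n w)) t (d - 1)"
    using assms(1)[unfolded vanish_def, rule_format, of "d + 1" "t - 1"]
      assms(1)[unfolded vanish_def, rule_format, of "d - 1" t] td by auto
  have "sacyc i (Suc i) (wcx n w) t (d - 2)"
  proof (cases "d < - t \<or> d = - t \<and> t < int (length w)")
    case True
    then have "acyc (wcx n w) t d"
      using assms(2)[unfolded vanish_def] by auto
    with sacyc_from_acyc[of i "Suc i" t "d - 2"] 1(2) show ?thesis
      by simp
  next
    case False
    \<comment> \<open>Now d = - t and t is at least the length of w, so that there are no nonzero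
      elements in degree d - 2.\<close>
    with td show ?thesis
      by (intro sacyc_wcx_top) auto
  qed
  then show "acyc (wcx n (i # i # w)) t d"
    using acyc_lten_lten[OF _ 1(1)] by simp
qed

text \<open>If A contains both or neither of p and q, the sum of the x_j over A is invariant under
  (p q) and passes through F_s.\<close>

lemma sum_lop_lten:
  fixes C :: "'v::ab_group_add bcx"
  assumes "finite A" "p \<noteq> q" "p \<in> A \<longleftrightarrow> q \<in> A"
  shows "(\<Sum>j\<in>A. lop (lten p q C) j (trip a b c)) = trip (\<Sum>j\<in>A. lop C j a) (\<Sum>j\<in>A. lop C j b) (\<Sum>j\<in>A. lop C j c)"
    and "(\<Sum>j\<in>A. rop (lten p q C) j (trip a b c)) = trip (\<Sum>j\<in>A. rop C j a) (\<Sum>j\<in>A. rop C j b) (\<Sum>j\<in>A. rop C j c)"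
proof -
  have trip_sum: "(\<Sum>j\<in>A. trip (f j) (g j) (h j)) = trip (sum f A) (sum g A) (sum h A)"
    if "finite A" for f g h :: "nat \<Rightarrow> nat list \<Rightarrow> 'v" and A
    using that
  proof (induction A rule: finite_induct)
    case empty
    then show ?case
      by (simp only: sum.empty trip_zero)
  next
    case (insert x A)
    show ?case
      unfolding sum.insert[OF insert(1,2)] insert(3) trip_add ..
  qed
  show "(\<Sum>j\<in>A. rop (lten p q C) j (trip a b c)) = trip (\<Sum>j\<in>A. rop C j a) (\<Sum>j\<in>A. rop C j b) (\<Sum>j\<in>A. rop C j c)"
    using assms(1) by (simp add: lten_trip trip_sum)
  define B where "B = A - {p, q}"
  have B: "finite B" "p \<notin> B" "q \<notin> B"
    using assms(1) by (auto simp: B_def)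
  have "(\<Sum>j\<in>B. lop (lten p q C) j (trip a b c)) = (\<Sum>j\<in>B. trip (lop C j a) (lop C j b) (lop C j c))"
    using B by (intro sum.cong refl) (auto simp: lten_trip)
  then have sB: "(\<Sum>j\<in>B. lop (lten p q C) j (trip a b c)) = trip (\<Sum>j\<in>B. lop C j a) (\<Sum>j\<in>B. lop C j b) (\<Sum>j\<in>B. lop C j c)"
    by (simp add: trip_sum[OF B(1)])
  have "A = B \<or> A = insert p (insert q B)"
    using assms(3) by (auto simp: B_def)
  then show "(\<Sum>j\<in>A. lop (lten p q C) j (trip a b c)) = trip (\<Sum>j\<in>A. lop C j a) (\<Sum>j\<in>A. lop C j b) (\<Sum>j\<in>A. lop C j c)"
  proof
    assume "A = insert p (insert q B)"
    then show ?thesis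
      using B assms(2) by (simp add: sB) (simp add: lten_trip algebra_simps)
  qed (simp add: sB)
qed

text \<open>The strands up to \<open>i\<close> are permuted among themselves.\<close>

lemma sum_lop_wcx:
  assumes "i \<notin> set w" "u \<in> piece (wcx n w) t d"
  shows "(\<Sum>j\<le>i. lop (wcx n w) j u) = (\<Sum>j\<le>i. rop (wcx n w) j u)"
  using assms
proof (induction w arbitrary: u t d)
  case Nil
  then obtain r where "u = emb r"
    by (auto dest!: piece_base)
  then show ?case
    by (simp add: base_emb)
next
  case (Cons l w)
  then obtain a b c where u: "u = trip a b c" and p: "a \<in> piece (wcx n w) t (d + 1)"
    "b \<in> piece (wcx n w) t (d - 1)" "c \<in> piece (wcx n w) (t - 1) (d + 1)"
    by (auto elim: piece_ltenE)
  have "l \<in> {..i} \<longleftrightarrow> Suc l \<in> {..i}"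
    using Cons.prems(1) by auto
  with Cons.IH[OF _ p(1)] Cons.IH[OF _ p(2)] Cons.IH[OF _ p(3)] Cons.prems(1) show ?case
    by (simp add: u sum_lop_lten)
qed

text \<open>As x_1 + ... + x_i acts alike on both sides, an element commuting with the variables
  before x_i commutes with x_i, and then with x_(i+1) because it commutes with x_i +
  x_(i+1).\<close>

lemma scentral_wcx:
  assumes "i \<notin> set w"
  shows "scentral i (Suc i) (wcx n w) t d = central (wcx n w) t d"
proof
  show "scentral i (Suc i) (wcx n w) t d \<subseteq> central (wcx n w) t d"
  proof
    fix u
    assume u: "u \<in> scentral i (Suc i) (wcx n w) t d"
    then have j: "lop (wcx n w) j u = rop (wcx n w) j u" if "j \<noteq> i" "j \<noteq> Suc i" for j
      using that by (simp add: scentral_def)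
    have "{..i} = insert i {..<i}"
      by auto
    with sum_lop_wcx[OF assms bcx.scentralD(1)[OF bcx_wcx u]] have i: "lop (wcx n w) i u = rop (wcx n w) i u"
      using sum.cong[OF refl, of "{..<i}" "\<lambda>j. lop (wcx n w) j u" "\<lambda>j. rop (wcx n w) j u"] j by simp
    then have "lop (wcx n w) (Suc i) u = rop (wcx n w) (Suc i) u"
      using u by (simp add: scentral_def)
    with i j have "lop (wcx n w) j u = rop (wcx n w) j u" for j
      by metis
    with u show "u \<in> central (wcx n w) t d"
      by (simp add: scentral_def central_def)
  qed
next
  interpret bcx "wcx n w"
    by (rule bcx_wcx)
  show "central (wcx n w) t d \<subseteq> scentral i (Suc i) (wcx n w) t d"
    by (auto simp: central_def scentral_def) (metis rop_lop rop_rop)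
qed

text \<open>By \<open>scentral_wcx\<close> both parts of the cone are complexes of central elements
  of the shorter word, in (t, d - 1) and (t - 1, d + 1). The first is strictly below the line, the
  second has the same t + d and a smaller t.\<close>

lemma vanish_markov:
  assumes "i \<notin> set w" "vanish n w"
  shows "vanish n (i # w)"
  unfolding vanish_def
proof (intro allI impI)
  fix t d
  assume td: "d < - t \<or> d = - t \<and> t < int (length (i # w))"
  interpret bcx "wcx n w"
    by (rule bcx_wcx)
  have "acyc (wcx n w) t (d - 1)" "acyc (wcx n w) (t - 1) (d + 1)"
    using assms(2)[unfolded vanish_def, rule_format, of "d + 1" "t - 1"]
      assms(2)[unfolded vanish_def, rule_format, of "d - 1" t] td by auto
  moreover have "sacyc i (Suc i) (wcx n w) = acyc (wcx n w)"
    unfolding sacyc_def acyc_def by (intro arg_cong2[of _ _ _ _ exact_at] ext refl scentral_wcx assms)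
  ultimately show "acyc (wcx n (i # w)) t d"
    using acyc_lten by simp
qed

text \<open>Within the induction on length, letters are collected in descending order: D holds
  distinct letters >= k, and c the letters below k. In each round either a square appears, or the
  largest letter of c occurs at most once and joins D. At k = 0 the letters are distinct and
  \<open>vanish_markov\<close> removes them one by one.\<close>

lemma vanish_wcx:
  assumes "w \<in> lists {1..<n}"
  shows "vanish n w"
  using assms
proof (induction "length w" arbitrary: w rule: less_induct)
  case less
  have "vanish n (c @ D)" if "set c \<subseteq> {..<k}" "distinct D" "set D \<subseteq> {k..}" "c @ D \<in> lists {1..<n}"
    "length (c @ D) = length w" for k c D
    using that
  proof (induction k arbitrary: c D)
    case 0
    show ?case
    proof (cases D)
      case Nil
      with 0 show ?thesis
        by (simp add: vanish_Nil)
    next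
      case (Cons i D')
      have "vanish n D'"
        using 0 Cons by (intro less.hyps) auto
      with 0 Cons show ?thesis
        by (auto intro: vanish_markov)
    qed
  next
    case (Suc k)
    obtain c' where c': "equivclp braid_move c c'"
      and alt: "(\<exists>a i b. c' = a @ [i, i] @ b) \<or> k \<notin> set c' \<or> (\<exists>a b. c' = a @ [k] @ b \<and> k \<notin> set a \<and> k \<notin> set b)"
      using braid_reduce[OF Suc.prems(1)] by blast
    have inv: "length c = length c'" "set c = set c'"
      using braid_equiv_invariants[OF c'] by auto
    have "equivclp braid_move ([] @ c @ D) ([] @ c' @ D)"
      by (rule braid_equiv_cong[OF c'])
    then have ce: "conj_eq n (c @ D) (c' @ D)"
      using Suc.prems(4) by (intro conj_eq_equiv) auto
    have l: "c' @ D \<in> lists {1..<n}"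
      using Suc.prems(4) inv by (auto simp: in_lists_conv_set)
    from alt consider a i b where "c' = a @ [i, i] @ b" | "k \<notin> set c'"
      | a b where "c' = a @ [k] @ b" "k \<notin> set a" "k \<notin> set b"
      by blast
    then have "vanish n (c' @ D)"
    proof cases
      case (1 a i b)
      have "vanish n (i # i # b @ D @ a)"
        using 1 Suc.prems(5) inv l by (intro vanish_square less.hyps) auto
      moreover have "conj_eq n (a @ [i, i] @ b @ D) (([i, i] @ b @ D) @ a)"
        using 1 l by (intro conj_eq_rotate) auto
      ultimately show ?thesis
        using 1 by (auto intro: vanish_cong)
    next
      case 2
      show ?thesis
        using 2 Suc.prems inv l by (intro Suc.IH) (auto simp: less_Suc_eq subset_iff)
    next
      case (3 a b)
      have sub: "set a \<subseteq> {..<k}" "set b \<subseteq> {..<k}"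
        using 3 Suc.prems(1) inv by (auto simp: less_Suc_eq subset_iff)
      \<comment> \<open>The word a k b D rotates to b D a k. Letters of D exceed k and those of a
        are below it, so D and a commute, and k is appended to D.\<close>
      have "conj_eq n (c' @ D) ([k] @ b @ D @ a)"
        using conj_eq_rotate[of a "[k] @ b @ D" n] 3 l by simp
      also have "conj_eq n \<dots> (b @ (D @ a) @ [k])"
        using conj_eq_rotate[of "[k]" "b @ D @ a" n] 3 l by simp
      also have "conj_eq n \<dots> (b @ (a @ D) @ [k])"
      proof (rule conj_eq_equiv[OF braid_equiv_cong[OF equivclp_sym[OF braid_equiv_commute_lists]]])
        show "\<forall>x\<in>set a. \<forall>y\<in>set D. x + 2 \<le> y"
          using sub Suc.prems(3) by fastforce
        show "b @ (D @ a) @ [k] \<in> lists {1..<n}"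
          using l 3 by auto
      qed
      finally have "conj_eq n (c' @ D) ((b @ a) @ (D @ [k]))"
        by simp
      moreover have "vanish n ((b @ a) @ (D @ [k]))"
        using 3 sub Suc.prems inv l by (intro Suc.IH) auto
      ultimately show ?thesis
        by (rule vanish_cong)
    qed
    with ce show ?case
      by (rule vanish_cong)
  qed
  \<comment> \<open>At the start every letter is below n and D is empty.\<close>
  from this[of w n "[]"] less.prems show ?case
    by (auto simp: in_lists_conv_set subset_iff)
qed

theorem acyc_wcx:
  assumes "w \<in> lists {1..<n}" "t \<noteq> int (length w)"
  shows "acyc (wcx n w) t (- t)"
proof (cases "t < int (length w)")
  case True
  then show ?thesis
    using vanish_wcx[OF assms(1)] by (simp add: vanish_def)
next
  case False
  with assms(2) show ?thesis
    by (intro sacyc_wcx_top) auto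
qed

section \<open>Concrete models of graded bimodules\<close>

text \<open>The models have the addition of a type class as group operation, which makes ordinary
  arithmetic available in them; the monoid fields only repeat it.\<close>

locale addm =
  fixes M :: "('a::ab_group_add, 'm) monoid_scheme" and gr :: "int \<Rightarrow> 'a set"
  assumes mult: "x \<otimes>\<^bsub>M\<^esub> y = x + y" and one: "\<one>\<^bsub>M\<^esub> = 0"
    and zero: "0 \<in> carrier M" and add: "x \<in> carrier M \<Longrightarrow> y \<in> carrier M \<Longrightarrow> x + y \<in> carrier M"
    and uminus: "x \<in> carrier M \<Longrightarrow> - x \<in> carrier M"
    and gr_carrier: "x \<in> gr q \<Longrightarrow> x \<in> carrier M" and gr_zero: "0 \<in> gr q"
    and gr_add: "x \<in> gr q \<Longrightarrow> y \<in> gr q \<Longrightarrow> x + y \<in> gr q" and gr_uminus: "x \<in> gr q \<Longrightarrow> - x \<in> gr q"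
begin

lemma comm_group: "comm_group M"
proof (rule comm_groupI)
  fix x
  assume "x \<in> carrier M"
  then show "\<exists>y\<in>carrier M. y \<otimes>\<^bsub>M\<^esub> x = \<one>\<^bsub>M\<^esub>"
    by (auto simp: mult one intro!: bexI[of _ "- x"] uminus)
qed (auto simp: mult one zero add algebra_simps)

end

locale mbim = addm M "grade M" for M :: "'a::ab_group_add gbim" +
  fixes n :: nat
  assumes lact: "r \<in> polyR n \<Longrightarrow> x \<in> carrier M \<Longrightarrow> lact M r x \<in> carrier M"
    and ract: "r \<in> polyR n \<Longrightarrow> x \<in> carrier M \<Longrightarrow> ract M x r \<in> carrier M"
    and lact_add: "r \<in> polyR n \<Longrightarrow> x \<in> carrier M \<Longrightarrow> y \<in> carrier M \<Longrightarrow> lact M r (x + y) = lact M r x + lact M r y"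
    and ract_add: "r \<in> polyR n \<Longrightarrow> x \<in> carrier M \<Longrightarrow> y \<in> carrier M \<Longrightarrow> ract M (x + y) r = ract M x r + ract M y r"
    and lact_ract: "r \<in> polyR n \<Longrightarrow> s \<in> polyR n \<Longrightarrow> x \<in> carrier M \<Longrightarrow> ract M (lact M r x) s = lact M r (ract M x s)"

definition giso :: "nat \<Rightarrow> ('a \<Rightarrow> 'b) \<Rightarrow> 'a gbim \<Rightarrow> 'b gbim \<Rightarrow> bool" where
  "giso n f M N \<longleftrightarrow> bij_betw f (carrier M) (carrier N)
    \<and> (\<forall>x\<in>carrier M. \<forall>y\<in>carrier M. f (x \<otimes>\<^bsub>M\<^esub> y) = f x \<otimes>\<^bsub>N\<^esub> f y) \<and> f \<one>\<^bsub>M\<^esub> = \<one>\<^bsub>N\<^esub>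
    \<and> (\<forall>r\<in>polyR n. \<forall>x\<in>carrier M. f (lact M r x) = lact N r (f x) \<and> f (ract M x r) = ract N (f x) r)
    \<and> (\<forall>q. f ` grade M q = grade N q)"

lemma gisoD:
  assumes "giso n f M N"
  shows "bij_betw f (carrier M) (carrier N)" "x \<in> carrier M \<Longrightarrow> f x \<in> carrier N"
    "x \<in> carrier M \<Longrightarrow> y \<in> carrier M \<Longrightarrow> f (x \<otimes>\<^bsub>M\<^esub> y) = f x \<otimes>\<^bsub>N\<^esub> f y"
    "f \<one>\<^bsub>M\<^esub> = \<one>\<^bsub>N\<^esub>" "r \<in> polyR n \<Longrightarrow> x \<in> carrier M \<Longrightarrow> f (lact M r x) = lact N r (f x)"
    "r \<in> polyR n \<Longrightarrow> x \<in> carrier M \<Longrightarrow> f (ract M x r) = ract N (f x) r" "f ` grade M q = grade N q"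
    "x \<in> grade M q \<Longrightarrow> f x \<in> grade N q"
    "x \<in> carrier M \<Longrightarrow> y \<in> carrier M \<Longrightarrow> f x = f y \<longleftrightarrow> x = y"
  using assms unfolding giso_def bij_betw_def inj_on_def by blast+

lemma gisoE:
  assumes "giso n f M N" "y \<in> carrier N"
  obtains x where "x \<in> carrier M" "y = f x"
  using assms unfolding giso_def bij_betw_def by blast

lemma giso_trans:
  assumes "giso n f M N" "giso n g N P"
  shows "giso n (\<lambda>x. g (f x)) M P"
proof -
  have "bij_betw (\<lambda>x. g (f x)) (carrier M) (carrier P)"
    using bij_betw_trans[of f _ _ g] assms by (auto simp: giso_def comp_def)
  moreover have "(\<lambda>x. g (f x)) ` grade M q = grade P q" for q
    using gisoD(7)[OF assms(1), of q] gisoD(7)[OF assms(2), of q] by (auto simp: image_image[symmetric])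
  ultimately show ?thesis
    unfolding giso_def using gisoD[OF assms(1)] gisoD[OF assms(2)] by auto
qed

lemma giso_refl: "giso n (\<lambda>x. x) M M"
  by (simp add: giso_def bij_betw_def)

lemma giso_shift: "giso n f M N \<Longrightarrow> giso n f (shift k M) (shift k N)"
  by (simp add: giso_def shift_def)

text \<open>Group laws for the literal bimodules, whose elements are cosets or numbers, are obtained
  by transport from the models.\<close>

lemma giso_comm_group:
  assumes "addm M gr" "giso n f M N"
  shows "comm_group N"
proof -
  interpret addm M gr
    by fact
  note g = gisoD[OF assms(2)]
  show ?thesis
  proof (rule comm_groupI)
    fix x
    assume "x \<in> carrier N"
    then obtain a where "a \<in> carrier M" "x = f a"
      by (rule gisoE[OF assms(2)])
    moreover have "f (- a + a) = f (- a) \<otimes>\<^bsub>N\<^esub> f a" if "a \<in> carrier M" for a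
      using g(3)[OF uminus[OF that] that] by (simp add: mult)
    ultimately show "\<exists>y\<in>carrier N. y \<otimes>\<^bsub>N\<^esub> x = \<one>\<^bsub>N\<^esub>"
      using g(4) by (auto simp: one intro!: bexI[of _ "f (- a)"] g(2) uminus)
    show "\<one>\<^bsub>N\<^esub> \<otimes>\<^bsub>N\<^esub> x = x"
      using \<open>a \<in> carrier M\<close> \<open>x = f a\<close> g(3)[OF zero, of a] g(4) by (simp add: mult one)
    fix y
    assume "y \<in> carrier N"
    then obtain b where b: "b \<in> carrier M" "y = f b"
      by (rule gisoE[OF assms(2)])
    with \<open>a \<in> carrier M\<close> \<open>x = f a\<close> show "x \<otimes>\<^bsub>N\<^esub> y \<in> carrier N" "x \<otimes>\<^bsub>N\<^esub> y = y \<otimes>\<^bsub>N\<^esub> x"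
      using g(3)[of a b] g(3)[of b a] g(2)[OF add, of a b] by (auto simp: mult add.commute)
    fix z
    assume "z \<in> carrier N"
    then obtain c where c: "c \<in> carrier M" "z = f c"
      by (rule gisoE[OF assms(2)])
    with b \<open>a \<in> carrier M\<close> \<open>x = f a\<close> show "x \<otimes>\<^bsub>N\<^esub> y \<otimes>\<^bsub>N\<^esub> z = x \<otimes>\<^bsub>N\<^esub> (y \<otimes>\<^bsub>N\<^esub> z)"
      using g(3)[of a b, symmetric] g(3)[of b c, symmetric] g(3)[of "a + b" c] g(3)[of a "b + c"]
      by (auto simp: mult add add.assoc)
  qed (use g(2)[OF zero] g(4) one in simp)
qed

lemma giso_inv:
  assumes "addm M gr" "giso n f M N" "x \<in> carrier M"
  shows "inv\<^bsub>N\<^esub> (f x) = f (- x)"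
proof -
  interpret addm M gr
    by fact
  interpret N: comm_group N
    by (rule giso_comm_group[OF assms(1,2)])
  note g = gisoD[OF assms(2)]
  have "f (- x) \<otimes>\<^bsub>N\<^esub> f x = \<one>\<^bsub>N\<^esub>"
    using g(3)[OF uminus[OF assms(3)] assms(3)] g(4) by (simp add: mult one)
  then show ?thesis
    using assms(3) by (intro N.inv_equality) (auto intro: g(2) uminus)
qed

lemma giso_relabel:
  assumes "countable (carrier M)" "\<And>x y. x \<in> carrier M \<Longrightarrow> y \<in> carrier M \<Longrightarrow> x \<otimes>\<^bsub>M\<^esub> y \<in> carrier M"
  shows "giso n (to_nat_on (carrier M)) M (relabel M)"
proof -
  have "from_nat_into (carrier M) (to_nat_on (carrier M) x) = x" if "x \<in> carrier M" for x
    using assms(1) that by (rule from_nat_into_to_nat_on)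
  then show ?thesis
    using assms inj_on_to_nat_on[OF assms(1)] by (auto simp: giso_def relabel_def Let_def bij_betw_def)
qed

section \<open>Tensor products\<close>

lemma tensor_simps:
  "carrier (tensor S N M) = carrier (tensor_free N M Mod tensor_ker S N M)"
  "monoid.mult (tensor S N M) = monoid.mult (tensor_free N M Mod tensor_ker S N M)"
  "\<one>\<^bsub>tensor S N M\<^esub> = \<one>\<^bsub>tensor_free N M Mod tensor_ker S N M\<^esub>"
  "lact (tensor S N M) r X = tensor_map S N M (lact N r) id X"
  "ract (tensor S N M) X r = tensor_map S N M id (\<lambda>y. ract M y r) X"
  "grade (tensor S N M) q = generate (tensor_free N M Mod tensor_ker S N M)
         {pure_tensor S N M x y | x y i. x \<in> grade N i \<and> y \<in> grade M (q - i)}"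
  by (simp_all add: tensor_def Let_def)

locale tens =
  fixes S :: "mpoly set" and N :: "'a gbim" and M :: "'b gbim"
  assumes N: "comm_group N" and M: "comm_group M"
    and N_act: "r \<in> S \<Longrightarrow> x \<in> carrier N \<Longrightarrow> ract N x r \<in> carrier N"
    and M_act: "r \<in> S \<Longrightarrow> y \<in> carrier M \<Longrightarrow> lact M r y \<in> carrier M"
begin

definition frees :: "('a \<times> 'b \<Rightarrow>\<^sub>0 int) set" where
  "frees = {z. Poly_Mapping.keys z \<subseteq> carrier N \<times> carrier M}"

definition cls :: "('a \<times> 'b \<Rightarrow>\<^sub>0 int) \<Rightarrow> ('a \<times> 'b \<Rightarrow>\<^sub>0 int) set" where
  "cls z = tensor_ker S N M #>\<^bsub>tensor_free N M\<^esub> z"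

sublocale N: comm_group N
  by (rule N)

sublocale M: comm_group M
  by (rule M)

sublocale free: comm_group "tensor_free N M"
  unfolding tensor_free_def by (rule abelian_free_Abelian_group)

lemma carrier_free: "carrier (tensor_free N M) = frees"
  by (auto simp: tensor_free_def frees_def)

lemma frees_intros: "x \<in> carrier N \<Longrightarrow> y \<in> carrier M \<Longrightarrow> frag_of (x, y) \<in> frees" "0 \<in> frees"
  "z \<in> frees \<Longrightarrow> z' \<in> frees \<Longrightarrow> z + z' \<in> frees" "z \<in> frees \<Longrightarrow> z' \<in> frees \<Longrightarrow> z - z' \<in> frees"
  "z \<in> frees \<Longrightarrow> - z \<in> frees"
  using keys_add[of z z'] keys_diff[of z z'] by (auto simp: frees_def)

lemma inv_free: "z \<in> frees \<Longrightarrow> inv\<^bsub>tensor_free N M\<^esub> z = - z"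
  by (simp add: tensor_free_def frees_def)

lemma rels_frees: "tensor_rels S N M \<subseteq> frees"
proof -
  have "frag_of (x \<otimes>\<^bsub>N\<^esub> x', y) - frag_of (x, y) - frag_of (x', y) \<in> frees"
    if "x \<in> carrier N" "x' \<in> carrier N" "y \<in> carrier M" for x x' y
    using that by (intro frees_intros) auto
  moreover have "frag_of (x, y \<otimes>\<^bsub>M\<^esub> y') - frag_of (x, y) - frag_of (x, y') \<in> frees"
    if "x \<in> carrier N" "y \<in> carrier M" "y' \<in> carrier M" for x y y'
    using that by (intro frees_intros) auto
  moreover have "frag_of (ract N x r, y) - frag_of (x, lact M r y) \<in> frees"
    if "x \<in> carrier N" "y \<in> carrier M" "r \<in> S" for x y r
    using that by (intro frees_intros) (auto intro: N_act M_act)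
  ultimately show ?thesis
    unfolding tensor_rels_def by auto
qed

lemma ker_subgroup: "subgroup (tensor_ker S N M) (tensor_free N M)"
  unfolding tensor_ker_def using rels_frees by (intro free.generate_is_subgroup) (simp add: carrier_free)

lemma ker_normal: "normal (tensor_ker S N M) (tensor_free N M)"
  by (rule free.subgroup_imp_normal[OF ker_subgroup])

lemma ker_intros: "0 \<in> tensor_ker S N M" "z \<in> tensor_ker S N M \<Longrightarrow> z \<in> frees"
  "z \<in> tensor_rels S N M \<Longrightarrow> z \<in> tensor_ker S N M"
  using subgroup.one_closed[OF ker_subgroup] subgroup.mem_carrier[OF ker_subgroup] carrier_free
  by (auto simp: tensor_free_def tensor_ker_def intro: generate.incl)

lemma cls_eq_iff:
  assumes "z \<in> frees" "z' \<in> frees"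
  shows "cls z = cls z' \<longleftrightarrow> z - z' \<in> tensor_ker S N M"
proof
  assume "cls z = cls z'"
  then have "z \<in> tensor_ker S N M #>\<^bsub>tensor_free N M\<^esub> z'"
    using assms free.rcos_self[OF _ ker_subgroup, of z] by (simp add: cls_def carrier_free)
  then show "z - z' \<in> tensor_ker S N M"
    by (auto simp: r_coset_def tensor_free_def)
next
  assume "z - z' \<in> tensor_ker S N M"
  then have "z \<in> tensor_ker S N M #>\<^bsub>tensor_free N M\<^esub> z'"
    by (auto simp: r_coset_def tensor_free_def intro!: bexI[of _ "z - z'"])
  then show "cls z = cls z'"
    using free.repr_independence[OF _ _ ker_subgroup] assms by (simp add: cls_def carrier_free)
qed

lemma carrier_tensor: "carrier (tensor S N M) = cls ` frees"
  by (simp add: tensor_simps carrier_FactGroup carrier_free cls_def)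

lemma one_tensor: "\<one>\<^bsub>tensor S N M\<^esub> = cls 0"
  using free.coset_mult_one[OF subgroup.subset[OF ker_subgroup]] by (simp add: tensor_simps cls_def tensor_free_def)

lemma mult_tensor: "z \<in> frees \<Longrightarrow> z' \<in> frees \<Longrightarrow> cls z \<otimes>\<^bsub>tensor S N M\<^esub> cls z' = cls (z + z')"
  using normal.rcos_sum[OF ker_normal, of z z'] by (simp add: tensor_simps cls_def carrier_free) (simp add: tensor_free_def)

lemma pure_cls: "pure_tensor S N M x y = cls (frag_of (x, y))"
  by (simp add: pure_tensor_def cls_def)

lemma FactGroup_comm_group: "comm_group (tensor_free N M Mod tensor_ker S N M)"
  by (rule free.abelian_FactGroup[OF ker_subgroup])

lemma tensor_comm_group: "comm_group (tensor S N M)"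
proof -
  interpret T: comm_group "tensor_free N M Mod tensor_ker S N M"
    by (rule FactGroup_comm_group)
  show ?thesis
    by (rule comm_groupI; unfold tensor_simps(1-3))
      (rule T.m_closed T.one_closed T.m_assoc T.m_comm T.l_one T.l_inv_ex; assumption)+
qed

lemma pure_closed: "x \<in> carrier N \<Longrightarrow> y \<in> carrier M \<Longrightarrow> pure_tensor S N M x y \<in> carrier (tensor S N M)"
  by (auto simp: pure_cls carrier_tensor intro: frees_intros)

lemma pure_add_left:
  assumes "x \<in> carrier N" "x' \<in> carrier N" "y \<in> carrier M"
  shows "pure_tensor S N M (x \<otimes>\<^bsub>N\<^esub> x') y = pure_tensor S N M x y \<otimes>\<^bsub>tensor S N M\<^esub> pure_tensor S N M x' y"
proof -
  have "frag_of (x \<otimes>\<^bsub>N\<^esub> x', y) - (frag_of (x, y) + frag_of (x', y)) \<in> tensor_ker S N M"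
    using assms by (intro ker_intros) (auto simp: tensor_rels_def algebra_simps)
  with assms show ?thesis
    by (simp add: pure_cls mult_tensor cls_eq_iff frees_intros)
qed

lemma pure_add_right:
  assumes "x \<in> carrier N" "y \<in> carrier M" "y' \<in> carrier M"
  shows "pure_tensor S N M x (y \<otimes>\<^bsub>M\<^esub> y') = pure_tensor S N M x y \<otimes>\<^bsub>tensor S N M\<^esub> pure_tensor S N M x y'"
proof -
  have "frag_of (x, y \<otimes>\<^bsub>M\<^esub> y') - (frag_of (x, y) + frag_of (x, y')) \<in> tensor_ker S N M"
    using assms by (intro ker_intros) (auto simp: tensor_rels_def algebra_simps)
  with assms show ?thesis
    by (simp add: pure_cls mult_tensor cls_eq_iff frees_intros)
qed

lemma pure_balanced:
  assumes "x \<in> carrier N" "r \<in> S" "y \<in> carrier M"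
  shows "pure_tensor S N M (ract N x r) y = pure_tensor S N M x (lact M r y)"
proof -
  have "frag_of (ract N x r, y) - frag_of (x, lact M r y) \<in> tensor_ker S N M"
    using assms by (intro ker_intros) (auto simp: tensor_rels_def)
  with assms show ?thesis
    by (simp add: pure_cls cls_eq_iff frees_intros N_act M_act)
qed

lemma tensor_induct [consumes 1, case_names one pure diff]:
  assumes "X \<in> carrier (tensor S N M)"
    and "P \<one>\<^bsub>tensor S N M\<^esub>" "\<And>x y. x \<in> carrier N \<Longrightarrow> y \<in> carrier M \<Longrightarrow> P (pure_tensor S N M x y)"
    and "\<And>X Y. X \<in> carrier (tensor S N M) \<Longrightarrow> Y \<in> carrier (tensor S N M) \<Longrightarrow> P X \<Longrightarrow> P Y
      \<Longrightarrow> P (X \<otimes>\<^bsub>tensor S N M\<^esub> inv\<^bsub>tensor S N M\<^esub> Y)"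
  shows "P X"
proof -
  interpret T: comm_group "tensor S N M"
    by (rule tensor_comm_group)
  obtain z where z: "X = cls z" "Poly_Mapping.keys z \<subseteq> carrier N \<times> carrier M"
    using assms(1) by (auto simp: carrier_tensor frees_def)
  have "P (cls z)"
    using z(2)
  proof (induction z rule: free_Abelian_group_induct[consumes 1])
    case 1
    then show ?case
      using assms(2) by (simp add: one_tensor)
  next
    case (2 u v)
    then have 2: "u \<in> frees" "v \<in> frees" "- v \<in> frees" "P (cls u)" "P (cls v)"
      by (auto simp: frees_def)
    then have uv: "cls u \<in> carrier (tensor S N M)" "cls v \<in> carrier (tensor S N M)" "cls (- v) \<in> carrier (tensor S N M)"
      by (auto simp: carrier_tensor)
    have "cls (- v) \<otimes>\<^bsub>tensor S N M\<^esub> cls v = \<one>\<^bsub>tensor S N M\<^esub>"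
      using 2 by (simp add: mult_tensor one_tensor)
    then have "inv\<^bsub>tensor S N M\<^esub> cls v = cls (- v)"
      using uv by (intro T.inv_equality)
    moreover have "cls u \<otimes>\<^bsub>tensor S N M\<^esub> cls (- v) = cls (u - v)"
      using 2 by (simp add: mult_tensor)
    ultimately show ?case
      using assms(4)[OF uv(1,2)] 2 by simp
  next
    case (3 a)
    then show ?case
      using assms(3) by (auto simp: pure_cls)
  qed
  with z show ?thesis
    by simp
qed

text \<open>This is the source of injectivity in the comparison with the models: a bilinear map on
  the model coordinates becomes a left inverse.\<close>

lemma tensor_universal:
  assumes "comm_group G" "\<And>x y. x \<in> carrier N \<Longrightarrow> y \<in> carrier M \<Longrightarrow> b x y \<in> carrier G"
    and "\<And>x x' y. x \<in> carrier N \<Longrightarrow> x' \<in> carrier N \<Longrightarrow> y \<in> carrier M \<Longrightarrow> b (x \<otimes>\<^bsub>N\<^esub> x') y = b x y \<otimes>\<^bsub>G\<^esub> b x' y"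
    and "\<And>x y y'. x \<in> carrier N \<Longrightarrow> y \<in> carrier M \<Longrightarrow> y' \<in> carrier M \<Longrightarrow> b x (y \<otimes>\<^bsub>M\<^esub> y') = b x y \<otimes>\<^bsub>G\<^esub> b x y'"
    and "\<And>x r y. x \<in> carrier N \<Longrightarrow> r \<in> S \<Longrightarrow> y \<in> carrier M \<Longrightarrow> b (ract N x r) y = b x (lact M r y)"
  obtains h where "h \<in> hom (tensor S N M) G"
    "\<And>x y. x \<in> carrier N \<Longrightarrow> y \<in> carrier M \<Longrightarrow> h (pure_tensor S N M x y) = b x y"
proof -
  interpret G: comm_group G
    by fact
  obtain k where k: "k \<in> hom (tensor_free N M) G" "\<And>x. x \<in> carrier N \<times> carrier M \<Longrightarrow> k (frag_of x) = (case x of (x, y) \<Rightarrow> b x y)"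
    unfolding tensor_free_def
    by (rule G.free_Abelian_group_universal[of "\<lambda>(x, y). b x y" "carrier N \<times> carrier M"]) (use assms(2) in auto)
  interpret k: group_hom "tensor_free N M" G k
    using k(1) by unfold_locales
  have k_diff: "k (z - z') = k z \<otimes>\<^bsub>G\<^esub> inv\<^bsub>G\<^esub> k z'" if "z \<in> frees" "z' \<in> frees" for z z'
    using that k.hom_mult[of z "- z'"] k.hom_inv[of z'] frees_intros(5)[of z'] inv_free[of z'] unfolding carrier_free
    by (simp add: tensor_free_def)
  have comm: "u \<otimes>\<^bsub>G\<^esub> v \<otimes>\<^bsub>G\<^esub> inv\<^bsub>G\<^esub> u \<otimes>\<^bsub>G\<^esub> inv\<^bsub>G\<^esub> v = \<one>\<^bsub>G\<^esub>"
    if "u \<in> carrier G" "v \<in> carrier G" for u v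
    using that G.m_comm[of u v] by (simp add: G.m_assoc)
  have "k z = \<one>\<^bsub>G\<^esub>" if "z \<in> tensor_rels S N M" for z
    using that unfolding tensor_rels_def
  proof (elim UnE CollectE exE conjE)
    fix x x' y
    assume "z = frag_of (x \<otimes>\<^bsub>N\<^esub> x', y) - frag_of (x, y) - frag_of (x', y)" "x \<in> carrier N" "x' \<in> carrier N" "y \<in> carrier M"
    then show ?thesis
      by (simp add: k_diff k(2) frees_intros(1,4) assms(3) comm assms(2))
  next
    fix x y y'
    assume "z = frag_of (x, y \<otimes>\<^bsub>M\<^esub> y') - frag_of (x, y) - frag_of (x, y')" "x \<in> carrier N" "y \<in> carrier M" "y' \<in> carrier M"
    then show ?thesis
      by (simp add: k_diff k(2) frees_intros(1,4) assms(4) comm assms(2))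
  next
    fix x r y
    assume "z = frag_of (ract N x r, y) - frag_of (x, lact M r y)" "x \<in> carrier N" "r \<in> S" "y \<in> carrier M"
    then show ?thesis
      by (simp add: k_diff k(2) frees_intros(1,4) assms(5) assms(2) N_act M_act)
  qed
  then have "tensor_rels S N M \<subseteq> kernel (tensor_free N M) G k"
    using rels_frees by (auto simp: kernel_def carrier_free)
  then have "tensor_ker S N M \<subseteq> kernel (tensor_free N M) G k"
    unfolding tensor_ker_def by (intro free.generate_subgroup_incl k.subgroup_kernel)
  from k.FactGroup_universal_kernel[OF ker_normal this] obtain h where
    h: "h \<in> hom (tensor_free N M Mod tensor_ker S N M) G" "\<And>z. z \<in> frees \<Longrightarrow> h (cls z) = k z"
    unfolding carrier_free cls_def by blast
  show ?thesis
  proof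
    show "h \<in> hom (tensor S N M) G"
      using h(1) by (simp add: hom_def tensor_simps(1,2))
    show "h (pure_tensor S N M x y) = b x y" if "x \<in> carrier N" "y \<in> carrier M" for x y
      using that by (simp add: pure_cls h(2) k(2) frees_intros(1))
  qed
qed

end

text \<open>f \<otimes> g is well defined on a tensor product over S once f is right S-linear and g
  is left S-linear, and differentials and one-sided actions have to be treated alike.\<close>

definition rlin :: "mpoly set \<Rightarrow> 'a gbim \<Rightarrow> 'b gbim \<Rightarrow> ('a \<Rightarrow> 'b) \<Rightarrow> bool" where
  "rlin S N N' f \<longleftrightarrow> (\<forall>x\<in>carrier N. f x \<in> carrier N' \<and> (\<forall>y\<in>carrier N. f (x \<otimes>\<^bsub>N\<^esub> y) = f x \<otimes>\<^bsub>N'\<^esub> f y)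
    \<and> (\<forall>r\<in>S. f (ract N x r) = ract N' (f x) r))"

definition llin :: "mpoly set \<Rightarrow> 'a gbim \<Rightarrow> 'b gbim \<Rightarrow> ('a \<Rightarrow> 'b) \<Rightarrow> bool" where
  "llin S N N' f \<longleftrightarrow> (\<forall>x\<in>carrier N. f x \<in> carrier N' \<and> (\<forall>y\<in>carrier N. f (x \<otimes>\<^bsub>N\<^esub> y) = f x \<otimes>\<^bsub>N'\<^esub> f y)
    \<and> (\<forall>r\<in>S. f (lact N r x) = lact N' r (f x)))"

locale tens2 = A: tens S N M + B: tens S N' M' for S N M N' M' +
  fixes f g
  assumes f: "rlin S N N' f" and g: "llin S M M' g"
begin

abbreviation "ext \<equiv> frag_extend (\<lambda>(x, y). frag_of (f x, g y))"

lemma fg_simps: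
  "x \<in> carrier N \<Longrightarrow> f x \<in> carrier N'" "x \<in> carrier N \<Longrightarrow> x' \<in> carrier N \<Longrightarrow> f (x \<otimes>\<^bsub>N\<^esub> x') = f x \<otimes>\<^bsub>N'\<^esub> f x'"
  "x \<in> carrier N \<Longrightarrow> r \<in> S \<Longrightarrow> f (ract N x r) = ract N' (f x) r"
  "y \<in> carrier M \<Longrightarrow> g y \<in> carrier M'" "y \<in> carrier M \<Longrightarrow> y' \<in> carrier M \<Longrightarrow> g (y \<otimes>\<^bsub>M\<^esub> y') = g y \<otimes>\<^bsub>M'\<^esub> g y'"
  "y \<in> carrier M \<Longrightarrow> r \<in> S \<Longrightarrow> g (lact M r y) = lact M' r (g y)"
  using f g by (auto simp: rlin_def llin_def)

lemma ext_frees: "z \<in> A.frees \<Longrightarrow> ext z \<in> B.frees"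
  using keys_frag_extend[of "\<lambda>(x, y). frag_of (f x, g y)" z]
  unfolding A.frees_def B.frees_def by (fastforce simp: fg_simps)

lemma ext_ker: "z \<in> tensor_ker S N M \<Longrightarrow> ext z \<in> tensor_ker S N' M'"
proof -
  have "tensor_ker S N M \<subseteq> {z \<in> A.frees. ext z \<in> tensor_ker S N' M'}"
    unfolding tensor_ker_def[of S N M]
  proof (rule A.free.generate_subgroup_incl)
    have "ext z \<in> tensor_rels S N' M'" if "z \<in> tensor_rels S N M" for z
      using that unfolding tensor_rels_def
      by (auto simp: frag_extend_diff fg_simps) (blast intro: fg_simps)+
    then show "tensor_rels S N M \<subseteq> {z \<in> A.frees. ext z \<in> tensor_ker S N' M'}"
      using A.rels_frees by (auto intro: B.ker_intros)
    show "subgroup {z \<in> A.frees. ext z \<in> tensor_ker S N' M'} (tensor_free N M)"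
    proof (rule A.free.subgroupI)
      fix a b
      assume a: "a \<in> {z \<in> A.frees. ext z \<in> tensor_ker S N' M'}"
      then have "inv\<^bsub>tensor_free N' M'\<^esub> (ext a) \<in> tensor_ker S N' M'"
        by (auto intro: subgroup.m_inv_closed[OF B.ker_subgroup])
      then show "inv\<^bsub>tensor_free N M\<^esub> a \<in> {z \<in> A.frees. ext z \<in> tensor_ker S N' M'}"
        using a ext_frees[of a] A.frees_intros(5)[of a] by (simp add: A.inv_free B.inv_free frag_extend_minus)
      assume b: "b \<in> {z \<in> A.frees. ext z \<in> tensor_ker S N' M'}"
      have "ext a + ext b \<in> tensor_ker S N' M'"
        using a b subgroup.m_closed[OF B.ker_subgroup, of "ext a" "ext b"] by (simp add: tensor_free_def)
      moreover have "a + b \<in> A.frees"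
        using a b by (intro A.frees_intros) auto
      ultimately show "a \<otimes>\<^bsub>tensor_free N M\<^esub> b \<in> {z \<in> A.frees. ext z \<in> tensor_ker S N' M'}"
        by (simp add: frag_extend_add tensor_free_def)
    qed (auto simp: A.carrier_free B.ker_intros A.frees_intros(2) intro!: exI[of _ 0])
  qed
  then show "z \<in> tensor_ker S N M \<Longrightarrow> ext z \<in> tensor_ker S N' M'"
    by blast
qed

lemma tensor_map_cls:
  assumes "z \<in> A.frees"
  shows "tensor_map S N' M' f g (A.cls z) = B.cls (ext z)"
proof -
  have "B.cls (ext z') = B.cls (ext z)" if z': "z' \<in> A.cls z" for z'
  proof -
    obtain k where k: "k \<in> tensor_ker S N M" "z' = k + z"
      using z' by (auto simp: A.cls_def r_coset_def tensor_free_def)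
    have "ext z' - ext z \<in> tensor_ker S N' M'"
      using ext_ker[OF k(1)] by (simp add: k(2) frag_extend_add)
    moreover have "ext z' \<in> B.frees" "ext z \<in> B.frees"
      using k assms A.ker_intros(2)[OF k(1)] by (auto intro!: ext_frees A.frees_intros )
    ultimately show ?thesis
      by (simp add: B.cls_eq_iff)
  qed
  moreover have "z \<in> A.cls z"
    using A.free.rcos_self[OF _ A.ker_subgroup] assms by (simp add: A.cls_def A.carrier_free)
  moreover have "tensor_map S N' M' f g (A.cls z) = (\<Union>z'\<in>A.cls z. B.cls (ext z'))"
    by (simp add: tensor_map_def B.cls_def)
  ultimately show ?thesis
    by blast
qed

lemma tensor_map_pure:
  assumes "x \<in> carrier N" "y \<in> carrier M"
  shows "tensor_map S N' M' f g (pure_tensor S N M x y) = pure_tensor S N' M' (f x) (g y)"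
  using tensor_map_cls[of "frag_of (x, y)"] assms by (simp add: A.pure_cls B.pure_cls A.frees_intros(1))

lemma tensor_map_hom: "tensor_map S N' M' f g \<in> hom (tensor S N M) (tensor S N' M')"
proof (rule homI)
  fix X Y
  assume "X \<in> carrier (tensor S N M)"
  then obtain z where z: "X = A.cls z" "z \<in> A.frees"
    by (auto simp: A.carrier_tensor)
  then show "tensor_map S N' M' f g X \<in> carrier (tensor S N' M')"
    using ext_frees[OF z(2)] by (simp add: tensor_map_cls B.carrier_tensor)
  assume "Y \<in> carrier (tensor S N M)"
  then obtain z' where z': "Y = A.cls z'" "z' \<in> A.frees"
    by (auto simp: A.carrier_tensor)
  with z show "tensor_map S N' M' f g (X \<otimes>\<^bsub>tensor S N M\<^esub> Y)
      = tensor_map S N' M' f g X \<otimes>\<^bsub>tensor S N' M'\<^esub> tensor_map S N' M' f g Y"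
    using A.frees_intros(3)[of z z'] ext_frees[of z] ext_frees[of z']
    by (simp add: A.mult_tensor B.mult_tensor tensor_map_cls frag_extend_add)
qed

end

text \<open>The tensor product of \<open>N \<cong> N0\<close> with \<open>M \<cong> M0\<close>, where every element of \<open>N0\<close> is
  \<open>e0 (c0 x) + e1 (c1 x)\<close> with \<open>c0 x, c1 x\<close> in \<open>S\<close>; it is identified with \<open>V\<close> by means of
  the bilinear map \<open>b\<close>, and \<open>f0 v, f1 v\<close> are the coordinates of \<open>v\<close> in \<open>M0\<close>.\<close>

locale tensor_model = N0: mbim N0 n + M0: mbim M0 n + V: addm V "grade V"
  for n :: nat and N0 :: "'a::ab_group_add gbim" and M0 :: "'b::ab_group_add gbim"
    and V :: "'v::ab_group_add gbim" +
  fixes S :: "mpoly set" and N :: "'c gbim" and M :: "'d gbim" and g :: "'a \<Rightarrow> 'c" and h :: "'b \<Rightarrow> 'd"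
    and b :: "'a \<Rightarrow> 'b \<Rightarrow> 'v" and e0 e1 :: 'a and c0 c1 :: "'a \<Rightarrow> mpoly" and f0 f1 :: "'v \<Rightarrow> 'b" and i0 i1 :: int
  assumes g: "giso n g N0 N" and h: "giso n h M0 M" and S: "S \<subseteq> polyR n"
    and b_closed: "x \<in> carrier N0 \<Longrightarrow> y \<in> carrier M0 \<Longrightarrow> b x y \<in> carrier V"
    and b_add1: "x \<in> carrier N0 \<Longrightarrow> x' \<in> carrier N0 \<Longrightarrow> y \<in> carrier M0 \<Longrightarrow> b (x + x') y = b x y + b x' y"
    and b_add2: "x \<in> carrier N0 \<Longrightarrow> y \<in> carrier M0 \<Longrightarrow> y' \<in> carrier M0 \<Longrightarrow> b x (y + y') = b x y + b x y'"
    and b_bal: "x \<in> carrier N0 \<Longrightarrow> r \<in> S \<Longrightarrow> y \<in> carrier M0 \<Longrightarrow> b (ract N0 x r) y = b x (lact M0 r y)"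
    and e: "e0 \<in> grade N0 i0" "e1 \<in> grade N0 i1"
    and c: "x \<in> carrier N0 \<Longrightarrow> c0 x \<in> S" "x \<in> carrier N0 \<Longrightarrow> c1 x \<in> S"
      "x \<in> carrier N0 \<Longrightarrow> ract N0 e0 (c0 x) + ract N0 e1 (c1 x) = x"
    and f_closed: "v \<in> carrier V \<Longrightarrow> f0 v \<in> carrier M0" "v \<in> carrier V \<Longrightarrow> f1 v \<in> carrier M0"
    and f_add: "v \<in> carrier V \<Longrightarrow> w \<in> carrier V \<Longrightarrow> f0 (v + w) = f0 v + f0 w"
      "v \<in> carrier V \<Longrightarrow> w \<in> carrier V \<Longrightarrow> f1 (v + w) = f1 v + f1 w"
    and f_b: "x \<in> carrier N0 \<Longrightarrow> y \<in> carrier M0 \<Longrightarrow> f0 (b x y) = lact M0 (c0 x) y"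
      "x \<in> carrier N0 \<Longrightarrow> y \<in> carrier M0 \<Longrightarrow> f1 (b x y) = lact M0 (c1 x) y"
    and b_f: "v \<in> carrier V \<Longrightarrow> b e0 (f0 v) + b e1 (f1 v) = v"
    and V_lact: "r \<in> polyR n \<Longrightarrow> v \<in> carrier V \<Longrightarrow> lact V r v = b (lact N0 r e0) (f0 v) + b (lact N0 r e1) (f1 v)"
    and V_ract: "r \<in> polyR n \<Longrightarrow> v \<in> carrier V \<Longrightarrow> ract V v r = b e0 (ract M0 (f0 v) r) + b e1 (ract M0 (f1 v) r)"
    and b_grade: "x \<in> grade N0 i \<Longrightarrow> y \<in> grade M0 j \<Longrightarrow> b x y \<in> grade V (i + j)"
    and f_grade: "v \<in> grade V q \<Longrightarrow> f0 v \<in> grade M0 (q - i0)" "v \<in> grade V q \<Longrightarrow> f1 v \<in> grade M0 (q - i1)"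
begin

definition iso :: "'v \<Rightarrow> ('c \<times> 'd \<Rightarrow>\<^sub>0 int) set" where
  "iso v = pure_tensor S N M (g e0) (h (f0 v)) \<otimes>\<^bsub>tensor S N M\<^esub> pure_tensor S N M (g e1) (h (f1 v))"

lemma e_carrier: "e0 \<in> carrier N0" "e1 \<in> carrier N0"
  using e by (auto intro: N0.gr_carrier)

lemmas g_simps = gisoD[OF g]
lemmas h_simps = gisoD[OF h]

sublocale T: tens S N M
proof (rule tens.intro)
  show "comm_group N" "comm_group M"
    using giso_comm_group[OF N0.addm_axioms g] giso_comm_group[OF M0.addm_axioms h] .
  fix r x
  assume r: "r \<in> S"
  assume "x \<in> carrier N"
  then obtain x0 where "x0 \<in> carrier N0" "x = g x0"
    by (rule gisoE[OF g])
  with r show "ract N x r \<in> carrier N"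
    using S g_simps(6)[of r x0] g_simps(2)[of "ract N0 x0 r"] N0.ract[of r x0] by auto
next
  fix r y
  assume r: "r \<in> S"
  assume "y \<in> carrier M"
  then obtain y0 where "y0 \<in> carrier M0" "y = h y0"
    by (rule gisoE[OF h])
  with r show "lact M r y \<in> carrier M"
    using S h_simps(5)[of r y0] h_simps(2)[of "lact M0 r y0"] M0.lact[of r y0] by auto
qed

sublocale TG: comm_group "tensor S N M"
  by (rule T.tensor_comm_group)

lemma pure_closed: "x \<in> carrier N0 \<Longrightarrow> y \<in> carrier M0 \<Longrightarrow> pure_tensor S N M (g x) (h y) \<in> carrier (tensor S N M)"
  by (intro T.pure_closed g_simps h_simps)

lemma iso_closed: "v \<in> carrier V \<Longrightarrow> iso v \<in> carrier (tensor S N M)"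
  unfolding iso_def by (intro TG.m_closed pure_closed e_carrier f_closed)

lemma iso_add:
  assumes "v \<in> carrier V" "w \<in> carrier V"
  shows "iso (v + w) = iso v \<otimes>\<^bsub>tensor S N M\<^esub> iso w"
proof -
  have p: "pure_tensor S N M (g x) (h (y + y')) = pure_tensor S N M (g x) (h y) \<otimes>\<^bsub>tensor S N M\<^esub> pure_tensor S N M (g x) (h y')"
    if "x \<in> carrier N0" "y \<in> carrier M0" "y' \<in> carrier M0" for x y y'
    using T.pure_add_right[of "g x" "h y" "h y'"] that h_simps(3)[of y y'] g_simps(2) h_simps(2) by (simp add: M0.mult)
  show ?thesis
    using assms by (simp add: iso_def f_add p e_carrier f_closed pure_closed TG.m_ac)
qed

lemma iso_b:
  assumes "x \<in> carrier N0" "y \<in> carrier M0"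
  shows "iso (b x y) = pure_tensor S N M (g x) (h y)"
proof -
  have p: "pure_tensor S N M (g u) (h (lact M0 r y)) = pure_tensor S N M (g (ract N0 u r)) (h y)"
    if "u \<in> carrier N0" "r \<in> S" for u r
    using T.pure_balanced[of "g u" r "h y"] that S assms(2) g_simps(2,6) h_simps(2,5) by (auto simp: subset_iff)
  have "pure_tensor S N M (g (u + u')) (h y) = pure_tensor S N M (g u) (h y) \<otimes>\<^bsub>tensor S N M\<^esub> pure_tensor S N M (g u') (h y)"
    if "u \<in> carrier N0" "u' \<in> carrier N0" for u u'
    using T.pure_add_left[of "g u" "g u'" "h y"] that assms(2) g_simps(3)[of u u'] g_simps(2) h_simps(2) by (simp add: N0.mult)
  from this[of "ract N0 e0 (c0 x)" "ract N0 e1 (c1 x)"] show ?thesis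
    using assms c[OF assms(1)] S by (simp add: iso_def f_b p e_carrier subset_iff N0.ract)
qed

lemma iso_zero: "iso 0 = \<one>\<^bsub>tensor S N M\<^esub>"
  using iso_add[OF V.zero V.zero] iso_closed[OF V.zero] TG.l_cancel_one'[of "iso 0" "iso 0"] by simp

lemma iso_uminus:
  assumes "v \<in> carrier V"
  shows "iso (- v) = inv\<^bsub>tensor S N M\<^esub> iso v"
proof -
  have "iso (- v) \<otimes>\<^bsub>tensor S N M\<^esub> iso v = \<one>\<^bsub>tensor S N M\<^esub>"
    using iso_add[OF V.uminus[OF assms] assms] iso_zero by simp
  then show ?thesis
    using TG.inv_equality[of "iso (- v)" "iso v"] assms by (simp add: iso_closed V.uminus)
qed

text \<open>The image is a subgroup containing all pure tensors. Conversely the balanced map b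
  induces a homomorphism back to V, which sends the image of v to b e0 (f0 v) + b e1 (f1 v) =
  v.\<close>

lemma iso_bij: "bij_betw iso (carrier V) (carrier (tensor S N M))"
  unfolding bij_betw_def
proof
  show "iso ` carrier V = carrier (tensor S N M)"
  proof
    show "carrier (tensor S N M) \<subseteq> iso ` carrier V"
    proof
      fix X
      assume "X \<in> carrier (tensor S N M)"
      then show "X \<in> iso ` carrier V"
      proof (induction rule: T.tensor_induct)
        case one
        then show ?case
          using iso_zero V.zero by force
      next
        case (pure x y)
        then obtain x0 y0 where "x0 \<in> carrier N0" "y0 \<in> carrier M0" "x = g x0" "y = h y0"
          by (meson gisoE g h)
        then show ?case
          using iso_b[of x0 y0] b_closed[of x0 y0] by (metis imageI)
      next
        case (diff X Y)
        then obtain v w where "v \<in> carrier V" "w \<in> carrier V" "X = iso v" "Y = iso w"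
          by blast
        then have "X \<otimes>\<^bsub>tensor S N M\<^esub> inv\<^bsub>tensor S N M\<^esub> Y = iso (v + - w)"
          by (simp only: iso_add iso_uminus V.uminus)
        moreover have "v + - w \<in> carrier V"
          using \<open>v \<in> carrier V\<close> \<open>w \<in> carrier V\<close> by (intro V.add V.uminus)
        ultimately show ?case
          by (rule image_eqI)
      qed
    qed
  qed (auto intro: iso_closed)
  define g' where "g' = the_inv_into (carrier N0) g"
  define h' where "h' = the_inv_into (carrier M0) h"
  have g': "g' (g x) = x" if "x \<in> carrier N0" for x
    unfolding g'_def using that g by (intro the_inv_into_f_f) (auto simp: giso_def bij_betw_def)
  have h': "h' (h y) = y" if "y \<in> carrier M0" for y
    unfolding h'_def using that h by (intro the_inv_into_f_f) (auto simp: giso_def bij_betw_def)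
  have gN: "g' x \<in> carrier N0" "g (g' x) = x" if "x \<in> carrier N" for x
    using gisoE[OF g that] g' by metis+
  have hM: "h' y \<in> carrier M0" "h (h' y) = y" if "y \<in> carrier M" for y
    using gisoE[OF h that] h' by metis+
  obtain k where k: "k \<in> hom (tensor S N M) V"
    "\<And>x y. x \<in> carrier N \<Longrightarrow> y \<in> carrier M \<Longrightarrow> k (pure_tensor S N M x y) = b (g' x) (h' y)"
  proof (rule T.tensor_universal[of V "\<lambda>x y. b (g' x) (h' y)"])
    show "comm_group V"
      by (rule V.comm_group)
    fix x y
    assume xy: "x \<in> carrier N" "y \<in> carrier M"
    then show "b (g' x) (h' y) \<in> carrier V"
      by (intro b_closed gN hM)
    fix x' 
    assume "x' \<in> carrier N"
    with xy show "b (g' (x \<otimes>\<^bsub>N\<^esub> x')) (h' y) = b (g' x) (h' y) \<otimes>\<^bsub>V\<^esub> b (g' x') (h' y)"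
      using g_simps(3)[of "g' x" "g' x'"] by (simp add: gN hM V.mult b_add1[symmetric] N0.mult)
        (metis N0.add g' gN(1))
  next
    fix x y y'
    assume "x \<in> carrier N" "y \<in> carrier M" "y' \<in> carrier M"
    then show "b (g' x) (h' (y \<otimes>\<^bsub>M\<^esub> y')) = b (g' x) (h' y) \<otimes>\<^bsub>V\<^esub> b (g' x) (h' y')"
      using h_simps(3)[of "h' y" "h' y'"] by (simp add: gN hM V.mult b_add2[symmetric] M0.mult)
        (metis M0.add h' hM(1))
  next
    fix x r y
    assume a: "x \<in> carrier N" "r \<in> S" "y \<in> carrier M"
    then have r: "r \<in> polyR n"
      using S by auto
    have "g' (ract N x r) = ract N0 (g' x) r"
      using g_simps(6)[OF r gN(1)[OF a(1)]] g'[OF N0.ract[OF r gN(1)[OF a(1)]]] by (simp add: gN a)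
    moreover have "h' (lact M r y) = lact M0 r (h' y)"
      using h_simps(5)[OF r hM(1)[OF a(3)]] h'[OF M0.lact[OF r hM(1)[OF a(3)]]] by (simp add: hM a)
    ultimately show "b (g' (ract N x r)) (h' y) = b (g' x) (h' (lact M r y))"
      using a by (simp add: b_bal gN hM)
  next
    fix h
    assume h: "h \<in> hom (tensor S N M) V"
      "\<And>x y. x \<in> carrier N \<Longrightarrow> y \<in> carrier M \<Longrightarrow> h (pure_tensor S N M x y) = b (g' x) (h' y)"
    show thesis
      by (rule that[OF h])
  qed
  have "k (iso v) = v" if v: "v \<in> carrier V" for v
  proof -
    have "k (iso v) = b e0 (f0 v) + b e1 (f1 v)"
      unfolding iso_def using k v
      by (simp add: hom_mult[OF k(1)] T.pure_closed g_simps h_simps e_carrier f_closed g' h' V.mult)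
    then show ?thesis
      using b_f[OF v] by simp
  qed
  then show "inj_on iso (carrier V)"
    by (rule inj_on_inverseI)
qed

lemma iso_pures: "tensor_map S N' M' \<phi> \<psi> (iso v)
    = tensor_map S N' M' \<phi> \<psi> (pure_tensor S N M (g e0) (h (f0 v))) \<otimes>\<^bsub>tensor S N' M'\<^esub>
      tensor_map S N' M' \<phi> \<psi> (pure_tensor S N M (g e1) (h (f1 v)))"
  if "tens2 S N M N' M' \<phi> \<psi>" "v \<in> carrier V" for N' M' \<phi> \<psi>
  unfolding iso_def using hom_mult[OF tens2.tensor_map_hom[OF that(1)]] that(2)
  by (simp add: pure_closed e_carrier f_closed)

lemma giso_iso: "giso n iso V (tensor S N M)"
  unfolding giso_def
proof (intro conjI ballI allI iso_bij)
  fix x y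
  assume "x \<in> carrier V" "y \<in> carrier V"
  then show "iso (x \<otimes>\<^bsub>V\<^esub> y) = iso x \<otimes>\<^bsub>tensor S N M\<^esub> iso y"
    by (simp add: V.mult iso_add)
next
  show "iso \<one>\<^bsub>V\<^esub> = \<one>\<^bsub>tensor S N M\<^esub>"
    by (simp add: V.one iso_zero)
next
  fix r v
  assume r: "r \<in> polyR n" and v: "v \<in> carrier V"
  have "rlin S N N (lact N r)"
    unfolding rlin_def
  proof (intro conjI ballI)
    fix x
    assume "x \<in> carrier N"
    then obtain x0 where x: "x0 \<in> carrier N0" "x = g x0"
      by (rule gisoE[OF g])
    then show "lact N r x \<in> carrier N"
      using g_simps(5)[OF r x(1)] g_simps(2)[OF N0.lact[OF r x(1)]] by simp
    show "lact N r (ract N x s) = ract N (lact N r x) s" if "s \<in> S" for s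
    proof -
      have s: "s \<in> polyR n"
        using that S by auto
      show ?thesis
        using N0.lact_ract[OF r s x(1)] g_simps(5)[OF r N0.ract[OF s x(1)]] g_simps(6)[OF s N0.lact[OF r x(1)]]
          g_simps(5)[OF r x(1)] g_simps(6)[OF s x(1)] x(2) by simp
    qed
    fix y
    assume "y \<in> carrier N"
    then obtain y0 where y: "y0 \<in> carrier N0" "y = g y0"
      by (rule gisoE[OF g])
    with x show "lact N r (x \<otimes>\<^bsub>N\<^esub> y) = lact N r x \<otimes>\<^bsub>N\<^esub> lact N r y"
      using g_simps(3)[of x0 y0] g_simps(3)[of "lact N0 r x0" "lact N0 r y0"] g_simps(5)[OF r, of x0]
        g_simps(5)[OF r, of y0] g_simps(5)[OF r, of "x0 + y0"] N0.lact_add[OF r, of x0 y0]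
      by (simp add: N0.mult N0.add N0.lact r)
  qed
  moreover have "llin S M M id"
    by (simp add: llin_def)
  ultimately have t: "tens2 S N M N M (lact N r) id"
    by unfold_locales
  have "lact (tensor S N M) r (iso v) = iso (b (lact N0 r e0) (f0 v)) \<otimes>\<^bsub>tensor S N M\<^esub> iso (b (lact N0 r e1) (f1 v))"
    using iso_pures[OF t v] tens2.tensor_map_pure[OF t] v
    by (simp add: tensor_simps(4) iso_b e_carrier f_closed N0.lact r g_simps(2,5) h_simps(2))
  also have "\<dots> = iso (lact V r v)"
    using v r by (simp add: V_lact iso_add[symmetric] b_closed N0.lact e_carrier f_closed)
  finally show "iso (lact V r v) = lact (tensor S N M) r (iso v)"
    by simp
  have "llin S M M (\<lambda>y. ract M y r)"
    unfolding llin_def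
  proof (intro conjI ballI)
    fix x
    assume "x \<in> carrier M"
    then obtain x0 where x: "x0 \<in> carrier M0" "x = h x0"
      by (rule gisoE[OF h])
    then show "ract M x r \<in> carrier M"
      using h_simps(6)[OF r x(1)] h_simps(2)[OF M0.ract[OF r x(1)]] by simp
    show "ract M (lact M s x) r = lact M s (ract M x r)" if "s \<in> S" for s
    proof -
      have s: "s \<in> polyR n"
        using that S by auto
      show ?thesis
        using M0.lact_ract[OF s r x(1)] h_simps(5)[OF s M0.ract[OF r x(1)]] h_simps(6)[OF r M0.lact[OF s x(1)]]
          h_simps(6)[OF r x(1)] h_simps(5)[OF s x(1)] x(2) by simp
    qed
    fix y
    assume "y \<in> carrier M"
    then obtain y0 where y: "y0 \<in> carrier M0" "y = h y0"
      by (rule gisoE[OF h])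
    with x show "ract M (x \<otimes>\<^bsub>M\<^esub> y) r = ract M x r \<otimes>\<^bsub>M\<^esub> ract M y r"
      using h_simps(3)[of x0 y0] h_simps(3)[of "ract M0 x0 r" "ract M0 y0 r"] h_simps(6)[OF r, of x0]
        h_simps(6)[OF r, of y0] h_simps(6)[OF r, of "x0 + y0"] M0.ract_add[OF r, of x0 y0]
      by (simp add: M0.mult M0.add M0.ract r)
  qed
  moreover have "rlin S N N id"
    by (simp add: rlin_def)
  ultimately have t: "tens2 S N M N M id (\<lambda>y. ract M y r)"
    by unfold_locales
  have "ract (tensor S N M) (iso v) r = iso (b e0 (ract M0 (f0 v) r)) \<otimes>\<^bsub>tensor S N M\<^esub> iso (b e1 (ract M0 (f1 v) r))"
    using iso_pures[OF t v] tens2.tensor_map_pure[OF t] v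
    by (simp add: tensor_simps(5) iso_b e_carrier f_closed M0.ract r g_simps(2) h_simps(2,6))
  also have "\<dots> = iso (ract V v r)"
    using v r by (simp add: V_ract iso_add[symmetric] b_closed M0.ract e_carrier f_closed)
  finally show "iso (ract V v r) = ract (tensor S N M) (iso v) r"
    by simp
next
  fix q
  interpret F: comm_group "tensor_free N M Mod tensor_ker S N M"
    by (rule T.FactGroup_comm_group)
  define P where "P = {pure_tensor S N M x y | x y i. x \<in> grade N i \<and> y \<in> grade M (q - i)}"
  have P: "P = {pure_tensor S N M (g x) (h y) | x y i. x \<in> grade N0 i \<and> y \<in> grade M0 (q - i)}"
    unfolding P_def gisoD(7)[OF g, symmetric] gisoD(7)[OF h, symmetric] by blast
  have inv: "inv\<^bsub>tensor_free N M Mod tensor_ker S N M\<^esub> X = inv\<^bsub>tensor S N M\<^esub> X" for X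
    by (simp add: m_inv_def tensor_simps(1-3))
  have "generate (tensor_free N M Mod tensor_ker S N M) P \<subseteq> iso ` grade V q"
  proof (rule F.generate_subgroup_incl)
    show "P \<subseteq> iso ` grade V q"
    proof
      fix X
      assume "X \<in> P"
      then obtain x y i where "X = pure_tensor S N M (g x) (h y)" "x \<in> grade N0 i" "y \<in> grade M0 (q - i)"
        by (auto simp: P)
      then show "X \<in> iso ` grade V q"
        using iso_b[of x y] b_grade[of x i y "q - i"] by (auto intro: N0.gr_carrier M0.gr_carrier intro!: image_eqI[of _ _ "b x y"])
    qed
    show "subgroup (iso ` grade V q) (tensor_free N M Mod tensor_ker S N M)"
    proof (rule F.subgroupI; (unfold inv)?; (unfold tensor_simps(1,2)[symmetric])?)
      show "iso ` grade V q \<subseteq> carrier (tensor S N M)"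
        by (auto intro: iso_closed V.gr_carrier)
      show "iso ` grade V q \<noteq> {}"
        using V.gr_zero by blast
      show "inv\<^bsub>tensor S N M\<^esub> X \<in> iso ` grade V q" if "X \<in> iso ` grade V q" for X
        using that by (auto simp: iso_uminus[symmetric] V.gr_carrier intro: V.gr_uminus)
      show "X \<otimes>\<^bsub>tensor S N M\<^esub> Y \<in> iso ` grade V q" if "X \<in> iso ` grade V q" "Y \<in> iso ` grade V q" for X Y
        using that by (auto simp: iso_add[symmetric] V.gr_carrier intro: V.gr_add)
    qed
  qed
  moreover have "iso ` grade V q \<subseteq> generate (tensor_free N M Mod tensor_ker S N M) P"
  proof
    fix X
    assume "X \<in> iso ` grade V q"
    then obtain v where v: "v \<in> grade V q" "X = iso v"
      by auto
    then have "pure_tensor S N M (g e0) (h (f0 v)) \<in> P" "pure_tensor S N M (g e1) (h (f1 v)) \<in> P"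
      using e f_grade[OF v(1)] unfolding P by blast+
    then show "X \<in> generate (tensor_free N M Mod tensor_ker S N M) P"
      unfolding v iso_def tensor_simps(2) by (intro generate.eng generate.incl)
  qed
  ultimately show "iso ` grade V q = grade (tensor S N M) q"
    unfolding tensor_simps(6) P_def by blast
qed

end

lemma giso_rlin:
  assumes "giso n g N0 N" "giso n g' N0' N'" "S \<subseteq> polyR n" "mbim N0 n"
    and "rlin S N0 N0' \<phi>" "\<And>x. x \<in> carrier N0 \<Longrightarrow> f (g x) = g' (\<phi> x)"
  shows "rlin S N N' f"
proof -
  interpret N0: mbim N0 n
    by fact
  note g = gisoD[OF assms(1)] and g' = gisoD[OF assms(2)]
  have \<phi>: "\<And>x. x \<in> carrier N0 \<Longrightarrow> \<phi> x \<in> carrier N0'"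
    "\<And>x y. x \<in> carrier N0 \<Longrightarrow> y \<in> carrier N0 \<Longrightarrow> \<phi> (x \<otimes>\<^bsub>N0\<^esub> y) = \<phi> x \<otimes>\<^bsub>N0'\<^esub> \<phi> y"
    "\<And>x r. x \<in> carrier N0 \<Longrightarrow> r \<in> S \<Longrightarrow> \<phi> (ract N0 x r) = ract N0' (\<phi> x) r"
    using assms(5) by (auto simp: rlin_def)
  show ?thesis
    unfolding rlin_def
  proof (intro conjI ballI)
    fix x
    assume "x \<in> carrier N"
    then obtain x0 where x: "x0 \<in> carrier N0" "x = g x0"
      by (rule gisoE[OF assms(1)])
    then show "f x \<in> carrier N'"
      by (simp add: assms(6) g'(2) \<phi>)
    show "f (ract N x r) = ract N' (f x) r" if "r \<in> S" for r
    proof -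
      have "r \<in> polyR n"
        using that assms(3) by auto
      then show ?thesis
        using x that by (simp add: g(6)[symmetric] assms(6) N0.ract \<phi> g'(6))
    qed
    fix y
    assume "y \<in> carrier N"
    then obtain y0 where y: "y0 \<in> carrier N0" "y = g y0"
      by (rule gisoE[OF assms(1)])
    have "x0 \<otimes>\<^bsub>N0\<^esub> y0 \<in> carrier N0"
      using x y by (simp add: N0.mult N0.add)
    with x y show "f (x \<otimes>\<^bsub>N\<^esub> y) = f x \<otimes>\<^bsub>N'\<^esub> f y"
      by (simp add: g(3)[symmetric] assms(6) \<phi> g'(3))
  qed
qed

lemma giso_llin:
  assumes "giso n g N0 N" "giso n g' N0' N'" "S \<subseteq> polyR n" "mbim N0 n"
    and "llin S N0 N0' \<phi>" "\<And>x. x \<in> carrier N0 \<Longrightarrow> f (g x) = g' (\<phi> x)"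
  shows "llin S N N' f"
proof -
  interpret N0: mbim N0 n
    by fact
  note g = gisoD[OF assms(1)] and g' = gisoD[OF assms(2)]
  have \<phi>: "\<And>x. x \<in> carrier N0 \<Longrightarrow> \<phi> x \<in> carrier N0'"
    "\<And>x y. x \<in> carrier N0 \<Longrightarrow> y \<in> carrier N0 \<Longrightarrow> \<phi> (x \<otimes>\<^bsub>N0\<^esub> y) = \<phi> x \<otimes>\<^bsub>N0'\<^esub> \<phi> y"
    "\<And>x r. x \<in> carrier N0 \<Longrightarrow> r \<in> S \<Longrightarrow> \<phi> (lact N0 r x) = lact N0' r (\<phi> x)"
    using assms(5) by (auto simp: llin_def)
  show ?thesis
    unfolding llin_def
  proof (intro conjI ballI)
    fix x
    assume "x \<in> carrier N"
    then obtain x0 where x: "x0 \<in> carrier N0" "x = g x0"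
      by (rule gisoE[OF assms(1)])
    then show "f x \<in> carrier N'"
      by (simp add: assms(6) g'(2) \<phi>)
    show "f (lact N r x) = lact N' r (f x)" if "r \<in> S" for r
    proof -
      have "r \<in> polyR n"
        using that assms(3) by auto
      then show ?thesis
        using x that by (simp add: g(5)[symmetric] assms(6) N0.lact \<phi> g'(5))
    qed
    fix y
    assume "y \<in> carrier N"
    then obtain y0 where y: "y0 \<in> carrier N0" "y = g y0"
      by (rule gisoE[OF assms(1)])
    have "x0 \<otimes>\<^bsub>N0\<^esub> y0 \<in> carrier N0"
      using x y by (simp add: N0.mult N0.add)
    with x y show "f (x \<otimes>\<^bsub>N\<^esub> y) = f x \<otimes>\<^bsub>N'\<^esub> f y"
      by (simp add: g(3)[symmetric] assms(6) \<phi> g'(3))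
  qed
qed

text \<open>A pure tensor e_j \<otimes> f_j v goes to \<phi> e_j \<otimes> \<psi> (f_j v), and b'
  expresses this in the coordinates of the target. It serves both halves of the differential of a
  tensor product.\<close>

lemma tensor_map_iso:
  fixes n N0 M0 V S N M g h b e0 e1 c0 c1 f0 f1 i0 i1 N0' M0' V' N' M' g' h' b' e0' e1' c0' c1' f0' f1' i0' i1'
  assumes A: "tensor_model n N0 M0 V S N M g h b e0 e1 c0 c1 f0 f1 i0 i1"
    and B: "tensor_model n N0' M0' V' S N' M' g' h' b' e0' e1' c0' c1' f0' f1' i0' i1'"
    and "rlin S N0 N0' \<phi>" "\<And>x. x \<in> carrier N0 \<Longrightarrow> u (g x) = g' (\<phi> x)"
    and "llin S M0 M0' \<psi>" "\<And>y. y \<in> carrier M0 \<Longrightarrow> k (h y) = h' (\<psi> y)"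
    and "v \<in> carrier V"
  shows "tensor_map S N' M' u k (tensor_model.iso S N M g h e0 e1 f0 f1 v)
    = tensor_model.iso S N' M' g' h' e0' e1' f0' f1' (b' (\<phi> e0) (\<psi> (f0 v)) + b' (\<phi> e1) (\<psi> (f1 v)))"
proof -
  interpret A: tensor_model n N0 M0 V S N M g h b e0 e1 c0 c1 f0 f1 i0 i1
    by fact
  interpret B: tensor_model n N0' M0' V' S N' M' g' h' b' e0' e1' c0' c1' f0' f1' i0' i1'
    by fact
  have "rlin S N N' u" "llin S M M' k"
    using giso_rlin[OF A.g B.g A.S A.N0.mbim_axioms assms(3,4)] giso_llin[OF A.h B.h A.S A.M0.mbim_axioms assms(5,6)] by auto
  then have t: "tens2 S N M N' M' u k"
    by unfold_locales
  have \<phi>: "\<phi> x \<in> carrier N0'" if "x \<in> carrier N0" for x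
    using assms(3) that by (auto simp: rlin_def)
  have \<psi>: "\<psi> x \<in> carrier M0'" if "x \<in> carrier M0" for x
    using assms(5) that by (auto simp: llin_def)
  show ?thesis
    using A.iso_pures[OF t assms(7)] tens2.tensor_map_pure[OF t] assms(7)
    by (simp add: B.iso_add B.b_closed B.iso_b \<phi> \<psi> A.e_carrier A.f_closed assms(4,6) A.g_simps(2) A.h_simps(2))
qed

section \<open>Free modules over the polynomial ring and its invariants\<close>

text \<open>The coordinates of a tensor product M enter through the left action of polynomials on M,
  so it is the left action that has to satisfy the module laws and to respect degrees.\<close>

locale lmod = mbim M n for M :: "'a::ab_group_add gbim" and n :: nat +
  assumes lact_plus: "r \<in> polyR n \<Longrightarrow> s \<in> polyR n \<Longrightarrow> x \<in> carrier M \<Longrightarrow> lact M (r + s) x = lact M r x + lact M s x"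
    and lact_times: "r \<in> polyR n \<Longrightarrow> s \<in> polyR n \<Longrightarrow> x \<in> carrier M \<Longrightarrow> lact M (r * s) x = lact M r (lact M s x)"
    and lact_one: "x \<in> carrier M \<Longrightarrow> lact M 1 x = x"
    and lact_grade: "r \<in> polyR_grade n i \<Longrightarrow> x \<in> grade M j \<Longrightarrow> lact M r x \<in> grade M (i + j)"
    and ract_grade: "r \<in> polyR_grade n i \<Longrightarrow> x \<in> grade M j \<Longrightarrow> ract M x r \<in> grade M (i + j)"
begin

lemma lact_0: "x \<in> carrier M \<Longrightarrow> lact M 0 x = 0" "r \<in> polyR n \<Longrightarrow> lact M r 0 = 0" "r \<in> polyR n \<Longrightarrow> ract M 0 r = 0"
  using lact_plus[of 0 0 x] lact_add[of r 0 0] ract_add[of r 0 0] zero by (auto simp: polyR_simps)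

lemma lact_uminus: "r \<in> polyR n \<Longrightarrow> x \<in> carrier M \<Longrightarrow> lact M (- r) x = - lact M r x"
  "r \<in> polyR n \<Longrightarrow> x \<in> carrier M \<Longrightarrow> lact M r (- x) = - lact M r x"
  "r \<in> polyR n \<Longrightarrow> x \<in> carrier M \<Longrightarrow> ract M (- x) r = - ract M x r"
  using lact_plus[of "- r" r x] lact_add[of r "- x" x] ract_add[of r "- x" x] uminus[of x]
  by (auto simp: polyR_simps polyR_uminus lact_0 eq_neg_iff_add_eq_0)

end

lemma mbim_regular: "mbim (regular_bim n) n"
  by unfold_locales
    (auto simp: regular_bim_def algebra_simps intro: polyR_simps polyR_add polyR_uminus polyR_mult
      grade_simps grade_polyR grade_add grade_uminus)

lemma lmod_regular: "lmod (regular_bim n) n"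
proof -
  interpret mbim "regular_bim n" n
    by (rule mbim_regular)
  show ?thesis
    by unfold_locales (auto simp: regular_bim_def algebra_simps intro: grade_mult)
qed

text \<open>\<open>F\<^sup>k \<otimes> M\<close> for the Rouquier complex \<open>F\<close> of \<open>s\<^sub>i\<close>; a pair \<open>(a, b)\<close> stands for
  \<open>1 \<otimes> a + x\<^sub>i \<otimes> b\<close> if \<open>k = 0\<close>, and for \<open>a\<close> if \<open>k = 1\<close>.\<close>

definition pairs :: "nat \<Rightarrow> nat \<Rightarrow> int \<Rightarrow> 'a::ab_group_add gbim \<Rightarrow> ('a \<times> 'a) gbim" where
  "pairs n i k M = \<lparr>
     carrier = (if k = 0 then carrier M else if k = 1 then carrier M else {0}) \<times> (if k = 0 then carrier M else {0}),
     monoid.mult = (+), one = 0,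
     lact = (\<lambda>r v. if k = 0 then
         (lact M (icoeff0 n i r) (fst v) + lact M (icoeff0 n i (xvar n i * r)) (snd v),
          lact M (icoeff1 n i r) (fst v) + lact M (icoeff1 n i (xvar n i * r)) (snd v))
       else (lact M r (fst v), lact M r (snd v))),
     ract = (\<lambda>v r. (ract M (fst v) r, ract M (snd v) r)),
     grade = (\<lambda>q. (if k = 0 then grade M (q + 1) else if k = 1 then grade M (q + 1) else {0})
        \<times> (if k = 0 then grade M (q - 1) else {0}))\<rparr>"

lemma pairs_simps:
  "v \<in> carrier (pairs n i k M) \<longleftrightarrow> (if k = 0 \<or> k = 1 then fst v \<in> carrier M else fst v = 0)
    \<and> (if k = 0 then snd v \<in> carrier M else snd v = 0)"
  "v \<otimes>\<^bsub>pairs n i k M\<^esub> w = v + w" "\<one>\<^bsub>pairs n i k M\<^esub> = 0"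
  "lact (pairs n i k M) r v = (if k = 0 then
         (lact M (icoeff0 n i r) (fst v) + lact M (icoeff0 n i (xvar n i * r)) (snd v),
          lact M (icoeff1 n i r) (fst v) + lact M (icoeff1 n i (xvar n i * r)) (snd v))
       else (lact M r (fst v), lact M r (snd v)))"
  "ract (pairs n i k M) v r = (ract M (fst v) r, ract M (snd v) r)"
  "v \<in> grade (pairs n i k M) q \<longleftrightarrow> (if k = 0 \<or> k = 1 then fst v \<in> grade M (q + 1) else fst v = 0)
    \<and> (if k = 0 then snd v \<in> grade M (q - 1) else snd v = 0)"
  by (auto simp: pairs_def mem_Times_iff)

lemma lmod_pairs:
  assumes "lmod M n" "i \<in> {1..<n}"
  shows "lmod (pairs n i k M) n"
proof -
  interpret lmod M n
    by fact
  note ic = icoeff[OF assms(2)] and ica = icoeff_add[OF assms(2)] and icm = icoeff_mult_inv[OF assms(2)]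
  define x where "x = xvar n i"
  have xR: "x \<in> polyR n" "x \<in> polyR_grade n 2"
    by (simp_all add: x_def xvar_polyR xvar_grade)
  \<comment> \<open>(A, B) and (A', B') are the columns of the matrix of multiplication by r in the
    basis 1, x over the invariants; the module laws are the rules for such matrices.\<close>
  define A where "A r = icoeff0 n i r" for r
  define B where "B r = icoeff1 n i r" for r
  define A' where "A' r = icoeff0 n i (x * r)" for r
  define B' where "B' r = icoeff1 n i (x * r)" for r
  have mem: "A r \<in> polyR n" "B r \<in> polyR n" "A' r \<in> polyR n" "B' r \<in> polyR n" if "r \<in> polyR n" for r
    using that xR(1) ic(4,5)[of r] ic(4,5)[of "x * r"] by (simp_all add: A_def B_def A'_def B'_def polyR_mult)
  have plus: "A (r + s) = A r + A s" "B (r + s) = B r + B s" "A' (r + s) = A' r + A' s" "B' (r + s) = B' r + B' s"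
    if "r \<in> polyR n" "s \<in> polyR n" for r s
    using that xR(1) ica[of r s] ica[of "x * r" "x * s"] by (simp_all add: A_def B_def A'_def B'_def polyR_mult distrib_left)
  have comb: "icoeff0 n i (r * s) = A s * A r + B s * A' r" "icoeff1 n i (r * s) = A s * B r + B s * B' r"
    if "r \<in> polyR n" "s \<in> polyR n" for r s
  proof -
    have "r * s = r * (A s + x * B s)"
      unfolding A_def B_def x_def by (rule arg_cong[OF ic(3)[OF that(2)]])
    also have "\<dots> = A s * r + B s * (x * r)"
      by (simp add: algebra_simps)
    finally have e: "r * s = A s * r + B s * (x * r)" .
    have m: "A s * r \<in> polyR n" "B s * (x * r) \<in> polyR n"
      using that xR mem by (auto intro: polyR_mult)
    show "icoeff0 n i (r * s) = A s * A r + B s * A' r" "icoeff1 n i (r * s) = A s * B r + B s * B' r"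
      unfolding e ica[OF m] using icm(1,2)[of "A s" r] icm(1,2)[of "B s" "x * r"] ic(1,2)[OF that(2)] that xR(1)
      by (simp_all add: A_def B_def A'_def B'_def polyR_mult)
  qed
  have times: "A (r * s) = A r * A s + A' r * B s" "B (r * s) = B r * A s + B' r * B s"
    "A' (r * s) = A r * A' s + A' r * B' s" "B' (r * s) = B r * A' s + B' r * B' s"
    if "r \<in> polyR n" "s \<in> polyR n" for r s
    using comb[OF that] comb[OF that(1) polyR_mult[OF xR(1) that(2)]] by (simp_all add: A_def B_def A'_def B'_def mult_ac)
  have one: "A 1 = 1" "B 1 = 0" "A' 1 = 0" "B' 1 = 1"
    using icoeff_inv[OF assms(2) invariants_simps(3)] by (simp_all add: A_def B_def A'_def B'_def x_def)
  have gr: "A r \<in> polyR_grade n d" "B r \<in> polyR_grade n (d - 2)" "A' r \<in> polyR_grade n (d + 2)" "B' r \<in> polyR_grade n d"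
    if "r \<in> polyR_grade n d" for r d
    using icoeff_grade[OF assms(2) that] icoeff_grade[OF assms(2) grade_mult[OF xR(2) that]]
    by (simp_all add: A_def B_def A'_def B'_def add.commute)
  have l: "lact (pairs n i k M) r v = (if k = 0 then
      (lact M (A r) (fst v) + lact M (A' r) (snd v), lact M (B r) (fst v) + lact M (B' r) (snd v))
      else (lact M r (fst v), lact M r (snd v)))" for r v
    by (simp add: pairs_simps A_def B_def A'_def B'_def x_def)
  note ps = pairs_simps(1,2,3,5,6)
  have "mbim (pairs n i k M) n"
  proof
    fix r s v w
    assume r: "r \<in> polyR n" and v: "v \<in> carrier (pairs n i k M)"
    show "lact (pairs n i k M) r v \<in> carrier (pairs n i k M)" "ract (pairs n i k M) v r \<in> carrier (pairs n i k M)"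
      using r v mem[OF r] by (auto simp: l ps lact ract add lact_0 split: if_splits)
    show "ract (pairs n i k M) (lact (pairs n i k M) r v) s = lact (pairs n i k M) r (ract (pairs n i k M) v s)"
      if "s \<in> polyR n"
      using that r v mem[OF r] by (auto simp: l ps lact ract ract_add lact_0 lact_ract split: if_splits)
    assume w: "w \<in> carrier (pairs n i k M)"
    show "lact (pairs n i k M) r (v + w) = lact (pairs n i k M) r v + lact (pairs n i k M) r w"
      "ract (pairs n i k M) (v + w) r = ract (pairs n i k M) v r + ract (pairs n i k M) w r"
      using r v w mem[OF r] by (auto simp: l ps lact_add ract_add lact_0 algebra_simps split: if_splits)
  qed (auto simp: ps zero add uminus gr_zero gr_add gr_uminus prod_eq_iff intro: gr_carrier split: if_splits)
  then interpret P: mbim "pairs n i k M" n .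
  show ?thesis
  proof
    fix r s v
    assume r: "r \<in> polyR n" and s: "s \<in> polyR n" and v: "v \<in> carrier (pairs n i k M)"
    show "lact (pairs n i k M) (r + s) v = lact (pairs n i k M) r v + lact (pairs n i k M) s v"
      using r s v mem[OF r] mem[OF s] by (auto simp: l ps plus lact_plus lact_0 polyR_add algebra_simps split: if_splits)
    show "lact (pairs n i k M) (r * s) v = lact (pairs n i k M) r (lact (pairs n i k M) s v)"
    proof (cases "k = 0")
      case True
      with v have v: "fst v \<in> carrier M" "snd v \<in> carrier M"
        by (auto simp: ps)
      have t: "lact M (a * b + c * d) u = lact M a (lact M b u) + lact M c (lact M d u)"
        if "a \<in> polyR n" "b \<in> polyR n" "c \<in> polyR n" "d \<in> polyR n" "u \<in> carrier M" for a b c d u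
        using that by (simp add: lact_plus lact_times polyR_mult)
      have t': "lact M a (lact M b (fst v) + lact M c (snd v)) = lact M a (lact M b (fst v)) + lact M a (lact M c (snd v))"
        if "a \<in> polyR n" "b \<in> polyR n" "c \<in> polyR n" for a b c
        using that v by (simp add: lact_add lact)
      show ?thesis
        unfolding l using True by (simp add: times[OF r s] t t' mem[OF r] mem[OF s] v)
    next
      case False
      with r s v show ?thesis
        by (auto simp: l ps lact_times lact_0 polyR_mult split: if_splits)
    qed
  next
    fix v
    assume "v \<in> carrier (pairs n i k M)"
    then show "lact (pairs n i k M) 1 v = v"
      by (auto simp: l ps one lact_one lact_0 polyR_simps prod_eq_iff split: if_splits)
  next
    fix r v a b
    assume r: "r \<in> polyR_grade n a" and v: "v \<in> grade (pairs n i k M) b"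
    show "ract (pairs n i k M) v r \<in> grade (pairs n i k M) (a + b)"
      using v ract_grade[OF r, of _ "b + 1"] ract_grade[OF r, of _ "b - 1"] lact_0(3)[OF grade_polyR[OF r]]
      by (auto simp: ps add_ac algebra_simps split: if_splits)
    show "lact (pairs n i k M) r v \<in> grade (pairs n i k M) (a + b)"
    proof (cases "k = 0")
      case True
      with v have "fst v \<in> grade M (b + 1)" "snd v \<in> grade M (b - 1)"
        by (auto simp: ps)
      then show ?thesis
        unfolding l using True
          lact_grade[OF gr(1)[OF r], of "fst v" "b + 1"] lact_grade[OF gr(3)[OF r], of "snd v" "b - 1"]
          lact_grade[OF gr(2)[OF r], of "fst v" "b + 1"] lact_grade[OF gr(4)[OF r], of "snd v" "b - 1"]
        by (auto simp: ps algebra_simps intro!: gr_add)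
    next
      case False
      with v lact_grade[OF r, of _ "b + 1"] lact_0(2)[OF grade_polyR[OF r]] show ?thesis
        by (auto simp: l ps add_ac split: if_splits)
    qed
  qed
qed

definition bil :: "'a gbim \<Rightarrow> mpoly \<times> mpoly \<Rightarrow> 'a \<Rightarrow> 'a \<times> 'a" where
  "bil M r m = (lact M (fst r) m, lact M (snd r) m)"

text \<open>The generators of F^k as a right module: 1 \<otimes> 1 and x_i \<otimes> 1 for B_s, in
  degrees - 1 and 1, and the single generator 1 of R(1) in degree - 1.\<close>

definition unit0 :: "int \<Rightarrow> mpoly \<times> mpoly" where
  "unit0 k = (if k = 0 \<or> k = 1 then (1, 0) else 0)"

definition unit1 :: "int \<Rightarrow> mpoly \<times> mpoly" where
  "unit1 k = (if k = 0 then (0, 1) else 0)"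

lemma tensor_model_pairs:
  assumes "lmod M0 n" "i \<in> {1..<n}" "giso n g (pairs n i k (regular_bim n)) N" "giso n h M0 M"
  shows "tensor_model n (pairs n i k (regular_bim n)) M0 (pairs n i k M0) (polyR n) N M g h (bil M0)
    (unit0 k) (unit1 k) fst snd fst snd (- 1) 1"
proof -
  interpret lmod M0 n
    by fact
  interpret R: lmod "pairs n i k (regular_bim n)" n
    by (rule lmod_pairs[OF lmod_regular assms(2)])
  interpret P: lmod "pairs n i k M0" n
    by (rule lmod_pairs[OF assms(1,2)])
  have reg: "carrier (regular_bim n) = polyR n" "lact (regular_bim n) = (*)" "ract (regular_bim n) = (*)"
    "grade (regular_bim n) = polyR_grade n"
    by (simp_all add: regular_bim_def)
  note d = pairs_simps bil_def unit0_def unit1_def reg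
  have sub: "polyR n \<subseteq> polyR n"
    by simp
  have xR: "xvar n i \<in> polyR n"
    by (rule xvar_polyR)
  show ?thesis
  proof (unfold_locales; (fact assms(3,4) sub)?)
    fix x y
    assume x: "x \<in> carrier (pairs n i k (regular_bim n))"
    show "fst x \<in> polyR n" "snd x \<in> polyR n"
      using x by (auto simp: d polyR_simps split: if_splits)
    show "ract (pairs n i k (regular_bim n)) (unit0 k) (fst x) + ract (pairs n i k (regular_bim n)) (unit1 k) (snd x) = x"
      using x by (auto simp: d prod_eq_iff split: if_splits)
    assume y: "y \<in> carrier M0"
    show "bil M0 x y \<in> carrier (pairs n i k M0)"
      using x y by (auto simp: d lact lact_0 polyR_simps split: if_splits)
    show "fst (bil M0 x y) = lact M0 (fst x) y" "snd (bil M0 x y) = lact M0 (snd x) y"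
      by (simp_all add: bil_def)
    show "bil M0 (ract (pairs n i k (regular_bim n)) x r) y = bil M0 x (lact M0 r y)" if "r \<in> polyR n" for r
      using x y that by (auto simp: d lact_times polyR_simps lact lact_0 split: if_splits)
    show "bil M0 (x + x') y = bil M0 x y + bil M0 x' y" if "x' \<in> carrier (pairs n i k (regular_bim n))" for x'
      using x y that by (auto simp: d lact_plus polyR_simps lact_0 split: if_splits)
    show "bil M0 x (y + y') = bil M0 x y + bil M0 x y'" if "y' \<in> carrier M0" for y'
      using x y that by (auto simp: d lact_add polyR_simps lact_0 add split: if_splits)
  next
    show "unit0 k \<in> grade (pairs n i k (regular_bim n)) (- 1)" "unit1 k \<in> grade (pairs n i k (regular_bim n)) 1"
      by (auto simp: d grade_simps)
  next
    fix v
    assume v: "v \<in> carrier (pairs n i k M0)"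
    show "fst v \<in> carrier M0" "snd v \<in> carrier M0"
      using v by (auto simp: d zero split: if_splits)
    show "bil M0 (unit0 k) (fst v) + bil M0 (unit1 k) (snd v) = v"
      using v by (auto simp: d lact_one lact_0 zero prod_eq_iff split: if_splits)
    fix r
    assume r: "r \<in> polyR n"
    have ic: "icoeff0 n i r \<in> polyR n" "icoeff1 n i r \<in> polyR n" "icoeff0 n i (xvar n i * r) \<in> polyR n" "icoeff1 n i (xvar n i * r) \<in> polyR n"
      using icoeff(4,5)[OF assms(2) r] icoeff(4,5)[OF assms(2) polyR_mult[OF xR r]] by auto
    show "lact (pairs n i k M0) r v = bil M0 (lact (pairs n i k (regular_bim n)) r (unit0 k)) (fst v)
        + bil M0 (lact (pairs n i k (regular_bim n)) r (unit1 k)) (snd v)"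
      using v r ic by (auto simp: d lact_0 zero split: if_splits)
    show "ract (pairs n i k M0) v r = bil M0 (unit0 k) (ract M0 (fst v) r) + bil M0 (unit1 k) (ract M0 (snd v) r)"
      using v r by (auto simp: d lact_one ract lact_0 zero split: if_splits)
  next
    fix x y a b
    assume "x \<in> grade (pairs n i k (regular_bim n)) a" "y \<in> grade M0 b"
    then show "bil M0 x y \<in> grade (pairs n i k M0) (a + b)"
      using lact_grade[of "fst x" "a + 1" y b] lact_grade[of "snd x" "a - 1" y b] lact_0(1)[of y] gr_carrier[of y b]
      by (auto simp: d algebra_simps split: if_splits)
  next
    fix v q
    assume "v \<in> grade (pairs n i k M0) q"
    then show "fst v \<in> grade M0 (q - - 1)" "snd v \<in> grade M0 (q - 1)"
      by (auto simp: d gr_zero split: if_splits)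
  qed auto
qed

text \<open>Here the base ring is the ring of invariants, and R is free on 1 and x_i in degrees 0
  and 2. The shift by - 1 undoes the grading shift that \<open>pairs\<close> contains and the bare
  tensor product lacks.\<close>

lemma tensor_model_Bs:
  assumes i: "i \<in> {1..<n}"
  shows "tensor_model n (regular_bim n) (regular_bim n) (shift (- 1) (pairs n i 0 (regular_bim n))) (invariants n i)
    (regular_bim n) (regular_bim n) (\<lambda>x. x) (\<lambda>x. x) (\<lambda>p r. (icoeff0 n i p * r, icoeff1 n i p * r))
    1 (xvar n i) (icoeff0 n i) (icoeff1 n i) fst snd 0 2"
proof -
  interpret R: lmod "regular_bim n" n
    by (rule lmod_regular)
  interpret P: lmod "pairs n i 0 (regular_bim n)" n
    by (rule lmod_pairs[OF lmod_regular i])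
  have reg: "carrier (regular_bim n) = polyR n" "lact (regular_bim n) = (*)" "ract (regular_bim n) = (*)"
    "grade (regular_bim n) = polyR_grade n"
    by (simp_all add: regular_bim_def)
  have sh: "carrier (shift k M) = carrier M" "lact (shift k M) = lact M" "ract (shift k M) = ract M"
    "monoid.mult (shift k M) = monoid.mult M" "\<one>\<^bsub>shift k M\<^esub> = \<one>\<^bsub>M\<^esub>" "grade (shift k M) q = grade M (q + k)"
    for k q and M :: "'z gbim"
    by (simp_all add: shift_def)
  have inv: "invariants n i \<subseteq> polyR n"
    using invariants_polyR by blast
  note d = pairs_simps reg sh
  note ic = icoeff[OF i]
  have one: "icoeff0 n i 1 = 1" "icoeff1 n i 1 = 0" "icoeff0 n i (xvar n i) = 0" "icoeff1 n i (xvar n i) = 1"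
    using icoeff_inv[OF i invariants_simps(3)] by simp_all
  note pR = polyR_mult polyR_add polyR_uminus polyR_simps
  have bg: "y * icoeff0 n i x \<in> polyR_grade n (a + b)" "y * icoeff1 n i x \<in> polyR_grade n (a + b - 2)"
    if "x \<in> polyR_grade n a" "y \<in> polyR_grade n b" for x y a b
    using grade_mult[OF icoeff_grade(1)[OF i that(1)] that(2)] grade_mult[OF icoeff_grade(2)[OF i that(1)] that(2)]
    by (simp_all add: algebra_simps)
  show ?thesis
    by (unfold_locales; (fact giso_refl inv)?)
      (auto simp: d one ic(1,2,4,5) pR grade_simps grade_add grade_uminus xvar_grade grade_polyR icoeff_add[OF i]
        icoeff_mult_inv[OF i] algebra_simps prod_eq_iff simp flip: ic(3)
        intro: bg)
qed

section \<open>Rouquier complexes\<close>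

lemma (in lmod) lact_diff:
  "r \<in> polyR n \<Longrightarrow> x \<in> carrier M \<Longrightarrow> y \<in> carrier M \<Longrightarrow> lact M r (x - y) = lact M r x - lact M r y"
  using lact_add[of r x "- y"] lact_uminus(2)[of r y] uminus[of y] by simp

lemma countable_poly_mapping:
  assumes "countable (UNIV :: 'a set)" "countable (UNIV :: 'b::zero set)"
  shows "countable (UNIV :: ('a \<Rightarrow>\<^sub>0 'b) set)"
proof -
  let ?f = "\<lambda>p :: 'a \<Rightarrow>\<^sub>0 'b. (\<lambda>k. (k, Poly_Mapping.lookup p k)) ` Poly_Mapping.keys p"
  have "inj ?f"
  proof (rule injI)
    fix p q
    assume eq: "?f p = ?f q"
    have "Poly_Mapping.lookup p k = Poly_Mapping.lookup q k" for k
    proof (cases "k \<in> Poly_Mapping.keys p \<or> k \<in> Poly_Mapping.keys q")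
      case True
      then have "(k, Poly_Mapping.lookup p k) \<in> ?f q \<or> (k, Poly_Mapping.lookup q k) \<in> ?f p"
        using eq by blast
      then show ?thesis
        by auto
    next
      case False
      then show ?thesis
        by (simp add: in_keys_iff)
    qed
    then show "p = q"
      by (rule poly_mapping_eqI)
  qed
  moreover have "countable (range ?f)"
  proof (rule countable_subset)
    show "range ?f \<subseteq> {A. finite A \<and> A \<subseteq> UNIV}"
      by auto
    show "countable {A :: ('a \<times> 'b) set. finite A \<and> A \<subseteq> UNIV}"
      using assms countable_SIGMA[of "UNIV :: 'a set" "\<lambda>_. UNIV :: 'b set"] by (intro countable_Collect_finite_subset) simp
  qed
  ultimately show ?thesis
    using countable_image_inj_on by blast
qed

lemma countable_polyR: "countable (A :: mpoly set)"
proof -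
  have "countable (UNIV :: (nat \<Rightarrow>\<^sub>0 nat) set)"
    by (rule countable_poly_mapping) auto
  then have "countable (UNIV :: mpoly set)"
    by (rule countable_poly_mapping) auto
  then show ?thesis
    by (rule countable_subset[rotated]) simp
qed

text \<open>\<open>Bs_mult\<close> is given by a formula on representatives; this shows that such a
  formula is constant on cosets.\<close>

lemma (in tens) ker_additive:
  assumes "\<And>z z'. \<phi> (z + z') = \<phi> z + (\<phi> z' :: 'u::ab_group_add)" "\<And>z. z \<in> tensor_rels S N M \<Longrightarrow> \<phi> z = 0"
    and "z \<in> tensor_ker S N M"
  shows "\<phi> z = 0"
proof -
  have z0: "\<phi> 0 = 0"
    using assms(1)[of 0 0] by simp
  have m: "\<phi> (- z) = - \<phi> z" for z
    using assms(1)[of "- z" z] z0 by (simp add: eq_neg_iff_add_eq_0)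
  have "tensor_ker S N M \<subseteq> {z \<in> frees. \<phi> z = 0}"
    unfolding tensor_ker_def
  proof (rule free.generate_subgroup_incl)
    show "tensor_rels S N M \<subseteq> {z \<in> frees. \<phi> z = 0}"
      using assms(2) rels_frees by auto
    show "subgroup {z \<in> frees. \<phi> z = 0} (tensor_free N M)"
    proof (rule free.subgroupI)
      fix a b
      assume a: "a \<in> {z \<in> frees. \<phi> z = 0}"
      then show "inv\<^bsub>tensor_free N M\<^esub> a \<in> {z \<in> frees. \<phi> z = 0}"
        by (simp add: inv_free frees_intros m)
      assume "b \<in> {z \<in> frees. \<phi> z = 0}"
      with a frees_intros(3)[of a b] show "a \<otimes>\<^bsub>tensor_free N M\<^esub> b \<in> {z \<in> frees. \<phi> z = 0}"
        by (simp add: tensor_free_def assms(1))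
    qed (auto simp: carrier_free frees_intros(2) z0 intro!: exI[of _ 0])
  qed
  with assms(3) show ?thesis
    by auto
qed

definition Bs_iso :: "nat \<Rightarrow> nat \<Rightarrow> mpoly \<times> mpoly \<Rightarrow> ((mpoly \<times> mpoly) \<Rightarrow>\<^sub>0 int) set" where
  "Bs_iso n i = tensor_model.iso (invariants n i) (regular_bim n) (regular_bim n) (\<lambda>x. x) (\<lambda>x. x) 1 (xvar n i) fst snd"

text \<open>The formula on representatives is additive and kills the tensor relations, so it may be
  evaluated at 1 \<otimes> a + x_i \<otimes> b.\<close>

lemma Bs_mult_iso:
  assumes i: "i \<in> {1..<n}" and v: "v \<in> carrier (pairs n i 0 (regular_bim n))"
  shows "Bs_mult (Bs_iso n i v) = fst v + xvar n i * snd v"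
proof -
  interpret tensor_model n "regular_bim n" "regular_bim n" "shift (- 1) (pairs n i 0 (regular_bim n))" "invariants n i"
    "regular_bim n" "regular_bim n" "\<lambda>x. x" "\<lambda>x. x" "\<lambda>p r. (icoeff0 n i p * r, icoeff1 n i p * r)"
    1 "xvar n i" "icoeff0 n i" "icoeff1 n i" fst snd 0 2
    by (rule tensor_model_Bs[OF i])
  have vR: "fst v \<in> polyR n" "snd v \<in> polyR n" and car: "carrier (regular_bim n) = polyR n"
    using v by (auto simp: pairs_simps regular_bim_def)
  define \<phi> where "\<phi> z = (\<Sum>(x, y) \<in> Poly_Mapping.keys z. of_int (Poly_Mapping.lookup z (x, y)) * (x * y))"
    for z :: "(mpoly \<times> mpoly) \<Rightarrow>\<^sub>0 int"
  have sup: "\<phi> z = (\<Sum>(x, y) \<in> A. of_int (Poly_Mapping.lookup z (x, y)) * (x * y))"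
    if "finite A" "Poly_Mapping.keys z \<subseteq> A" for z A
    unfolding \<phi>_def using that by (intro sum.mono_neutral_left) (auto simp: in_keys_iff)
  have add: "\<phi> (z + z') = \<phi> z + \<phi> z'" for z z'
    using keys_add[of z z'] sup[of "Poly_Mapping.keys z \<union> Poly_Mapping.keys z'" z]
      sup[of "Poly_Mapping.keys z \<union> Poly_Mapping.keys z'" z'] sup[of "Poly_Mapping.keys z \<union> Poly_Mapping.keys z'" "z + z'"]
    by (simp add: lookup_add split_def distrib_right sum.distrib)
  have fr: "\<phi> (frag_of (x, y)) = x * y" for x y
    by (simp add: \<phi>_def)
  have "\<phi> (- z) = - \<phi> z" for z
    by (simp add: \<phi>_def split_def sum_negf)
  then have diff: "\<phi> (z - z') = \<phi> z - \<phi> z'" for z z'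
    using add[of z "- z'"] by simp
  have rel: "\<phi> z = 0" if "z \<in> tensor_rels (invariants n i) (regular_bim n) (regular_bim n)" for z
    using that unfolding tensor_rels_def by (auto simp: diff fr regular_bim_def distrib_left distrib_right mult_ac simp del: diff_diff_eq)
  define z where "z = frag_of (1 :: mpoly, fst v) + frag_of (xvar n i, snd v)"
  have fz: "frag_of (1, fst v) \<in> T.frees" "frag_of (xvar n i, snd v) \<in> T.frees"
    using vR by (auto intro!: T.frees_intros simp: car polyR_simps xvar_polyR)
  then have z: "Bs_iso n i v = T.cls z"
    unfolding Bs_iso_def iso_def z_def by (simp add: T.pure_cls T.mult_tensor)
  have "\<phi> z' = \<phi> z" if z': "z' \<in> T.cls z" for z'
  proof -
    obtain k where "k \<in> tensor_ker (invariants n i) (regular_bim n) (regular_bim n)" "z' = k + z"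
      using z' unfolding T.cls_def r_coset_def tensor_free_def by auto
    then show ?thesis
      using T.ker_additive[of \<phi> k, OF add rel] by (simp add: add)
  qed
  moreover have "z \<in> T.cls z"
    using T.free.rcos_self[OF _ T.ker_subgroup, of z] T.frees_intros(3)[OF fz] by (simp add: T.cls_def T.carrier_free z_def)
  ultimately have "\<phi> ` T.cls z = {\<phi> z}"
    by blast
  moreover have "Bs_mult (T.cls z) = the_elem (\<phi> ` T.cls z)"
    unfolding Bs_mult_def \<phi>_def ..
  ultimately show ?thesis
    unfolding z by (simp add: z_def add fr)
qed

definition gen_iso :: "nat \<Rightarrow> nat \<Rightarrow> int \<Rightarrow> mpoly \<times> mpoly \<Rightarrow> nat" where
  "gen_iso n i k v = (if k = 0 then to_nat_on (carrier (Bs n i)) (Bs_iso n i v)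
     else if k = 1 then to_nat_on (polyR n) (fst v) else 0)"

definition gen_diff :: "nat \<Rightarrow> nat \<Rightarrow> int \<Rightarrow> mpoly \<times> mpoly \<Rightarrow> mpoly \<times> mpoly" where
  "gen_diff n i k v = (if k = 0 then (fst v + xvar n i * snd v, 0) else 0)"

lemma giso_Bs:
  assumes "i \<in> {1..<n}"
  shows "giso n (Bs_iso n i) (pairs n i 0 (regular_bim n)) (Bs n i)"
    "countable (carrier (Bs n i))" "comm_group (Bs n i)"
proof -
  have s: "shift 1 (shift (- 1) M) = M" for M :: "'z gbim"
    by (simp add: shift_def)
  show 1: "giso n (Bs_iso n i) (pairs n i 0 (regular_bim n)) (Bs n i)"
    using giso_shift[OF tensor_model.giso_iso[OF tensor_model_Bs[OF assms]], of 1] unfolding s Bs_iso_def Bs_def .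
  have "countable (carrier (pairs n i 0 (regular_bim n)))"
    by (simp add: pairs_def countable_polyR)
  then show "countable (carrier (Bs n i))"
    using gisoD(1)[OF 1] by (metis bij_betw_imp_surj_on countable_image)
  interpret P: lmod "pairs n i 0 (regular_bim n)" n
    by (rule lmod_pairs[OF lmod_regular assms])
  show "comm_group (Bs n i)"
    by (rule giso_comm_group[OF P.addm_axioms 1])
qed

lemma giso_gen:
  assumes "i \<in> {1..<n}"
  shows "giso n (gen_iso n i k) (pairs n i k (regular_bim n)) (obj (rouquier_gen n i) k)"
proof -
  interpret B: comm_group "Bs n i"
    by (rule giso_Bs(3)[OF assms])
  consider "k = 0" | "k = 1" | "k \<noteq> 0" "k \<noteq> 1"
    by blast
  then show ?thesis
  proof cases
    case 1
    have "giso n (\<lambda>v. to_nat_on (carrier (Bs n i)) (Bs_iso n i v)) (pairs n i 0 (regular_bim n)) (relabel (Bs n i))"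
      by (rule giso_trans[OF giso_Bs(1)[OF assms] giso_relabel[OF giso_Bs(2)[OF assms]]]) auto
    with 1 show ?thesis
      by (simp add: gen_iso_def[abs_def] rouquier_gen_def)
  next
    case 2
    let ?R = "shift 1 (regular_bim n)"
    have c: "carrier ?R = polyR n"
      by (simp add: shift_def regular_bim_def)
    have "bij_betw fst (carrier (pairs n i 1 (regular_bim n))) (polyR n)"
      by (rule bij_betwI[of _ _ _ "\<lambda>r. (r, 0)"]) (auto simp: pairs_def regular_bim_def)
    then have "giso n fst (pairs n i 1 (regular_bim n)) ?R"
      unfolding giso_def by (auto simp: c pairs_def shift_def regular_bim_def image_iff)
    from giso_trans[OF this giso_relabel] have "giso n (\<lambda>v. to_nat_on (polyR n) (fst v)) (pairs n i 1 (regular_bim n)) (relabel ?R)"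
      unfolding c by (auto simp: countable_polyR shift_def regular_bim_def polyR_add)
    with 2 show ?thesis
      by (simp add: gen_iso_def[abs_def] rouquier_gen_def)
  next
    case 3
    then show ?thesis
      by (auto simp: gen_iso_def giso_def rouquier_gen_def zero_bim_def pairs_def bij_betw_def zero_prod_def regular_bim_def)
  qed
qed

lemma gen_iso_diff:
  assumes i: "i \<in> {1..<n}" and v: "v \<in> carrier (pairs n i k (regular_bim n))"
  shows "diff (rouquier_gen n i) k (gen_iso n i k v) = gen_iso n i (k + 1) (gen_diff n i k v)"
proof -
  consider "k = 0" | "k = - 1" | "k \<noteq> 0" "k \<noteq> - 1"
    by blast
  then show ?thesis
  proof cases
    case 1
    have "Bs_iso n i v \<in> carrier (Bs n i)"
      using gisoD(2)[OF giso_Bs(1)[OF i]] v 1 by simp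
    then have "from_nat_into (carrier (Bs n i)) (to_nat_on (carrier (Bs n i)) (Bs_iso n i v)) = Bs_iso n i v"
      by (rule from_nat_into_to_nat_on[OF giso_Bs(2)[OF i]])
    with 1 v Bs_mult_iso[OF i] show ?thesis
      by (simp add: rouquier_gen_def gen_iso_def gen_diff_def relabel_map_def shift_def regular_bim_def)
  next
    case 2
    have "gen_iso n i 0 0 = \<one>\<^bsub>relabel (Bs n i)\<^esub>"
      using gisoD(4)[OF giso_gen[OF i, of 0]] by (simp add: pairs_simps rouquier_gen_def)
    with 2 show ?thesis
      by (simp add: rouquier_gen_def gen_diff_def)
  next
    case 3
    then show ?thesis
      by (auto simp: rouquier_gen_def gen_iso_def)
  qed
qed

lemma rlin_gen_diff:
  assumes "i \<in> {1..<n}"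
  shows "rlin (polyR n) (pairs n i k (regular_bim n)) (pairs n i (k + 1) (regular_bim n)) (gen_diff n i k)"
  by (auto simp: rlin_def gen_diff_def pairs_simps regular_bim_def distrib_left distrib_right add_ac mult.assoc zero_prod_def
      intro!: polyR_add polyR_mult xvar_polyR polyR_simps)

text \<open>The degree t term of F_s \<otimes> C, where M and M' stand for the terms of C in degrees
  t and t - 1: a pair for B_s \<otimes> M and a third component for R(1) \<otimes> M'.\<close>

definition tripm :: "nat \<Rightarrow> nat \<Rightarrow> (nat list \<Rightarrow> mpoly) gbim \<Rightarrow> (nat list \<Rightarrow> mpoly) gbim \<Rightarrow> (nat list \<Rightarrow> mpoly) gbim" where
  "tripm n i M M' = (let P = pairs n i 0 M; p = (\<lambda>v. (part 0 v, part (Suc 0) v)) in \<lparr>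
     carrier = {trip a b c | a b c. (a, b) \<in> carrier P \<and> c \<in> carrier M'},
     monoid.mult = (+), one = 0,
     lact = (\<lambda>r v. trip (fst (lact P r (p v))) (snd (lact P r (p v))) (lact M' r (part 2 v))),
     ract = (\<lambda>v r. trip (fst (ract P (p v) r)) (snd (ract P (p v) r)) (ract M' (part 2 v) r)),
     grade = (\<lambda>q. {trip a b c | a b c. (a, b) \<in> grade P q \<and> c \<in> grade M' (q + 1)})\<rparr>)"

lemma tripm_simps:
  "trip a b c \<in> carrier (tripm n i M M') \<longleftrightarrow> (a, b) \<in> carrier (pairs n i 0 M) \<and> c \<in> carrier M'"
  "v \<otimes>\<^bsub>tripm n i M M'\<^esub> w = v + w" "\<one>\<^bsub>tripm n i M M'\<^esub> = 0"
  "lact (tripm n i M M') r (trip a b c) = trip (fst (lact (pairs n i 0 M) r (a, b))) (snd (lact (pairs n i 0 M) r (a, b))) (lact M' r c)"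
  "ract (tripm n i M M') (trip a b c) r = trip (fst (ract (pairs n i 0 M) (a, b) r)) (snd (ract (pairs n i 0 M) (a, b) r)) (ract M' c r)"
  "trip a b c \<in> grade (tripm n i M M') q \<longleftrightarrow> (a, b) \<in> grade (pairs n i 0 M) q \<and> c \<in> grade M' (q + 1)"
  by (auto simp: tripm_def Let_def)

lemma tripmE:
  assumes "v \<in> carrier (tripm n i M M')"
  obtains a b c where "v = trip a b c" "(a, b) \<in> carrier (pairs n i 0 M)" "c \<in> carrier M'"
  using assms by (auto simp: tripm_def Let_def)

lemma tripm_gradeE:
  assumes "v \<in> grade (tripm n i M M') q"
  obtains a b c where "v = trip a b c" "(a, b) \<in> grade (pairs n i 0 M) q" "c \<in> grade M' (q + 1)"
  using assms by (auto simp: tripm_def Let_def)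

lemma lmod_tripm:
  assumes "lmod M n" "lmod M' n" "i \<in> {1..<n}"
  shows "lmod (tripm n i M M') n"
proof -
  interpret M': lmod M' n
    by fact
  interpret P: lmod "pairs n i 0 M" n
    by (rule lmod_pairs[OF assms(1,3)])
  have p0: "(0, 0) \<in> carrier (pairs n i 0 M)" "(0, 0) \<in> grade (pairs n i 0 M) q" for q
    using P.zero P.gr_zero by (simp_all add: zero_prod_def)
  have pa: "(a + a', b + b') \<in> carrier (pairs n i 0 M)"
    if "(a, b) \<in> carrier (pairs n i 0 M)" "(a', b') \<in> carrier (pairs n i 0 M)" for a b a' b'
    using P.add[OF that] by simp
  have pm: "(- a, - b) \<in> carrier (pairs n i 0 M)" if "(a, b) \<in> carrier (pairs n i 0 M)" for a b
    using P.uminus[OF that] by simp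
  have ga: "(a + a', b + b') \<in> grade (pairs n i 0 M) q"
    if "(a, b) \<in> grade (pairs n i 0 M) q" "(a', b') \<in> grade (pairs n i 0 M) q" for a b a' b' q
    using P.gr_add[OF that] by simp
  have gm: "(- a, - b) \<in> grade (pairs n i 0 M) q" if "(a, b) \<in> grade (pairs n i 0 M) q" for a b q
    using P.gr_uminus[OF that] by simp
  have la: "lact (pairs n i 0 M) r (a + a', b + b') = lact (pairs n i 0 M) r (a, b) + lact (pairs n i 0 M) r (a', b')"
    "ract (pairs n i 0 M) (a + a', b + b') r = ract (pairs n i 0 M) (a, b) r + ract (pairs n i 0 M) (a', b') r"
    if "r \<in> polyR n" "(a, b) \<in> carrier (pairs n i 0 M)" "(a', b') \<in> carrier (pairs n i 0 M)" for r a b a' b'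
    using P.lact_add[OF that] P.ract_add[OF that] by simp_all
  note d = tripm_simps
  show ?thesis
  proof (unfold_locales)
    fix x y
    show "x \<otimes>\<^bsub>tripm n i M M'\<^esub> y = x + y" "\<one>\<^bsub>tripm n i M M'\<^esub> = 0"
      by (simp_all add: d)
    show "0 \<in> carrier (tripm n i M M')" "0 \<in> grade (tripm n i M M') q" for q
      using d(1)[of 0 0 0] d(6)[of 0 0 0] by (simp_all add: p0 M'.zero M'.gr_zero)
    assume "x \<in> carrier (tripm n i M M')"
    then obtain a b c where x: "x = trip a b c" "(a, b) \<in> carrier (pairs n i 0 M)" "c \<in> carrier M'"
      by (rule tripmE)
    then show "- x \<in> carrier (tripm n i M M')"
      by (simp add: d pm M'.uminus)
    show "lact (tripm n i M M') 1 x = x"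
      using x by (simp add: d P.lact_one M'.lact_one)
    show "lact (tripm n i M M') r x \<in> carrier (tripm n i M M')" "ract (tripm n i M M') x r \<in> carrier (tripm n i M M')"
      if "r \<in> polyR n" for r
      using x that by (simp_all add: d P.lact M'.lact P.ract M'.ract)
    show "ract (tripm n i M M') (lact (tripm n i M M') r x) s = lact (tripm n i M M') r (ract (tripm n i M M') x s)"
      "lact (tripm n i M M') (r + s) x = lact (tripm n i M M') r x + lact (tripm n i M M') s x"
      "lact (tripm n i M M') (r * s) x = lact (tripm n i M M') r (lact (tripm n i M M') s x)"
      if "r \<in> polyR n" "s \<in> polyR n" for r s
      using x that by (simp_all add: d P.lact_ract M'.lact_ract P.lact_plus M'.lact_plus P.lact_times M'.lact_times)
    assume "y \<in> carrier (tripm n i M M')"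
    then obtain a' b' c' where y: "y = trip a' b' c'" "(a', b') \<in> carrier (pairs n i 0 M)" "c' \<in> carrier M'"
      by (rule tripmE)
    with x show "x + y \<in> carrier (tripm n i M M')"
      by (simp add: d pa M'.add)
    show "lact (tripm n i M M') r (x + y) = lact (tripm n i M M') r x + lact (tripm n i M M') r y"
      "ract (tripm n i M M') (x + y) r = ract (tripm n i M M') x r + ract (tripm n i M M') y r"
      if "r \<in> polyR n" for r
      using x y that by (simp_all add: d la M'.lact_add M'.ract_add)
  next
    fix x y q
    assume "x \<in> grade (tripm n i M M') q"
    then obtain a b c where x: "x = trip a b c" "(a, b) \<in> grade (pairs n i 0 M) q" "c \<in> grade M' (q + 1)"
      by (rule tripm_gradeE)
    then show "x \<in> carrier (tripm n i M M')" "- x \<in> grade (tripm n i M M') q"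
      by (auto simp: d gm M'.gr_uminus intro: P.gr_carrier M'.gr_carrier)
    show "lact (tripm n i M M') r x \<in> grade (tripm n i M M') (p + q)" "ract (tripm n i M M') x r \<in> grade (tripm n i M M') (p + q)"
      if "r \<in> polyR_grade n p" for r p
      using P.lact_grade[OF that x(2)] M'.lact_grade[OF that x(3)] P.ract_grade[OF that x(2)] M'.ract_grade[OF that x(3)]
      by (simp_all add: x(1) d add.assoc)
    assume "y \<in> grade (tripm n i M M') q"
    then obtain a' b' c' where y: "y = trip a' b' c'" "(a', b') \<in> grade (pairs n i 0 M) q" "c' \<in> grade M' (q + 1)"
      by (rule tripm_gradeE)
    with x show "x + y \<in> grade (tripm n i M M') q"
      by (simp add: d ga M'.gr_add)
  qed
qed

text \<open>\<open>wcx\<close> records the action of the variables and the homogeneous parts. The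
  graded bimodules needed for the comparison also have carriers with inhomogeneous elements and an
  action of every polynomial.\<close>

primrec wmod :: "nat \<Rightarrow> nat list \<Rightarrow> int \<Rightarrow> (nat list \<Rightarrow> mpoly) gbim" where
  "wmod n [] = (\<lambda>t. \<lparr>carrier = (if t = 0 then emb ` polyR n else {0}), monoid.mult = (+), one = 0,
     lact = (\<lambda>r v l. r * v l), ract = (\<lambda>v r l. v l * r), grade = piece (base n) t\<rparr>)"
| "wmod n (i # w) = (\<lambda>t. tripm n i (wmod n w t) (wmod n w (t - 1)))"

lemma lmod_wmod_Nil: "lmod (wmod n [] t) n"
proof -
  have e: "(\<lambda>l. r * emb s l) = emb (r * s)" "(\<lambda>l. emb s l * r) = emb (s * r)" for r s
    by (auto simp: emb_def fun_eq_iff)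
  have z: "(\<lambda>l :: nat list. r * 0) = (0 :: nat list \<Rightarrow> mpoly)" "(\<lambda>l :: nat list. 0 * r) = (0 :: nat list \<Rightarrow> mpoly)" for r
    by (auto simp: fun_eq_iff)
  have c: "v \<in> carrier (wmod n [] t) \<longleftrightarrow> (\<exists>r \<in> polyR n. v = emb r \<and> (t \<noteq> 0 \<longrightarrow> r = 0))" for v
    by (auto simp: polyR_simps intro: bexI[of _ 0])
  have g: "v \<in> grade (wmod n [] t) q \<longleftrightarrow> (\<exists>r \<in> polyR_grade n q. v = emb r \<and> (t \<noteq> 0 \<longrightarrow> r = 0))" for v q
    using piece_base[of v n t q] by (auto simp: emb_base zero_base)
  have ops: "lact (wmod n [] t) r (emb s) = emb (r * s)" "ract (wmod n [] t) (emb s) r = emb (s * r)"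
     "x \<otimes>\<^bsub>wmod n [] t\<^esub> y = x + y" "\<one>\<^bsub>wmod n [] t\<^esub> = 0"
     "lact (wmod n [] t) r 0 = 0" "ract (wmod n [] t) 0 r = 0" for r s x y t
    using e[of r 0] e[of 0 r] by (simp_all add: e fun_eq_iff)
  have [simp]: "0 = emb r \<longleftrightarrow> r = 0" for r
    using emb_simps(7)[of r] by metis
  show ?thesis
    by (unfold_locales; (unfold c g)?)
      (auto simp: ops algebra_simps intro: polyR_simps polyR_add polyR_uminus polyR_mult grade_simps grade_add grade_uminus
        grade_mult grade_polyR simp del: wmod.simps)
qed

lemma lmod_wmod: "w \<in> lists {1..<n} \<Longrightarrow> lmod (wmod n w t) n"
proof (induction w arbitrary: t)
  case Nil
  show ?case
    by (rule lmod_wmod_Nil)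
next
  case (Cons i w)
  then show ?case
    unfolding wmod.simps by (intro lmod_tripm) auto
qed

lemma grade_wmod: "grade (wmod n w t) q = piece (wcx n w) t q"
proof (induction w arbitrary: t q)
  case (Cons i w)
  have "v \<in> grade (wmod n (i # w) t) q \<longleftrightarrow> v \<in> piece (wcx n (i # w)) t q" for v
  proof
    assume "v \<in> grade (wmod n (i # w) t) q"
    then show "v \<in> piece (wcx n (i # w)) t q"
      unfolding wmod.simps by (rule tripm_gradeE) (simp add: piece_lten_iff pairs_simps Cons)
  next
    assume "v \<in> piece (wcx n (i # w)) t q"
    then have "v \<in> piece (lten i (Suc i) (wcx n w)) t q"
      by simp
    then show "v \<in> grade (wmod n (i # w) t) q"
      unfolding wmod.simps by (rule piece_ltenE) (simp add: tripm_simps pairs_simps Cons)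
  qed
  then show ?case
    by blast
qed simp

text \<open>The left action in \<open>lten\<close> is multiplication by x_i, x_(i+1) and the other
  variables in the basis 1, x_i; computing their invariant coefficients identifies it with the
  action of polynomials in \<open>wmod\<close>.\<close>

lemma wmod_ops:
  assumes "w \<in> lists {1..<n}" "v \<in> carrier (wmod n w t)"
  shows "lop (wcx n w) j v = lact (wmod n w t) (xvar n j) v" "rop (wcx n w) j v = ract (wmod n w t) v (xvar n j)"
    "del (wcx n w) v \<in> carrier (wmod n w (t + 1))"
    "r \<in> polyR n \<Longrightarrow> del (wcx n w) (lact (wmod n w t) r v) = lact (wmod n w (t + 1)) r (del (wcx n w) v)"
  using assms
proof (induction w arbitrary: v t j r rule: list.induct)
  case Nil
  {
    case 1
    then show ?case
      by (simp add: base_def)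
  next
    case 2
    then show ?case
      by (auto simp: base_def mult.commute)
  next
    case 3
    then show ?case
      by (auto simp: base_def intro!: image_eqI[of _ _ 0] polyR_simps)
  next
    case 4
    then show ?case
      by (auto simp: base_def fun_eq_iff)
  }
next
  case (Cons i w)
  have w: "w \<in> lists {1..<n}" "i \<in> {1..<n}" if "i # w \<in> lists {1..<n}"
    using that by auto
  have C: "bcx (wcx n w)"
    by (rule bcx_wcx)
  have ic: "icoeff0 n i (xvar n i) = 0" "icoeff1 n i (xvar n i) = 1"
    "icoeff0 n i (xvar n i * xvar n i) = - (xvar n i * xvar n (Suc i))"
    "icoeff1 n i (xvar n i * xvar n i) = xvar n i + xvar n (Suc i)"
    "icoeff0 n i (xvar n (Suc i)) = xvar n i + xvar n (Suc i)" "icoeff1 n i (xvar n (Suc i)) = - 1"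
    "icoeff0 n i (xvar n i * xvar n (Suc i)) = xvar n i * xvar n (Suc i)" "icoeff1 n i (xvar n i * xvar n (Suc i)) = 0"
    "j \<noteq> i \<Longrightarrow> j \<noteq> Suc i \<Longrightarrow> icoeff0 n i (xvar n j) = xvar n j" "j \<noteq> i \<Longrightarrow> j \<noteq> Suc i \<Longrightarrow> icoeff1 n i (xvar n j) = 0"
    "j \<noteq> i \<Longrightarrow> j \<noteq> Suc i \<Longrightarrow> icoeff0 n i (xvar n i * xvar n j) = 0"
    "j \<noteq> i \<Longrightarrow> j \<noteq> Suc i \<Longrightarrow> icoeff1 n i (xvar n i * xvar n j) = xvar n j"
    if i: "i \<in> {1..<n}" for j
  proof -
    have one: "icoeff0 n i 1 = 1" "icoeff1 n i 1 = 0"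
      using icoeff_inv(1,2)[OF i invariants_simps(3)] by auto
    show "icoeff0 n i (xvar n i) = 0" "icoeff1 n i (xvar n i) = 1"
      "icoeff0 n i (xvar n (Suc i)) = xvar n i + xvar n (Suc i)" "icoeff1 n i (xvar n (Suc i)) = - 1"
      using icoeff_mult_x[OF i polyR_simps(3)] one by simp_all
    then show "icoeff0 n i (xvar n i * xvar n i) = - (xvar n i * xvar n (Suc i))"
      "icoeff1 n i (xvar n i * xvar n i) = xvar n i + xvar n (Suc i)"
      using icoeff_mult_x(1,2)[OF i xvar_polyR, of i] by simp_all
    show "icoeff0 n i (xvar n i * xvar n (Suc i)) = xvar n i * xvar n (Suc i)" "icoeff1 n i (xvar n i * xvar n (Suc i)) = 0"
      using icoeff_inv(1,2)[OF i sym_invariants(2)[OF i]] .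
    assume j: "j \<noteq> i" "j \<noteq> Suc i"
    show "icoeff0 n i (xvar n j) = xvar n j" "icoeff1 n i (xvar n j) = 0"
      "icoeff0 n i (xvar n i * xvar n j) = 0" "icoeff1 n i (xvar n i * xvar n j) = xvar n j"
      using icoeff_inv[OF i sym_invariants(5)[OF i j]] .
  qed
  {
    case 1
    note w = w[OF 1(1)]
    interpret M: lmod "wmod n w t" n
      by (rule lmod_wmod[OF w(1)])
    from 1(2) obtain a b c where v: "v = trip a b c" and ab: "a \<in> carrier (wmod n w t)" "b \<in> carrier (wmod n w t)"
      and c: "c \<in> carrier (wmod n w (t - 1))"
      unfolding wmod.simps by (auto elim!: tripmE simp: pairs_simps)
    have L: "lop (wcx n w) j u = lact (wmod n w t) (xvar n j) u" if "u \<in> carrier (wmod n w t)" for u j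
      using Cons(1)[OF w(1) that] .
    have L': "lop (wcx n w) j c = lact (wmod n w (t - 1)) (xvar n j) c" for j
      using Cons(1)[OF w(1) c] .
    have u: "xvar n i * xvar n (Suc i) \<in> polyR n" "- (xvar n i * xvar n (Suc i)) \<in> polyR n"
      by (auto intro: polyR_mult polyR_uminus xvar_polyR)
    consider "j = i" | "j = Suc i" | "j \<noteq> i" "j \<noteq> Suc i"
      by blast
    then show ?case
      by cases (simp_all add: v lten_trip tripm_simps pairs_simps L L' ab M.lact xvar_polyR ic[OF w(2)] M.lact_0 M.lact_one
          M.lact_plus M.lact_times[symmetric] M.lact_uminus M.lact_uminus(1)[OF polyR_simps(3)] u add.assoc polyR_simps mult.commute)
  next
    case 2
    note w = w[OF 2(1)]
    from 2(2) obtain a b c where v: "v = trip a b c" and ab: "a \<in> carrier (wmod n w t)" "b \<in> carrier (wmod n w t)"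
      and c: "c \<in> carrier (wmod n w (t - 1))"
      unfolding wmod.simps by (auto elim!: tripmE simp: pairs_simps)
    then show ?case
      using Cons(2)[OF w(1) ab(1)] Cons(2)[OF w(1) ab(2)] Cons(2)[OF w(1) c]
      by (simp add: lten_trip tripm_simps pairs_simps)
  next
    case 3
    note w = w[OF 3(1)]
    interpret M: lmod "wmod n w t" n
      by (rule lmod_wmod[OF w(1)])
    from 3(2) obtain a b c where v: "v = trip a b c" and ab: "a \<in> carrier (wmod n w t)" "b \<in> carrier (wmod n w t)"
      and c: "c \<in> carrier (wmod n w (t - 1))"
      unfolding wmod.simps by (auto elim!: tripmE simp: pairs_simps)
    have "a + lop (wcx n w) i b + - del (wcx n w) c \<in> carrier (wmod n w t)"
      unfolding Cons(1)[OF w(1) ab(2)] using Cons(3)[OF w(1) c] ab by (intro M.add M.uminus M.lact xvar_polyR) auto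
    then show ?case
      using v Cons(3)[OF w(1) ab(1)] Cons(3)[OF w(1) ab(2)] by (simp add: lten_trip tripm_simps pairs_simps)
  next
    case 4
    note w = w[OF 4(2)]
    interpret C: bcx "wcx n w"
      by (rule C)
    interpret M: lmod "wmod n w t" n
      by (rule lmod_wmod[OF w(1)])
    interpret M': lmod "wmod n w (t + 1)" n
      by (rule lmod_wmod[OF w(1)])
    from 4(3) obtain a b c where v: "v = trip a b c" and ab: "a \<in> carrier (wmod n w t)" "b \<in> carrier (wmod n w t)"
      and c: "c \<in> carrier (wmod n w (t - 1))"
      unfolding wmod.simps by (auto elim!: tripmE simp: pairs_simps)
    note r = 4(1)
    have xr: "xvar n i * r \<in> polyR n"
      using r by (simp add: polyR_mult xvar_polyR)
    note m = icoeff(4,5)[OF w(2) r] icoeff(4,5)[OF w(2) xr]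
    have L: "lop (wcx n w) i u = lact (wmod n w t) (xvar n i) u" if "u \<in> carrier (wmod n w t)" for u
      using Cons(1)[OF w(1) that] .
    have D: "del (wcx n w) (lact (wmod n w t) s u) = lact (wmod n w (t + 1)) s (del (wcx n w) u)"
      if "u \<in> carrier (wmod n w t)" "s \<in> polyR n" for u s
      using Cons(4)[OF that(2) w(1) that(1)] .
    have D': "del (wcx n w) (lact (wmod n w (t - 1)) r c) = lact (wmod n w t) r (del (wcx n w) c)"
      using Cons(4)[OF r w(1) c] by simp
    have dc: "del (wcx n w) c \<in> carrier (wmod n w t)"
      using Cons(3)[OF w(1) c] by simp
    have ic: "lact (wmod n w t) (icoeff0 n i s) u + lact (wmod n w t) (xvar n i) (lact (wmod n w t) (icoeff1 n i s) u) = lact (wmod n w t) s u"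
      if "s \<in> polyR n" "u \<in> carrier (wmod n w t)" for s u
      using that icoeff(3-5)[OF w(2) that(1)] M.lact_plus[of "icoeff0 n i s" "xvar n i * icoeff1 n i s" u]
        M.lact_times[of "xvar n i" "icoeff1 n i s" u] by (simp add: polyR_mult xvar_polyR)
    let ?l = "lact (wmod n w t)"
    have "(?l (icoeff0 n i r) a + ?l (icoeff0 n i (xvar n i * r)) b) + ?l (xvar n i) (?l (icoeff1 n i r) a + ?l (icoeff1 n i (xvar n i * r)) b)
      = (?l (icoeff0 n i r) a + ?l (xvar n i) (?l (icoeff1 n i r) a)) + (?l (icoeff0 n i (xvar n i * r)) b + ?l (xvar n i) (?l (icoeff1 n i (xvar n i * r)) b))"
      using m ab by (simp add: M.lact_add M.lact xvar_polyR add_ac)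
    also have "\<dots> = ?l r a + ?l r (?l (xvar n i) b)"
      using ic[OF r ab(1)] ic[OF xr ab(2)] M.lact_times[OF r xvar_polyR ab(2), of i] by (simp add: mult.commute)
    finally have e: "(?l (icoeff0 n i r) a + ?l (icoeff0 n i (xvar n i * r)) b) + ?l (xvar n i) (?l (icoeff1 n i r) a + ?l (icoeff1 n i (xvar n i * r)) b)
      - ?l r (del (wcx n w) c) = ?l r (a + ?l (xvar n i) b + - del (wcx n w) c)"
      using r ab dc by (simp add: M.lact_add M.lact xvar_polyR M.add M.lact_diff)
    have L2: "lop (wcx n w) i (?l (icoeff1 n i r) a + ?l (icoeff1 n i (xvar n i * r)) b)
      = ?l (xvar n i) (?l (icoeff1 n i r) a + ?l (icoeff1 n i (xvar n i * r)) b)"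
      using m ab by (intro L M.add M.lact)
    show ?case
      using e by (simp add: v lten_trip tripm_simps pairs_simps C.del_add D D' ab m L L2)
  }
qed

definition component :: "int \<Rightarrow> (nat list \<Rightarrow> mpoly) \<Rightarrow> (nat list \<Rightarrow> mpoly) \<times> (nat list \<Rightarrow> mpoly)" where
  "component k v = (if k = 0 then (part 0 v, part (Suc 0) v) else if k = 1 then (part 2 v, 0) else 0)"

definition cpx_model :: "nat \<Rightarrow> nat list \<Rightarrow> nat cpx \<Rightarrow> (int \<Rightarrow> (nat list \<Rightarrow> mpoly) \<Rightarrow> nat) \<Rightarrow> bool" where
  "cpx_model n w C \<gamma> \<longleftrightarrow> (\<forall>t. giso n (\<gamma> t) (wmod n w t) (obj C t) \<and>
     (\<forall>v\<in>carrier (wmod n w t). diff C t (\<gamma> t v) = \<gamma> (t + 1) (del (wcx n w) v)))"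

lemma cpx_model_Nil: "\<exists>\<gamma>. cpx_model n [] (rouquier n []) \<gamma>"
proof -
  define \<gamma> where "\<gamma> t v = (if t = 0 then to_nat_on (polyR n) (v []) else 0)" for t :: int and v :: "nat list \<Rightarrow> mpoly"
  have "giso n (\<gamma> t) (wmod n [] t) (obj (rouquier n []) t)" for t
  proof (cases "t = 0")
    case True
    have c: "carrier (regular_bim n) = polyR n"
      by (simp add: regular_bim_def)
    have e: "(\<lambda>l. r * emb s l) = emb (r * s)" "(\<lambda>l. emb s l * r) = emb (s * r)" for r s
      by (auto simp: emb_def fun_eq_iff)
    have "bij_betw (\<lambda>v. v []) (carrier (wmod n [] 0)) (polyR n)"
      by (rule bij_betwI[of _ _ _ emb]) auto
    moreover have "(\<lambda>v. v []) ` grade (wmod n [] 0) q = polyR_grade n q" for q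
      by (auto simp: base_def image_image)
    ultimately have "giso n (\<lambda>v. v []) (wmod n [] 0) (regular_bim n)"
      unfolding giso_def c by (auto simp: regular_bim_def)
    from giso_trans[OF this giso_relabel] have "giso n (\<lambda>v. to_nat_on (polyR n) (v [])) (wmod n [] 0) (relabel (regular_bim n))"
      unfolding c by (auto simp: countable_polyR regular_bim_def polyR_add)
    with True show ?thesis
      by (simp add: \<gamma>_def[abs_def] unit_cpx_def)
  next
    case False
    then show ?thesis
      by (auto simp: \<gamma>_def giso_def unit_cpx_def zero_bim_def bij_betw_def base_def fun_eq_iff)
  qed
  moreover have "diff (rouquier n []) t (\<gamma> t v) = \<gamma> (t + 1) (del (wcx n []) v)" for t v
    using gisoD(4)[OF calculation[of 0]] by (auto simp: unit_cpx_def base_def \<gamma>_def)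
  ultimately show ?thesis
    unfolding cpx_model_def by blast
qed

text \<open>The direct sum runs over all integers, but \<open>pairs\<close> is zero unless k is 0 or
  1. The family P stands for the second factors in the remaining degrees.\<close>

lemma giso_bim_sum:
  assumes lm: "lmod M n" "lmod M' n" and i: "i \<in> {1..<n}"
    and \<tau>: "\<And>k. giso n (\<tau> k) (pairs n i k (if k = 0 then M else if k = 1 then M' else P k)) (B k)"
    and P: "\<And>k. lmod (P k) n"
  shows "giso n (\<lambda>v k. \<tau> k (component k v)) (tripm n i M M') (bim_sum B)"
proof -
  define Q where "Q k = (if k = 0 then M else if k = 1 then M' else P k)" for k :: int
  have Q: "lmod (pairs n i k (Q k)) n" for k
    unfolding Q_def using lmod_pairs[OF _ i] lm P by auto
  have \<tau>': "giso n (\<tau> k) (pairs n i k (Q k)) (B k)" for k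
    using \<tau> by (simp add: Q_def)
  note g = gisoD[OF \<tau>']
  have group: "group (B k)" for k
    using giso_comm_group[OF mbim.axioms(1)[OF lmod.axioms(1)[OF Q]] \<tau>'] by (rule comm_group.axioms(2))
  have car: "carrier (bim_sum B) = {x. (\<forall>k. x k \<in> carrier (B k)) \<and> finite {k. x k \<noteq> \<one>\<^bsub>B k\<^esub>}}"
    using carrier_sum_group[of UNIV B] group by (auto simp: bim_sum_def Let_def PiE_iff)
  have ops: "x \<otimes>\<^bsub>bim_sum B\<^esub> y = (\<lambda>k. x k \<otimes>\<^bsub>B k\<^esub> y k)" "\<one>\<^bsub>bim_sum B\<^esub> = (\<lambda>k. \<one>\<^bsub>B k\<^esub>)"
    "lact (bim_sum B) r x = (\<lambda>k. lact (B k) r (x k))" "ract (bim_sum B) x r = (\<lambda>k. ract (B k) (x k) r)"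
    "grade (bim_sum B) q = {x \<in> carrier (bim_sum B). \<forall>k. x k \<in> grade (B k) q}" for x y r q
    by (simp_all add: bim_sum_def Let_def fun_eq_iff)
  have component: "component k v \<in> carrier (pairs n i k (Q k))" if "v \<in> carrier (tripm n i M M')" for k v
    using that by (auto elim!: tripmE simp: component_def Q_def pairs_simps)
  have gcomp: "component k v \<in> grade (pairs n i k (Q k)) q" if "v \<in> grade (tripm n i M M') q" for k v q
    using that by (auto elim!: tripm_gradeE simp: component_def Q_def pairs_simps)
  have one: "\<tau> k 0 = \<one>\<^bsub>B k\<^esub>" for k
    using g(4)[of k] by (simp add: pairs_simps)
  have into: "(\<lambda>k. \<tau> k (component k v)) \<in> carrier (bim_sum B)" if "v \<in> carrier (tripm n i M M')" for v
  proof -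
    have "{k. \<tau> k (component k v) \<noteq> \<one>\<^bsub>B k\<^esub>} \<subseteq> {0, 1}"
      by (auto simp: component_def one)
    then have "finite {k. \<tau> k (component k v) \<noteq> \<one>\<^bsub>B k\<^esub>}"
      by (rule finite_subset) simp
    then show ?thesis
      using g(2) component[OF that] by (simp add: car)
  qed
  have surj: "\<exists>v. x = (\<lambda>k. \<tau> k (component k v)) \<and> (\<forall>k. component k v = u k) \<and> v = trip (fst (u 0)) (snd (u 0)) (fst (u 1))"
    if "\<And>k. u k \<in> carrier (pairs n i k (Q k))" "\<And>k. x k = \<tau> k (u k)" for x u
  proof (intro exI conjI allI)
    show c: "component k (trip (fst (u 0)) (snd (u 0)) (fst (u 1))) = u k" for k
      using that(1)[of k] by (auto simp: component_def pairs_simps prod_eq_iff)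
    show "x = (\<lambda>k. \<tau> k (component k (trip (fst (u 0)) (snd (u 0)) (fst (u 1)))))"
      unfolding c by (rule ext) (rule that(2))
  qed (rule refl)
  show ?thesis
    unfolding giso_def
  proof (intro conjI ballI allI)
    show "bij_betw (\<lambda>v k. \<tau> k (component k v)) (carrier (tripm n i M M')) (carrier (bim_sum B))"
      unfolding bij_betw_def
    proof
      show "inj_on (\<lambda>v k. \<tau> k (component k v)) (carrier (tripm n i M M'))"
      proof (rule inj_onI)
        fix v v'
        assume v: "v \<in> carrier (tripm n i M M')" "v' \<in> carrier (tripm n i M M')"
          and eq: "(\<lambda>k. \<tau> k (component k v)) = (\<lambda>k. \<tau> k (component k v'))"
        have "component k v = component k v'" for k
          using fun_cong[OF eq, of k] g(9)[OF component[OF v(1)] component[OF v(2)]] by simp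
        from this[of 0] this[of 1] v show "v = v'"
          by (auto elim!: tripmE simp: component_def)
      qed
      show "(\<lambda>v k. \<tau> k (component k v)) ` carrier (tripm n i M M') = carrier (bim_sum B)"
      proof (intro equalityI subsetI)
        fix x
        assume "x \<in> carrier (bim_sum B)"
        then have "\<forall>k. \<exists>u. u \<in> carrier (pairs n i k (Q k)) \<and> x k = \<tau> k u"
          using gisoE[OF \<tau>'] unfolding car by blast
        then obtain u where u: "\<And>k. u k \<in> carrier (pairs n i k (Q k))" "\<And>k. x k = \<tau> k (u k)"
          by metis
        from surj[of u x, OF u] obtain v where v: "x = (\<lambda>k. \<tau> k (component k v))" "v = trip (fst (u 0)) (snd (u 0)) (fst (u 1))"
          by blast
        have "v \<in> carrier (tripm n i M M')"
          using u(1)[of 0] u(1)[of 1] by (simp add: v(2) tripm_simps pairs_simps Q_def)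
        with v(1) show "x \<in> (\<lambda>v k. \<tau> k (component k v)) ` carrier (tripm n i M M')"
          by blast
      qed (use into in blast)
    qed
    fix v
    assume v: "v \<in> carrier (tripm n i M M')"
    show "(\<lambda>k. \<tau> k (component k (v \<otimes>\<^bsub>tripm n i M M'\<^esub> v'))) = (\<lambda>k. \<tau> k (component k v)) \<otimes>\<^bsub>bim_sum B\<^esub> (\<lambda>k. \<tau> k (component k v'))"
      if "v' \<in> carrier (tripm n i M M')" for v'
    proof -
      have "component k (v + v') = component k v + component k v'" for k
        by (simp add: component_def)
      then show ?thesis
        using g(3)[OF component[OF v] component[OF that]] by (simp add: ops tripm_simps pairs_simps)
    qed
    fix r
    assume r: "r \<in> polyR n"
    interpret M': lmod M' n
      by fact
    interpret Pk: lmod "P k" n for k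
      by (rule P)
    have "component k (lact (tripm n i M M') r v) = lact (pairs n i k (Q k)) r (component k v)"
      "component k (ract (tripm n i M M') v r) = ract (pairs n i k (Q k)) (component k v) r" for k
      using v r by (auto elim!: tripmE simp: component_def tripm_simps pairs_simps Q_def M'.lact_0 Pk.lact_0 zero_prod_def)
    then show "(\<lambda>k. \<tau> k (component k (lact (tripm n i M M') r v))) = lact (bim_sum B) r (\<lambda>k. \<tau> k (component k v))"
      "(\<lambda>k. \<tau> k (component k (ract (tripm n i M M') v r))) = ract (bim_sum B) (\<lambda>k. \<tau> k (component k v)) r"
      using g(5,6)[OF r component[OF v]] by (simp_all add: ops)
  next
    have "component k 0 = 0" for k
      by (simp add: component_def zero_prod_def)
    then show "(\<lambda>k. \<tau> k (component k \<one>\<^bsub>tripm n i M M'\<^esub>)) = \<one>\<^bsub>bim_sum B\<^esub>"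
      by (simp add: ops tripm_simps one)
  next
    fix q
    show "(\<lambda>v k. \<tau> k (component k v)) ` grade (tripm n i M M') q = grade (bim_sum B) q"
    proof (intro equalityI subsetI)
      fix x
      assume "x \<in> (\<lambda>v k. \<tau> k (component k v)) ` grade (tripm n i M M') q"
      then obtain v where v: "v \<in> grade (tripm n i M M') q" "x = (\<lambda>k. \<tau> k (component k v))"
        by blast
      have "v \<in> carrier (tripm n i M M')"
        using v(1) lmod_tripm[OF lm i] by (auto intro: addm.gr_carrier[OF mbim.axioms(1)[OF lmod.axioms(1)]])
      then show "x \<in> grade (bim_sum B) q"
        using into[of v] g(8)[OF gcomp[OF v(1)]] by (simp add: ops v(2))
    next
      fix x
      assume x: "x \<in> grade (bim_sum B) q"
      have "\<forall>k. \<exists>u. u \<in> grade (pairs n i k (Q k)) q \<and> x k = \<tau> k u"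
      proof
        fix k
        have "x k \<in> \<tau> k ` grade (pairs n i k (Q k)) q"
          using x unfolding ops g(7) by blast
        then show "\<exists>u. u \<in> grade (pairs n i k (Q k)) q \<and> x k = \<tau> k u"
          by blast
      qed
      then obtain u where u: "\<And>k. u k \<in> grade (pairs n i k (Q k)) q" "\<And>k. x k = \<tau> k (u k)"
        by metis
      have "u k \<in> carrier (pairs n i k (Q k))" for k
        using u(1) addm.gr_carrier[OF mbim.axioms(1)[OF lmod.axioms(1)[OF Q]]] by blast
      from surj[of u x, OF this u(2)] obtain v where v: "x = (\<lambda>k. \<tau> k (component k v))" "v = trip (fst (u 0)) (snd (u 0)) (fst (u 1))"
        by blast
      have "v \<in> grade (tripm n i M M') q"
        using u(1)[of 0] u(1)[of 1] by (simp add: v(2) tripm_simps pairs_simps Q_def)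
      with v(1) show "x \<in> (\<lambda>v k. \<tau> k (component k v)) ` grade (tripm n i M M') q"
        by blast
    qed
  qed
qed

lemma cpx_model_Cons:
  assumes i: "i \<in> {1..<n}" and w: "w \<in> lists {1..<n}" and \<gamma>: "cpx_model n w (rouquier n w) \<gamma>"
  shows "\<exists>\<gamma>'. cpx_model n (i # w) (rouquier n (i # w)) \<gamma>'"
proof -
  define F where "F = rouquier_gen n i"
  define G where "G = rouquier n w"
  let ?S = "polyR n" and ?R = "regular_bim n"
  have \<gamma>g: "giso n (\<gamma> s) (wmod n w s) (obj G s)" and \<gamma>d: "v \<in> carrier (wmod n w s) \<Longrightarrow> diff G s (\<gamma> s v) = \<gamma> (s + 1) (del (wcx n w) v)" for s v
    using \<gamma> by (auto simp: cpx_model_def G_def)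
  have W: "lmod (wmod n w s) n" for s
    by (rule lmod_wmod[OF w])
  interpret C: bcx "wcx n w"
    by (rule bcx_wcx)
  define \<tau> where "\<tau> k s = tensor_model.iso ?S (obj F k) (obj G s) (gen_iso n i k) (\<gamma> s) (unit0 k) (unit1 k) fst snd" for k s
  have TM: "tensor_model n (pairs n i k ?R) (wmod n w s) (pairs n i k (wmod n w s)) ?S (obj F k) (obj G s) (gen_iso n i k) (\<gamma> s)
      (bil (wmod n w s)) (unit0 k) (unit1 k) fst snd fst snd (- 1) 1" for k s
    unfolding F_def by (rule tensor_model_pairs[OF W i giso_gen[OF i] \<gamma>g])
  have \<tau>g: "giso n (\<tau> k s) (pairs n i k (wmod n w s)) (tensor ?S (obj F k) (obj G s))" for k s
    unfolding \<tau>_def by (rule tensor_model.giso_iso[OF TM])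
  define X where "X = cpx_tensor ?S F G"
  define \<Gamma> where "\<Gamma> t v = (\<lambda>k. \<tau> k (t - k) (component k v))" for t :: int and v
  have \<Gamma>g: "giso n (\<Gamma> t) (wmod n (i # w) t) (obj X t)" for t
  proof -
    have "giso n (\<lambda>v k. \<tau> k (t - k) (component k v)) (tripm n i (wmod n w t) (wmod n w (t - 1)))
        (bim_sum (\<lambda>k. tensor ?S (obj F k) (obj G (t - k))))"
    proof (rule giso_bim_sum[OF W W i _ W])
      fix k
      show "giso n (\<tau> k (t - k)) (pairs n i k (if k = 0 then wmod n w t else if k = 1 then wmod n w (t - 1) else wmod n w (t - k)))
          (tensor ?S (obj F k) (obj G (t - k)))"
        using \<tau>g[of k "t - k"] by auto
    qed
    then show ?thesis
      by (simp add: \<Gamma>_def[abs_def] X_def cpx_tensor_def)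
  qed
  have \<Gamma>d: "diff X t (\<Gamma> t v) = \<Gamma> (t + 1) (del (wcx n (i # w)) v)" if v: "v \<in> carrier (wmod n (i # w) t)" for t v
  proof
    fix k
    define s where "s = t + 1 - k"
    let ?T = "tensor ?S (obj F k) (obj G s)"
    obtain a b c where abc: "v = trip a b c" "a \<in> carrier (wmod n w t)" "b \<in> carrier (wmod n w t)" "c \<in> carrier (wmod n w (t - 1))"
      using v unfolding wmod.simps by (auto elim!: tripmE simp: pairs_simps)
    have cc: "component j v \<in> carrier (pairs n i j (wmod n w (t - j)))" for j
      using abc by (auto simp: component_def pairs_simps)
    interpret Ws: lmod "wmod n w s" n
      by (rule W)
    interpret W': lmod "wmod n w (t - k)" n
      by (rule W)
    interpret TM: tensor_model n "pairs n i k ?R" "wmod n w s" "pairs n i k (wmod n w s)" ?S "obj F k" "obj G s" "gen_iso n i k" "\<gamma> s"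
      "bil (wmod n w s)" "unit0 k" "unit1 k" fst snd fst snd "- 1" 1
      by (rule TM)
    have sk: "t - (k - 1) = s" "t - k + 1 = s" "k - 1 + 1 = k"
      by (simp_all add: s_def)
    define u where "u = component (k - 1) v"
    have u: "u \<in> carrier (pairs n i (k - 1) (wmod n w s))"
      using cc[of "k - 1"] by (simp add: u_def sk)
    have us: "fst u \<in> carrier (wmod n w s)" "snd u \<in> carrier (wmod n w s)"
      using u Ws.zero by (auto simp: pairs_simps split: if_splits)
    have "tensor_map ?S (obj F k) (obj G s) (diff F (k - 1)) id (\<tau> (k - 1) s u)
      = \<tau> k s (bil (wmod n w s) (gen_diff n i (k - 1) (unit0 (k - 1))) (fst u) + bil (wmod n w s) (gen_diff n i (k - 1) (unit1 (k - 1))) (snd u))"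
      using tensor_map_iso[OF TM[of "k - 1" s] TM[of k s], where \<phi> = "gen_diff n i (k - 1)" and u = "diff F (k - 1)"
            and \<psi> = "\<lambda>y. y" and k = id and v = u]
        rlin_gen_diff[OF i, of "k - 1"] gen_iso_diff[OF i, of _ "k - 1"] u
      unfolding \<tau>_def by (simp add: sk F_def llin_def)
    also have "bil (wmod n w s) (gen_diff n i (k - 1) (unit0 (k - 1))) (fst u) + bil (wmod n w s) (gen_diff n i (k - 1) (unit1 (k - 1))) (snd u)
      = (if k = 1 then (fst u + lop (wcx n w) i (snd u), 0) else 0)"
      using us by (auto simp: bil_def gen_diff_def unit0_def unit1_def Ws.lact_0 Ws.lact_one zero_prod_def wmod_ops(1)[OF w])
    finally have 1: "tensor_map ?S (obj F k) (obj G s) (diff F (k - 1)) id (\<tau> (k - 1) s u)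
      = \<tau> k s (if k = 1 then (fst u + lop (wcx n w) i (snd u), 0) else 0)" .
    \<comment> \<open>The Koszul sign (-1)^k; at k = 1 it is the minus sign before
      \<open>del C c\<close> in \<open>lten\<close>.\<close>
    define \<psi> where "\<psi> y = (if even k then del (wcx n w) y else - del (wcx n w) y)" for y
    have \<psi>: "\<psi> y \<in> carrier (wmod n w s)" if "y \<in> carrier (wmod n w (t - k))" for y
      using wmod_ops(3)[OF w that] by (simp add: \<psi>_def sk Ws.uminus)
    define u' where "u' = component k v"
    have u': "u' \<in> carrier (pairs n i k (wmod n w (t - k)))"
      using cc[of k] by (simp add: u'_def)
    have us': "fst u' \<in> carrier (wmod n w (t - k))" "snd u' \<in> carrier (wmod n w (t - k))"
      using u' W'.zero by (auto simp: pairs_simps split: if_splits)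
    have k: "(if even k then diff G (t - k) (\<gamma> (t - k) y) else inv\<^bsub>obj G s\<^esub> (diff G (t - k) (\<gamma> (t - k) y))) = \<gamma> s (\<psi> y)"
      if "y \<in> carrier (wmod n w (t - k))" for y
      using \<gamma>d[OF that] giso_inv[OF Ws.addm_axioms \<gamma>g wmod_ops(3)[OF w that, unfolded sk]] by (simp add: \<psi>_def sk)
    have "llin ?S (wmod n w (t - k)) (wmod n w s) \<psi>"
      unfolding llin_def using wmod_ops(4)[OF w, of _ "t - k"] wmod_ops(3)[OF w, of _ "t - k"]
      by (auto simp: \<psi> Ws.mult W'.mult \<psi>_def C.del_add sk Ws.lact_uminus Ws.uminus)
    then have "tensor_map ?S (obj F k) (obj G s) id (\<lambda>y. if even k then diff G (t - k) y else inv\<^bsub>obj G s\<^esub> (diff G (t - k) y)) (\<tau> k (t - k) u')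
      = \<tau> k s (bil (wmod n w s) (unit0 k) (\<psi> (fst u')) + bil (wmod n w s) (unit1 k) (\<psi> (snd u')))"
      using tensor_map_iso[OF TM[of k "t - k"] TM[of k s], where \<phi> = "\<lambda>x. x" and u = id and \<psi> = \<psi>
          and k = "\<lambda>y. if even k then diff G (t - k) y else inv\<^bsub>obj G s\<^esub> (diff G (t - k) y)" and v = u'] u' k
      unfolding \<tau>_def by (simp add: rlin_def)
    also have "bil (wmod n w s) (unit0 k) (\<psi> (fst u')) + bil (wmod n w s) (unit1 k) (\<psi> (snd u')) = (\<psi> (fst u'), \<psi> (snd u'))"
    proof -
      have "\<psi> 0 = 0"
        by (simp add: \<psi>_def C.op_0)
      then have "(\<psi> (fst u'), \<psi> (snd u')) \<in> carrier (pairs n i k (wmod n w s))"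
        using u' by (auto simp: pairs_simps \<psi>)
      from TM.b_f[OF this] show ?thesis
        by simp
    qed
    finally have 2: "tensor_map ?S (obj F k) (obj G s) id (\<lambda>y. if even k then diff G (t - k) y else inv\<^bsub>obj G s\<^esub> (diff G (t - k) y)) (\<tau> k (t - k) u')
      = \<tau> k s (\<psi> (fst u'), \<psi> (snd u'))" .
    have m: "(if k = 1 then (fst u + lop (wcx n w) i (snd u), 0) else 0) \<in> carrier (pairs n i k (wmod n w s))"
      using us Ws.add[OF us(1) Ws.lact[OF xvar_polyR us(2), of i]] wmod_ops(1)[OF w us(2)] Ws.zero by (auto simp: pairs_simps)
    have m': "(\<psi> (fst u'), \<psi> (snd u')) \<in> carrier (pairs n i k (wmod n w s))"
      using u' C.op_0(3) by (auto simp: pairs_simps \<psi> intro: \<psi>) (auto simp: \<psi>_def)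
    have "diff X t (\<Gamma> t v) k = tensor_map ?S (obj F k) (obj G s) (diff F (k - 1)) id (\<tau> (k - 1) s u) \<otimes>\<^bsub>?T\<^esub>
      tensor_map ?S (obj F k) (obj G s) id (\<lambda>y. if even k then diff G (t - k) y else inv\<^bsub>obj G s\<^esub> (diff G (t - k) y)) (\<tau> k (t - k) u')"
      by (simp add: X_def cpx_tensor_def \<Gamma>_def u_def u'_def sk(1) cong: if_cong flip: s_def)
    also have "\<dots> = \<tau> k s ((if k = 1 then (fst u + lop (wcx n w) i (snd u), 0) else 0) + (\<psi> (fst u'), \<psi> (snd u')))"
      unfolding 1 2 using gisoD(3)[OF \<tau>g m m'] by (simp add: pairs_simps)
    also have "(if k = 1 then (fst u + lop (wcx n w) i (snd u), 0) else 0) + (\<psi> (fst u'), \<psi> (snd u')) = component k (del (wcx n (i # w)) v)"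
      by (auto simp: u_def u'_def component_def \<psi>_def abc(1) lten_trip zero_prod_def C.op_0)
    finally show "diff X t (\<Gamma> t v) k = \<Gamma> (t + 1) (del (wcx n (i # w)) v) k"
      by (simp add: \<Gamma>_def s_def)
  qed
  have W2: "lmod (wmod n (i # w) t) n" for t
    using i w by (intro lmod_wmod) auto
  \<comment> \<open>The isomorphism for w takes values in the natural numbers.\<close>
  have cnt: "countable (carrier (wmod n w s))" for s
    using gisoD(1)[OF \<gamma>g, of s] by (rule bij_betw_imp_inj_on[THEN countable_image_inj_on[rotated]]) simp
  have "countable (carrier (wmod n (i # w) t))" for t
  proof (rule countable_subset)
    show "carrier (wmod n (i # w) t) \<subseteq> (\<lambda>(a, b, c). trip a b c) ` (carrier (wmod n w t) \<times> carrier (wmod n w t) \<times> carrier (wmod n w (t - 1)))"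
    proof
      fix v
      assume "v \<in> carrier (wmod n (i # w) t)"
      then obtain a b c where "v = trip a b c" "a \<in> carrier (wmod n w t)" "b \<in> carrier (wmod n w t)" "c \<in> carrier (wmod n w (t - 1))"
        unfolding wmod.simps by (auto elim!: tripmE simp: pairs_simps)
      then show "v \<in> (\<lambda>(a, b, c). trip a b c) ` (carrier (wmod n w t) \<times> carrier (wmod n w t) \<times> carrier (wmod n w (t - 1)))"
        by (intro image_eqI[of _ _ "(a, b, c)"]) auto
    qed
    show "countable ((\<lambda>(a, b, c). trip a b c) ` (carrier (wmod n w t) \<times> carrier (wmod n w t) \<times> carrier (wmod n w (t - 1))))"
      by (intro countable_image countable_SIGMA cnt)
  qed
  then have cX: "countable (carrier (obj X t))" for t
    using gisoD(1)[OF \<Gamma>g, of t] by (metis bij_betw_imp_surj_on countable_image)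
  have cm: "x \<otimes>\<^bsub>obj X t\<^esub> y \<in> carrier (obj X t)" if "x \<in> carrier (obj X t)" "y \<in> carrier (obj X t)" for x y t
  proof -
    interpret comm_group "obj X t"
      by (rule giso_comm_group[OF mbim.axioms(1)[OF lmod.axioms(1)[OF W2]] \<Gamma>g])
    show ?thesis
      using that by simp
  qed
  have "cpx_model n (i # w) (relabel_cpx X) (\<lambda>t v. to_nat_on (carrier (obj X t)) (\<Gamma> t v))"
    unfolding cpx_model_def
  proof (intro allI conjI ballI)
    fix t
    show "giso n (\<lambda>v. to_nat_on (carrier (obj X t)) (\<Gamma> t v)) (wmod n (i # w) t) (obj (relabel_cpx X) t)"
      unfolding relabel_cpx_def using giso_trans[OF \<Gamma>g giso_relabel[OF cX cm]] by simp
    fix v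
    assume v: "v \<in> carrier (wmod n (i # w) t)"
    then show "diff (relabel_cpx X) t (to_nat_on (carrier (obj X t)) (\<Gamma> t v)) = to_nat_on (carrier (obj X (t + 1))) (\<Gamma> (t + 1) (del (wcx n (i # w)) v))"
      using \<Gamma>d[OF v] gisoD(2)[OF \<Gamma>g v] by (simp add: relabel_cpx_def relabel_map_def cX)
  qed
  then show ?thesis
    by (auto simp: X_def F_def G_def)
qed

lemma rouquier_model: "w \<in> lists {1..<n} \<Longrightarrow> \<exists>\<gamma>. cpx_model n w (rouquier n w) \<gamma>"
proof (induction w)
  case Nil
  show ?case
    by (rule cpx_model_Nil)
next
  case (Cons i w)
  then obtain \<gamma> where "cpx_model n w (rouquier n w) \<gamma>" "i \<in> {1..<n}" "w \<in> lists {1..<n}"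
    by auto
  then show ?case
    by (intro cpx_model_Cons)
qed

section \<open>Homology\<close>

text \<open>Coordinates are taken with respect to the left factors, so right multiplication happens
  in the last factor R.\<close>

lemma wmod_ract: "u \<in> carrier (wmod n w t) \<Longrightarrow> ract (wmod n w t) u r = (\<lambda>l. u l * r)"
proof (induction w arbitrary: u t)
  case (Cons i w)
  then show ?case
    unfolding wmod.simps by (auto elim!: tripmE simp: tripm_simps pairs_simps trip_def fun_eq_iff split: list.split)
qed simp

lemma wmod_lact_const:
  assumes "w \<in> lists {1..<n}" "u \<in> carrier (wmod n w t)"
  shows "lact (wmod n w t) (const_poly c) u = (\<lambda>l. u l * const_poly c)"
  using assms
proof (induction w arbitrary: u t rule: list.induct)
  case Nil
  then show ?case
    by (simp add: mult.commute)
next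
  case (Cons i w)
  then have i: "i \<in> {1..<n}" and w: "w \<in> lists {1..<n}"
    by auto
  interpret lmod "wmod n w t" n
    by (rule lmod_wmod[OF w])
  obtain a b c' where u: "u = trip a b c'" "a \<in> carrier (wmod n w t)" "b \<in> carrier (wmod n w t)" "c' \<in> carrier (wmod n w (t - 1))"
    using Cons.prems(2) unfolding wmod.simps by (auto elim!: tripmE simp: pairs_simps)
  have "trip (\<lambda>l. a l * p) (\<lambda>l. b l * p) (\<lambda>l. c' l * p) = (\<lambda>l. trip a b c' l * p)" for p
    by (auto simp: trip_def fun_eq_iff split: list.split)
  then show ?case
    using u Cons.IH[OF w] icoeff_inv[OF i invariants_simps(1), of c] by (simp add: tripm_simps pairs_simps lact_0)
qed

definition cent :: "nat \<Rightarrow> nat list \<Rightarrow> int \<Rightarrow> (nat list \<Rightarrow> mpoly) set" where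
  "cent n w t = {u \<in> carrier (wmod n w t). \<forall>j. lop (wcx n w) j u = rop (wcx n w) j u}"

text \<open>Centrality is tested on the variables only. Constants act alike on both sides, and
  \<alpha>_k = x_k - x_(k+1), so the variables and constants generate R.\<close>

lemma cent_lact:
  assumes w: "w \<in> lists {1..<n}" and u: "u \<in> cent n w t" and r: "r \<in> polyR n"
  shows "lact (wmod n w t) r u = ract (wmod n w t) u r"
  using r
proof (induction r rule: polyR_induct)
  case (const c)
  then show ?case
    using u wmod_lact_const[OF w] wmod_ract by (simp add: cent_def)
next
  interpret lmod "wmod n w t" n
    by (rule lmod_wmod[OF w])
  have c: "u \<in> carrier (wmod n w t)" and x: "lact (wmod n w t) (xvar n j) u = ract (wmod n w t) u (xvar n j)" for j
    using u wmod_ops(1,2)[OF w, of u t j] by (auto simp: cent_def)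
  {
    case (add p p')
    then show ?case
      using c by (simp add: lact_plus wmod_ract distrib_left fun_eq_iff)
  next
    case (alpha k p)
    have k: "alpha k = xvar n k + - xvar n (Suc k)"
      using alpha_xvar[OF alpha(1)] by simp
    have kR: "alpha k \<in> polyR n"
      by (rule polyR_simps(4)[OF alpha(1)])
    have "lact (wmod n w t) (alpha k) u = lact (wmod n w t) (xvar n k) u + - lact (wmod n w t) (xvar n (Suc k)) u"
      unfolding k by (simp only: lact_plus lact_uminus polyR_uminus xvar_polyR c)
    also have "\<dots> = ract (wmod n w t) u (alpha k)"
      by (simp add: x k wmod_ract[OF c] fun_eq_iff algebra_simps)
    finally have "lact (wmod n w t) (alpha k) u = ract (wmod n w t) u (alpha k)" .
    moreover have "ract (wmod n w t) (ract (wmod n w t) u (alpha k)) p = ract (wmod n w t) u (alpha k * p)"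
      using c ract[OF kR c] by (simp add: wmod_ract mult.assoc)
    ultimately show ?case
      using lact_times[OF kR alpha(2) c] alpha(3) lact_ract[OF kR alpha(2) c] by simp
  }
qed

section \<open>The top cohomological degree\<close>

lemma wmod_top:
  assumes "t > int (length w)" "v \<in> carrier (wmod n w t)"
  shows "v = 0"
  using assms
proof (induction w arbitrary: t v)
  case Nil
  then show ?case
    by simp
next
  case (Cons i w)
  from Cons.prems(2) obtain a b c where v: "v = trip a b c" and p: "a \<in> carrier (wmod n w t)"
    "b \<in> carrier (wmod n w t)" "c \<in> carrier (wmod n w (t - 1))"
    unfolding wmod.simps by (auto elim!: tripmE simp: pairs_simps)
  have "a = 0" "b = 0" "c = 0"
    by (rule Cons.IH[OF _ p(1)] Cons.IH[OF _ p(2)] Cons.IH[OF _ p(3)], use Cons.prems(1) in force)+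
  then show ?case
    by (simp add: v)
qed

lemma wmod_topE:
  assumes "v \<in> carrier (wmod n (i # w) (int (length (i # w))))"
  obtains c where "v = trip 0 0 c" "c \<in> carrier (wmod n w (int (length w)))"
proof -
  from assms obtain a b c where v: "v = trip a b c" and p: "a \<in> carrier (wmod n w (1 + int (length w)))"
    "b \<in> carrier (wmod n w (1 + int (length w)))" "c \<in> carrier (wmod n w (int (length w)))"
    unfolding wmod.simps by (auto elim!: tripmE simp: pairs_simps)
  have "a = 0" "b = 0"
    using wmod_top[OF _ p(1)] wmod_top[OF _ p(2)] by auto
  with v p that show ?thesis
    by blast
qed

text \<open>The top term is a product of copies of R(1), that is, R with a shift, and there the two
  actions coincide.\<close>

lemma wmod_top_cent:
  assumes "w \<in> lists {1..<n}" "v \<in> carrier (wmod n w (int (length w)))"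
  shows "v \<in> cent n w (int (length w))"
proof -
  have "lop (wcx n w) j v = rop (wcx n w) j v" for j
    using assms
  proof (induction w arbitrary: v rule: list.induct)
    case Nil
    then show ?case
      by (auto simp: base_def)
  next
    case (Cons i w)
    interpret bcx "wcx n w"
      by (rule bcx_wcx)
    from Cons.prems(2) obtain c where c: "v = trip 0 0 c" "c \<in> carrier (wmod n w (int (length w)))"
      by (rule wmod_topE)
    then show ?case
      using Cons.IH[of c] Cons.prems(1) by (simp add: lten_trip op_0)
  qed
  with assms(2) show ?thesis
    by (simp add: cent_def)
qed

text \<open>The digit 2 selects R(1) in every factor; this is the only summand of top
  degree.\<close>

abbreviation top_pos :: "nat list \<Rightarrow> nat list" where
  "top_pos w \<equiv> replicate (length w) 2"

abbreviation const_term :: "mpoly \<Rightarrow> mpoly" where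
  "const_term \<equiv> poly_subst (\<lambda>_. 0)"

lemma trip_2: "trip a b c (2 # l) = c l"
  by (simp add: trip_def)

lemma const_term_xvar: "const_term (xvar n j) = 0"
  by (simp add: xvar_def poly_subst_simps)

text \<open>A central \<open>(a, b, c)\<close> has \<open>a = - x\<^sub>i\<^sub>+\<^sub>1 b\<close>, so that \<open>a + x\<^sub>i b = \<alpha>\<^sub>i b\<close>.\<close>

lemma const_term_coboundary:
  assumes "w \<in> lists {1..<n}" "v \<in> cent n w (int (length w) - 1)"
  shows "const_term (del (wcx n w) v (top_pos w)) = 0"
  using assms
proof (induction w arbitrary: v rule: list.induct)
  case Nil
  then show ?case
    by (simp add: base_def poly_subst_simps)
next
  case (Cons i w)
  have w: "w \<in> lists {1..<n}"
    using Cons.prems by simp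
  have "v \<in> carrier (wmod n (i # w) (int (length w)))"
    using Cons.prems(2) by (simp add: cent_def)
  then obtain a b c where v: "v = trip a b c" and p: "a \<in> carrier (wmod n w (int (length w)))"
    "b \<in> carrier (wmod n w (int (length w)))" "c \<in> carrier (wmod n w (int (length w) - 1))"
    unfolding wmod.simps by (auto elim!: tripmE simp: pairs_simps)
  have eq: "lop (wcx n (i # w)) j v = rop (wcx n (i # w)) j v" for j
    using Cons.prems(2) by (simp add: cent_def)
  have "c \<in> cent n w (int (length w) - 1)"
    using eq p(3) by (auto simp: v lten_trip cent_def)
  then have "const_term (del (wcx n w) c (top_pos w)) = 0"
    by (rule Cons.IH[OF w])
  \<comment> \<open>Commuting with x_i gives a + x_i b + x_(i+1) b = b x_i. Since b is in the top
    degree of w, x_(i+1) acts on it from either side alike.\<close>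
  moreover have "a + lop (wcx n w) i b = rop (wcx n w) i b - rop (wcx n w) (Suc i) b"
    using eq[of i] wmod_top_cent[OF w p(2)] by (simp add: v lten_trip cent_def eq_diff_eq)
  then have "(a + lop (wcx n w) i b) (top_pos w) = b (top_pos w) * xvar n i - b (top_pos w) * xvar n (Suc i)"
    using wmod_ops(2)[OF w p(2)] by (simp add: wmod_ract[OF p(2)])
  then have "const_term ((a + lop (wcx n w) i b) (top_pos w)) = 0"
    by (simp add: poly_subst_simps const_term_xvar)
  ultimately show ?case
    by (simp add: v lten_trip trip_2 poly_subst_simps)
qed

definition topv :: "nat list \<Rightarrow> rat \<Rightarrow> nat list \<Rightarrow> mpoly" where
  "topv w q = (\<lambda>l. if l = top_pos w then const_poly q else 0)"

lemma topv_Cons: "topv (i # w) q = trip 0 0 (topv w q)"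
  by (auto simp: trip_def topv_def fun_eq_iff split: list.split)

lemma piece_top: "v \<in> piece (wcx n w) (int (length w)) (- int (length w)) \<longleftrightarrow> (\<exists>q. v = topv w q)"
proof (induction w arbitrary: v)
  case Nil
  have "topv [] q = emb (const_poly q)" for q
    by (auto simp: topv_def emb_def)
  then show ?case
    by (auto simp: base_def grade_0 image_iff)
next
  case (Cons i w)
  show ?case
  proof
    assume "v \<in> piece (wcx n (i # w)) (int (length (i # w))) (- int (length (i # w)))"
    then obtain a b c where v: "v = trip a b c" "a \<in> piece (wcx n w) (1 + int (length w)) (- int (length w))"
      "b \<in> piece (wcx n w) (1 + int (length w)) (- int (length w) - 2)" "c \<in> piece (wcx n w) (int (length w)) (- int (length w))"
      by (auto elim!: piece_ltenE simp: algebra_simps)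
    have "a = 0" "b = 0"
      using piece_wcx_top[OF _ v(2)] piece_wcx_top[OF _ v(3)] by auto
    with v Cons show "\<exists>q. v = topv (i # w) q"
      by (auto simp: topv_Cons)
  next
    assume "\<exists>q. v = topv (i # w) q"
    then obtain q where v: "v = trip 0 0 (topv w q)"
      by (auto simp: topv_Cons)
    have "topv w q \<in> piece (wcx n w) (int (length w)) (- int (length w))"
      using Cons by blast
    then show "v \<in> piece (wcx n (i # w)) (int (length (i # w))) (- int (length (i # w)))"
      unfolding v using bcx.piece_0[OF bcx_wcx] by (simp add: piece_lten_iff)
  qed
qed

lemma topv_simps: "topv w (p + q) = topv w p + topv w q" "topv w (p - q) = topv w p - topv w q"
  "(\<lambda>l. topv w q l * const_poly c) = topv w (c * q)" "const_term (topv w q (top_pos w)) = const_poly q" "topv w 0 = 0"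
proof -
  have "const_poly (p - q) = const_poly p - const_poly q"
    using const_poly_simps(3)[of p "- q"] const_poly_simps(5)[of q] by simp
  then show "topv w (p + q) = topv w p + topv w q" "topv w (p - q) = topv w p - topv w q"
    "(\<lambda>l. topv w q l * const_poly c) = topv w (c * q)" "const_term (topv w q (top_pos w)) = const_poly q" "topv w 0 = 0"
    by (auto simp: topv_def fun_eq_iff const_poly_simps poly_subst_simps mult.commute)
qed

section \<open>Hochschild cohomology through central elements\<close>

definition hmod :: "nat \<Rightarrow> nat list \<Rightarrow> int \<Rightarrow> (nat list \<Rightarrow> mpoly) gbim" where
  "hmod n w t = (wmod n w t)\<lparr>carrier := cent n w t, grade := central (wcx n w) t\<rparr>"

locale rouquier_homology =
  fixes n :: nat and w :: "nat list" and \<gamma> :: "int \<Rightarrow> (nat list \<Rightarrow> mpoly) \<Rightarrow> nat"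
  assumes w: "w \<in> lists {1..<n}" and \<gamma>: "cpx_model n w (rouquier n w) \<gamma>"
begin

abbreviation "C \<equiv> rouquier n w"
abbreviation "W \<equiv> wmod n w"
abbreviation "Z \<equiv> cent n w"
abbreviation "D \<equiv> HH0_cpx n C"

sublocale W: lmod "W t" n for t
  by (rule lmod_wmod[OF w])

sublocale B: bcx "wcx n w"
  by (rule bcx_wcx)

lemma \<gamma>g: "giso n (\<gamma> t) (W t) (obj C t)"
  and \<gamma>d: "v \<in> carrier (W t) \<Longrightarrow> diff C t (\<gamma> t v) = \<gamma> (t + 1) (del (wcx n w) v)"
  using \<gamma> by (auto simp: cpx_model_def)

lemma Z_carrier: "m \<in> Z t \<Longrightarrow> m \<in> carrier (W t)"
  by (simp add: cent_def)

lemma Z_closed: "0 \<in> Z t" "m \<in> Z t \<Longrightarrow> m' \<in> Z t \<Longrightarrow> m + m' \<in> Z t" "m \<in> Z t \<Longrightarrow> - m \<in> Z t"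
  "m \<in> Z t \<Longrightarrow> del (wcx n w) m \<in> Z (t + 1)"
  by (auto simp: cent_def B.op_linear W.zero W.add W.uminus wmod_ops(3)[OF w] B.del_lop[symmetric] B.del_rop[symmetric])

lemma Z_lact:
  assumes "m \<in> Z t" "r \<in> polyR n"
  shows "lact (W t) r m \<in> Z t"
proof -
  note m = Z_carrier[OF assms(1)]
  have "lop (wcx n w) j (lact (W t) r m) = rop (wcx n w) j (lact (W t) r m)" for j
  proof -
    have "lop (wcx n w) j (lact (W t) r m) = lact (W t) r (lact (W t) (xvar n j) m)"
      using wmod_ops(1)[OF w W.lact[OF assms(2) m]] W.lact_times[OF assms(2) xvar_polyR m, symmetric] W.lact_times[OF xvar_polyR assms(2) m]
      by (simp add: mult.commute)
    also have "\<dots> = rop (wcx n w) j (lact (W t) r m)"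
      using wmod_ops(2)[OF w W.lact[OF assms(2) m]] W.lact_ract[OF assms(2) xvar_polyR m] cent_lact[OF w assms(1) xvar_polyR] by simp
    finally show ?thesis .
  qed
  then show ?thesis
    using W.lact[OF assms(2) m] by (simp add: cent_def)
qed

lemma central_Z: "m \<in> central (wcx n w) t q \<longleftrightarrow> m \<in> Z t \<and> m \<in> piece (wcx n w) t q"
  using W.gr_carrier[of m t q] by (auto simp: central_def cent_def grade_wmod)

lemma hmod_simps: "carrier (hmod n w t) = Z t" "x \<otimes>\<^bsub>hmod n w t\<^esub> y = x + y" "\<one>\<^bsub>hmod n w t\<^esub> = 0"
  "lact (hmod n w t) = lact (W t)" "ract (hmod n w t) = ract (W t)" "grade (hmod n w t) = central (wcx n w) t"
  by (simp_all add: hmod_def W.mult W.one)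

lemma addm_hmod: "addm (hmod n w t) (central (wcx n w) t)"
  by unfold_locales (auto simp: hmod_simps Z_closed central_Z B.piece_intros)

definition hom_of :: "int \<Rightarrow> (nat list \<Rightarrow> mpoly) \<Rightarrow> mpoly \<Rightarrow> nat" where
  "hom_of t m = (\<lambda>x\<in>polyR n. \<gamma> t (lact (W t) x m))"

lemma hom_of_bimod_hom:
  assumes "m \<in> Z t"
  shows "hom_of t m \<in> bimod_hom n (regular_bim n) (obj C t)"
proof -
  note m = Z_carrier[OF assms]
  note g = gisoD[OF \<gamma>g]
  show ?thesis
    unfolding bimod_hom_def
  proof (intro CollectI conjI IntI ballI)
    show "hom_of t m \<in> hom (regular_bim n) (obj C t)"
      by (rule homI) (auto simp: hom_of_def regular_bim_def polyR_add W.lact m W.lact_plus g(2) W.mult simp flip: g(3))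
    show "hom_of t m \<in> extensional (carrier (regular_bim n))"
      by (simp add: hom_of_def regular_bim_def)
    fix r x
    assume r: "r \<in> polyR n" and "x \<in> carrier (regular_bim n)"
    then have x: "x \<in> polyR n"
      by (simp add: regular_bim_def)
    show "hom_of t m (lact (regular_bim n) r x) = lact (obj C t) r (hom_of t m x)"
      using r x m by (simp add: hom_of_def regular_bim_def polyR_mult W.lact_times W.lact g(5))
    have "lact (W t) (x * r) m = ract (W t) (lact (W t) x m) r"
      using W.lact_times[OF x r m] cent_lact[OF w assms r] W.lact_ract[OF x r m] by simp
    then show "hom_of t m (ract (regular_bim n) x r) = ract (obj C t) (hom_of t m x) r"
      using r x g(6)[OF r W.lact[OF x m]] by (simp add: hom_of_def regular_bim_def polyR_mult)
  qed
qed

lemma giso_hom_of: "giso n (hom_of t) (hmod n w t) (obj D t)"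
proof -
  note g = gisoD[OF \<gamma>g]
  have obj: "obj D t = HH0 n (obj C t)"
    by (simp add: HH0_cpx_def)
  have one: "hom_of t m 1 = \<gamma> t m" if "m \<in> Z t" for m
    using Z_carrier[OF that] by (simp add: hom_of_def polyR_simps W.lact_one)
  have bij: "bij_betw (hom_of t) (Z t) (carrier (obj D t))"
    unfolding bij_betw_def
  proof
    show "inj_on (hom_of t) (Z t)"
    proof (rule inj_onI)
      fix m m'
      assume m: "m \<in> Z t" "m' \<in> Z t" "hom_of t m = hom_of t m'"
      then show "m = m'"
        using one[OF m(1)] one[OF m(2)] g(9)[OF Z_carrier Z_carrier, OF m(1,2)] by simp
    qed
    show "hom_of t ` Z t = carrier (obj D t)"
    proof (intro equalityI subsetI)
      fix f
      assume "f \<in> carrier (obj D t)"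
      then have fb: "f \<in> bimod_hom n (regular_bim n) (obj C t)"
        by (simp add: obj HH0_def)
      have reg: "carrier (regular_bim n) = polyR n" "lact (regular_bim n) = (*)" "ract (regular_bim n) = (*)"
        by (simp_all add: regular_bim_def)
      have f: "f \<in> hom (regular_bim n) (obj C t)" "f \<in> extensional (polyR n)"
        "\<And>r x. r \<in> polyR n \<Longrightarrow> x \<in> polyR n \<Longrightarrow> f (r * x) = lact (obj C t) r (f x)"
        "\<And>r x. r \<in> polyR n \<Longrightarrow> x \<in> polyR n \<Longrightarrow> f (x * r) = ract (obj C t) (f x) r"
        using fb unfolding bimod_hom_def reg by blast+
      have "f 1 \<in> carrier (obj C t)"
        using hom_in_carrier[OF f(1), of 1] by (simp add: regular_bim_def polyR_simps)
      then obtain m where m: "m \<in> carrier (W t)" "f 1 = \<gamma> t m"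
        by (rule gisoE[OF \<gamma>g])
      have "lact (W t) r m = ract (W t) m r" if "r \<in> polyR n" for r
      proof -
        have "\<gamma> t (lact (W t) r m) = \<gamma> t (ract (W t) m r)"
          using f(3)[OF that polyR_simps(3)] f(4)[OF that polyR_simps(3)] m g(5,6)[OF that m(1)] by simp
        then show ?thesis
          using g(9)[OF W.lact[OF that m(1)] W.ract[OF that m(1)]] by simp
      qed
      then have "m \<in> Z t"
        using m(1) wmod_ops(1,2)[OF w m(1)] by (simp add: cent_def xvar_polyR)
      moreover have "f = hom_of t m"
        unfolding hom_of_def
      proof (rule extensionalityI[OF f(2)])
        fix x
        assume x: "x \<in> polyR n"
        then show "f x = (\<lambda>x\<in>polyR n. \<gamma> t (lact (W t) x m)) x"
          using f(3)[OF x polyR_simps(3)] m g(5)[OF x m(1)] by simp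
      qed simp
      ultimately show "f \<in> hom_of t ` Z t"
        by blast
    qed (auto simp: obj HH0_def intro: hom_of_bimod_hom)
  qed
  show ?thesis
    unfolding giso_def hmod_simps
  proof (intro conjI ballI allI)
    show "bij_betw (hom_of t) (Z t) (carrier (obj D t))"
      by (rule bij)
    fix m
    assume m: "m \<in> Z t"
    note mc = Z_carrier[OF m]
    show "hom_of t (m + m') = hom_of t m \<otimes>\<^bsub>obj D t\<^esub> hom_of t m'" if "m' \<in> Z t" for m'
      using mc Z_carrier[OF that] by (auto simp: obj HH0_def hom_of_def W.lact_add W.lact W.mult fun_eq_iff simp flip: g(3))
    fix r
    assume r: "r \<in> polyR n"
    have "lact (W t) x (lact (W t) r m) = lact (W t) r (lact (W t) x m)" if "x \<in> polyR n" for x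
      using W.lact_times[OF r that mc] W.lact_times[OF that r mc] by (simp add: mult.commute)
    then have "hom_of t (lact (W t) r m) x = lact (obj D t) r (hom_of t m) x" for x
      using g(5)[OF r W.lact[OF _ mc], of x] by (simp add: obj HH0_def hom_of_def)
    then show "hom_of t (lact (W t) r m) = lact (obj D t) r (hom_of t m)" ..
    have "hom_of t (ract (W t) m r) x = ract (obj D t) (hom_of t m) r x" for x
      using g(6)[OF r W.lact[OF _ mc], of x] W.lact_ract[OF _ r mc, of x] by (simp add: obj HH0_def hom_of_def)
    then show "hom_of t (ract (W t) m r) = ract (obj D t) (hom_of t m) r" ..
  next
    show "hom_of t 0 = \<one>\<^bsub>obj D t\<^esub>"
      using g(4) by (auto simp: obj HH0_def hom_of_def fun_eq_iff W.lact_0 W.one)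
  next
    fix q
    have "hom_of t m \<in> grade (obj D t) q \<longleftrightarrow> m \<in> piece (wcx n w) t q" if m: "m \<in> Z t" for m
    proof
      assume "hom_of t m \<in> grade (obj D t) q"
      then have "\<forall>j. hom_of t m ` polyR_grade n j \<subseteq> grade (obj C t) (j + q)"
        by (simp add: obj HH0_def)
      \<comment> \<open>Degree 0 of R contains 1, whose image is m itself.\<close>
      then have "hom_of t m ` polyR_grade n 0 \<subseteq> grade (obj C t) (0 + q)"
        by (rule spec)
      then have "\<gamma> t m \<in> \<gamma> t ` grade (W t) q"
        using one[OF m] grade_simps(3)[of n] g(7)[of t q] by force
      then show "m \<in> piece (wcx n w) t q"
        using g(9)[OF Z_carrier[OF m] W.gr_carrier] by (auto simp: grade_wmod)
    next
      assume "m \<in> piece (wcx n w) t q"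
      then have "hom_of t m x \<in> grade (obj C t) (j + q)" if "x \<in> polyR_grade n j" for x j
        using g(8)[OF W.lact_grade[OF that, of m t q]] grade_polyR[OF that] by (simp add: hom_of_def grade_wmod)
      then show "hom_of t m \<in> grade (obj D t) q"
        using hom_of_bimod_hom[OF m] by (auto simp: obj HH0_def)
    qed
    moreover have "grade (obj D t) q \<subseteq> hom_of t ` Z t"
      using bij by (auto simp: bij_betw_def obj HH0_def)
    ultimately show "hom_of t ` central (wcx n w) t q = grade (obj D t) q"
      by (auto simp: central_Z)
  qed
qed

lemma diff_hom_of:
  assumes "m \<in> Z t"
  shows "diff D t (hom_of t m) = hom_of (t + 1) (del (wcx n w) m)"
  using \<gamma>d[OF W.lact[OF _ Z_carrier[OF assms]]] wmod_ops(4)[OF w Z_carrier[OF assms]]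
  by (auto simp: HH0_cpx_def hom_of_def fun_eq_iff)

definition bnd :: "int \<Rightarrow> (nat list \<Rightarrow> mpoly) set" where
  "bnd t = del (wcx n w) ` Z (t - 1)"

lemma bnd_Z: "b \<in> bnd t \<Longrightarrow> b \<in> Z t"
  using Z_closed(4)[of _ "t - 1"] by (auto simp: bnd_def)

lemma bnd_closed: "0 \<in> bnd t" "b \<in> bnd t \<Longrightarrow> b' \<in> bnd t \<Longrightarrow> b + b' \<in> bnd t" "b \<in> bnd t \<Longrightarrow> - b \<in> bnd t"
  "b \<in> bnd t \<Longrightarrow> r \<in> polyR n \<Longrightarrow> lact (W t) r b \<in> bnd t"
proof -
  show "0 \<in> bnd t"
    unfolding bnd_def using Z_closed(1) B.op_0(3) by (auto intro!: image_eqI[of _ _ 0])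
  show "b + b' \<in> bnd t" if "b \<in> bnd t" "b' \<in> bnd t"
    using that Z_closed(2) by (auto simp: bnd_def B.del_add[symmetric])
  show "- b \<in> bnd t" if "b \<in> bnd t"
    using that Z_closed(3) by (auto simp: bnd_def B.op_minus[symmetric])
  show "lact (W t) r b \<in> bnd t" if "b \<in> bnd t" "r \<in> polyR n"
    using that wmod_ops(4)[OF w Z_carrier _, of _ "t - 1" r] by (auto simp: bnd_def intro!: image_eqI[OF _ Z_lact])
qed

lemmas h = gisoD[OF giso_hom_of, unfolded hmod_simps]

sublocale D: comm_group "obj D t" for t
  by (rule giso_comm_group[OF addm_hmod giso_hom_of])

lemma inv_hom_of: "m \<in> Z t \<Longrightarrow> inv\<^bsub>obj D t\<^esub> hom_of t m = hom_of t (- m)"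
  using giso_inv[OF addm_hmod giso_hom_of, unfolded hmod_simps] by simp

lemma coboundaries_hom_of: "coboundaries D t = hom_of t ` bnd t"
proof -
  have "carrier (obj D (t - 1)) = hom_of (t - 1) ` Z (t - 1)"
    using h(1)[of "t - 1"] by (simp add: bij_betw_def)
  then show ?thesis
    using diff_hom_of[of _ "t - 1"] by (auto simp: coboundaries_def bnd_def image_image intro!: image_cong)
qed

lemma coboundaries_subgroup: "subgroup (coboundaries D t) (obj D t)"
  unfolding coboundaries_hom_of
proof (rule D.subgroupI)
  show "hom_of t ` bnd t \<subseteq> carrier (obj D t)"
    using bnd_Z h(2) by auto
  show "hom_of t ` bnd t \<noteq> {}"
    using bnd_closed(1) by auto
  show "inv\<^bsub>obj D t\<^esub> a \<in> hom_of t ` bnd t" if "a \<in> hom_of t ` bnd t" for a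
    using that bnd_closed(3) by (auto simp: inv_hom_of bnd_Z)
  show "a \<otimes>\<^bsub>obj D t\<^esub> b \<in> hom_of t ` bnd t" if "a \<in> hom_of t ` bnd t" "b \<in> hom_of t ` bnd t" for a b
    using that bnd_closed(2) by (auto simp: bnd_Z simp flip: h(3))
qed

lemma cocycles_hom_of: "cocycles D t \<inter> grade (obj D t) q = hom_of t ` {m \<in> central (wcx n w) t q. del (wcx n w) m = 0}"
proof -
  have "hom_of t m \<in> cocycles D t \<longleftrightarrow> del (wcx n w) m = 0" if "m \<in> Z t" for m
    using h(9)[OF Z_closed(4)[OF that] Z_closed(1)] h(4)[of "t + 1"] h(2)[OF that]
    by (simp add: cocycles_def kernel_def diff_hom_of[OF that])
  then show ?thesis
    by (auto simp: h(7)[symmetric] central_Z)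
qed

definition cls :: "int \<Rightarrow> (nat list \<Rightarrow> mpoly) \<Rightarrow> (mpoly \<Rightarrow> nat) set" where
  "cls t m = coboundaries D t #>\<^bsub>obj D t\<^esub> hom_of t m"

lemma HHH0_simps:
  "carrier (HHH0 n w t q) = cls t ` {m \<in> central (wcx n w) t q. del (wcx n w) m = 0}"
  "\<one>\<^bsub>HHH0 n w t q\<^esub> = coboundaries D t"
  "X \<otimes>\<^bsub>HHH0 n w t q\<^esub> Y = X <#>\<^bsub>obj D t\<^esub> Y"
  "qscale (HHH0 n w t q) c X = (\<Union>x\<in>X. coboundaries D t #>\<^bsub>obj D t\<^esub> lact (obj D t) (const_poly c) x)"
proof -
  have "carrier (HHH0 n w t q) = (\<lambda>x. coboundaries D t #>\<^bsub>obj D t\<^esub> x) ` (cocycles D t \<inter> grade (obj D t) q)"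
    by (auto simp: HHH0_def cohomology_def Let_def)
  then show "carrier (HHH0 n w t q) = cls t ` {m \<in> central (wcx n w) t q. del (wcx n w) m = 0}"
    by (simp add: cocycles_hom_of image_image cls_def)
  show "X \<otimes>\<^bsub>HHH0 n w t q\<^esub> Y = X <#>\<^bsub>obj D t\<^esub> Y"
    by (simp add: HHH0_def cohomology_def Let_def set_mult_def)
qed (simp_all add: HHH0_def cohomology_def Let_def)

lemma cls_eq_iff:
  assumes "m \<in> Z t" "m' \<in> Z t"
  shows "cls t m = cls t m' \<longleftrightarrow> m - m' \<in> bnd t"
proof -
  have "m' + b = m \<longleftrightarrow> b = m - m'" for b
    by (auto simp: algebra_simps)
  have mem: "hom_of t m \<in> cls t m' \<longleftrightarrow> m - m' \<in> bnd t"
  proof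
    assume "hom_of t m \<in> cls t m'"
    then obtain b where b: "b \<in> bnd t" "hom_of t m = hom_of t b \<otimes>\<^bsub>obj D t\<^esub> hom_of t m'"
      by (auto simp: cls_def r_coset_def coboundaries_hom_of)
    then have "hom_of t m = hom_of t (b + m')"
      using assms bnd_Z by (simp add: h(3))
    then have "m = b + m'"
      using h(9)[OF assms(1) Z_closed(2)[OF bnd_Z[OF b(1)] assms(2)]] by simp
    with b show "m - m' \<in> bnd t"
      by simp
  next
    assume b: "m - m' \<in> bnd t"
    then have "hom_of t (m - m') \<otimes>\<^bsub>obj D t\<^esub> hom_of t m' = hom_of t m"
      using h(3)[OF bnd_Z[OF b] assms(2)] by simp
    with b show "hom_of t m \<in> cls t m'"
      by (force simp: cls_def r_coset_def coboundaries_hom_of)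
  qed
  have "cls t m = cls t m' \<longleftrightarrow> hom_of t m \<in> cls t m'"
    using D.rcos_self[OF _ coboundaries_subgroup, of "hom_of t m" t] D.repr_independence[OF _ _ coboundaries_subgroup, of "hom_of t m" t "hom_of t m'"]
      h(2) assms by (auto simp: cls_def)
  with mem show ?thesis
    by simp
qed

lemma cls_0: "cls t 0 = coboundaries D t"
  using D.coset_mult_one[OF subgroup.subset[OF coboundaries_subgroup]] by (simp add: cls_def h(4))

lemma cls_add: "m \<in> Z t \<Longrightarrow> m' \<in> Z t \<Longrightarrow> cls t m <#>\<^bsub>obj D t\<^esub> cls t m' = cls t (m + m')"
  using normal.rcos_sum[OF D.subgroup_imp_normal[OF coboundaries_subgroup] h(2) h(2)] by (simp add: cls_def h(3))

lemma cls_scale: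
  assumes "m \<in> Z t" "r \<in> polyR n"
  shows "(\<Union>x\<in>cls t m. coboundaries D t #>\<^bsub>obj D t\<^esub> lact (obj D t) r x) = cls t (lact (W t) r m)"
proof -
  have "coboundaries D t #>\<^bsub>obj D t\<^esub> lact (obj D t) r x = cls t (lact (W t) r m)" if x: "x \<in> cls t m" for x
  proof -
    obtain b where b: "b \<in> bnd t" "x = hom_of t b \<otimes>\<^bsub>obj D t\<^esub> hom_of t m"
      using x by (auto simp: cls_def r_coset_def coboundaries_hom_of)
    then have "x = hom_of t (b + m)"
      using assms(1) bnd_Z by (simp add: h(3))
    then have "coboundaries D t #>\<^bsub>obj D t\<^esub> lact (obj D t) r x = cls t (lact (W t) r (b + m))"
      using h(5)[OF assms(2) Z_closed(2)[OF bnd_Z[OF b(1)] assms(1)]] by (simp add: cls_def)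
    moreover have "lact (W t) r (b + m) - lact (W t) r m \<in> bnd t"
      using W.lact_add[OF assms(2) Z_carrier[OF bnd_Z[OF b(1)]] Z_carrier[OF assms(1)]] bnd_closed(4)[OF b(1) assms(2)] by simp
    ultimately show ?thesis
      using cls_eq_iff[OF Z_lact[OF Z_closed(2)[OF bnd_Z[OF b(1)] assms(1)] assms(2)] Z_lact[OF assms]] by simp
  qed
  moreover have "hom_of t m \<in> cls t m"
    using D.rcos_self[OF _ coboundaries_subgroup] h(2)[OF assms(1)] by (simp add: cls_def)
  ultimately show ?thesis
    by blast
qed

lemma HHH0_vanish:
  assumes "t \<noteq> int (length w)"
  shows "carrier (HHH0 n w t (- t)) = {\<one>\<^bsub>HHH0 n w t (- t)\<^esub>}"
proof -
  have "cls t m = coboundaries D t" if m: "m \<in> central (wcx n w) t (- t)" "del (wcx n w) m = 0" for m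
  proof -
    have "exact_at (central (wcx n w)) (del (wcx n w)) t (- t)"
      using acyc_wcx[OF w assms] by (simp add: acyc_def)
    then obtain u where "u \<in> central (wcx n w) (t - 1) (- t)" "del (wcx n w) u = m"
      using m unfolding exact_at_def by blast
    then have "m \<in> bnd t"
      by (auto simp: bnd_def central_Z)
    then show ?thesis
      using cls_eq_iff[of m t 0] Z_closed(1) cls_0 bnd_Z by simp
  qed
  moreover have "0 \<in> central (wcx n w) t (- t)" "del (wcx n w) 0 = 0"
    by (auto simp: central_Z Z_closed B.piece_0 B.op_0)
  ultimately have "cls t ` {m \<in> central (wcx n w) t (- t). del (wcx n w) m = 0} = {coboundaries D t}"
    by force
  then show ?thesis
    by (simp add: HHH0_simps)
qed

lemma HHH0_top: "qspace_iso (HHH0 n w (int (length w)) (- int (length w))) Q_space"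
proof -
  let ?t = "int (length w)"
  let ?H = "HHH0 n w ?t (- ?t)"
  define K where "K q = cls ?t (topv w q)" for q
  have top: "topv w q \<in> central (wcx n w) ?t (- ?t)" for q
    using piece_top[of "topv w q" n w] W.gr_carrier[of "topv w q" ?t "- ?t"] wmod_top_cent[OF w, of "topv w q"]
    by (auto simp: central_Z grade_wmod)
  then have topZ: "topv w q \<in> Z ?t" for q
    by (simp add: central_Z)
  have "central (wcx n w) ?t (- ?t) = range (topv w)"
    using top piece_top[of _ n w] by (auto simp: central_Z)
  moreover have "del (wcx n w) m = 0" if "m \<in> central (wcx n w) ?t (- ?t)" for m
    using wmod_top[of w "?t + 1" "del (wcx n w) m" n] wmod_ops(3)[OF w, of m ?t] that by (simp add: central_Z cent_def)
  ultimately have "{m \<in> central (wcx n w) ?t (- ?t). del (wcx n w) m = 0} = range (topv w)"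
    by auto
  then have car: "carrier ?H = range K"
    by (simp add: HHH0_simps K_def image_image)
  have inj: "inj K"
  proof (rule injI)
    fix p q
    assume "K p = K q"
    then have "topv w (p - q) \<in> bnd ?t"
      using cls_eq_iff[OF topZ topZ] by (simp add: K_def topv_simps)
    then have "const_term (topv w (p - q) (top_pos w)) = 0"
      using const_term_coboundary[OF w] by (auto simp: bnd_def)
    then have "const_poly (p - q) = 0"
      by (simp only: topv_simps(4))
    then show "p = q"
      by (metis const_poly_def lookup_single_eq lookup_zero eq_iff_diff_eq_0)
  qed
  have add: "K (p + q) = K p \<otimes>\<^bsub>?H\<^esub> K q" for p q
    by (simp add: HHH0_simps K_def topv_simps cls_add[OF topZ topZ])
  have scale: "K (c * q) = qscale ?H c (K q)" for c q
    using cls_scale[OF topZ polyR_simps(2)] wmod_lact_const[OF w Z_carrier[OF topZ]] by (simp add: HHH0_simps K_def topv_simps)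
  define f where "f = the_inv K"
  have f: "f (K q) = q" for q
    unfolding f_def by (rule the_inv_f_f[OF inj])
  have "f \<in> iso ?H Q_space"
    unfolding Group.iso_def
  proof (intro CollectI conjI)
    show "f \<in> hom ?H Q_space"
      by (rule homI) (auto simp: car f Q_space_def simp flip: add)
    show "bij_betw f (carrier ?H) (carrier Q_space)"
      by (rule bij_betwI[of _ _ _ K]) (auto simp: car f Q_space_def)
  qed
  moreover have "f (qscale ?H c x) = qscale Q_space c (f x)" if "x \<in> carrier ?H" for c x
    using that by (auto simp: car f Q_space_def simp flip: scale)
  ultimately show ?thesis
    unfolding qspace_iso_def by blast
qed

end

section \<open>From words to braids\<close>

lemma braid_length_class:
  assumes "\<beta> \<in> pos_braids n" "w \<in> \<beta>"
  shows "w \<in> lists {1..<n}" "braid_length \<beta> = length w"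
proof -
  obtain u where \<beta>: "\<beta> = braid_rel n `` {u}"
    using assms(1) by (auto simp: pos_braids_def quotient_def)
  with assms(2) show "w \<in> lists {1..<n}"
    by (auto simp: braid_rel_def braid_words_def)
  have "length v = length w" if "v \<in> \<beta>" for v
    using that assms(2) braid_equiv_invariants[of u v] braid_equiv_invariants[of u w] by (auto simp: \<beta> braid_rel_def)
  then have "length ` \<beta> = {length w}"
    using assms(2) by blast
  then show "braid_length \<beta> = length w"
    by (simp add: braid_length_def)
qed

theorem theorem1p8:
  fixes n :: nat and \<beta> :: "nat list set" and w :: "nat list" and t :: int
  assumes "n \<ge> 1"
    and "\<beta> \<in> pos_braids n"
    and "w \<in> \<beta>"
  shows "(t \<noteq> int (braid_length \<beta>) \<longrightarrow>
            carrier (HHH0 n w t (- t)) = {\<one>\<^bsub>HHH0 n w t (- t)\<^esub>}) \<and>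
         (t = int (braid_length \<beta>) \<longrightarrow> qspace_iso (HHH0 n w t (- t)) Q_space)"
proof -
  note len = braid_length_class[OF assms(2,3)]
  obtain \<gamma> where "cpx_model n w (rouquier n w) \<gamma>"
    using rouquier_model[OF len(1)] by blast
  then interpret rouquier_homology n w \<gamma>
    using len(1) by unfold_locales
  show ?thesis
    using HHH0_vanish HHH0_top by (auto simp: len(2))
qed

end
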